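(* Let $f,g:[0,1]\to\mathbb R_{\ge0}$ be piecewise $\mathcal C^1$ with $f(s)>0$, $g(s)\ge0$, let $n,k\to\infty$ with $\lim\frac kn=c$, and specialize $x_i=f(i/n)$, $y_j=g(j/k)$. Assume there are two support intervals $(t_-,t_d)$ and $(t_d,t_+)$. Denote by $z_{\mathsf c}$ the real root of the critical point equation that corresponds to $t_d$. Consider the asymptotic regime $m\approx t_dn+\xi n^{1/4}\sigma^{-1}$, $m'\approx t_dn+\eta n^{1/4}\sigma^{-1}$ for some constant $\sigma$ as $n\to\infty$. Then $$\lim_{n,k\to\infty}\sigma^{-1}n^{1/4}z_{\mathsf c}^{\,m-m'}\,\mathcal K(m,m')=\mathcal K_{\mathrm{Pearcey}}(\xi,\eta)=\iint\frac{d\zeta\,d\nu}{(2\pi\mathbf i)^2}\,\frac{\exp\bigl(\frac{\zeta^4}4-\zeta\xi\bigr)}{\exp\bigl(\frac{\nu^4}4-\nu\eta\bigr)}\,\frac1{\zeta-\nu}.$$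
   Context: $\mathcal K$ is the correlation kernel of $\{\lambda_i-i+\frac12\}$ for a random partition $\lambda$ in the $n\times k$ rectangle (at most $n$ parts, each at most $k$) with law $s_\lambda(x_1,\dots,x_n)s_{\lambda'}(y_1,\dots,y_k)/\prod_{i,j}(1+x_iy_j)$, where $s_\lambda$ is the Schur polynomial and $\lambda'$ the conjugate partition: $$\mathcal K(m,m')=\oint\oint_{|w|<|z|}\frac{dz}{2\pi\mathbf i z}\frac{dw}{2\pi\mathbf i w}\frac{K(z)}{K(w)}z^{-m}w^{m'}\frac{\sqrt{zw}}{z-w},\quad K(z)=\prod_{i=1}^n\frac1{1-x_iz}\prod_{j=1}^k\frac1{1+y_j/z},$$ $\mathbf i=\sqrt{-1}$, where the $z$-contour contains all $-y_j$ and no $x_i^{-1}$, and the $w$-contour encircles $0$. The action is $S(z,t)=-\int_0^1\ln(1-f(s)z)ds-c\int_0^1\ln(1+g(s)/z)ds-t\ln z$, and the critical point equation is $$z\partial_zS(z,t)=\int_0^1\frac{f(s)z}{1-f(s)z}ds+c\int_0^1\frac{g(s)}{z+g(s)}ds-t=0.$$ A support interval is an interval of $t\in[-1,c]$ on which this equation has exactly two complex conjugate roots and whose endpoints correspond to real double critical points. At $t=t_d$, $z=z_{\mathsf c}$ the first three $z$-derivatives of $S$ vanish. In this generic case the fourth derivative is taken to be nonzero, and the constant is $$\sigma=\Bigl(\frac6{\partial_z^4S(z,t_d)|_{z=z_{\mathsf c}}}\Bigr)^{1/4}\frac1{z_{\mathsf c}}.$$ In $\mathcal K_{\mathrm{Pearcey}}$,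 $\nu$ runs along the imaginary axis from $-\mathbf i\infty$ to $\mathbf i\infty$; the $\zeta$-contour has two branches not meeting the $\nu$-contour, one from $e^{-\mathbf i\pi/4}\infty$ to $e^{\mathbf i\pi/4}\infty$ to the right of the imaginary axis and one from $e^{3\pi\mathbf i/4}\infty$ to $e^{-3\pi\mathbf i/4}\infty$ to its left.
   Formalization: Two conditions are added: k/n tends to c fast enough that (k − cn)/n^{1/4} → 0 (otherwise the limit is shifted), and, when z_c < 0, m ≠ m' for all large n (on the diagonal the rescaled kernel diverges there). *)

theory Defs
  imports "HOL-Analysis.Analysis" "HOL-Complex_Analysis.Complex_Analysis"
begin

text \<open>
  Piecewise continuously differentiable on \<open>[0,1]\<close>, with jumps allowed at the finitely many
  breakpoints (the library's \<^const>\<open>piecewise_C1_differentiable_on\<close> requires global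
  continuity). On each open piece the function agrees with a function that is continuously
  differentiable on the closed piece; the values at the breakpoints are unrestricted.
\<close>

definition piecewise_C1 :: "(real \<Rightarrow> real) \<Rightarrow> bool" where
  "piecewise_C1 f \<longleftrightarrow>
     (\<exists>N p. p 0 = 0 \<and> p N = 1 \<and>
        (\<forall>i<N. p i < p (Suc i) \<and>
           (\<exists>h. h C1_differentiable_on {p i..p (Suc i)} \<and> (\<forall>s\<in>{p i<..<p (Suc i)}. f s = h s))))"


subsection \<open>The correlation kernel\<close>

definition K_fun :: "(nat \<Rightarrow> real) \<Rightarrow> nat \<Rightarrow> (nat \<Rightarrow> real) \<Rightarrow> nat \<Rightarrow> complex \<Rightarrow> complex" where
  "K_fun x n y k z =
     (\<Prod>i=1..n. 1 / (1 - of_real (x i) * z)) * (\<Prod>j=1..k. 1 / (1 + of_real (y j) / z))"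

text \<open>
  The pair consists of the \<open>z\<close>-contour and the \<open>w\<close>-contour. ``Contains'' and ``encircles'' mean
  winding number 1. The point 0 lies inside the \<open>z\<close>-contour as well, since that contour is
  outside the \<open>w\<close>-contour.
\<close>

definition kernel_contours ::
  "(nat \<Rightarrow> real) \<Rightarrow> nat \<Rightarrow> (nat \<Rightarrow> real) \<Rightarrow> nat \<Rightarrow> (real \<Rightarrow> complex) \<Rightarrow> (real \<Rightarrow> complex) \<Rightarrow> bool" where
  "kernel_contours x n y k \<gamma> \<delta> \<longleftrightarrow>
     valid_path \<gamma> \<and> pathfinish \<gamma> = pathstart \<gamma> \<and>
     valid_path \<delta> \<and> pathfinish \<delta> = pathstart \<delta> \<and>
     (\<forall>z\<in>path_image \<gamma>. \<forall>w\<in>path_image \<delta>. norm w < norm z) \<and>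
     0 \<notin> path_image \<delta> \<and> winding_number \<delta> 0 = 1 \<and>
     0 \<notin> path_image \<gamma> \<and> winding_number \<gamma> 0 = 1 \<and>
     (\<forall>j\<in>{1..k}. - of_real (y j) \<notin> path_image \<gamma> \<and> winding_number \<gamma> (- of_real (y j)) = 1) \<and>
     (\<forall>i\<in>{1..n}. of_real (1 / x i) \<notin> path_image \<gamma> \<and> winding_number \<gamma> (of_real (1 / x i)) = 0)"

text \<open>
  The points \<open>\<lambda>\<^sub>i - i + 1/2\<close> are half-integers; an integer \<open>a\<close> encodes the site \<open>m = a + 1/2\<close>.
\<close>

definition site :: "int \<Rightarrow> real" where
  "site a = of_int a + 1 / 2"

text \<open>
  The kernel at \<open>m = site a\<close>, \<open>m' = site b\<close>. As \<open>m\<close> and \<open>m'\<close> are half-integers, the factor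
  \<open>sqrt (z * w)\<close> combines with the powers of exponent \<open>- m\<close>, \<open>m'\<close> and with \<open>1 / (z * w)\<close> into
  the single-valued \<open>z powi (- a - 1) * w powi b\<close>. Where \<open>1 / K w\<close> vanishes on the
  \<open>w\<close>-contour (\<open>w = 1 / x i\<close> or \<open>w = - y j\<close>), division by zero makes the quotient
  \<open>K z / K w\<close> zero as well, which is its correct value.
\<close>

definition corr_kernel ::
  "(real \<Rightarrow> complex) \<Rightarrow> (real \<Rightarrow> complex) \<Rightarrow> (nat \<Rightarrow> real) \<Rightarrow> nat \<Rightarrow> (nat \<Rightarrow> real) \<Rightarrow> nat
     \<Rightarrow> int \<Rightarrow> int \<Rightarrow> complex" where
  "corr_kernel \<gamma> \<delta> x n y k a b =
     1 / (2 * of_real pi * \<i>)\<^sup>2 *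
     contour_integral \<gamma> (\<lambda>z. contour_integral \<delta> (\<lambda>w.
       K_fun x n y k z / K_fun x n y k w * (z powi (- a - 1) * w powi b) / (z - w)))"


subsection \<open>The action and its critical points\<close>

text \<open>
  Real points at which no integrand of the action is singular, even in the limit.
\<close>

definition action_domain :: "(real \<Rightarrow> real) \<Rightarrow> (real \<Rightarrow> real) \<Rightarrow> real set" where
  "action_domain f g =
     - (insert 0 (closure ((\<lambda>s. 1 / f s) ` {0..1} \<union> (\<lambda>s. - g s) ` {0..1})))"

text \<open>
  The action on the real axis. The complex logarithms are multivalued; for real arguments the
  branches of \<open>ln u\<close> differ from \<open>ln \<bar>u\<bar>\<close> by locally constant imaginary terms, which do not affect
  the derivatives in \<open>z\<close>.
\<close>

definition action :: "(real \<Rightarrow> real) \<Rightarrow> (real \<Rightarrow> real) \<Rightarrow> real \<Rightarrow> real \<Rightarrow> real \<Rightarrow> real" where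
  "action f g c z t =
     - integral {0..1} (\<lambda>s. ln \<bar>1 - f s * z\<bar>) - c * integral {0..1} (\<lambda>s. ln \<bar>1 + g s / z\<bar>)
     - t * ln \<bar>z\<bar>"

abbreviation action_deriv ::
  "nat \<Rightarrow> (real \<Rightarrow> real) \<Rightarrow> (real \<Rightarrow> real) \<Rightarrow> real \<Rightarrow> real \<Rightarrow> real \<Rightarrow> real" where
  "action_deriv r f g c z t \<equiv> (deriv ^^ r) (\<lambda>u. action f g c u t) z"

definition real_double_critical ::
  "(real \<Rightarrow> real) \<Rightarrow> (real \<Rightarrow> real) \<Rightarrow> real \<Rightarrow> real \<Rightarrow> real \<Rightarrow> bool" where
  "real_double_critical f g c z t \<longleftrightarrow>
     z \<in> action_domain f g \<and> action_deriv 1 f g c z t = 0 \<and> action_deriv 2 f g c z t = 0"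

definition critical_equation ::
  "(real \<Rightarrow> real) \<Rightarrow> (real \<Rightarrow> real) \<Rightarrow> real \<Rightarrow> complex \<Rightarrow> real \<Rightarrow> bool" where
  "critical_equation f g c z t \<longleftrightarrow>
     integral {0..1} (\<lambda>s. of_real (f s) * z / (1 - of_real (f s) * z))
     + of_real c * integral {0..1} (\<lambda>s. of_real (g s) / (z + of_real (g s)))
     - of_real t = 0"

definition support_interval ::
  "(real \<Rightarrow> real) \<Rightarrow> (real \<Rightarrow> real) \<Rightarrow> real \<Rightarrow> real \<Rightarrow> real \<Rightarrow> bool" where
  "support_interval f g c a b \<longleftrightarrow>
     - 1 \<le> a \<and> a < b \<and> b \<le> c \<and>
     (\<forall>t\<in>{a<..<b}. \<exists>z. Im z \<noteq> 0 \<and> {u. Im u \<noteq> 0 \<and> critical_equation f g c u t} = {z, cnj z}) \<and>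
     (\<exists>z. real_double_critical f g c z a) \<and> (\<exists>z. real_double_critical f g c z b)"

definition pearcey_sigma ::
  "(real \<Rightarrow> real) \<Rightarrow> (real \<Rightarrow> real) \<Rightarrow> real \<Rightarrow> real \<Rightarrow> real \<Rightarrow> real" where
  "pearcey_sigma f g c t z = (6 / action_deriv 4 f g c z t) powr (1 / 4) * (1 / z)"


subsection \<open>The Pearcey kernel\<close>

text \<open>
  The right branch of the \<open>\<zeta>\<close>-contour is the hyperbola branch
  \<open>\<zeta> u = sqrt (1 + u\<^sup>2) + \<i> u\<close>, with asymptotic directions \<open>exp (\<plusminus> \<i> \<pi> / 4)\<close>,
  traversed upwards; the left branch is \<open>- \<zeta> u\<close>, which comes from \<open>exp (3 \<pi> \<i> / 4) \<infinity>\<close>.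
\<close>

definition pearcey_zeta :: "real \<Rightarrow> complex" where
  "pearcey_zeta u = Complex (sqrt (1 + u\<^sup>2)) u"

definition pearcey_integrand :: "real \<Rightarrow> real \<Rightarrow> complex \<Rightarrow> complex \<Rightarrow> complex" where
  "pearcey_integrand \<xi> \<eta> \<zeta> \<nu> =
     exp (\<zeta> ^ 4 / 4 - \<zeta> * of_real \<xi>) / exp (\<nu> ^ 4 / 4 - \<nu> * of_real \<eta>) * (1 / (\<zeta> - \<nu>))"

definition pearcey_kernel :: "real \<Rightarrow> real \<Rightarrow> complex" where
  "pearcey_kernel \<xi> \<eta> =
     1 / (2 * of_real pi * \<i>)\<^sup>2 *
     (\<Sum>\<epsilon>\<in>{1, - 1}. LINT u|lborel. LINT v|lborel.
        pearcey_integrand \<xi> \<eta> (\<epsilon> * pearcey_zeta u) (\<i> * of_real v)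
        * (\<epsilon> * vector_derivative pearcey_zeta (at u)) * \<i>)"

end

theory Submission
  imports Defs "HOL-Real_Asymp.Real_Asymp"
begin

text \<open>
  In the variable \<open>u = z / z\<^sub>c\<close> every factor of \<open>K\<close> is, up to a constant, \<open>1 / (1 - p (u - 1))\<close>, with
  a real node \<open>p = \<phi> / (1 - \<phi>)\<close> for \<open>\<phi> = f z\<^sub>c\<close> and \<open>p = - 1 / (1 + \<psi>)\<close> for \<open>\<psi> = g / z\<^sub>c\<close>. The
  vanishing of the first three derivatives of the action says, up to Riemann sum errors of order 1,
  that the sums of \<open>T\<close> and \<open>p T\<close> over the nodes vanish, where \<open>T = p (1 + p)\<close>, while the fourth
  derivative is the sum of \<open>T\<^sup>2\<close>; these facts alone drive the asymptotics. The \<open>w\<close>-contour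
  becomes the unit circle, on which \<open>\<bar>1 - p (u - 1)\<bar>\<^sup>2 = 1 + 2 T (1 - Re u)\<close>. The \<open>z\<close>-contour
  becomes the difference of a loop outside and a loop inside the circle, which follow the scaled
  Pearcey hyperbola near \<open>u = 1\<close> and then an explicit curve along which \<open>ln \<bar>1 - p (u - 1)\<bar>\<close>,
  after subtraction of the part linear in \<open>p\<close> and \<open>T\<close>, grows at a rate proportional to \<open>T\<^sup>2\<close>
  for every node. Moving the \<open>w\<close>-contour across the \<open>z\<close>-contour only produces the residue
  \<open>z powi (b - a - 1)\<close>, which integrates to zero: if \<open>z\<^sub>c > 0\<close> the inner loop does not wind about 0,
  and otherwise \<open>a \<noteq> b\<close>. Dominated convergence on the hyperbola and the circle gives the Pearcey
  kernel, and the remaining pieces are exponentially small.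
\<close>

section \<open>Piecewise Lipschitz functions and Riemann sums\<close>

text \<open>The steepest descent curves of the action depend on \<open>f\<close> and
  \<open>g\<close> and are not explicit, so one contour must serve every node. Its origin is
  interpolation in \<open>p\<close>. At \<open>p = 0\<close> and \<open>p = -1\<close> the function
  \<open>- Ln (1 - p (u - 1))\<close> is simple: 0 and \<open>- Ln u\<close>. The cubic in
  \<open>p\<close> that matches values and first derivatives at these two points is a combination of
  \<open>p\<close>, \<open>T\<close> and \<open>p T\<close> with coefficients depending on
  \<open>u\<close> only, and the error has the factor \<open>T\<^sup>2\<close>. The coefficient of
  \<open>p T\<close> is \<open>u - 1 / u - 2 Ln u\<close>, and the explicit curve is the set where
  its real part vanishes: there only the controlled sums of \<open>p\<close> and \<open>T\<close>
  enter, and the real part of the error has one sign at all nodes. The curve leaves 1 at 30 degrees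
  while the hyperbola tends to 45 degrees, so a segment inside a common sector joins them. The arcs
  that close the loops leave the curve. On them it matters that nodes from \<open>f\<close> and from
  \<open>g\<close> have \<open>T\<close> of opposite signs (or \<open>T = 0\<close>): each closing
  direction favours one kind, while the other kind contributes an error of order
  \<open>exp (- R)\<close>.\<close>

definition pw_lip :: "(real \<Rightarrow> real) \<Rightarrow> bool" where
  "pw_lip h \<longleftrightarrow> (\<exists>D \<Lambda> b. finite D \<and> 0 \<le> \<Lambda> \<and> 0 \<le> b \<and> (\<forall>s\<in>{0..1}. \<bar>h s\<bar> \<le> b) \<and>
     (\<forall>s\<in>{0..1}. \<forall>s'\<in>{0..1}. s \<le> s' \<longrightarrow> {s..s'} \<inter> D = {} \<longrightarrow> \<bar>h s - h s'\<bar> \<le> \<Lambda> * (s' - s)))"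

lemma pw_lipE:
  assumes "pw_lip h"
  obtains D \<Lambda> b where "finite D" "0 \<le> \<Lambda>" "0 \<le> b" "\<And>s. s \<in> {0..1} \<Longrightarrow> \<bar>h s\<bar> \<le> b"
    "\<And>s s'. \<lbrakk>s \<in> {0..1}; s' \<in> {0..1}; s \<le> s'; {s..s'} \<inter> D = {}\<rbrakk> \<Longrightarrow> \<bar>h s - h s'\<bar> \<le> \<Lambda> * (s' - s)"
proof -
  from assms obtain D \<Lambda> b where "finite D" "0 \<le> \<Lambda>" "0 \<le> b" "\<forall>s\<in>{0..1}. \<bar>h s\<bar> \<le> b"
    "\<forall>s\<in>{0..1}. \<forall>s'\<in>{0..1}. s \<le> s' \<longrightarrow> {s..s'} \<inter> D = {} \<longrightarrow> \<bar>h s - h s'\<bar> \<le> \<Lambda> * (s' - s)"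
    unfolding pw_lip_def by (elim exE conjE)
  then show ?thesis by (intro that[of D \<Lambda> b]) simp_all
qed

lemma pw_lip_compose:
  assumes h: "pw_lip h" and "0 \<le> \<Lambda>'" and "\<And>s. s \<in> {0..1} \<Longrightarrow> \<bar>L (h s)\<bar> \<le> b'"
    and "\<And>s s'. \<lbrakk>s \<in> {0..1}; s' \<in> {0..1}\<rbrakk> \<Longrightarrow> \<bar>L (h s) - L (h s')\<bar> \<le> \<Lambda>' * \<bar>h s - h s'\<bar>"
  shows "pw_lip (\<lambda>s. L (h s))"
proof -
  obtain D \<Lambda> b where D: "finite D" "0 \<le> \<Lambda>" "0 \<le> b" "\<And>s. s \<in> {0..1} \<Longrightarrow> \<bar>h s\<bar> \<le> b"
    "\<And>s s'. \<lbrakk>s \<in> {0..1}; s' \<in> {0..1}; s \<le> s'; {s..s'} \<inter> D = {}\<rbrakk> \<Longrightarrow> \<bar>h s - h s'\<bar> \<le> \<Lambda> * (s' - s)"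
    by (rule pw_lipE[OF h]) (rule that)
  have b': "0 \<le> b'" using assms(3)[of 0] by force
  have "\<bar>L (h s) - L (h s')\<bar> \<le> (\<Lambda>' * \<Lambda>) * (s' - s)"
    if "s \<in> {0..1}" "s' \<in> {0..1}" "s \<le> s'" "{s..s'} \<inter> D = {}" for s s'
  proof -
    have "\<bar>L (h s) - L (h s')\<bar> \<le> \<Lambda>' * \<bar>h s - h s'\<bar>" using assms(4) that by blast
    also have "\<dots> \<le> \<Lambda>' * (\<Lambda> * (s' - s))" using D(5)[OF that] assms(2) by (intro mult_left_mono) auto
    finally show ?thesis by (simp add: mult.assoc)
  qed
  then show ?thesis unfolding pw_lip_def
    using D(1,2) assms(2,3) b' by (intro exI[of _ D] exI[of _ "\<Lambda>' * \<Lambda>"] exI[of _ b']) auto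
qed

lemma continuous_on_Icc_bounded:
  fixes h :: "real \<Rightarrow> 'a::real_normed_vector"
  assumes "continuous_on {a..b} h"
  obtains B where "B > 0" "\<And>x. x \<in> {a..b} \<Longrightarrow> norm (h x) \<le> B"
proof -
  have "bounded (h ` {a..b})" using assms compact_Icc by (intro compact_imp_bounded compact_continuous_image)
  then obtain B where "B > 0" "\<forall>y\<in>h ` {a..b}. norm y \<le> B" unfolding bounded_pos by blast
  then show ?thesis using that by blast
qed

text \<open>The values at the breakpoints are arbitrary, so a Lipschitz bound can only hold on
  intervals that avoid them; this is why \<open>pw_lip\<close> speaks of intervals disjoint from a
  finite set. On each piece the mean value bound for the C1 extension supplies the constant.\<close>

lemma piecewise_C1_imp_pw_lip:
  assumes "piecewise_C1 f" shows "pw_lip f"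
proof -
  obtain N and p :: "nat \<Rightarrow> real" where p: "p 0 = 0" "p N = 1" "\<And>i. i < N \<Longrightarrow> p i < p (Suc i)"
    and ex: "\<And>i. i < N \<Longrightarrow> \<exists>h. h C1_differentiable_on {p i..p (Suc i)} \<and> (\<forall>s\<in>{p i<..<p (Suc i)}. f s = h s)"
    using assms unfolding piecewise_C1_def by metis
  have "\<exists>\<Lambda> b. 0 \<le> \<Lambda> \<and> 0 \<le> b \<and> (\<forall>s\<in>{p i<..<p (Suc i)}. \<bar>f s\<bar> \<le> b) \<and>
     (\<forall>s\<in>{p i<..<p (Suc i)}. \<forall>s'\<in>{p i<..<p (Suc i)}. \<bar>f s - f s'\<bar> \<le> \<Lambda> * \<bar>s' - s\<bar>)" if i: "i < N" for i
  proof -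
    obtain h where h: "h C1_differentiable_on {p i..p (Suc i)}" "\<And>s. s\<in>{p i<..<p (Suc i)} \<Longrightarrow> f s = h s"
      using ex[OF i] by blast
    obtain h' where h': "\<And>x. x \<in> {p i..p (Suc i)} \<Longrightarrow> (h has_vector_derivative h' x) (at x)"
        "continuous_on {p i..p (Suc i)} h'"
      using h(1) unfolding C1_differentiable_on_def by blast
    obtain L where L: "\<And>x. x \<in> {p i..p (Suc i)} \<Longrightarrow> norm (h' x) \<le> L" "L > 0"
      using continuous_on_Icc_bounded[OF h'(2)] by metis
    have "continuous_on {p i..p (Suc i)} h"
      by (intro continuous_at_imp_continuous_on ballI has_vector_derivative_continuous[OF h'(1)])
    then obtain b where b: "\<And>x. x \<in> {p i..p (Suc i)} \<Longrightarrow> norm (h x) \<le> b" "b > 0"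
      using continuous_on_Icc_bounded by metis
    have lip: "norm (h s - h s') \<le> L * norm (s - s')" if "s\<in>{p i<..<p (Suc i)}" "s'\<in>{p i<..<p (Suc i)}" for s s'
    proof (rule field_differentiable_bound)
      show "convex {p i..p (Suc i)}" by simp
      show "s \<in> {p i..p (Suc i)}" "s' \<in> {p i..p (Suc i)}" using that by auto
      show "(h has_field_derivative h' x) (at x within {p i..p (Suc i)})" if "x \<in> {p i..p (Suc i)}" for x
        using h'(1)[OF that] has_vector_derivative_at_within has_real_derivative_iff_has_vector_derivative by blast
      show "norm (h' x) \<le> L" if "x \<in> {p i..p (Suc i)}" for x using L that by auto
    qed
    show ?thesis
      apply (rule exI[of _ L], rule exI[of _ b])
      using lip L b h(2) by (auto simp: abs_minus_commute)
  qed
  then obtain \<Lambda> b where Lb: "\<And>i. i < N \<Longrightarrow> 0 \<le> \<Lambda> i" "\<And>i. i < N \<Longrightarrow> 0 \<le> b i"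
     "\<And>i s. i < N \<Longrightarrow> s\<in>{p i<..<p (Suc i)} \<Longrightarrow> \<bar>f s\<bar> \<le> b i"
     "\<And>i s s'. i < N \<Longrightarrow> s\<in>{p i<..<p (Suc i)} \<Longrightarrow> s'\<in>{p i<..<p (Suc i)} \<Longrightarrow> \<bar>f s - f s'\<bar> \<le> \<Lambda> i * \<bar>s' - s\<bar>"
    by metis
  define D where "D = p ` {..N}"
  \<comment> \<open>A point off the breakpoints lies in the piece with the largest \<open>i\<close>
    such that \<open>p i < s\<close>, and an interval starting there can leave the piece only
    through the breakpoint \<open>p (Suc i)\<close>.\<close>
  have piece: "\<exists>i<N. s \<in> {p i<..<p (Suc i)} \<and> (\<forall>s'\<in>{0..1}. s \<le> s' \<longrightarrow> {s..s'} \<inter> D = {} \<longrightarrow> s' \<in> {p i<..<p (Suc i)})"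
    if s: "s \<in> {0..1}" "s \<notin> D" for s
  proof -
    define S where "S = {i. i \<le> N \<and> p i < s}"
    have "finite S" unfolding S_def by auto
    have s0: "s \<noteq> 0" "s \<noteq> 1" using s(2) p unfolding D_def by (metis atMost_iff bot_nat_0.extremum image_eqI order_refl)+
    have "0 \<in> S" unfolding S_def using s s0 p by auto
    define i where "i = Max S"
    have iS: "i \<in> S" unfolding i_def using \<open>finite S\<close> \<open>0 \<in> S\<close> by (intro Max_in) auto
    have "i \<noteq> N" using iS s p s0 unfolding S_def by auto
    then have iN: "i < N" using iS unfolding S_def by auto
    have "Suc i \<notin> S" using Max_ge[OF \<open>finite S\<close>, of "Suc i"] unfolding i_def by fastforce
    have "p (Suc i) \<in> D" using iN unfolding D_def by auto
    then have "s \<noteq> p (Suc i)" using s(2) by blast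
    then have "s < p (Suc i)" using iN \<open>Suc i \<notin> S\<close> unfolding S_def by auto
    moreover have "p i < s" using iS unfolding S_def by auto
    moreover have "s' < p (Suc i)" if "s \<le> s'" "{s..s'} \<inter> D = {}" for s'
    proof (rule ccontr)
      assume "\<not> s' < p (Suc i)"
      then have "p (Suc i) \<in> {s..s'} \<inter> D" using \<open>s < p (Suc i)\<close> iN unfolding D_def by auto
      then show False using that by auto
    qed
    ultimately show ?thesis using iN by (intro exI[of _ i]) auto
  qed
  \<comment> \<open>The second sum bounds the values at the breakpoints, about which the pieces say
    nothing.\<close>
  define BB where "BB = (\<Sum>i<N. b i) + (\<Sum>x\<in>D. \<bar>f x\<bar>)"
  define LL where "LL = (\<Sum>i<N. \<Lambda> i)"
  have bB: "b i \<le> (\<Sum>i<N. b i)" "\<Lambda> i \<le> LL" if "i < N" for i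
    unfolding LL_def using Lb that by (auto intro!: member_le_sum)
  have finD: "finite D" unfolding D_def by auto
  have n1: "0 \<le> (\<Sum>i<N. b i)" "0 \<le> (\<Sum>x\<in>D. \<bar>f x\<bar>)" "0 \<le> LL" unfolding LL_def using Lb by (auto intro!: sum_nonneg)
  have "\<bar>f s\<bar> \<le> BB" if s01: "s \<in> {0..1}" for s
  proof (cases "s \<in> D")
    case True
    then have "\<bar>f s\<bar> \<le> (\<Sum>x\<in>D. \<bar>f x\<bar>)" using finD by (intro member_le_sum) auto
    then show ?thesis using n1 unfolding BB_def by auto
  next
    case False
    then obtain i where "i < N" "s \<in> {p i<..<p (Suc i)}" using piece s01 by blast
    then show ?thesis using Lb(3)[of i s] bB(1)[of i] n1(2) unfolding BB_def by linarith
  qed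
  moreover have "\<bar>f s - f s'\<bar> \<le> LL * (s' - s)" if ss: "s \<in> {0..1}" "s' \<in> {0..1}" "s \<le> s'" "{s..s'} \<inter> D = {}" for s s'
  proof -
    have "s \<notin> D" using ss by auto
    then obtain i where "i < N" "s \<in> {p i<..<p (Suc i)}" "s' \<in> {p i<..<p (Suc i)}"
      using piece[of s] ss by blast
    then have "\<bar>f s - f s'\<bar> \<le> \<Lambda> i * \<bar>s' - s\<bar>" using Lb(4) by blast
    also have "\<dots> \<le> LL * (s' - s)" using bB(2)[OF \<open>i < N\<close>] ss by (simp add: mult_right_mono)
    finally show ?thesis .
  qed
  ultimately show ?thesis unfolding pw_lip_def using finD n1
    by (intro exI[of _ D] exI[of _ LL] exI[of _ BB]) (auto simp: BB_def)
qed

text \<open>Bounded, and continuous off the finite exceptional set and the two endpoints, which are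
  negligible.\<close>

lemma pw_lip_integrable:
  assumes "pw_lip h" shows "h integrable_on {0..1}"
proof -
  obtain D \<Lambda> b where D: "finite D" "0 \<le> \<Lambda>" "0 \<le> b" "\<And>s. s \<in> {0..1} \<Longrightarrow> \<bar>h s\<bar> \<le> b"
    "\<And>s s'. \<lbrakk>s \<in> {0..1}; s' \<in> {0..1}; s \<le> s'; {s..s'} \<inter> D = {}\<rbrakk> \<Longrightarrow> \<bar>h s - h s'\<bar> \<le> \<Lambda> * (s' - s)"
    by (rule pw_lipE[OF assms]) (rule that)
  define U where "U = {0<..<1} - D"
  have U: "open U" unfolding U_def using D(1) by (intro open_Diff finite_imp_closed) auto
  have "isCont h x" if xU: "x \<in> U" for x
  proof -
    obtain e where e: "e > 0" "ball x e \<subseteq> U" using openE[OF U xU] by metis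
    have "\<bar>h x - h y\<bar> \<le> \<Lambda> * \<bar>x - y\<bar>" if "y \<in> ball x e" for y
    proof -
      have 1: "z \<in> U" if "z \<in> {x..y} \<or> z \<in> {y..x}" for z
        using that \<open>y \<in> ball x e\<close> e(2) by (intro subsetD[OF e(2)]) (auto simp: dist_real_def)
      then have "{x..y} \<inter> D = {}" "{y..x} \<inter> D = {}" unfolding U_def by blast+
      moreover have "x \<in> {0..1}" "y \<in> {0..1}" using \<open>x \<in> U\<close> that e(2) unfolding U_def by auto
      ultimately show ?thesis using D(5)[of x y] D(5)[of y x] by (cases "x \<le> y") (simp_all add: abs_minus_commute)
    qed
    then have ev: "\<forall>\<^sub>F y in at x. norm (h y - h x) \<le> \<Lambda> * \<bar>x - y\<bar>"
      unfolding eventually_at using e(1) by (intro exI[of _ e]) (auto simp: dist_commute abs_minus_commute)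
    have "((\<lambda>y. \<Lambda> * \<bar>x - y\<bar>) \<longlongrightarrow> \<Lambda> * \<bar>x - x\<bar>) (at x)" by (intro tendsto_intros)
    then have "((\<lambda>y. h y - h x) \<longlongrightarrow> 0) (at x)" using Lim_null_comparison[OF ev] by simp
    then show ?thesis unfolding isCont_def using LIM_zero_iff by blast
  qed
  then have cont: "continuous_on U h" by (auto intro: continuous_at_imp_continuous_on)
  have "set_integrable lborel U h" unfolding set_integrable_def
  proof (rule integrableI_bounded_set[where A = "{0..1}" and B = b])
    show "(\<lambda>x. indicator U x *\<^sub>R h x) \<in> borel_measurable lborel"
      using borel_measurable_continuous_on_indicator[OF _ cont] U by simp
    show "AE x in lborel. x \<in> {0..1} \<longrightarrow> norm (indicator U x *\<^sub>R h x) \<le> b"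
      using D(3,4) by (auto simp: indicator_def)
  qed (auto simp: U_def indicator_def)
  then have "h integrable_on U" using set_borel_integral_eq_integral by blast
  then show ?thesis
  proof (rule integrable_spike_set)
    have "negligible (insert 0 (insert 1 D))" using D(1) by (intro negligible_finite) auto
    then show "negligible {x \<in> {0..1} - U. h x \<noteq> 0}"
      by (rule negligible_subset) (auto simp: U_def)
    have "{x \<in> U - {0..1}. h x \<noteq> 0} = {}" unfolding U_def by auto
    then show "negligible {x \<in> U - {0..1}. h x \<noteq> 0}" by (simp only: negligible_empty)
  qed
qed

text \<open>On a subinterval free of exceptional points the scaled error is at most
  \<open>\<Lambda> / n\<close>, and each exceptional point spoils at most two closed subintervals at
  a cost of \<open>2 b\<close> apiece. The total stays bounded as \<open>n\<close> grows, so it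
  disappears after division by the fourth root of \<open>n\<close>.\<close>

lemma pw_lip_riemann_sum:
  assumes "pw_lip h"
  shows "\<exists>C. \<forall>n>0. \<bar>(\<Sum>i=1..n. h (real i / real n)) - real n * integral {0..1} h\<bar> \<le> C"
proof -
  obtain D \<Lambda> b where D: "finite D" "0 \<le> \<Lambda>" "0 \<le> b" "\<And>s. s \<in> {0..1} \<Longrightarrow> \<bar>h s\<bar> \<le> b"
    "\<And>s s'. \<lbrakk>s \<in> {0..1}; s' \<in> {0..1}; s \<le> s'; {s..s'} \<inter> D = {}\<rbrakk> \<Longrightarrow> \<bar>h s - h s'\<bar> \<le> \<Lambda> * (s' - s)"
    by (rule pw_lipE[OF assms]) (rule that)
  have int: "h integrable_on {0..1}" by (rule pw_lip_integrable[OF assms])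
  have "\<bar>(\<Sum>i=1..n. h (real i / real n)) - real n * integral {0..1} h\<bar> \<le> \<Lambda> + 4 * b * card D" if n: "n > 0" for n
  proof -
    define I where "I i = {real i / real n..real (Suc i) / real n}" for i
    have Isub: "I i \<subseteq> {0..1}" if "i < n" for i using that n unfolding I_def by (auto simp: field_simps)
    have intI: "h integrable_on I i" if "i < n" for i
      using integrable_on_subinterval[OF int] Isub[OF that] unfolding I_def by auto
    have split: "integral {0..real m / real n} h = (\<Sum>i<m. integral (I i) h)" if "m \<le> n" for m
      using that
    proof (induction m)
      case (Suc m)
      have "integral {0..real (Suc m) / real n} h = integral {0..real m / real n} h + integral (I m) h"
        unfolding I_def using Suc.prems n
        by (intro Henstock_Kurzweil_Integration.integral_combine[symmetric] integrable_on_subinterval[OF int]) (auto simp: field_simps)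
      then show ?case using Suc by simp
    qed auto
    define G where "G = {i. i < n \<and> I i \<inter> D \<noteq> {}}"
    have err: "\<bar>h (real (Suc i) / real n) - real n * integral (I i) h\<bar> \<le> \<Lambda> / real n + (if i \<in> G then 2 * b else 0)" if i: "i < n" for i
    proof -
      have c: "real n * integral (I i) (\<lambda>_. h (real (Suc i) / real n)) = h (real (Suc i) / real n)"
        using n unfolding I_def by (simp add: field_simps)
      have "h (real (Suc i) / real n) - real n * integral (I i) h
          = real n * integral (I i) (\<lambda>s. h (real (Suc i) / real n) - h s)"
        using intI[OF i] c by (subst Henstock_Kurzweil_Integration.integral_diff) (auto simp: I_def algebra_simps)
      moreover have "\<bar>integral (I i) (\<lambda>s. h (real (Suc i) / real n) - h s)\<bar> \<le> (\<Lambda> / real n + (if i \<in> G then 2 * b else 0)) * (1 / real n)"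
      proof -
        have "norm (integral (cbox (real i / real n) (real (Suc i) / real n)) (\<lambda>s. h (real (Suc i) / real n) - h s))
           \<le> (\<Lambda> / real n + (if i \<in> G then 2 * b else 0)) * measure lborel (cbox (real i / real n) (real (Suc i) / real n))"
        proof (rule integrable_bound)
          show "0 \<le> \<Lambda> / real n + (if i \<in> G then 2 * b else 0)" using D by auto
          show "(\<lambda>s. h (real (Suc i) / real n) - h s) integrable_on cbox (real i / real n) (real (Suc i) / real n)"
            using intI[OF i] unfolding I_def by (intro integrable_diff) auto
          fix x assume "x \<in> cbox (real i / real n) (real (Suc i) / real n)"
          then have x: "x \<in> I i" unfolding I_def by auto
          have e: "real (Suc i) / real n \<in> I i" unfolding I_def using n by (auto simp: field_simps)
          have m: "x \<in> {0..1}" "real (Suc i) / real n \<in> {0..1}" using x e Isub[OF i] by blast+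
          show "norm (h (real (Suc i) / real n) - h x) \<le> \<Lambda> / real n + (if i \<in> G then 2 * b else 0)"
          proof (cases "i \<in> G")
            case True
            have "\<bar>h (real (Suc i) / real n) - h x\<bar> \<le> 2 * b"
              using D(4)[OF m(1)] D(4)[OF m(2)] by linarith
            moreover have "0 \<le> \<Lambda> / real n" using D by auto
            ultimately show ?thesis using True by auto
          next
            case False
            have "I i \<inter> D = {}" using False i unfolding G_def by blast
            moreover have "{x..real (Suc i) / real n} \<subseteq> I i" using x unfolding I_def by simp
            ultimately have "{x..real (Suc i) / real n} \<inter> D = {}" by blast
            then have "\<bar>h x - h (real (Suc i) / real n)\<bar> \<le> \<Lambda> * (real (Suc i) / real n - x)"
              using D(5)[OF m] x unfolding I_def by auto
            also have "\<dots> \<le> \<Lambda> * (1 / real n)" using x n D(2) unfolding I_def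
              by (intro mult_left_mono) (auto simp: field_simps)
            finally show ?thesis using False by (simp add: abs_minus_commute)
          qed
        qed
        then show ?thesis unfolding I_def using n by (simp add: field_simps)
      qed
      ultimately have "\<bar>h (real (Suc i) / real n) - real n * integral (I i) h\<bar>
          \<le> real n * ((\<Lambda> / real n + (if i \<in> G then 2 * b else 0)) * (1 / real n))"
        by (simp only: abs_mult abs_of_nat) (intro mult_left_mono, simp_all)
      then show ?thesis using n by simp
    qed
    have cardG: "card G \<le> 2 * card D"
    proof -
      \<comment> \<open>Indices of the subintervals containing \<open>x\<close>: only the floor of
        \<open>n x\<close> qualifies, and its predecessor when \<open>x\<close> is a grid
        point.\<close>
      define F where "F x = {i::nat. real i \<le> real n * x \<and> real n * x \<le> real (Suc i)}" for x
      have Fs: "F x \<subseteq> {nat \<lfloor>real n * x\<rfloor>, nat \<lfloor>real n * x\<rfloor> - 1}" for x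
      proof
        fix i assume "i \<in> F x"
        then have "int i \<le> \<lfloor>real n * x\<rfloor>" "\<lfloor>real n * x\<rfloor> \<le> int i + 1" unfolding F_def by (auto simp: le_floor_iff floor_le_iff)
        then show "i \<in> {nat \<lfloor>real n * x\<rfloor>, nat \<lfloor>real n * x\<rfloor> - 1}" by auto
      qed
      have cF: "card (F x) \<le> 2" for x
      proof -
        have "card (F x) \<le> card {nat \<lfloor>real n * x\<rfloor>, nat \<lfloor>real n * x\<rfloor> - 1}" using Fs by (intro card_mono) auto
        also have "\<dots> \<le> 2" by (simp add: card_insert_if)
        finally show ?thesis .
      qed
      have "G \<subseteq> (\<Union>x\<in>D. F x)" unfolding G_def F_def I_def using n by (auto simp: field_simps)
      then have "card G \<le> card (\<Union>x\<in>D. F x)" using D(1) Fs by (intro card_mono finite_UN_I) (auto intro: finite_subset)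
      also have "\<dots> \<le> (\<Sum>x\<in>D. card (F x))" using D(1) by (rule card_UN_le)
      also have "\<dots> \<le> (\<Sum>x\<in>D. 2)" using cF by (intro sum_mono) auto
      finally show ?thesis by simp
    qed
    have "(\<Sum>i=1..n. h (real i / real n)) = (\<Sum>i<n. h (real (Suc i) / real n))"
      by (simp only: lessThan_atLeast0 atLeastLessThanSuc_atLeastAtMost[symmetric] One_nat_def sum.shift_bounds_Suc_ivl)
    moreover have "integral {0..1} h = (\<Sum>i<n. integral (I i) h)" using split[of n] n by simp
    ultimately have "\<bar>(\<Sum>i=1..n. h (real i / real n)) - real n * integral {0..1} h\<bar>
        = \<bar>\<Sum>i<n. h (real (Suc i) / real n) - real n * integral (I i) h\<bar>"
      by (simp add: sum_subtractf sum_distrib_left)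
    also have "\<dots> \<le> (\<Sum>i<n. \<bar>h (real (Suc i) / real n) - real n * integral (I i) h\<bar>)" by (rule sum_abs)
    also have "\<dots> \<le> (\<Sum>i<n. \<Lambda> / real n + (if i \<in> G then 2 * b else 0))" using err by (intro sum_mono) auto
    also have "\<dots> = \<Lambda> + 2 * b * card G"
    proof -
      have "{..<n} \<inter> {i. i \<in> G} = G" unfolding G_def by auto
      then show ?thesis using n by (simp add: sum.distrib sum.If_cases)
    qed
    also have "\<dots> \<le> \<Lambda> + 2 * b * (2 * card D)" using cardG D(3) by (intro add_left_mono mult_left_mono) (auto simp: of_nat_mono simp flip: of_nat_mult)
    finally show ?thesis by simp
  qed
  then show ?thesis by blast
qed

section \<open>Closure properties of piecewise Lipschitz functions\<close>

lemma pw_lip_combine: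
  assumes "pw_lip h" "pw_lip k" "0 \<le> L1" "0 \<le> L2"
    and "\<And>s. s \<in> {0..1} \<Longrightarrow> \<bar>F s\<bar> \<le> b'"
    and "\<And>s s'. \<lbrakk>s \<in> {0..1}; s' \<in> {0..1}\<rbrakk> \<Longrightarrow> \<bar>F s - F s'\<bar> \<le> L1 * \<bar>h s - h s'\<bar> + L2 * \<bar>k s - k s'\<bar>"
  shows "pw_lip F"
proof -
  obtain D \<Lambda> b where D: "finite D" "0 \<le> \<Lambda>" "0 \<le> b" "\<And>s. s \<in> {0..1} \<Longrightarrow> \<bar>h s\<bar> \<le> b"
    "\<And>s s'. \<lbrakk>s \<in> {0..1}; s' \<in> {0..1}; s \<le> s'; {s..s'} \<inter> D = {}\<rbrakk> \<Longrightarrow> \<bar>h s - h s'\<bar> \<le> \<Lambda> * (s' - s)"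
    by (rule pw_lipE[OF assms(1)]) (rule that)
  obtain E M b2 where E: "finite E" "0 \<le> M" "0 \<le> b2" "\<And>s. s \<in> {0..1} \<Longrightarrow> \<bar>k s\<bar> \<le> b2"
    "\<And>s s'. \<lbrakk>s \<in> {0..1}; s' \<in> {0..1}; s \<le> s'; {s..s'} \<inter> E = {}\<rbrakk> \<Longrightarrow> \<bar>k s - k s'\<bar> \<le> M * (s' - s)"
    by (rule pw_lipE[OF assms(2)]) (rule that)
  have b': "0 \<le> b'" using assms(5)[of 0] by force
  have "\<bar>F s - F s'\<bar> \<le> (L1 * \<Lambda> + L2 * M) * (s' - s)"
    if s: "s \<in> {0..1}" "s' \<in> {0..1}" "s \<le> s'" and d: "{s..s'} \<inter> (D \<union> E) = {}" for s s'
  proof -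
    have d': "{s..s'} \<inter> D = {}" "{s..s'} \<inter> E = {}" using d by blast+
    have "\<bar>F s - F s'\<bar> \<le> L1 * \<bar>h s - h s'\<bar> + L2 * \<bar>k s - k s'\<bar>" using assms(6) s by blast
    also have "\<dots> \<le> L1 * (\<Lambda> * (s' - s)) + L2 * (M * (s' - s))"
      using D(5)[OF s d'(1)] E(5)[OF s d'(2)] assms(3,4) by (intro add_mono mult_left_mono) auto
    finally show ?thesis by (simp add: algebra_simps)
  qed
  then show ?thesis unfolding pw_lip_def
    using D(1,2) E(1,2) assms(3,4,5) b'
    by (intro exI[of _ "D \<union> E"] exI[of _ "L1 * \<Lambda> + L2 * M"] exI[of _ b']) auto
qed

lemma pw_lip_bounded:
  assumes "pw_lip h" obtains b where "b > 0" "\<And>s. s \<in> {0..1} \<Longrightarrow> \<bar>h s\<bar> \<le> b"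
proof (rule pw_lipE[OF assms])
  fix D \<Lambda> b assume "0 \<le> (b::real)" "\<And>s. s \<in> {0..1} \<Longrightarrow> \<bar>h s\<bar> \<le> b"
  then show ?thesis by (intro that[of "b + 1"]) fastforce+
qed

lemma pw_lip_const: "pw_lip (\<lambda>_. a)"
  unfolding pw_lip_def by (intro exI[of _ "{}"] exI[of _ 0] exI[of _ "\<bar>a\<bar>"]) auto

lemma pw_lip_add: assumes "pw_lip h" "pw_lip k" shows "pw_lip (\<lambda>s. h s + k s)"
proof -
  obtain b b' where b: "\<And>s. s \<in> {0..1} \<Longrightarrow> \<bar>h s\<bar> \<le> b" "\<And>s. s \<in> {0..1} \<Longrightarrow> \<bar>k s\<bar> \<le> b'"
    using pw_lip_bounded assms by metis
  show ?thesis
  proof (rule pw_lip_combine[OF assms, of 1 1 _ "b + b'"])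
    fix s :: real assume "s \<in> {0..1}" then show "\<bar>h s + k s\<bar> \<le> b + b'" using b[of s] by linarith
  qed auto
qed

lemma pw_lip_mult: assumes "pw_lip h" "pw_lip k" shows "pw_lip (\<lambda>s. h s * k s)"
proof -
  obtain b b' where b: "\<And>s. s \<in> {0..1} \<Longrightarrow> \<bar>h s\<bar> \<le> b" "\<And>s. s \<in> {0..1} \<Longrightarrow> \<bar>k s\<bar> \<le> b'" "b > 0" "b' > 0"
    using pw_lip_bounded assms by metis
  show ?thesis
  proof (rule pw_lip_combine[OF assms, of b' b _ "b * b'"])
    fix s :: real assume s: "s \<in> {0..1}"
    show "\<bar>h s * k s\<bar> \<le> b * b'" unfolding abs_mult using b(1,2)[OF s] b(3,4) by (intro mult_mono) auto
    fix s' :: real assume s': "s' \<in> {0..1}"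
    have "\<bar>h s * k s - h s' * k s'\<bar> = \<bar>k s * (h s - h s') + h s' * (k s - k s')\<bar>" by (simp add: algebra_simps)
    also have "\<dots> \<le> \<bar>k s\<bar> * \<bar>h s - h s'\<bar> + \<bar>h s'\<bar> * \<bar>k s - k s'\<bar>" by (metis abs_mult abs_triangle_ineq)
    also have "\<dots> \<le> b' * \<bar>h s - h s'\<bar> + b * \<bar>k s - k s'\<bar>"
      using b(1)[OF s'] b(2)[OF s] by (intro add_mono mult_right_mono) auto
    finally show "\<bar>h s * k s - h s' * k s'\<bar> \<le> b' * \<bar>h s - h s'\<bar> + b * \<bar>k s - k s'\<bar>" .
  qed (use b in auto)
qed

lemma pw_lip_cmult: "pw_lip h \<Longrightarrow> pw_lip (\<lambda>s. a * h s)"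
  using pw_lip_mult[OF pw_lip_const] .

lemma pw_lip_uminus: "pw_lip h \<Longrightarrow> pw_lip (\<lambda>s. - h s)"
  using pw_lip_cmult[of h "-1"] by simp

lemma pw_lip_diff: "pw_lip h \<Longrightarrow> pw_lip k \<Longrightarrow> pw_lip (\<lambda>s. h s - k s)"
  using pw_lip_add[of h "\<lambda>s. - k s"] pw_lip_uminus by simp

lemma pw_lip_power: "pw_lip h \<Longrightarrow> pw_lip (\<lambda>s. h s ^ r)"
  by (induction r) (auto intro: pw_lip_const pw_lip_mult)

lemma pw_lip_inverse:
  assumes "pw_lip h" "e > 0" "\<And>s. s \<in> {0..1} \<Longrightarrow> e \<le> \<bar>h s\<bar>"
  shows "pw_lip (\<lambda>s. 1 / h s)"
proof (rule pw_lip_compose[where L = "\<lambda>y. 1 / y" and h = h and b' = "1 / e" and \<Lambda>' = "1 / (e * e)"])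
  fix s :: real assume s: "s \<in> {0..1}"
  show "\<bar>1 / h s\<bar> \<le> 1 / e" using assms(2) assms(3)[OF s] by (simp add: frac_le)
  fix s' :: real assume s': "s' \<in> {0..1}"
  have nz: "h s \<noteq> 0" "h s' \<noteq> 0" using assms(2) assms(3)[OF s] assms(3)[OF s'] by auto
  have "\<bar>1 / h s - 1 / h s'\<bar> = \<bar>h s - h s'\<bar> / (\<bar>h s\<bar> * \<bar>h s'\<bar>)"
    using nz by (simp add: field_simps abs_mult abs_minus_commute)
  also have "\<dots> \<le> \<bar>h s - h s'\<bar> / (e * e)"
    using assms(2) assms(3)[OF s] assms(3)[OF s'] by (intro divide_left_mono mult_mono mult_pos_pos) auto
  finally show "\<bar>1 / h s - 1 / h s'\<bar> \<le> 1 / (e * e) * \<bar>h s - h s'\<bar>" by simp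
qed (use assms in auto)

lemma pw_lip_divide:
  assumes "pw_lip k" "pw_lip h" "e > 0" "\<And>s. s \<in> {0..1} \<Longrightarrow> e \<le> \<bar>h s\<bar>"
  shows "pw_lip (\<lambda>s. k s / h s)"
  using pw_lip_mult[OF assms(1) pw_lip_inverse[OF assms(2-4)]] by simp

text \<open>The inequality \<open>ln y \<le> y - 1\<close>, applied to the quotient of two values in
  both orders, shows that the logarithm is Lipschitz with constant \<open>1 / e\<close> away from
  0.\<close>

lemma pw_lip_ln_abs:
  assumes "pw_lip h" "e > 0" "\<And>s. s \<in> {0..1} \<Longrightarrow> e \<le> \<bar>h s\<bar>"
  shows "pw_lip (\<lambda>s. ln \<bar>h s\<bar>)"
proof -
  obtain b where b: "b > 0" "\<And>s. s \<in> {0..1} \<Longrightarrow> \<bar>h s\<bar> \<le> b"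
    using pw_lip_bounded assms by metis
  have main: "ln \<bar>h s\<bar> - ln \<bar>h s'\<bar> \<le> 1 / e * \<bar>h s - h s'\<bar>" if s: "s \<in> {0..1}" "s' \<in> {0..1}" for s s'
  proof -
    have p: "0 < \<bar>h s\<bar>" "0 < \<bar>h s'\<bar>" using assms(2) assms(3)[OF s(1)] assms(3)[OF s(2)] by auto
    have "ln \<bar>h s\<bar> - ln \<bar>h s'\<bar> \<le> \<bar>h s\<bar> / \<bar>h s'\<bar> - 1"
      using ln_le_minus_one[of "\<bar>h s\<bar> / \<bar>h s'\<bar>"] p by (simp add: ln_div)
    also have "\<dots> = (\<bar>h s\<bar> - \<bar>h s'\<bar>) / \<bar>h s'\<bar>" using p by (simp add: field_simps)
    also have "\<dots> \<le> \<bar>h s - h s'\<bar> / \<bar>h s'\<bar>" using p by (intro divide_right_mono) auto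
    also have "\<dots> \<le> \<bar>h s - h s'\<bar> / e" using assms(2) assms(3)[OF s(2)] p by (intro divide_left_mono) auto
    finally show ?thesis by simp
  qed
  show ?thesis
  proof (rule pw_lip_compose[where L = "\<lambda>y. ln \<bar>y\<bar>" and h = h and b' = "\<bar>ln e\<bar> + \<bar>ln b\<bar>" and \<Lambda>' = "1 / e"])
    fix s :: real assume s: "s \<in> {0..1}"
    have "ln e \<le> ln \<bar>h s\<bar>" "ln \<bar>h s\<bar> \<le> ln b" using assms(2) assms(3)[OF s] b(2)[OF s] b(1) by auto
    then show "\<bar>ln \<bar>h s\<bar>\<bar> \<le> \<bar>ln e\<bar> + \<bar>ln b\<bar>" by linarith
    fix s' :: real assume s': "s' \<in> {0..1}"
    show "\<bar>ln \<bar>h s\<bar> - ln \<bar>h s'\<bar>\<bar> \<le> 1 / e * \<bar>h s - h s'\<bar>"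
      using main[OF s s'] main[OF s' s] by (simp add: abs_le_iff abs_minus_commute)
  qed (use assms in auto)
qed

lemmas pw_lip_intros = pw_lip_const pw_lip_add pw_lip_mult pw_lip_uminus pw_lip_diff pw_lip_power

section \<open>Derivatives of the action\<close>

text \<open>Differentiation under the integral sign. The integrands may jump in \<open>s\<close>, so
  a second order remainder bound that is uniform in \<open>s\<close> takes the place of joint
  continuity.\<close>

lemma DERIV_parametric_integral:
  fixes F :: "real \<Rightarrow> real \<Rightarrow> real"
  assumes \<delta>: "\<delta> > 0" and int: "\<And>h. \<bar>h\<bar> < \<delta> \<Longrightarrow> F h integrable_on {0..1}" "F' integrable_on {0..1}"
    and rem: "\<And>h s. \<bar>h\<bar> < \<delta> \<Longrightarrow> s \<in> {0..1} \<Longrightarrow> \<bar>F h s - F 0 s - h * F' s\<bar> \<le> C * h\<^sup>2"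
  shows "((\<lambda>h. integral {0..1} (F h)) has_real_derivative integral {0..1} F') (at 0)"
proof -
  have bd: "\<bar>integral {0..1} (F h) - integral {0..1} (F 0) - h * integral {0..1} F'\<bar> \<le> C * h\<^sup>2" if h: "\<bar>h\<bar> < \<delta>" for h
  proof -
    have i: "F h integrable_on {0..1}" "F 0 integrable_on {0..1}" "(\<lambda>s. h * F' s) integrable_on {0..1}"
      using int h \<delta> by (auto intro: integrable_on_mult_right)
    have "integral {0..1} (F h) - integral {0..1} (F 0) - h * integral {0..1} F'
       = integral {0..1} (\<lambda>s. F h s - F 0 s - h * F' s)"
      using i by (simp add: Henstock_Kurzweil_Integration.integral_diff integrable_diff)
    also have "norm \<dots> \<le> integral {0..1} (\<lambda>s::real. C * h\<^sup>2)"
    proof (rule Henstock_Kurzweil_Integration.integral_norm_bound_integral)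
      show "(\<lambda>s. F h s - F 0 s - h * F' s) integrable_on {0..1}" using i by (intro integrable_diff)
    qed (use rem[OF h] in auto)
    finally show ?thesis by simp
  qed
  show ?thesis unfolding DERIV_def
  proof -
    have ev: "\<forall>\<^sub>F h in at 0. norm ((integral {0..1} (F (0 + h)) - integral {0..1} (F 0)) / h - integral {0..1} F') \<le> C * \<bar>h\<bar>"
      unfolding eventually_at
    proof (intro exI[of _ \<delta>] conjI ballI impI \<delta>)
      fix h :: real assume h: "h \<noteq> 0 \<and> dist h 0 < \<delta>"
      have "norm ((integral {0..1} (F (0 + h)) - integral {0..1} (F 0)) / h - integral {0..1} F')
         = \<bar>integral {0..1} (F h) - integral {0..1} (F 0) - h * integral {0..1} F'\<bar> / \<bar>h\<bar>"
        using h by (simp add: field_simps flip: abs_divide)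
      also have "\<dots> \<le> C * h\<^sup>2 / \<bar>h\<bar>" using bd[of h] h by (intro divide_right_mono) (auto simp: dist_real_def)
      also have "\<dots> = C * \<bar>h\<bar>" using h by (simp add: power2_eq_square field_simps abs_if)
      finally show "norm ((integral {0..1} (F (0 + h)) - integral {0..1} (F 0)) / h - integral {0..1} F') \<le> C * \<bar>h\<bar>" .
    qed
    have "((\<lambda>h. C * \<bar>h\<bar>) \<longlongrightarrow> C * \<bar>0\<bar>) (at 0)" by (intro tendsto_intros)
    then have "((\<lambda>h. (integral {0..1} (F (0 + h)) - integral {0..1} (F 0)) / h - integral {0..1} F') \<longlongrightarrow> 0) (at 0)"
      using Lim_null_comparison[OF ev] by simp
    then show "(\<lambda>h. (integral {0..1} (F (0 + h)) - integral {0..1} (F 0)) / h) \<midarrow>0\<rightarrow> integral {0..1} F'"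
      using LIM_zero_iff by blast
  qed
qed

lemma geometric_power_remainder:
  "\<exists>C\<ge>0. \<forall>v::real. \<bar>v\<bar> \<le> 1/2 \<longrightarrow> \<bar>(1 / (1 - v)) ^ r - 1 - real r * v\<bar> \<le> C * v\<^sup>2"
proof (induction r)
  case 0 then show ?case by (intro exI[of _ 0]) auto
next
  case (Suc r)
  then obtain C where C: "C \<ge> 0" "\<And>v::real. \<bar>v\<bar> \<le> 1/2 \<Longrightarrow> \<bar>(1 / (1 - v)) ^ r - 1 - real r * v\<bar> \<le> C * v\<^sup>2" by blast
  have "\<bar>(1 / (1 - v)) ^ Suc r - 1 - real (Suc r) * v\<bar> \<le> (2 * C + 2 * (r + 1)) * v\<^sup>2" if v: "\<bar>v\<bar> \<le> 1/2" for v :: real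
  proof -
    let ?a = "1 / (1 - v)"
    have v': "1/2 \<le> 1 - v" using v by linarith
    then have "1 / (1 - v) \<le> 1 / (1/2)" by (intro divide_left_mono) auto
    then have nz: "1 - v \<noteq> 0" "\<bar>?a\<bar> \<le> 2" using v' by auto
    have "?a * (1 - v) = 1" using nz by simp
    moreover have "?a * (?a ^ r - 1 - real r * v) + ?a * ((real r + 1) * v\<^sup>2)
        = ?a ^ Suc r - (?a * (1 - v)) * (1 + (real r + 1) * v)"
      by (simp only: power_Suc power2_eq_square) (simp only: algebra_simps)
    ultimately have "?a ^ Suc r - 1 - real (Suc r) * v = ?a * (?a ^ r - 1 - real r * v) + ?a * ((real r + 1) * v\<^sup>2)"
      by simp
    also have "\<bar>\<dots>\<bar> \<le> \<bar>?a\<bar> * \<bar>?a ^ r - 1 - real r * v\<bar> + \<bar>?a\<bar> * ((real r + 1) * v\<^sup>2)"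
      by (rule order_trans[OF abs_triangle_ineq]) (simp add: abs_mult)
    also have "\<dots> \<le> 2 * (C * v\<^sup>2) + 2 * ((real r + 1) * v\<^sup>2)"
      using nz(2) C(2)[OF v] C(1) by (intro add_mono mult_mono) auto
    finally show ?thesis by (simp add: algebra_simps)
  qed
  then show ?case using C(1) by (intro exI[of _ "2 * C + 2 * (r + 1)"]) auto
qed

text \<open>The function \<open>\<tau> / (1 - \<tau> h)\<close> has its own square as derivative in
  \<open>h\<close>, so differentiating a power raises the exponent by one. After recentring at a
  base point both kinds of integrands of the action take this form, which is why derivatives at 0
  suffice.\<close>

lemma DERIV_integral_geometric_power:
  assumes \<tau>: "pw_lip \<tau>"
  shows "((\<lambda>h. integral {0..1} (\<lambda>s. (\<tau> s / (1 - \<tau> s * h)) ^ r)) has_real_derivative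
           (real r * integral {0..1} (\<lambda>s. \<tau> s ^ Suc r))) (at 0)"
    and "((\<lambda>h. - integral {0..1} (\<lambda>s. ln \<bar>1 - \<tau> s * h\<bar>)) has_real_derivative
           integral {0..1} \<tau>) (at 0)"
proof -
  obtain b where b: "b > 0" "\<And>s. s \<in> {0..1} \<Longrightarrow> \<bar>\<tau> s\<bar> \<le> b" using pw_lip_bounded[OF \<tau>] by metis
  have small: "\<bar>\<tau> s * h\<bar> \<le> 1/2" if "\<bar>h\<bar> < 1 / (2 * b)" "s \<in> {0..1}" for h s
  proof -
    have "\<bar>\<tau> s * h\<bar> \<le> b * (1 / (2 * b))" unfolding abs_mult using b that by (intro mult_mono) auto
    then show ?thesis using b by simp
  qed
  have low: "1/2 \<le> \<bar>1 - \<tau> s * h\<bar>" if "\<bar>h\<bar> < 1 / (2 * b)" "s \<in> {0..1}" for h s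
    using small[OF that] by linarith
  have pl: "pw_lip (\<lambda>s. 1 - \<tau> s * h)" for h by (intro pw_lip_intros \<tau>)
  obtain C where C: "C \<ge> 0" "\<And>v::real. \<bar>v\<bar> \<le> 1/2 \<Longrightarrow> \<bar>(1 / (1 - v)) ^ r - 1 - real r * v\<bar> \<le> C * v\<^sup>2"
    using geometric_power_remainder by blast
  have "((\<lambda>h. integral {0..1} (\<lambda>s. (\<tau> s / (1 - \<tau> s * h)) ^ r)) has_real_derivative
           (integral {0..1} (\<lambda>s. real r * \<tau> s ^ Suc r))) (at 0)"
  proof (rule DERIV_parametric_integral[where \<delta> = "1 / (2 * b)" and C = "b ^ r * (C * b\<^sup>2)"])
    show "(\<lambda>s. (\<tau> s / (1 - \<tau> s * h)) ^ r) integrable_on {0..1}" if "\<bar>h\<bar> < 1 / (2 * b)" for h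
      using low[OF that] by (intro pw_lip_integrable pw_lip_power pw_lip_divide[where e = "1/2"] \<tau> pl) auto
    show "(\<lambda>s. real r * \<tau> s ^ Suc r) integrable_on {0..1}"
      by (intro pw_lip_integrable pw_lip_cmult pw_lip_power \<tau>)
    fix h s :: real assume h: "\<bar>h\<bar> < 1 / (2 * b)" and s: "s \<in> {0..1}"
    have "(\<tau> s / (1 - \<tau> s * h)) ^ r - (\<tau> s / (1 - \<tau> s * 0)) ^ r - h * (real r * \<tau> s ^ Suc r)
       = \<tau> s ^ r * ((1 / (1 - \<tau> s * h)) ^ r - 1 - real r * (\<tau> s * h))"
      by (simp add: power_divide algebra_simps)
    also have "\<bar>\<dots>\<bar> \<le> \<bar>\<tau> s\<bar> ^ r * (C * (\<tau> s * h)\<^sup>2)"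
      unfolding abs_mult power_abs using C(2)[OF small[OF h s]] by (intro mult_left_mono) auto
    also have "\<dots> \<le> b ^ r * (C * (b\<^sup>2 * h\<^sup>2))"
    proof -
      have "(\<tau> s)\<^sup>2 * h\<^sup>2 \<le> b\<^sup>2 * h\<^sup>2" using b(1) b(2)[OF s] by (intro mult_right_mono) (simp_all add: power2_le_iff_abs_le)
      then have "C * ((\<tau> s)\<^sup>2 * h\<^sup>2) \<le> C * (b\<^sup>2 * h\<^sup>2)" using C(1) by (rule mult_left_mono)
      moreover have "\<bar>\<tau> s\<bar> ^ r \<le> b ^ r" using b(2)[OF s] by (intro power_mono) auto
      ultimately show ?thesis using b(1) C(1) unfolding power_mult_distrib by - (rule mult_mono, auto)
    qed
    finally show "\<bar>(\<tau> s / (1 - \<tau> s * h)) ^ r - (\<tau> s / (1 - \<tau> s * 0)) ^ r - h * (real r * \<tau> s ^ Suc r)\<bar> \<le> b ^ r * (C * b\<^sup>2) * h\<^sup>2"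
      by (simp add: algebra_simps)
  qed (use b in auto)
  then show "((\<lambda>h. integral {0..1} (\<lambda>s. (\<tau> s / (1 - \<tau> s * h)) ^ r)) has_real_derivative
           (real r * integral {0..1} (\<lambda>s. \<tau> s ^ Suc r))) (at 0)" by simp
  have "((\<lambda>h. integral {0..1} (\<lambda>s. ln \<bar>1 - \<tau> s * h\<bar>)) has_real_derivative
           (integral {0..1} (\<lambda>s. - \<tau> s))) (at 0)"
  proof (rule DERIV_parametric_integral[where \<delta> = "1 / (2 * b)" and C = "2 * b\<^sup>2"])
    show "(\<lambda>s. ln \<bar>1 - \<tau> s * h\<bar>) integrable_on {0..1}" if "\<bar>h\<bar> < 1 / (2 * b)" for h
      using low[OF that] by (intro pw_lip_integrable pw_lip_ln_abs[where e = "1/2"] pl) auto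
    show "(\<lambda>s. - \<tau> s) integrable_on {0..1}" by (intro pw_lip_integrable pw_lip_intros \<tau>)
    fix h s :: real assume h: "\<bar>h\<bar> < 1 / (2 * b)" and s: "s \<in> {0..1}"
    have "\<bar>ln (1 + - (\<tau> s * h)) - (- (\<tau> s * h))\<bar> \<le> 2 * (- (\<tau> s * h))\<^sup>2"
      using small[OF h s] by (intro abs_ln_one_plus_x_minus_x_bound) auto
    moreover have "\<bar>1 - \<tau> s * h\<bar> = 1 + - (\<tau> s * h)" using small[OF h s] by linarith
    moreover have "2 * (- (\<tau> s * h))\<^sup>2 \<le> 2 * b\<^sup>2 * h\<^sup>2"
    proof -
      have "(\<tau> s)\<^sup>2 \<le> b\<^sup>2" using b(2)[OF s] by (simp add: power2_le_iff_abs_le)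
      then show ?thesis by (simp add: power_mult_distrib mult_right_mono)
    qed
    ultimately show "\<bar>ln \<bar>1 - \<tau> s * h\<bar> - ln \<bar>1 - \<tau> s * 0\<bar> - h * - \<tau> s\<bar> \<le> 2 * b\<^sup>2 * h\<^sup>2"
      by (simp add: mult.commute[of h] mult.assoc)
  qed (use b in auto)
  then show "((\<lambda>h. - integral {0..1} (\<lambda>s. ln \<bar>1 - \<tau> s * h\<bar>)) has_real_derivative
           integral {0..1} \<tau>) (at 0)"
    by (auto dest: DERIV_minus)
qed

text \<open>Where \<open>f s\<close> is small, \<open>f s * z\<close> is small and the factor is
  near 1; elsewhere \<open>f s\<close> is bounded below and the distance of \<open>z\<close> from
  the closure of the singular points transfers to the factor. The split is there because
  \<open>f\<close> may come arbitrarily close to 0.\<close>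

lemma action_domain_bound:
  assumes z: "z \<in> action_domain f g" and f: "\<And>s. s \<in> {0..1} \<Longrightarrow> f s > 0"
  obtains e where "e > 0" "\<And>s. s \<in> {0..1} \<Longrightarrow> e \<le> \<bar>1 - f s * z\<bar>" "\<And>s. s \<in> {0..1} \<Longrightarrow> e \<le> \<bar>z + g s\<bar>"
proof -
  let ?A = "(\<lambda>s. 1 / f s) ` {0..1} \<union> (\<lambda>s. - g s) ` {0..1}"
  have z0: "z \<noteq> 0" and "z \<notin> closure ?A" using z unfolding action_domain_def by auto
  then obtain d where d: "d > 0" "\<And>w. w \<in> ?A \<Longrightarrow> d \<le> dist w z"
    unfolding closure_approachable by (force simp: not_less)
  define e where "e = min d (min (1/2) (d / (2 * \<bar>z\<bar>)))"
  have e_le: "e \<le> d" "e \<le> 1/2" "e \<le> d / (2 * \<bar>z\<bar>)" unfolding e_def by auto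
  have "e > 0" unfolding e_def using d z0 by auto
  moreover have "e \<le> \<bar>1 - f s * z\<bar>" if s: "s \<in> {0..1}" for s
  proof (cases "f s \<le> 1 / (2 * \<bar>z\<bar>)")
    case True
    then have "\<bar>f s * z\<bar> \<le> 1/2" using z0 f[OF s] by (simp add: abs_mult field_simps)
    then have "1/2 \<le> \<bar>1 - f s * z\<bar>" by linarith
    then show ?thesis using e_le by linarith
  next
    case False
    have "d \<le> dist (1 / f s) z" using s by (intro d(2)) auto
    then have "d * f s \<le> \<bar>1 / f s - z\<bar> * f s" using f[OF s] by (intro mult_right_mono) (auto simp: dist_real_def)
    also have "\<dots> = \<bar>(1 / f s - z) * f s\<bar>" using f[OF s] by (simp add: abs_mult)
    also have "(1 / f s - z) * f s = 1 - f s * z" using f[OF s] by (simp add: field_simps)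
    finally have "d * f s \<le> \<bar>1 - f s * z\<bar>" .
    moreover have "d * (1 / (2 * \<bar>z\<bar>)) \<le> d * f s" using False d by (intro mult_left_mono) auto
    ultimately show ?thesis using e_le(3) by simp
  qed
  moreover have "e \<le> \<bar>z + g s\<bar>" if s: "s \<in> {0..1}" for s
  proof -
    have "d \<le> dist (- g s) z" using s by (intro d(2)) auto
    then show ?thesis using e_le(1) unfolding dist_real_def by linarith
  qed
  ultimately show ?thesis by (rule that)
qed

lemma open_action_domain: "open (action_domain f g)"
  unfolding action_domain_def by (intro open_Compl closed_insert closed_closure)

text \<open>Closed form of the \<open>r\<close>-th derivative of the action for
  \<open>r \<ge> 1\<close>. The term with \<open>t - c\<close> arises from writing
  \<open>1 + g / z\<close> as \<open>(z + g) / z\<close>, which moves \<open>c\<close> copies of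
  \<open>ln z\<close> into the last summand of the action.\<close>

definition action_D :: "(real \<Rightarrow> real) \<Rightarrow> (real \<Rightarrow> real) \<Rightarrow> real \<Rightarrow> real \<Rightarrow> nat \<Rightarrow> real \<Rightarrow> real" where
  "action_D f g c t r z = fact (r - 1) * (integral {0..1} (\<lambda>s. (f s / (1 - f s * z)) ^ r)
     + (-1) ^ r * (c * integral {0..1} (\<lambda>s. (1 / (z + g s)) ^ r) + (t - c) * (1 / z) ^ r))"

lemma mobius_shift:
  assumes "1 - (f::real) * z \<noteq> 0"
  shows "f / (1 - f * u) = f / (1 - f * z) / (1 - f / (1 - f * z) * (u - z))"
    "1 - f * u = (1 - f * z) * (1 - f / (1 - f * z) * (u - z))"
proof -
  have "(1 - f * z) * (1 - f / (1 - f * z) * (u - z)) = (1 - f * z) - ((1 - f * z) / (1 - f * z)) * (f * (u - z))"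
    by (simp add: right_diff_distrib del: divide_self_if)
  then show e: "1 - f * u = (1 - f * z) * (1 - f / (1 - f * z) * (u - z))" using assms by (simp add: right_diff_distrib)
  show "f / (1 - f * u) = f / (1 - f * z) / (1 - f / (1 - f * z) * (u - z))"
    by (subst e) simp
qed

lemma DERIV_action_D:
  assumes z: "z \<in> action_domain f g" and f0: "\<And>s. s \<in> {0..1} \<Longrightarrow> f s > 0"
    and f: "pw_lip f" and g: "pw_lip g" and r: "r \<ge> 1"
  shows "(action_D f g c t r has_real_derivative action_D f g c t (Suc r) z) (at z)"
    and "((\<lambda>u. action f g c u t) has_real_derivative action_D f g c t 1 z) (at z)"
proof -
  obtain e where e: "e > 0" "\<And>s. s \<in> {0..1} \<Longrightarrow> e \<le> \<bar>1 - f s * z\<bar>" "\<And>s. s \<in> {0..1} \<Longrightarrow> e \<le> \<bar>z + g s\<bar>"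
    using action_domain_bound[OF z f0] by metis
  have z0: "z \<noteq> 0" using z unfolding action_domain_def by auto
  define \<tau> where "\<tau> s = f s / (1 - f s * z)" for s
  define \<rho> where "\<rho> s = - 1 / (z + g s)" for s
  have \<tau>: "pw_lip \<tau>" unfolding \<tau>_def using e by (intro pw_lip_divide[where e = e] pw_lip_intros f) auto
  have \<rho>: "pw_lip \<rho>" unfolding \<rho>_def using e by (intro pw_lip_divide[where e = e] pw_lip_intros g) auto
  have nz: "1 - f s * u \<noteq> 0" "u + g s \<noteq> 0" if "u \<in> action_domain f g" "s \<in> {0..1}" for u s
    using action_domain_bound[OF that(1) f0] that(2) by (metis abs_zero not_less)+
  have nz0: "1 - f s * z \<noteq> 0" "z + g s \<noteq> 0" if "s \<in> {0..1}" for s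
    using nz[OF z that] .
  have T: "f s / (1 - f s * u) = \<tau> s / (1 - \<tau> s * (u - z))" "1 - f s * u = (1 - f s * z) * (1 - \<tau> s * (u - z))"
    if "u \<in> action_domain f g" "s \<in> {0..1}" for u s
    using mobius_shift[of "f s" z u] nz0[OF that(2)] unfolding \<tau>_def by blast+
  have R: "- 1 / (u + g s) = \<rho> s / (1 - \<rho> s * (u - z))" "u + g s = (z + g s) * (1 - \<rho> s * (u - z))"
    if "u \<in> action_domain f g" "s \<in> {0..1}" for u s
  proof -
    show e: "u + g s = (z + g s) * (1 - \<rho> s * (u - z))"
      unfolding \<rho>_def using nz0(2)[OF that(2)] by (simp add: field_simps)
    show "- 1 / (u + g s) = \<rho> s / (1 - \<rho> s * (u - z))"
      by (subst e, subst (2) \<rho>_def) simp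
  qed
  \<comment> \<open>Transfers a derivative at 0 in the variable \<open>u - z\<close> to the point
    \<open>z\<close>; agreement is required only on the open domain.\<close>
  have shift: "(G has_real_derivative D) (at z)" if "((\<lambda>h. G' h) has_real_derivative D) (at 0)"
     "\<And>u. u \<in> action_domain f g \<Longrightarrow> G u = G' (u - z)" for G G' D
  proof -
    have "((\<lambda>u. G' (u - z)) has_real_derivative D) (at z)"
      using DERIV_shift[of G' D z "-z"] that(1) by simp
    then show ?thesis
      using open_action_domain[of f g] z
      by (rule has_field_derivative_transform_within_open) (simp add: that(2))
  qed
  have m1: "(\<rho> s) ^ r = (-1) ^ r * (1 / (z + g s)) ^ r" for s r
    unfolding \<rho>_def by (simp only: power_mult_distrib[symmetric]) simp
  have m2: "(- 1 / (u + g s)) ^ r = (-1) ^ r * (1 / (u + g s)) ^ r" for u s r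
    by (simp only: power_mult_distrib[symmetric]) simp
  have d1: "((\<lambda>u. integral {0..1} (\<lambda>s. (f s / (1 - f s * u)) ^ r)) has_real_derivative
      real r * integral {0..1} (\<lambda>s. (f s / (1 - f s * z)) ^ Suc r)) (at z)"
    using DERIV_integral_geometric_power(1)[OF \<tau>, of r] unfolding \<tau>_def[symmetric]
    by (rule shift) (intro Henstock_Kurzweil_Integration.integral_cong, simp add: T(1))
  have "((\<lambda>u. integral {0..1} (\<lambda>s. (- 1 / (u + g s)) ^ r)) has_real_derivative
      real r * integral {0..1} (\<lambda>s. \<rho> s ^ Suc r)) (at z)"
    using DERIV_integral_geometric_power(1)[OF \<rho>, of r]
    by (rule shift) (intro Henstock_Kurzweil_Integration.integral_cong, subst R(1), assumption+, rule refl)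
  then have d2: "((\<lambda>u. (-1) ^ r * integral {0..1} (\<lambda>s. (1 / (u + g s)) ^ r)) has_real_derivative
      real r * ((-1) ^ Suc r * integral {0..1} (\<lambda>s. (1 / (z + g s)) ^ Suc r))) (at z)"
    unfolding m1 m2 by (simp only: Henstock_Kurzweil_Integration.integral_mult_right)
  have d3: "((\<lambda>u. (-1) ^ r * (1 / u) ^ r) has_real_derivative real r * ((-1) ^ Suc r * (1 / z) ^ Suc r)) (at z)"
    using z0 r by (auto intro!: derivative_eq_intros simp: divide_simps power2_eq_square) (cases r; simp)+
  have fac: "fact (Suc r - 1) = fact (r - 1) * (real r :: real)" using r by (cases r) auto
  have "((\<lambda>u. fact (r - 1) * (integral {0..1} (\<lambda>s. (f s / (1 - f s * u)) ^ r) +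
       c * ((-1) ^ r * integral {0..1} (\<lambda>s. (1 / (u + g s)) ^ r)) + (t - c) * ((-1) ^ r * (1 / u) ^ r))) has_real_derivative
     fact (r - 1) * (real r * integral {0..1} (\<lambda>s. (f s / (1 - f s * z)) ^ Suc r)
       + c * (real r * ((-1) ^ Suc r * integral {0..1} (\<lambda>s. (1 / (z + g s)) ^ Suc r)))
       + (t - c) * (real r * ((-1) ^ Suc r * (1 / z) ^ Suc r)))) (at z)"
    by (intro DERIV_cmult DERIV_add d1 d2 d3)
  then show "(action_D f g c t r has_real_derivative action_D f g c t (Suc r) z) (at z)"
    unfolding action_D_def[abs_def] fac by (simp only: algebra_simps)
  \<comment> \<open>The added constant turns the integrand into
    \<open>ln \<bar>1 - \<tau> s * (u - z)\<bar>\<close>, to which the recentred formula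
    applies.\<close>
  have ln1: "((\<lambda>u. - integral {0..1} (\<lambda>s. ln \<bar>1 - f s * u\<bar>) + integral {0..1} (\<lambda>s. ln \<bar>1 - f s * z\<bar>)) has_real_derivative
      integral {0..1} (\<lambda>s. f s / (1 - f s * z))) (at z)"
    using DERIV_integral_geometric_power(2)[OF \<tau>] unfolding \<tau>_def[symmetric]
  proof (rule shift)
    fix u assume u: "u \<in> action_domain f g"
    obtain e' where e': "e' > 0" "\<And>s. s \<in> {0..1} \<Longrightarrow> e' \<le> \<bar>1 - f s * u\<bar>"
      using action_domain_bound[OF u f0] by metis
    have i: "(\<lambda>s. ln \<bar>1 - f s * u\<bar>) integrable_on {0..1}" "(\<lambda>s. ln \<bar>1 - f s * z\<bar>) integrable_on {0..1}"
      using e(1,2) e' by (intro pw_lip_integrable pw_lip_ln_abs[where e = e'] pw_lip_intros f; simp)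
        (use e(1,2) e' in \<open>intro pw_lip_integrable pw_lip_ln_abs[where e = e] pw_lip_intros f; simp\<close>)
    have "integral {0..1} (\<lambda>s. ln \<bar>1 - \<tau> s * (u - z)\<bar>) = integral {0..1} (\<lambda>s. ln \<bar>1 - f s * u\<bar> - ln \<bar>1 - f s * z\<bar>)"
    proof (rule Henstock_Kurzweil_Integration.integral_cong)
      fix s :: real assume s: "s \<in> {0..1}"
      have "1 - \<tau> s * (u - z) \<noteq> 0" using T(2)[OF u s] nz(1)[OF u s] by auto
      then show "ln \<bar>1 - \<tau> s * (u - z)\<bar> = ln \<bar>1 - f s * u\<bar> - ln \<bar>1 - f s * z\<bar>"
        unfolding T(2)[OF u s] abs_mult using nz0[OF s] by (subst ln_mult) auto
    qed
    then show "- integral {0..1} (\<lambda>s. ln \<bar>1 - f s * u\<bar>) + integral {0..1} (\<lambda>s. ln \<bar>1 - f s * z\<bar>)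
        = - integral {0..1} (\<lambda>s. ln \<bar>1 - \<tau> s * (u - z)\<bar>)"
      using i by (simp add: Henstock_Kurzweil_Integration.integral_diff)
  qed
  have ln2: "((\<lambda>u. - integral {0..1} (\<lambda>s. ln \<bar>u + g s\<bar>) + integral {0..1} (\<lambda>s. ln \<bar>z + g s\<bar>)) has_real_derivative
      integral {0..1} \<rho>) (at z)"
    using DERIV_integral_geometric_power(2)[OF \<rho>]
  proof (rule shift)
    fix u assume u: "u \<in> action_domain f g"
    obtain e' where e': "e' > 0" "\<And>s. s \<in> {0..1} \<Longrightarrow> e' \<le> \<bar>u + g s\<bar>"
      using action_domain_bound[OF u f0] by metis
    have i: "(\<lambda>s. ln \<bar>u + g s\<bar>) integrable_on {0..1}" "(\<lambda>s. ln \<bar>z + g s\<bar>) integrable_on {0..1}"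
      using e(1,3) e' by (intro pw_lip_integrable pw_lip_ln_abs[where e = e'] pw_lip_intros g; simp)
        (use e(1,3) e' in \<open>intro pw_lip_integrable pw_lip_ln_abs[where e = e] pw_lip_intros g; simp\<close>)
    have "integral {0..1} (\<lambda>s. ln \<bar>1 - \<rho> s * (u - z)\<bar>) = integral {0..1} (\<lambda>s. ln \<bar>u + g s\<bar> - ln \<bar>z + g s\<bar>)"
    proof (rule Henstock_Kurzweil_Integration.integral_cong)
      fix s :: real assume s: "s \<in> {0..1}"
      have "1 - \<rho> s * (u - z) \<noteq> 0" using R(2)[OF u s] nz(2)[OF u s] by auto
      then show "ln \<bar>1 - \<rho> s * (u - z)\<bar> = ln \<bar>u + g s\<bar> - ln \<bar>z + g s\<bar>"
        unfolding R(2)[OF u s] abs_mult using nz0[OF s] by (subst ln_mult) auto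
    qed
    then show "- integral {0..1} (\<lambda>s. ln \<bar>u + g s\<bar>) + integral {0..1} (\<lambda>s. ln \<bar>z + g s\<bar>)
        = - integral {0..1} (\<lambda>s. ln \<bar>1 - \<rho> s * (u - z)\<bar>)"
      using i by (simp add: Henstock_Kurzweil_Integration.integral_diff)
  qed
  have ln3: "((\<lambda>u. ln \<bar>u\<bar>) has_real_derivative 1 / z) (at z)"
  proof (cases "z > 0")
    case True
    have "(ln has_real_derivative 1 / z) (at z)" using DERIV_ln_divide[OF True] by simp
    then show ?thesis by (rule has_field_derivative_transform_within_open[where S = "{0<..}"]) (use True in auto)
  next
    case False
    then have "((\<lambda>u. ln (- u)) has_real_derivative 1 / z) (at z)"
      using z0 by (auto intro!: derivative_eq_intros)
    then show ?thesis by (rule has_field_derivative_transform_within_open[where S = "{..<0}"]) (use False z0 in auto)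
  qed
  let ?S = "\<lambda>u. - integral {0..1} (\<lambda>s. ln \<bar>1 - f s * u\<bar>) + integral {0..1} (\<lambda>s. ln \<bar>1 - f s * z\<bar>)
     + c * (- integral {0..1} (\<lambda>s. ln \<bar>u + g s\<bar>) + integral {0..1} (\<lambda>s. ln \<bar>z + g s\<bar>)) + (c - t) * ln \<bar>u\<bar>
     + (- integral {0..1} (\<lambda>s. ln \<bar>1 - f s * z\<bar>) - c * integral {0..1} (\<lambda>s. ln \<bar>z + g s\<bar>))"
  have "(?S has_real_derivative (integral {0..1} (\<lambda>s. f s / (1 - f s * z)) + c * integral {0..1} \<rho> + (c - t) * (1 / z)) + 0) (at z)"
    by (intro DERIV_add DERIV_const DERIV_cmult ln1 ln2 ln3)
  then have "((\<lambda>u. action f g c u t) has_real_derivative (integral {0..1} (\<lambda>s. f s / (1 - f s * z)) + c * integral {0..1} \<rho> + (c - t) * (1 / z)) + 0) (at z)"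
    using open_action_domain[of f g] z
  proof (rule has_field_derivative_transform_within_open)
    fix u assume u: "u \<in> action_domain f g"
    have u0: "u \<noteq> 0" using u unfolding action_domain_def by auto
    obtain e' where e': "e' > 0" "\<And>s. s \<in> {0..1} \<Longrightarrow> e' \<le> \<bar>u + g s\<bar>"
      using action_domain_bound[OF u f0] by metis
    have i: "(\<lambda>s. ln \<bar>u + g s\<bar>) integrable_on {0..1}"
      using e' by (auto intro!: pw_lip_integrable pw_lip_ln_abs[where e = e'] pw_lip_intros g)
    have "integral {0..1} (\<lambda>s. ln \<bar>1 + g s / u\<bar>) = integral {0..1} (\<lambda>s. ln \<bar>u + g s\<bar> - ln \<bar>u\<bar>)"
    proof (rule Henstock_Kurzweil_Integration.integral_cong)
      fix s :: real assume s: "s \<in> {0..1}"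
      have "1 + g s / u = (u + g s) / u" using u0 by (simp add: field_simps)
      then show "ln \<bar>1 + g s / u\<bar> = ln \<bar>u + g s\<bar> - ln \<bar>u\<bar>"
        using nz(2)[OF u s] u0 by (simp add: ln_div)
    qed
    also have "\<dots> = integral {0..1} (\<lambda>s. ln \<bar>u + g s\<bar>) - ln \<bar>u\<bar>"
      using i by (subst Henstock_Kurzweil_Integration.integral_diff) auto
    finally have eq: "integral {0..1} (\<lambda>s. ln \<bar>1 + g s / u\<bar>) = integral {0..1} (\<lambda>s. ln \<bar>u + g s\<bar>) - ln \<bar>u\<bar>" .
    show "?S u = action f g c u t" unfolding action_def eq by (simp add: algebra_simps)
  qed
  moreover have "integral {0..1} \<rho> = - integral {0..1} (\<lambda>s. 1 / (z + g s))"
    unfolding \<rho>_def[abs_def] by (simp add: minus_divide_left[symmetric] del: minus_divide_left)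
  ultimately show "((\<lambda>u. action f g c u t) has_real_derivative action_D f g c t 1 z) (at z)"
    unfolding action_D_def by (simp add: algebra_simps diff_divide_distrib)
qed

text \<open>The induction carries the formula at every point of the open domain, since the next
  derivative depends on neighbouring points.\<close>

lemma action_deriv_eq:
  assumes f0: "\<And>s. s \<in> {0..1} \<Longrightarrow> f s > 0"
    and f: "pw_lip f" and g: "pw_lip g" and z: "z \<in> action_domain f g"
  shows "action_deriv (Suc r) f g c z t = action_D f g c t (Suc r) z"
  using z
proof (induction r arbitrary: z)
  case 0
  then show ?case using DERIV_action_D(2)[OF 0 f0 f g order_refl] by (simp add: DERIV_imp_deriv)
next
  case (Suc r)
  have "((deriv ^^ Suc r) (\<lambda>u. action f g c u t) has_real_derivative action_D f g c t (Suc (Suc r)) z) (at z)"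
    using DERIV_action_D(1)[OF Suc.prems f0 f g, of "Suc r"] open_action_domain[of f g] Suc.prems
    by (rule has_field_derivative_transform_within_open) (use Suc.IH in auto)
  then show ?case by (simp add: DERIV_imp_deriv)
qed

section \<open>Deforming the contours of the correlation kernel\<close>

text \<open>The parameter interval is symmetric about 0, so that the critical point
  \<open>w = 1\<close> is the image of an interior parameter and the integral rescales to growing
  symmetric intervals.\<close>

abbreviation unit_circle :: "real \<Rightarrow> complex" where
  "unit_circle \<equiv> part_circlepath 0 1 (- pi) pi"

lemma path_image_unit_circle: "path_image unit_circle \<subseteq> {w. norm w = 1}"
  using in_path_image_part_circlepath[of _ 0 1 "-pi" pi] by auto

lemma unit_circle_closed: "pathfinish unit_circle = pathstart unit_circle"
  by (simp add: exp_eq_polar cis_conv_exp[symmetric] complex_eq_iff)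

lemma winding_number_unit_circle:
  "norm z < 1 \<Longrightarrow> winding_number unit_circle z = 1" "norm z > 1 \<Longrightarrow> winding_number unit_circle z = 0"
proof -
  note closed = unit_circle_closed
  have "contour_integral unit_circle (\<lambda>w. 1 / (w - 0)) = integral {-pi..pi} (\<lambda>t. 1 / (0 + 1 * cis t - 0) * 1 * \<i> * cis t)"
    by (subst contour_integral_part_circlepath_eq) auto
  also have "(\<lambda>t. 1 / (0 + 1 * cis t - 0) * 1 * \<i> * cis t) = (\<lambda>t. \<i>)" by (auto simp: field_simps)
  finally have "contour_integral unit_circle (\<lambda>w. 1 / (w - 0)) = 2 * pi * \<i>" by (simp add: scaleR_conv_of_real)
  then have w0: "winding_number unit_circle 0 = 1"
    using path_image_unit_circle by (subst winding_number_valid_path) auto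
  show "winding_number unit_circle z = 1" if "norm z < 1"
  proof -
    have "winding_number unit_circle z = winding_number unit_circle 0"
      using path_image_unit_circle that closed
      by (intro winding_number_eq[where S = "ball 0 1"]) auto
    then show ?thesis using w0 by simp
  qed
  show "winding_number unit_circle z = 0" if "norm z > 1"
    using path_image_unit_circle that closed
    by (intro winding_number_zero_outside[where s = "cball 0 1"]) auto
qed

lemma cauchy_transform_holomorphic:
  assumes h: "continuous_on (path_image (part_circlepath c r \<alpha> \<beta>)) h"
  shows "(\<lambda>z. contour_integral (part_circlepath c r \<alpha> \<beta>) (\<lambda>w. h w / (z - w)))
           holomorphic_on - path_image (part_circlepath c r \<alpha> \<beta>)"
proof -
  let ?g = "part_circlepath c r \<alpha> \<beta>"
  have op: "open (- path_image ?g)" by (intro open_Compl closed_valid_path_image) auto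
  have int: "((\<lambda>w. - h w / (w - z) ^ 1) has_contour_integral contour_integral ?g (\<lambda>w. h w / (z - w))) ?g"
    if "z \<in> UNIV - path_image ?g" for z
  proof -
    have "continuous_on (path_image ?g) (\<lambda>w. h w / (z - w))"
      using that by (intro continuous_intros h) auto
    then have "(\<lambda>w. h w / (z - w)) contour_integrable_on ?g" by (rule contour_integrable_continuous_part_circlepath)
    then have "((\<lambda>w. h w / (z - w)) has_contour_integral contour_integral ?g (\<lambda>w. h w / (z - w))) ?g"
      by (rule has_contour_integral_integral)
    moreover have "- h w / (w - z) ^ 1 = h w / (z - w)" for w
      by (metis minus_diff_eq minus_divide_divide power_one_right minus_minus)
    ultimately show ?thesis by simp
  qed
  have "\<exists>D. ((\<lambda>z. contour_integral ?g (\<lambda>w. h w / (z - w))) has_field_derivative D) (at z)"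
    if "z \<in> - path_image ?g" for z
  proof -
    have "norm (vector_derivative ?g (at t)) \<le> \<bar>r\<bar> * \<bar>\<beta> - \<alpha>\<bar>" for t
      by (simp add: vector_derivative_part_circlepath norm_mult flip: of_real_diff)
    then show ?thesis
      using Cauchy_next_derivative(2)[of ?g "\<lambda>w. - h w" "\<bar>r\<bar> * \<bar>\<beta> - \<alpha>\<bar>" UNIV 1, OF _ _ int] h that
      by (auto intro: continuous_intros)
  qed
  then show ?thesis using holomorphic_on_open[OF op] by blast
qed

text \<open>The identity survives division by zero, because a vanishing factor makes both sides 0.
  It shows that \<open>1 / K\<close> is a polynomial in \<open>w\<close> times a polynomial in
  \<open>1 / w\<close>, so that 0 is its only singularity.\<close>

lemma inverse_K_fun:
  "1 / K_fun x n y k w = (\<Prod>i=1..n. 1 - of_real (x i) * w) * (\<Prod>j=1..k. 1 + of_real (y j) / w)"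
  unfolding K_fun_def by (simp add: prod_dividef)

lemma K_inverse_holomorphic: "(\<lambda>w. w powi b / K_fun x n y k w) holomorphic_on - {0}"
proof -
  have "(\<lambda>w. w powi b * ((\<Prod>i=1..n. 1 - of_real (x i) * w) * (\<Prod>j=1..k. 1 + of_real (y j) / w))) holomorphic_on - {0}"
    by (intro holomorphic_intros) auto
  then show ?thesis unfolding inverse_K_fun[symmetric] by simp
qed

definition kernel_poles :: "(nat \<Rightarrow> real) \<Rightarrow> nat \<Rightarrow> (nat \<Rightarrow> real) \<Rightarrow> nat \<Rightarrow> real set" where
  "kernel_poles x n y k = insert 0 ((\<lambda>i. 1 / x i) ` {1..n} \<union> (\<lambda>j. - y j) ` {1..k})"

lemma K_fun_nonzero:
  assumes "z \<notin> of_real ` kernel_poles x n y k" shows "K_fun x n y k z \<noteq> 0"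
    and "i \<in> {1..n} \<Longrightarrow> 1 - of_real (x i) * z \<noteq> 0" and "j \<in> {1..k} \<Longrightarrow> 1 + of_real (y j) / z \<noteq> 0"
proof -
  have z0: "z \<noteq> 0" using assms unfolding kernel_poles_def by (metis image_eqI insertI1 of_real_0)
  have 1: "1 - of_real (x i) * z \<noteq> 0" if "i \<in> {1..n}" for i
  proof
    assume e: "1 - of_real (x i) * z = 0"
    then have "z = of_real (1 / x i)" by (cases "x i = 0") (auto simp: field_simps)
    then show False using assms that unfolding kernel_poles_def by blast
  qed
  have 2: "1 + of_real (y j) / z \<noteq> 0" if "j \<in> {1..k}" for j
  proof
    assume e: "1 + of_real (y j) / z = 0"
    then have "z = of_real (- y j)" using z0 by (simp add: field_simps add_eq_0_iff2)
    then show False using assms that unfolding kernel_poles_def by blast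
  qed
  show "K_fun x n y k z \<noteq> 0" unfolding K_fun_def using 1 2 by simp
  show "i \<in> {1..n} \<Longrightarrow> 1 - of_real (x i) * z \<noteq> 0" "j \<in> {1..k} \<Longrightarrow> 1 + of_real (y j) / z \<noteq> 0" using 1 2 by auto
qed

lemma K_fun_holomorphic: "K_fun x n y k holomorphic_on - of_real ` kernel_poles x n y k"
proof -
  have "0 \<in> of_real ` kernel_poles x n y k" unfolding kernel_poles_def by (metis image_eqI insertI1 of_real_0)
  then have "z \<noteq> 0" if "z \<notin> of_real ` kernel_poles x n y k" for z :: complex using that by blast
  then show ?thesis unfolding K_fun_def[abs_def]
    by (intro holomorphic_intros) (use K_fun_nonzero[of _ x n y k] in auto)
qed

text \<open>Among contours with winding number 1 about 0, the integral distinguishes only the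
  winding number about \<open>z\<close>. This one formula compares the original
  \<open>w\<close>-contour with the unit circle, for \<open>z\<close> on either side of the
  circle.\<close>

lemma contour_integral_over_pole:
  assumes Q: "Q holomorphic_on - {0}" and p: "valid_path p" "pathfinish p = pathstart p"
    and "0 \<notin> path_image p" "z \<notin> path_image p" "winding_number p 0 = 1" and z: "z \<noteq> (0::complex)"
  shows "contour_integral p (\<lambda>w. Q w / (z - w))
     = 2 * of_real pi * \<i> * (residue (\<lambda>w. Q w / (z - w)) 0 - winding_number p z * Q z)"
proof -
  have "(\<lambda>w. - Q w / (w - z)) holomorphic_on UNIV - {0, z}"
    using Q by (intro holomorphic_intros) (auto elim: holomorphic_on_subset)
  moreover have eq: "(\<lambda>w. - Q w / (w - z)) = (\<lambda>w. Q w / (z - w))"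
    by (metis minus_diff_eq minus_divide_divide)
  ultimately have "(\<lambda>w. Q w / (z - w)) holomorphic_on UNIV - {0, z}" by simp
  then have "contour_integral p (\<lambda>w. Q w / (z - w))
     = 2 * pi * \<i> * (\<Sum>q\<in>{0, z}. winding_number p q * residue (\<lambda>w. Q w / (z - w)) q)"
    using assms by (intro Residue_theorem) auto
  moreover have "residue (\<lambda>w. - Q w / (w - z)) z = - Q z"
    using z Q by (intro residue_simple[of "- {0}"]) (auto intro!: holomorphic_intros)
  note this[unfolded eq]
  ultimately show ?thesis using z assms by (simp add: algebra_simps)
qed

text \<open>Near \<open>z0\<close> the residue is, up to \<open>2 pi \<i>\<close>, an integral over
  the fixed circle of radius \<open>\<bar>z0\<bar> / 2\<close>, hence a Cauchy transform.\<close>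

lemma residue_zero_holomorphic:
  assumes Q: "Q holomorphic_on - {0}"
  shows "(\<lambda>z. residue (\<lambda>w. Q w / (z - w)) 0) holomorphic_on - {0}"
proof -
  have "\<exists>D. ((\<lambda>z. residue (\<lambda>w. Q w / (z - w)) 0) has_field_derivative D) (at z0)" if z0: "z0 \<noteq> 0" for z0
  proof -
    define r where "r = norm z0 / 2"
    have r: "r > 0" unfolding r_def using z0 by auto
    let ?p = "circlepath 0 r"
    have pi: "path_image ?p = sphere 0 r" using r by simp
    have "continuous_on (sphere 0 r) Q" using r by (intro holomorphic_on_imp_continuous_on holomorphic_on_subset[OF Q]) auto
    then have "(\<lambda>z. contour_integral ?p (\<lambda>w. Q w / (z - w))) holomorphic_on - sphere 0 r"
      using cauchy_transform_holomorphic[of 0 r 0 "2 * pi" Q] pi unfolding circlepath_def by simp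
    then have "(\<lambda>z. contour_integral ?p (\<lambda>w. Q w / (z - w)) / (2 * of_real pi * \<i>)) holomorphic_on - cball 0 r"
      by (intro holomorphic_intros) (auto elim!: holomorphic_on_subset)
    moreover have "contour_integral ?p (\<lambda>w. Q w / (z - w)) / (2 * of_real pi * \<i>) = residue (\<lambda>w. Q w / (z - w)) 0"
      if z: "z \<in> - cball 0 r" for z
    proof -
      have "winding_number ?p z = 0"
        using z r pi by (intro winding_number_zero_outside[where s = "cball 0 r"]) auto
      moreover have "winding_number ?p 0 = 1" using r by (rule winding_number_circlepath_centre)
      ultimately show ?thesis
        using contour_integral_over_pole[OF Q, of ?p z] pi r z by (cases "z = 0") auto
    qed
    ultimately have "(\<lambda>z. residue (\<lambda>w. Q w / (z - w)) 0) holomorphic_on - cball 0 r"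
      by (rule holomorphic_transform)
    moreover have "z0 \<in> - cball 0 r" unfolding r_def using z0 by auto
    ultimately show ?thesis by (metis holomorphic_on_open open_Compl closed_cball)
  qed
  then show ?thesis by (subst holomorphic_on_open) auto
qed

text \<open>After the inner integration the integrand \<open>G\<close> in \<open>z\<close> is
  holomorphic off the finite set of poles, so the \<open>z\<close>-contour matters only through its
  winding numbers about them. Any combination \<open>s1 c1 + s2 c2\<close> with the same winding
  numbers may therefore replace it, and the \<open>w\<close>-contour is moved to the unit circle
  afterwards.\<close>

theorem corr_kernel_two_loops:
  fixes s1 s2 :: complex
  assumes kc: "kernel_contours x n y k \<gamma> \<delta>"
    and c1: "valid_path c1" "pathfinish c1 = pathstart c1" "path_image c1 \<inter> of_real ` kernel_poles x n y k = {}"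
      "\<And>z. z \<in> path_image c1 \<Longrightarrow> norm z > 1"
    and c2: "valid_path c2" "pathfinish c2 = pathstart c2" "path_image c2 \<inter> of_real ` kernel_poles x n y k = {}"
      "\<And>z. z \<in> path_image c2 \<Longrightarrow> norm z < 1"
    and wn: "\<And>p. p \<in> kernel_poles x n y k \<Longrightarrow>
        winding_number \<gamma> (of_real p) = s1 * winding_number c1 (of_real p) + s2 * winding_number c2 (of_real p)"
    and c20: "a = b \<Longrightarrow> winding_number c2 0 = 0"
  defines "F \<equiv> \<lambda>z. K_fun x n y k z * z powi (- a - 1) * contour_integral unit_circle (\<lambda>w. w powi b / K_fun x n y k w / (z - w))"
  shows "corr_kernel \<gamma> \<delta> x n y k a b = 1 / (2 * of_real pi * \<i>)\<^sup>2 * (s1 * contour_integral c1 F + s2 * contour_integral c2 F)"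
proof -
  define Q where "Q = (\<lambda>w. w powi b / K_fun x n y k w)"
  define P where "P = (of_real ` kernel_poles x n y k :: complex set)"
  define R where "R = (\<lambda>z. residue (\<lambda>w. Q w / (z - w)) 0)"
  define c where "c = 2 * complex_of_real pi * \<i>"
  define G where "G = (\<lambda>z. K_fun x n y k z * z powi (- a - 1) * (c * R z))"
  have c0: "c \<noteq> 0" unfolding c_def by simp
  have FQ: "F z = K_fun x n y k z * z powi (- a - 1) * contour_integral unit_circle (\<lambda>w. Q w / (z - w))" for z
    unfolding F_def Q_def ..
  have Qh: "Q holomorphic_on - {0}" unfolding Q_def by (rule K_inverse_holomorphic)
  have P0: "0 \<in> P" unfolding P_def kernel_poles_def by (metis image_eqI insertI1 of_real_0)
  have finP: "finite P" unfolding P_def kernel_poles_def by auto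
  have Rh: "R holomorphic_on - {0}" unfolding R_def by (rule residue_zero_holomorphic[OF Qh])
  have Gh: "G holomorphic_on UNIV - P" unfolding G_def
    using K_fun_holomorphic[of x n y k] Rh P0 unfolding P_def[symmetric]
    by (intro holomorphic_intros) (auto elim!: holomorphic_on_subset)
  have kc': "valid_path \<gamma>" "pathfinish \<gamma> = pathstart \<gamma>" "valid_path \<delta>" "pathfinish \<delta> = pathstart \<delta>"
     "\<And>z w. z\<in>path_image \<gamma> \<Longrightarrow> w\<in>path_image \<delta> \<Longrightarrow> norm w < norm z"
     "0 \<notin> path_image \<delta>" "winding_number \<delta> 0 = 1" "0 \<notin> path_image \<gamma>" "path_image \<gamma> \<inter> P = {}"
    using kc unfolding kernel_contours_def P_def kernel_poles_def by auto
  have res: "contour_integral p G = c * (\<Sum>q\<in>P. winding_number p q * residue G q)"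
    if "valid_path p" "pathfinish p = pathstart p" "path_image p \<inter> P = {}" for p
    using Residue_theorem[OF open_UNIV connected_UNIV finP Gh that(1,2)] that(3) unfolding c_def by auto
  have circ0: "0 \<notin> path_image unit_circle" using path_image_unit_circle by auto
  have circz: "norm z > 1 \<Longrightarrow> z \<notin> path_image unit_circle" "norm z < 1 \<Longrightarrow> z \<notin> path_image unit_circle" for z
    using path_image_unit_circle by auto
  have inner: "contour_integral \<delta> (\<lambda>w. K_fun x n y k z / K_fun x n y k w * (z powi (- a - 1) * w powi b) / (z - w)) = G z"
    if z: "z \<in> path_image \<gamma>" for z
  proof -
    have z0: "z \<noteq> 0" using kc'(8) z by auto
    have zd: "z \<notin> path_image \<delta>" using kc'(5)[OF z] by force
    have "winding_number \<delta> z = 0"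
    proof (rule winding_number_zero_outside[where s = "ball 0 (norm z)"])
      show "path_image \<delta> \<subseteq> ball 0 (norm z)" using kc'(5)[OF z] by auto
    qed (use kc' in \<open>auto intro: valid_path_imp_path\<close>)
    then have e: "contour_integral \<delta> (\<lambda>w. Q w / (z - w)) = c * R z"
      using contour_integral_over_pole[OF Qh kc'(3,4,6) zd kc'(7) z0] unfolding R_def c_def by simp
    have "(\<lambda>w. Q w / (z - w)) contour_integrable_on \<delta>"
    proof (rule contour_integrable_holomorphic_simple)
      show "(\<lambda>w. Q w / (z - w)) holomorphic_on - {0, z}"
        using Qh by (intro holomorphic_intros) (auto elim: holomorphic_on_subset)
    qed (use kc' zd in auto)
    then have "contour_integral \<delta> (\<lambda>w. (K_fun x n y k z * z powi (- a - 1)) * (Q w / (z - w))) = G z"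
      unfolding G_def e[symmetric] by (rule contour_integral_lmul)
    then show ?thesis unfolding Q_def by (simp add: mult_ac)
  qed
  have "contour_integral \<gamma> (\<lambda>z. contour_integral \<delta> (\<lambda>w. K_fun x n y k z / K_fun x n y k w * (z powi (- a - 1) * w powi b) / (z - w)))
      = contour_integral \<gamma> G" by (intro contour_integral_eq inner)
  also have "\<dots> = c * (\<Sum>p\<in>P. winding_number \<gamma> p * residue G p)"
    by (intro res) (use kc' in auto)
  also have "\<dots> = c * (\<Sum>p\<in>P. (s1 * winding_number c1 p + s2 * winding_number c2 p) * residue G p)"
  proof -
    have "winding_number \<gamma> p = s1 * winding_number c1 p + s2 * winding_number c2 p" if "p \<in> P" for p
      using wn that unfolding P_def by auto
    then show ?thesis by simp
  qed
  also have "\<dots> = s1 * (c * (\<Sum>p\<in>P. winding_number c1 p * residue G p)) + s2 * (c * (\<Sum>p\<in>P. winding_number c2 p * residue G p))"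
    by (simp add: sum.distrib sum_distrib_left algebra_simps)
  also have "c * (\<Sum>p\<in>P. winding_number c1 p * residue G p) = contour_integral c1 G"
    using c1(1,2,3) unfolding P_def[symmetric] by (rule res[symmetric])
  also have "contour_integral c1 G = contour_integral c1 F"
  proof (rule contour_integral_eq)
    fix z assume z: "z \<in> path_image c1"
    have "contour_integral unit_circle (\<lambda>w. Q w / (z - w)) = c * R z"
      using contour_integral_over_pole[OF Qh _ unit_circle_closed circ0 circz(1)[of z]] c1(4)[OF z]
        winding_number_unit_circle(1)[of 0] winding_number_unit_circle(2)[of z]
      unfolding R_def c_def by (cases "z = 0") auto
    then show "G z = F z" unfolding G_def F_def Q_def by simp
  qed
  also have "c * (\<Sum>p\<in>P. winding_number c2 p * residue G p) = contour_integral c2 G"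
    using c2(1,2,3) unfolding P_def[symmetric] by (rule res[symmetric])
  \<comment> \<open>Here the circle winds about \<open>z\<close>, which the original
    \<open>w\<close>-contour does not, and the two integrands differ by
    \<open>c * z powi (b - a - 1)\<close>. For \<open>a \<noteq> b\<close> this has a single-valued
    primitive; for \<open>a = b\<close> its integral is a multiple of the winding number about
    0.\<close>
  also have "contour_integral c2 G = contour_integral c2 F"
  proof -
    have z0: "z \<noteq> 0" if "z \<in> path_image c2" for z using that c2(3) P0 unfolding P_def by blast
    have GF: "G z - F z = c * z powi (b - a - 1)" if z: "z \<in> path_image c2" for z
    proof -
      have K0: "K_fun x n y k z \<noteq> 0" using z c2(3) by (intro K_fun_nonzero) blast
      have e: "contour_integral unit_circle (\<lambda>w. Q w / (z - w)) = c * (R z - Q z)"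
        using contour_integral_over_pole[OF Qh _ unit_circle_closed circ0 circz(2)[of z]] c2(4)[OF z] z0[OF z]
          winding_number_unit_circle(1)[of 0] winding_number_unit_circle(1)[of z]
        unfolding R_def c_def by auto
      have "G z - F z = c * (z powi (- a - 1) * (K_fun x n y k z * Q z))"
        unfolding G_def FQ e by (simp add: algebra_simps)
      also have "K_fun x n y k z * Q z = z powi b" unfolding Q_def using K0 by simp
      also have "z powi (- a - 1) * z powi b = z powi (b - a - 1)"
        using z0[OF z] by (subst power_int_add[symmetric]) (auto simp: algebra_simps)
      finally show ?thesis .
    qed
    have Gi: "G contour_integrable_on c2"
      using c2 unfolding P_def[symmetric] by (intro contour_integrable_holomorphic_simple[OF Gh] open_Diff finite_imp_closed finP) auto
    have pw: "(\<lambda>z. z powi m) contour_integrable_on c2" for m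
      by (rule contour_integrable_holomorphic_simple[where S = "- {0}"])
         (use z0 c2 in \<open>auto intro!: holomorphic_intros\<close>)
    have "contour_integral c2 (\<lambda>z. z powi (b - a - 1)) = 0"
    proof (cases "a = b")
      case True
      have "contour_integral c2 (\<lambda>z. 1 / (z - 0)) = c * winding_number c2 0"
        using winding_number_valid_path[of c2 0] c2(1) z0 c0 unfolding c_def by force
      then show ?thesis using True c20 by (simp add: power_int_minus divide_inverse)
    next
      case False
      have "((\<lambda>z. z powi (b - a - 1)) has_contour_integral
        ((pathfinish c2) powi (b - a) / of_int (b - a) - (pathstart c2) powi (b - a) / of_int (b - a))) c2"
      proof (rule contour_integral_primitive[where S = "- {0}"])
        fix z :: complex assume "z \<in> - {0}"
        then show "((\<lambda>z. z powi (b - a) / of_int (b - a)) has_field_derivative z powi (b - a - 1)) (at z within - {0})"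
          using False by (auto intro!: derivative_eq_intros)
      qed (use c2 z0 in auto)
      then show ?thesis using c2(2) by (simp add: contour_integral_unique)
    qed
    then have "contour_integral c2 (\<lambda>z. G z - c * z powi (b - a - 1)) = contour_integral c2 G"
      by (subst contour_integral_diff) (auto intro: Gi pw contour_integrable_lmul simp: contour_integral_lmul[OF pw])
    moreover have "contour_integral c2 (\<lambda>z. G z - c * z powi (b - a - 1)) = contour_integral c2 F"
      by (intro contour_integral_eq) (use GF in \<open>simp add: algebra_simps\<close>)
    ultimately show ?thesis by simp
  qed
  finally show ?thesis unfolding corr_kernel_def by simp
qed

text \<open>In the closed upper half-plane \<open>Ln (- \<i> * (z - p))\<close> is a primitive of
  \<open>1 / (z - p)\<close>, its cut pointing downwards, and the mirror image serves below. At a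
  real point \<open>q\<close> the two differ by \<open>- \<i> * pi * sgn (q - p)\<close>, so only
  the endpoints enter.\<close>

lemma symmetric_loop_winding:
  assumes g: "valid_path g" "path_image g \<subseteq> {z. 0 \<le> Im z}" "pathstart g = of_real A" "pathfinish g = of_real B"
    and p: "of_real p \<notin> path_image g"
  shows "winding_number (g +++ reversepath (cnj \<circ> g)) (of_real p) = (if p < A then 1 else 0) - (if p < B then 1 else 0)"
proof -
  have pA: "p \<noteq> A" "p \<noteq> B" using p g(3,4) pathstart_in_path_image[of g] pathfinish_in_path_image[of g] by auto
  have vc: "valid_path (cnj \<circ> g)" using g(1) valid_path_cnj by blast
  have ic: "path_image (cnj \<circ> g) = cnj ` path_image g" by (simp add: path_image_def image_comp)
  have pc: "of_real p \<notin> path_image (cnj \<circ> g)" unfolding ic using p by (metis complex_cnj_complex_of_real complex_cnj_cnj image_iff)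
  have up: "((\<lambda>w. 1 / (w - of_real p)) has_contour_integral
      (Ln (- \<i> * (pathfinish g - of_real p)) - Ln (- \<i> * (pathstart g - of_real p)))) g"
  proof (rule contour_integral_primitive[where S = "{z. 0 \<le> Im z} - {of_real p}"])
    fix z assume z: "z \<in> {z. 0 \<le> Im z} - {complex_of_real p}"
    have "- \<i> * (z - of_real p) \<notin> \<real>\<^sub>\<le>\<^sub>0" using z by (auto simp: complex_nonpos_Reals_iff complex_eq_iff)
    then show "((\<lambda>z. Ln (- \<i> * (z - of_real p))) has_field_derivative 1 / (z - of_real p)) (at z within {z. 0 \<le> Im z} - {of_real p})"
      using z by (auto intro!: derivative_eq_intros simp: field_simps)
  qed (use g p in auto)
  have down: "((\<lambda>w. 1 / (w - of_real p)) has_contour_integral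
      (Ln (\<i> * (pathfinish (cnj \<circ> g) - of_real p)) - Ln (\<i> * (pathstart (cnj \<circ> g) - of_real p)))) (cnj \<circ> g)"
  proof (rule contour_integral_primitive[where S = "{z. Im z \<le> 0} - {of_real p}"])
    fix z assume z: "z \<in> {z. Im z \<le> 0} - {complex_of_real p}"
    have "\<i> * (z - of_real p) \<notin> \<real>\<^sub>\<le>\<^sub>0" using z by (auto simp: complex_nonpos_Reals_iff complex_eq_iff)
    then show "((\<lambda>z. Ln (\<i> * (z - of_real p))) has_field_derivative 1 / (z - of_real p)) (at z within {z. Im z \<le> 0} - {of_real p})"
      using z by (auto intro!: derivative_eq_intros simp: field_simps)
  next
    show "valid_path (cnj \<circ> g)" by (rule vc)
    show "path_image (cnj \<circ> g) \<subseteq> {z. Im z \<le> 0} - {complex_of_real p}"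
      using g(2) pc unfolding ic by (auto simp del: image_iff) (metis imageI)
  qed
  have L: "Ln (- \<i> * (of_real q - of_real p)) - Ln (\<i> * (of_real q - of_real p)) = - \<i> * pi * sgn (q - p)" if "q \<noteq> p" for q
  proof (cases "q > p")
    case True
    have "Ln (\<i> * (of_real q - of_real p)) = Ln \<i> + Ln (of_real (q - p))"
      using True Ln_times_of_real[of "q - p" \<i>] by (simp add: mult.commute)
    moreover have "Ln (- \<i> * (of_real q - of_real p)) = Ln (- \<i>) + Ln (of_real (q - p))"
      using True Ln_times_of_real[of "q - p" "- \<i>"] by (simp add: mult.commute)
    ultimately show ?thesis using True by (simp add: algebra_simps)
  next
    case False
    have m: "\<i> * (complex_of_real q - of_real p) = of_real (p - q) * (- \<i>)"
       "- \<i> * (complex_of_real q - of_real p) = of_real (p - q) * \<i>" by (simp_all add: algebra_simps)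
    have e: "Ln (of_real (p - q) * (- \<i>)) = Ln (of_real (p - q)) - \<i> * pi / 2" "Ln (of_real (p - q) * \<i>) = Ln (of_real (p - q)) + \<i> * pi / 2"
      using False that Ln_times_of_real[of "p - q" "- \<i>"] Ln_times_of_real[of "p - q" \<i>] by auto
    show ?thesis unfolding m e using False that by (simp add: sgn_if del: of_real_diff)
  qed
  have fc: "pathfinish (cnj \<circ> g) = of_real B" "pathstart (cnj \<circ> g) = of_real A" using g(3,4) by (simp_all add: pathfinish_def pathstart_def)
  have "((\<lambda>w. 1 / (w - of_real p)) has_contour_integral
      ((Ln (- \<i> * (of_real B - of_real p)) - Ln (- \<i> * (of_real A - of_real p)))
        + - (Ln (\<i> * (of_real B - of_real p)) - Ln (\<i> * (of_real A - of_real p))))) (g +++ reversepath (cnj \<circ> g))"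
    using up down unfolding fc g(3,4)
    by (intro has_contour_integral_join has_contour_integral_reversepath g(1) vc valid_path_reversepath[THEN iffD2]) auto
  then have "contour_integral (g +++ reversepath (cnj \<circ> g)) (\<lambda>w. 1 / (w - of_real p))
     = (Ln (- \<i> * (of_real B - of_real p)) - Ln (\<i> * (of_real B - of_real p)))
       - (Ln (- \<i> * (of_real A - of_real p)) - Ln (\<i> * (of_real A - of_real p)))"
    by (subst contour_integral_unique, assumption) simp
  then have ci: "contour_integral (g +++ reversepath (cnj \<circ> g)) (\<lambda>w. 1 / (w - of_real p)) = \<i> * pi * (sgn (A - p) - sgn (B - p))"
    unfolding L[OF pA(1)[symmetric]] L[OF pA(2)[symmetric]] by (simp add: algebra_simps)
  have "valid_path (g +++ reversepath (cnj \<circ> g))"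
    using g(1) vc fc g(4) by (intro valid_path_join) auto
  moreover have "of_real p \<notin> path_image (g +++ reversepath (cnj \<circ> g))"
    using p pc fc g(4) by (simp add: path_image_join)
  ultimately have "winding_number (g +++ reversepath (cnj \<circ> g)) (of_real p) = 1 / (2 * pi * \<i>) * (\<i> * pi * (sgn (A - p) - sgn (B - p)))"
    using ci by (simp add: winding_number_valid_path)
  then show ?thesis using pA by (auto simp: sgn_if)
qed

lemma symmetric_loop_integral:
  assumes g: "valid_path g" "pathfinish g = of_real B" and "f contour_integrable_on g" "f contour_integrable_on (cnj \<circ> g)"
  shows "contour_integral (g +++ reversepath (cnj \<circ> g)) f = contour_integral g f - contour_integral (cnj \<circ> g) f"
  using assms valid_path_cnj[of g]
  by (subst contour_integral_join) (auto simp: contour_integrable_reversepath contour_integral_reversepath pathfinish_def pathstart_def)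

section \<open>Products over nodes\<close>

text \<open>Sharper than \<open>1 + z \<le> exp z\<close> by a quadratic term, which later produces
  the decay on the unit circle. The difference of the exponent and \<open>ln (1 + y)\<close> has
  derivative \<open>y * (1 / (1 + y) - 1 / (1 + Z))\<close>, and this has the sign of
  \<open>y\<close> as long as \<open>y \<le> Z\<close>.\<close>

lemma one_plus_le_exp_quadratic:
  fixes z :: real assumes "-1 \<le> z" "z \<le> Z" "0 \<le> Z"
  shows "1 + z \<le> exp (z - z\<^sup>2 / (2 * (1 + Z)))"
proof (cases "z = -1")
  case False
  then have z: "-1 < z" using assms by auto
  define \<phi> where "\<phi> y = y - y\<^sup>2 / (2 * (1 + Z)) - ln (1 + y)" for y
  have d: "(\<phi> has_real_derivative y * (1 / (1 + y) - 1 / (1 + Z))) (at y)" if "-1 < y" for y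
  proof -
    have "1 - y / (1 + Z) - 1 / (1 + y) = y * (1 / (1 + y) - 1 / (1 + Z))"
      using that by (simp add: right_diff_distrib) (simp add: field_simps)
    moreover have "(\<phi> has_real_derivative 1 - y / (1 + Z) - 1 / (1 + y)) (at y)"
      unfolding \<phi>_def[abs_def] using that assms by (auto intro!: derivative_eq_intros) (simp add: field_simps)
    ultimately show ?thesis by simp
  qed
  have "\<phi> 0 \<le> \<phi> z"
  proof (cases "z \<ge> 0")
    case True
    show ?thesis
    proof (rule DERIV_nonneg_imp_nondecreasing[where f = \<phi>, OF True])
      fix y assume y: "0 \<le> y" "y \<le> z"
      have "1 / (1 + Z) \<le> 1 / (1 + y)" using y assms by (intro divide_left_mono) auto
      then have "0 \<le> y * (1 / (1 + y) - 1 / (1 + Z))" using y by simp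
      then show "\<exists>D. (\<phi> has_real_derivative D) (at y) \<and> 0 \<le> D"
        using d[of y] y by (intro exI[of _ "y * (1 / (1 + y) - 1 / (1 + Z))"]) auto
    qed
  next
    case False
    show ?thesis
    proof (rule DERIV_nonpos_imp_nonincreasing[where f = \<phi> and a = z and b = 0])
      fix y assume y: "z \<le> y" "y \<le> 0"
      have "1 / (1 + Z) \<le> 1 / (1 + y)" using y z assms by (intro divide_left_mono) auto
      then have "y * (1 / (1 + y) - 1 / (1 + Z)) \<le> 0" using y by (intro mult_nonpos_nonneg) auto
      then show "\<exists>D. (\<phi> has_real_derivative D) (at y) \<and> D \<le> 0"
        using d[of y] y z by (intro exI[of _ "y * (1 / (1 + y) - 1 / (1 + Z))"]) auto
    qed (use False in auto)
  qed
  then have "ln (1 + z) \<le> z - z\<^sup>2 / (2 * (1 + Z))" unfolding \<phi>_def by simp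
  then have "exp (ln (1 + z)) \<le> exp (z - z\<^sup>2 / (2 * (1 + Z)))" by simp
  then show ?thesis using z by simp
qed auto

definition node_prod :: "int \<Rightarrow> 'i set \<Rightarrow> ('i \<Rightarrow> real) \<Rightarrow> complex \<Rightarrow> complex" where
  "node_prod A I P u = u powi A * (\<Prod>i\<in>I. 1 / (1 - of_real (P i) * (u - 1)))"

abbreviation tw :: "real \<Rightarrow> real" where "tw p \<equiv> p * (1 + p)"

lemma norm_node_factor:
  "(norm (1 - of_real p * (u - 1)))\<^sup>2 = (1 + p)\<^sup>2 + p\<^sup>2 * (norm u)\<^sup>2 - 2 * tw p * Re u"
  unfolding cmod_power2 by (simp add: power2_eq_square algebra_simps)

text \<open>The minimum is at \<open>p = - 1/2\<close>. It guarantees \<open>2 T m \<ge> -1\<close>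
  for \<open>0 \<le> m \<le> 2\<close>, the range of \<open>1 - Re w\<close> on the unit
  circle.\<close>

lemma tw_ge: "- (1/4) \<le> tw p"
proof -
  have "tw p = (p + 1/2)\<^sup>2 - 1/4" by (simp add: power2_eq_square algebra_simps)
  then show ?thesis by simp
qed

lemma abs_tw_le: "\<bar>p\<bar> \<le> B \<Longrightarrow> \<bar>tw p\<bar> \<le> B * (1 + B)"
  unfolding abs_mult by (intro mult_mono) auto

text \<open>On the circle the squared modulus of a factor is \<open>1 + 2 T m\<close> with
  \<open>m = 1 - Re w\<close>. The constant \<open>Z = 4 B (1 + B)\<close> bounds
  \<open>2 T m\<close>, because \<open>m \<le> 2\<close>.\<close>

lemma node_prod_circle_bound:
  assumes I: "\<And>i. i \<in> I \<Longrightarrow> \<bar>P i\<bar> \<le> B" "0 \<le> B" and w: "norm w = 1"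
  shows "norm (1 / node_prod A I P w) \<le> exp ((1 - Re w) * (\<Sum>i\<in>I. tw (P i))
     - (1 - Re w)\<^sup>2 / (1 + 4 * (B * (1 + B))) * (\<Sum>i\<in>I. (tw (P i))\<^sup>2))"
proof -
  define m where "m = 1 - Re w"
  define Z where "Z = 4 * (B * (1 + B))"
  have m: "0 \<le> m" "m \<le> 2" using complex_Re_le_cmod[of w] abs_Re_le_cmod[of w] w unfolding m_def by linarith+
  have Z: "0 \<le> Z" unfolding Z_def using I by simp
  have fac: "norm (1 - of_real (P i) * (w - 1)) \<le> exp (m * tw (P i) - m\<^sup>2 / (1 + Z) * (tw (P i))\<^sup>2)" if i: "i \<in> I" for i
  proof -
    let ?t = "tw (P i)"
    have "m * - (1/4) \<le> m * ?t" using m tw_ge[of "P i"] by (intro mult_left_mono) auto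
    then have 1: "-1 \<le> 2 * ?t * m" using m(2) by (simp only: mult.commute[of _ m] mult.left_commute[of _ m])
    have "m * ?t \<le> m * \<bar>?t\<bar>" using m by (intro mult_left_mono) auto
    also have "\<dots> \<le> 2 * \<bar>?t\<bar>" using m by (intro mult_right_mono) auto
    finally have "m * ?t \<le> 2 * \<bar>?t\<bar>" .
    then have 2: "2 * ?t * m \<le> Z" using abs_tw_le[OF I(1)[OF i]] unfolding Z_def by (simp add: algebra_simps)
    have "(norm (1 - of_real (P i) * (w - 1)))\<^sup>2 = 1 + 2 * ?t * m"
      unfolding norm_node_factor w m_def by (simp add: power2_eq_square algebra_simps)
    also have "\<dots> \<le> exp (2 * ?t * m - (2 * ?t * m)\<^sup>2 / (2 * (1 + Z)))"
      using one_plus_le_exp_quadratic[OF 1 2 Z] .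
    also have "\<dots> = (exp (m * ?t - m\<^sup>2 / (1 + Z) * ?t\<^sup>2))\<^sup>2"
    proof -
      have "2 * t * m - (2 * t * m)\<^sup>2 / (2 * (1 + Z)) = 2 * (m * t - m\<^sup>2 / (1 + Z) * t\<^sup>2)" for t
        using Z by (simp add: field_simps power2_eq_square)
      from this[of ?t] show ?thesis by (simp only: exp_double)
    qed
    finally show ?thesis by (rule power2_le_imp_le) simp
  qed
  have "norm (1 / node_prod A I P w) = (\<Prod>i\<in>I. norm (1 - of_real (P i) * (w - 1)))"
    unfolding node_prod_def using w by (simp add: norm_divide norm_mult norm_power_int prod_norm[symmetric] prod_dividef)
  also have "\<dots> \<le> (\<Prod>i\<in>I. exp (m * tw (P i) - m\<^sup>2 / (1 + Z) * (tw (P i))\<^sup>2))"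
    using fac by (intro prod_mono) auto
  also have "\<dots> = exp (m * (\<Sum>i\<in>I. tw (P i)) - m\<^sup>2 / (1 + Z) * (\<Sum>i\<in>I. (tw (P i))\<^sup>2))"
    by (cases "finite I") (simp_all add: exp_sum[symmetric] sum_subtractf sum_distrib_left)
  finally show ?thesis unfolding m_def Z_def .
qed

text \<open>What remains of \<open>- Ln (1 - p d)\<close> after Hermite interpolation in
  \<open>p\<close> at the double points 0 and -1. The three subtracted terms are the cubic
  interpolant in the basis \<open>p\<close>, \<open>T\<close>, \<open>p T\<close>; a double zero at
  both points is where the factor \<open>T\<^sup>2\<close> of the remainder comes from.\<close>

definition node_exp :: "real \<Rightarrow> complex \<Rightarrow> complex" where
  "node_exp p d = - Ln (1 - of_real p * d) - of_real p * Ln (1 + d) - of_real (tw p) * (d - Ln (1 + d))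
     - of_real (p * tw p) * ((1 + d) - 1 / (1 + d) - 2 * Ln (1 + d))"

lemma one_plus_nonpos_Reals: "norm (d::complex) < 1 \<Longrightarrow> 1 + d \<notin> \<real>\<^sub>\<le>\<^sub>0"
  using abs_Re_le_cmod[of d] by (auto simp: complex_nonpos_Reals_iff)

lemma one_over_minus_one: "x + y = 1 \<Longrightarrow> x \<noteq> 0 \<Longrightarrow> 1 / x - 1 = y / (x::complex)"
  by (metis add_diff_cancel_left' diff_divide_distrib divide_self)

text \<open>The derivative of \<open>node_exp p\<close> at \<open>z\<close> is exactly
  \<open>T\<^sup>2 z\<^sup>3 / ((1 - p z) (1 + z)\<^sup>2)\<close>. Replacing it by
  \<open>T\<^sup>2 z\<^sup>3\<close> costs a relative error of at most
  \<open>24 (1 + B) \<bar>z\<bar>\<close>, where 24 is a numerator bound 3 over a denominator bound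
  1/8.\<close>

lemma node_exp_estimate:
  assumes p: "\<bar>p\<bar> \<le> B" and d: "norm d * (1 + B) \<le> 1 / 2"
  shows "norm (node_exp p d - of_real ((tw p)\<^sup>2) * d ^ 4 / 4) \<le> 24 * (1 + B) * (tw p)\<^sup>2 * norm d ^ 5"
proof -
  have B: "0 \<le> B" using p by linarith
  have sm: "norm z \<le> 1/2" "norm (of_real p * z) \<le> 1/2" if "norm z \<le> norm d" for z :: complex
  proof -
    have "norm z * 1 \<le> norm d * (1 + B)" using that B by (intro mult_mono) auto
    then show "norm z \<le> 1/2" using d by linarith
    have "norm (of_real p * z) = norm z * \<bar>p\<bar>" by (simp add: norm_mult)
    also have "\<dots> \<le> norm d * (1 + B)" using that p by (intro mult_mono) auto
    finally show "norm (of_real p * z) \<le> 1/2" using d by linarith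
  qed
  define h where "h z = node_exp p z - of_real ((tw p)\<^sup>2) * z ^ 4 / 4" for z
  define h' where "h' z = of_real ((tw p)\<^sup>2) * z ^ 3 * (1 / ((1 - of_real p * z) * (1 + z)\<^sup>2) - 1)" for z :: complex
  have "norm (h d - h 0) \<le> (24 * (1 + B) * (tw p)\<^sup>2 * norm d ^ 4) * norm (d - 0)"
  proof (rule field_differentiable_bound[where S = "cball 0 (norm d)" and f' = h'])
    fix z assume z: "z \<in> cball (0::complex) (norm d)"
    have s: "norm z \<le> 1/2" "norm (of_real p * z) \<le> 1/2" using sm z by auto
    have nz: "1 + z \<noteq> 0" "1 - of_real p * z \<noteq> 0" using s by (auto simp: add_eq_0_iff)
    have nn: "1 + z \<notin> \<real>\<^sub>\<le>\<^sub>0" "1 - of_real p * z \<notin> \<real>\<^sub>\<le>\<^sub>0"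
      using one_plus_nonpos_Reals[of z] one_plus_nonpos_Reals[of "- of_real p * z"] s by auto
    define P' where "P' = complex_of_real p"
    \<comment> \<open>With the abbreviations \<open>a\<close> and \<open>b\<close> the denominators
      clear to a polynomial identity whose right side is the numerator
      \<open>T\<^sup>2 z\<^sup>3\<close>.\<close>
    have alg: "P' / (1 - P' * z) - P' * (1 / (1 + z)) - (P' * (1 + P')) * (1 - 1 / (1 + z))
       - P' * (P' * (1 + P')) * (1 + 1 / (1 + z)\<^sup>2 - 2 * (1 / (1 + z))) - (P' * (1 + P'))\<^sup>2 * z ^ 3
       = (P' * (1 + P'))\<^sup>2 * z ^ 3 * (1 / ((1 - P' * z) * (1 + z)\<^sup>2) - 1)"
    proof -
      define a where "a = 1 + z"
      define b where "b = 1 - P' * z"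
      have ab: "a \<noteq> 0" "b \<noteq> 0" using nz unfolding a_def b_def P'_def by auto
      have "P' / b - P' * (1 / a) - (P' * (1 + P')) * (1 - 1 / a)
         - P' * (P' * (1 + P')) * (1 + 1 / a\<^sup>2 - 2 * (1 / a))
        = (P' * a\<^sup>2 - P' * (a * b) - (P' * (1 + P')) * (a\<^sup>2 * b - a * b)
           - P' * (P' * (1 + P')) * (a\<^sup>2 * b + b - 2 * (a * b))) / (b * a\<^sup>2)"
        using ab by (simp add: field_simps power2_eq_square)
      also have "P' * a\<^sup>2 - P' * (a * b) - (P' * (1 + P')) * (a\<^sup>2 * b - a * b)
           - P' * (P' * (1 + P')) * (a\<^sup>2 * b + b - 2 * (a * b)) = (P' * (1 + P'))\<^sup>2 * z ^ 3"
        unfolding a_def b_def by algebra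
      finally show ?thesis unfolding a_def[symmetric] b_def[symmetric] by (simp add: algebra_simps)
    qed
    have "(h has_field_derivative (P' / (1 - P' * z) - P' * (1 / (1 + z)) - (P' * (1 + P')) * (1 - 1 / (1 + z))
       - P' * (P' * (1 + P')) * (1 + 1 / (1 + z)\<^sup>2 - 2 * (1 / (1 + z))) - (P' * (1 + P'))\<^sup>2 * z ^ 3)) (at z)"
      unfolding h_def node_exp_def P'_def
      using nz nn by (auto intro!: derivative_eq_intros simp: power2_eq_square inverse_eq_divide mult_ac)
    then show "(h has_field_derivative h' z) (at z within cball 0 (norm d))"
      unfolding alg h'_def by (auto simp: P'_def intro: has_field_derivative_at_within)
    have l1: "1/2 \<le> norm (1 - of_real p * z)" using norm_triangle_ineq2[of 1 "of_real p * z"] s by simp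
    have l2: "1/2 \<le> norm (1 + z)" using norm_diff_ineq[of 1 z] s by simp
    have "1/2 * (1/2)\<^sup>2 \<le> norm (1 - of_real p * z) * norm (1 + z) ^ 2"
      using l1 l2 by (intro mult_mono power_mono) auto
    then have den: "1/8 \<le> norm ((1 - of_real p * z) * (1 + z)\<^sup>2)" by (simp add: norm_mult norm_power power2_eq_square)
    have "(1 - of_real p * z) * (1 + z)\<^sup>2 + z * (of_real p * (1 + z)\<^sup>2 - (2 + z)) = 1" by algebra
    then have "1 / ((1 - of_real p * z) * (1 + z)\<^sup>2) - 1 = z * (of_real p * (1 + z)\<^sup>2 - (2 + z)) / ((1 - of_real p * z) * (1 + z)\<^sup>2)"
      by (rule one_over_minus_one) (use nz in auto)
    then have "norm (1 / ((1 - of_real p * z) * (1 + z)\<^sup>2) - 1)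
        = norm z * norm (of_real p * (1 + z)\<^sup>2 - (2 + z)) / norm ((1 - of_real p * z) * (1 + z)\<^sup>2)"
      by (simp add: norm_divide norm_mult)
    also have "\<dots> \<le> norm z * (3 * (1 + B)) / (1/8)"
    proof (intro frac_le mult_left_mono)
      have "norm (1 + z) \<le> 3/2" using norm_triangle_ineq[of 1 z] s by simp
      then have "norm (1 + z) ^ 2 \<le> (3/2)\<^sup>2" by (intro power_mono) auto
      then have "\<bar>p\<bar> * norm (1 + z) ^ 2 \<le> B * 3" using p B by (intro mult_mono) (auto simp: power2_eq_square)
      moreover have "norm (2 + z) \<le> 3" using norm_triangle_ineq[of 2 z] s by simp
      ultimately show "norm (of_real p * (1 + z)\<^sup>2 - (2 + z)) \<le> 3 * (1 + B)"
        using norm_triangle_ineq4[of "of_real p * (1 + z)\<^sup>2" "2 + z"] by (simp add: norm_mult norm_power)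
    qed (use den B in auto)
    finally have k: "norm (1 / ((1 - of_real p * z) * (1 + z)\<^sup>2) - 1) \<le> 24 * (1 + B) * norm z" by (simp add: algebra_simps)
    have "norm (h' z) = (tw p)\<^sup>2 * norm z ^ 3 * norm (1 / ((1 - of_real p * z) * (1 + z)\<^sup>2) - 1)"
      unfolding h'_def by (simp only: norm_mult norm_power norm_of_real) simp
    also have "\<dots> \<le> (tw p)\<^sup>2 * norm z ^ 3 * (24 * (1 + B) * norm z)" using k by (intro mult_left_mono) auto
    also have "\<dots> = 24 * (1 + B) * (tw p)\<^sup>2 * norm z ^ 4" by (simp add: power3_eq_cube power4_eq_xxxx)
    also have "\<dots> \<le> 24 * (1 + B) * (tw p)\<^sup>2 * norm d ^ 4" using z B by (intro mult_left_mono power_mono) auto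
    finally show "norm (h' z) \<le> 24 * (1 + B) * (tw p)\<^sup>2 * norm d ^ 4" .
  qed auto
  moreover have "h 0 = 0" unfolding h_def node_exp_def by simp
  ultimately show ?thesis unfolding h_def by (simp add: eval_nat_numeral mult_ac)
qed

lemma node_prod_local:
  assumes fin: "finite I" and I: "\<And>i. i \<in> I \<Longrightarrow> \<bar>P i\<bar> \<le> B" "0 \<le> B" and d: "norm d * (1 + B) \<le> 1 / 2"
  obtains E where "node_prod A I P (1 + d) = exp (of_real (of_int A + (\<Sum>i\<in>I. P i)) * Ln (1 + d)
     + of_real (\<Sum>i\<in>I. tw (P i)) * (d - Ln (1 + d))
     + of_real (\<Sum>i\<in>I. P i * tw (P i)) * ((1 + d) - 1 / (1 + d) - 2 * Ln (1 + d))
     + of_real (\<Sum>i\<in>I. (tw (P i))\<^sup>2) * d ^ 4 / 4 + E)"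
   "norm E \<le> 24 * (1 + B) * (\<Sum>i\<in>I. (tw (P i))\<^sup>2) * norm d ^ 5"
proof -
  define E where "E = (\<Sum>i\<in>I. node_exp (P i) d - of_real ((tw (P i))\<^sup>2) * d ^ 4 / 4)"
  have sm: "norm d \<le> 1/2" "\<And>i. i \<in> I \<Longrightarrow> norm (of_real (P i) * d) \<le> 1/2"
  proof -
    have "norm d * 1 \<le> norm d * (1 + B)" using I(2) by (intro mult_left_mono) auto
    then show "norm d \<le> 1/2" using d by linarith
    fix i assume "i \<in> I"
    have "norm (of_real (P i) * d) = norm d * \<bar>P i\<bar>" by (simp add: norm_mult)
    also have "\<dots> \<le> norm d * (1 + B)" using I(1)[OF \<open>i \<in> I\<close>] by (intro mult_left_mono) auto
    finally show "norm (of_real (P i) * d) \<le> 1/2" using d by linarith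
  qed
  have nz: "1 + d \<noteq> 0" "\<And>i. i \<in> I \<Longrightarrow> 1 - of_real (P i) * d \<noteq> 0"
    using one_plus_nonpos_Reals[of d] one_plus_nonpos_Reals[of "- of_real (P _) * d"] sm by force+
  have pw: "(1 + d) powi A = exp (of_int A * Ln (1 + d))"
    using exp_power_int[of "Ln (1 + d)" A] nz(1) by simp
  have "node_prod A I P (1 + d) = exp (of_int A * Ln (1 + d)) * (\<Prod>i\<in>I. exp (- Ln (1 - of_real (P i) * d)))"
    unfolding node_prod_def pw using nz by (simp add: exp_minus inverse_eq_divide)
  also have "\<dots> = exp (of_int A * Ln (1 + d) + (\<Sum>i\<in>I. - Ln (1 - of_real (P i) * d)))"
    using fin by (simp add: exp_add exp_sum)
  also have "of_int A * Ln (1 + d) + (\<Sum>i\<in>I. - Ln (1 - of_real (P i) * d))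
     = of_real (of_int A + (\<Sum>i\<in>I. P i)) * Ln (1 + d)
     + of_real (\<Sum>i\<in>I. tw (P i)) * (d - Ln (1 + d))
     + of_real (\<Sum>i\<in>I. P i * tw (P i)) * ((1 + d) - 1 / (1 + d) - 2 * Ln (1 + d))
     + of_real (\<Sum>i\<in>I. (tw (P i))\<^sup>2) * d ^ 4 / 4 + E"
  proof -
    have "- Ln (1 - of_real (P i) * d) = of_real (P i) * Ln (1 + d) + of_real (tw (P i)) * (d - Ln (1 + d))
       + of_real (P i * tw (P i)) * ((1 + d) - 1 / (1 + d) - 2 * Ln (1 + d)) + of_real ((tw (P i))\<^sup>2) * (d ^ 4 / 4)
       + (node_exp (P i) d - of_real ((tw (P i))\<^sup>2) * d ^ 4 / 4)" for i
      unfolding node_exp_def by simp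
    then have "(\<Sum>i\<in>I. - Ln (1 - of_real (P i) * d)) = (\<Sum>i\<in>I. of_real (P i) * Ln (1 + d) + of_real (tw (P i)) * (d - Ln (1 + d))
       + of_real (P i * tw (P i)) * ((1 + d) - 1 / (1 + d) - 2 * Ln (1 + d)) + of_real ((tw (P i))\<^sup>2) * (d ^ 4 / 4)
       + (node_exp (P i) d - of_real ((tw (P i))\<^sup>2) * d ^ 4 / 4))" by (intro sum.cong refl)
    also have "\<dots> = of_real (\<Sum>i\<in>I. P i) * Ln (1 + d) + of_real (\<Sum>i\<in>I. tw (P i)) * (d - Ln (1 + d))
     + of_real (\<Sum>i\<in>I. P i * tw (P i)) * ((1 + d) - 1 / (1 + d) - 2 * Ln (1 + d))
     + of_real (\<Sum>i\<in>I. (tw (P i))\<^sup>2) * (d ^ 4 / 4) + E"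
      unfolding E_def of_real_sum sum_distrib_right sum.distrib ..
    finally show ?thesis by (simp only: of_real_add of_real_of_int_eq distrib_right times_divide_eq_right add.assoc)
  qed
  finally have "node_prod A I P (1 + d) = exp (of_real (of_int A + (\<Sum>i\<in>I. P i)) * Ln (1 + d)
     + of_real (\<Sum>i\<in>I. tw (P i)) * (d - Ln (1 + d))
     + of_real (\<Sum>i\<in>I. P i * tw (P i)) * ((1 + d) - 1 / (1 + d) - 2 * Ln (1 + d))
     + of_real (\<Sum>i\<in>I. (tw (P i))\<^sup>2) * d ^ 4 / 4 + E)" .
  moreover have "norm E \<le> 24 * (1 + B) * (\<Sum>i\<in>I. (tw (P i))\<^sup>2) * norm d ^ 5"
  proof -
    have "norm E \<le> (\<Sum>i\<in>I. 24 * (1 + B) * (tw (P i))\<^sup>2 * norm d ^ 5)"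
      unfolding E_def using I d by (intro sum_norm_le node_exp_estimate) auto
    then show ?thesis by (simp add: sum_distrib_left sum_distrib_right)
  qed
  ultimately show ?thesis by (rule that)
qed

text \<open>The 9 covers all three coefficient functions: the logarithm is at most
  \<open>2 \<bar>d\<bar>\<close>, and the third function, the largest, at most
  \<open>5 \<bar>d\<bar> + 4 \<bar>d\<bar>\<close>.\<close>

lemma node_prod_local_bound:
  assumes fin: "finite I" and I: "\<And>i. i \<in> I \<Longrightarrow> \<bar>P i\<bar> \<le> B" "0 \<le> B" and d: "norm d * (1 + B) < 1 / 2"
  shows "norm (node_prod A I P (1 + d)) \<le> exp (9 * (\<bar>of_int A + (\<Sum>i\<in>I. P i)\<bar> + \<bar>\<Sum>i\<in>I. tw (P i)\<bar> + \<bar>\<Sum>i\<in>I. P i * tw (P i)\<bar>) * norm d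
     + (\<Sum>i\<in>I. (tw (P i))\<^sup>2) * (Re (d ^ 4) / 4 + 24 * (1 + B) * norm d ^ 5))"
proof -
  define s where "s = Ln (1 + d)"
  define S1 S2 S3 S4 where "S1 = of_int A + (\<Sum>i\<in>I. P i)" and "S2 = (\<Sum>i\<in>I. tw (P i))"
    and "S3 = (\<Sum>i\<in>I. P i * tw (P i))" and "S4 = (\<Sum>i\<in>I. (tw (P i))\<^sup>2)"
  obtain E where E: "node_prod A I P (1 + d) = exp (of_real S1 * s + of_real S2 * (d - s)
     + of_real S3 * ((1 + d) - 1 / (1 + d) - 2 * s) + of_real S4 * d ^ 4 / 4 + E)"
   "norm E \<le> 24 * (1 + B) * S4 * norm d ^ 5"
    by (rule node_prod_local[where I = I and P = P and A = A and B = B and d = d, OF fin I less_imp_le[OF d],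
          folded s_def S1_def S2_def S3_def S4_def], assumption) (rule that)
  have "norm d * 1 \<le> norm d * (1 + B)" using I(2) by (intro mult_left_mono) auto
  then have d2: "norm d < 1/2" using d by linarith
  have s: "norm s \<le> 2 * norm d" unfolding s_def using d2 norm_Ln_le[of d] by auto
  have 1: "norm (of_real S1 * s) \<le> \<bar>S1\<bar> * (9 * norm d)"
    unfolding norm_mult norm_of_real using s norm_ge_zero[of d] by (intro mult_left_mono) linarith+
  have "norm (d - s) \<le> norm d + norm s" by (rule norm_triangle_ineq4)
  then have 2: "norm (of_real S2 * (d - s)) \<le> \<bar>S2\<bar> * (9 * norm d)"
    unfolding norm_mult norm_of_real using s norm_ge_zero[of d] by (intro mult_left_mono) linarith+
  have l2: "1/2 \<le> norm (1 + d)" using norm_diff_ineq[of 1 d] d2 by simp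
  then have "1 + d \<noteq> 0" by auto
  then have "(1 + d) - 1 / (1 + d) = d * (2 + d) / (1 + d)" by (simp add: field_simps)
  then have "norm ((1 + d) - 1 / (1 + d)) = norm d * norm (2 + d) / norm (1 + d)" by (simp add: norm_divide norm_mult)
  also have "\<dots> \<le> norm d * (5/2) / (1/2)"
    using l2 norm_triangle_ineq[of 2 d] d2 by (intro frac_le mult_left_mono) auto
  finally have "norm ((1 + d) - 1 / (1 + d)) \<le> 5 * norm d" by simp
  then have "norm ((1 + d) - 1 / (1 + d) - 2 * s) \<le> 9 * norm d"
    using norm_triangle_ineq4[of "(1 + d) - 1 / (1 + d)" "2 * s"] s by (simp add: norm_mult)
  then have 3: "norm (of_real S3 * ((1 + d) - 1 / (1 + d) - 2 * s)) \<le> \<bar>S3\<bar> * (9 * norm d)"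
    unfolding norm_mult norm_of_real by (intro mult_left_mono) linarith+
  have "Re (of_real S1 * s + of_real S2 * (d - s) + of_real S3 * ((1 + d) - 1 / (1 + d) - 2 * s) + of_real S4 * d ^ 4 / 4 + E)
    \<le> norm (of_real S1 * s) + norm (of_real S2 * (d - s)) + norm (of_real S3 * ((1 + d) - 1 / (1 + d) - 2 * s)) + S4 * (Re (d ^ 4) / 4) + norm E"
    using complex_Re_le_cmod[of "of_real S1 * s"] complex_Re_le_cmod[of "of_real S2 * (d - s)"]
      complex_Re_le_cmod[of "of_real S3 * ((1 + d) - 1 / (1 + d) - 2 * s)"] complex_Re_le_cmod[of E]
    by (simp only: plus_complex.sel Re_divide_numeral) (simp add: Re_complex_of_real del: complex_Re_le_cmod)
  also have "\<dots> \<le> 9 * (\<bar>S1\<bar> + \<bar>S2\<bar> + \<bar>S3\<bar>) * norm d + S4 * (Re (d ^ 4) / 4 + 24 * (1 + B) * norm d ^ 5)"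
    using 1 2 3 E(2) by (simp add: algebra_simps)
  finally show ?thesis unfolding E(1) norm_exp_eq_Re S1_def S2_def S3_def S4_def by simp
qed

section \<open>The level curve\<close>

text \<open>The curve is parametrized by \<open>x = ln \<bar>u\<bar>\<close>. Its real part is chosen such that in the derivative of
  \<open>level_gain p\<close> the terms of first order in \<open>tw p\<close> cancel, whatever \<open>p\<close> is.\<close>

definition level_lam :: "real \<Rightarrow> real" where
  "level_lam x = x * cosh x / sinh x - 1"

definition level_re :: "real \<Rightarrow> real" where
  "level_re x = 1 + x + level_lam x"

definition level_curve :: "real \<Rightarrow> complex" where
  "level_curve x = Complex (level_re x) (sqrt (exp (2 * x) - (level_re x)\<^sup>2))"

lemma sinh_gt_self: "0 < x \<Longrightarrow> x < sinh (x::real)"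
proof -
  assume x: "0 < x"
  have "(\<lambda>x. sinh x - x) 0 < (\<lambda>x. sinh x - x) x"
  proof (rule DERIV_pos_imp_increasing_open[OF x])
    fix y :: real assume "0 < y"
    then have "0 < cosh y - 1" using cosh_real_ge_1[of y] cosh_real_one_iff[of y] by linarith
    then show "\<exists>D. ((\<lambda>x. sinh x - x) has_real_derivative D) (at y) \<and> 0 < D"
      by (intro exI[of _ "cosh y - 1"]) (auto intro!: derivative_eq_intros)
  qed (auto intro!: continuous_intros)
  then show ?thesis by simp
qed

lemma level_lam_minus: "level_lam (- x) = level_lam x"
  unfolding level_lam_def by simp

lemma DERIV_level_lam:
  assumes "x \<noteq> 0"
  shows "(level_lam has_real_derivative (cosh x * sinh x - x) / (sinh x)\<^sup>2) (at x)"
proof -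
  have s: "sinh x \<noteq> 0" using assms by simp
  have "cosh x * cosh x = sinh x * sinh x + 1" using cosh_square_eq[of x] by (simp add: power2_eq_square)
  then have "((1 * cosh x + sinh x * x) * sinh x - x * cosh x * cosh x) / (sinh x * sinh x) = (cosh x * sinh x - x) / (sinh x)\<^sup>2"
    by (simp add: power2_eq_square algebra_simps)
  moreover have "(level_lam has_real_derivative ((1 * cosh x + sinh x * x) * sinh x - x * cosh x * cosh x) / (sinh x * sinh x)) (at x)"
    unfolding level_lam_def[abs_def] using s by (auto intro!: derivative_eq_intros)
  ultimately show ?thesis by simp
qed

lemma level_lam_deriv_pos: "0 < x \<Longrightarrow> 0 < (cosh x * sinh x - x) / (sinh (x::real))\<^sup>2"
proof -
  assume x: "0 < x"
  have "x < sinh x" by (rule sinh_gt_self[OF x])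
  also have "sinh x \<le> cosh x * sinh x" using x cosh_real_ge_1[of x] by (simp add: mult_le_cancel_right1)
  finally show ?thesis using x by (simp add: zero_less_divide_iff)
qed

text \<open>The first identity is the vanishing of \<open>Re (u - 1 / u - 2 Ln u)\<close> on the
  curve, where \<open>\<bar>u\<bar> = exp x\<close>. As moreover
  \<open>level_lam x = Re (u - 1 - Ln u)\<close>, the function \<open>level_gain p\<close> below is
  \<open>- Re (node_exp p (u - 1))\<close> along the curve.\<close>

lemma level_re_eq:
  assumes "x \<noteq> 0" shows "level_re x * (exp (2 * x) - 1) = 2 * x * exp (2 * x)"
    and "level_re x = x * exp x / sinh x"
proof -
  have s: "sinh x \<noteq> 0" using assms by simp
  have "x + x * cosh x / sinh x = x * exp x / sinh x"
    using s by (simp add: field_simps flip: cosh_plus_sinh)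
  then show 1: "level_re x = x * exp x / sinh x" unfolding level_re_def level_lam_def by simp
  have "exp (2 * x) - 1 = 2 * exp x * sinh x"
    by (simp add: sinh_def algebra_simps exp_double power2_eq_square flip: exp_add)
  then show "level_re x * (exp (2 * x) - 1) = 2 * x * exp (2 * x)"
    unfolding 1 using s by (simp add: exp_double power2_eq_square)
qed

text \<open>By \<open>level_re_eq\<close> the real part is the fraction \<open>x / sinh x\<close> of
  the modulus, and this fraction lies strictly between 0 and 1. Hence the curve meets the real axis
  only at its start.\<close>

lemma level_re_less:
  assumes "x \<noteq> 0" shows "0 < level_re x" "level_re x < exp x" "(level_re x)\<^sup>2 < exp (2 * x)"
proof -
  have r: "0 < x / sinh x" "x / sinh x < 1"
  proof -
    show "0 < x / sinh x" using assms by (auto simp: zero_less_divide_iff)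
    show "x / sinh x < 1"
    proof (cases "x > 0")
      case True then show ?thesis using sinh_gt_self[of x] by simp
    next
      case False then show ?thesis using sinh_gt_self[of "-x"] assms by (simp add: divide_less_eq)
    qed
  qed
  have e: "level_re x = (x / sinh x) * exp x" using level_re_eq(2)[OF assms] by simp
  show 1: "0 < level_re x" by (subst e) (rule mult_pos_pos[OF r(1) exp_gt_zero])
  show 2: "level_re x < exp x" using mult_strict_right_mono[OF r(2) exp_gt_zero[of x]] by (subst e) simp
  have "(level_re x)\<^sup>2 < (exp x)\<^sup>2" using 1 2 by (intro power_strict_mono) auto
  then show "(level_re x)\<^sup>2 < exp (2 * x)" by (simp add: exp_double)
qed

lemma level_curve_props:
  assumes "x \<noteq> 0"
  shows "Re (level_curve x) = level_re x" "0 < Im (level_curve x)" "norm (level_curve x) = exp x"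
proof -
  show "Re (level_curve x) = level_re x" "0 < Im (level_curve x)"
    unfolding level_curve_def using level_re_less[OF assms] by auto
  have "(norm (level_curve x))\<^sup>2 = (exp x)\<^sup>2"
    unfolding level_curve_def cmod_power2 using level_re_less(3)[OF assms] by (simp add: exp_double)
  then show "norm (level_curve x) = exp x" by (simp add: power2_eq_iff_nonneg)
qed

text \<open>The squared modulus of \<open>1 - p (u - 1)\<close> in terms of \<open>C = Re u\<close> and \<open>r = norm u\<close>.\<close>

definition node_sq :: "real \<Rightarrow> real \<Rightarrow> real \<Rightarrow> real" where
  "node_sq p r C = (1 + p)\<^sup>2 + p\<^sup>2 * r\<^sup>2 - 2 * tw p * C"

lemma node_sq_eq: "node_sq p r C = (1 - p * (C - 1))\<^sup>2 + p\<^sup>2 * (r\<^sup>2 - C\<^sup>2)"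
  unfolding node_sq_def by (simp add: power2_eq_square algebra_simps)

lemma node_sq_pos: assumes "C\<^sup>2 < r\<^sup>2" shows "0 < node_sq p r C"
proof (cases "p = 0")
  case False
  then have "0 < p\<^sup>2 * (r\<^sup>2 - C\<^sup>2)" using assms by simp
  then show ?thesis unfolding node_sq_eq by (smt (verit) zero_le_power2)
qed (simp add: node_sq_def)

definition level_gain :: "real \<Rightarrow> real \<Rightarrow> real" where
  "level_gain p x = ln (node_sq p (exp x) (level_re x)) / 2 + p * x + tw p * level_lam x"

lemma level_node_sq_pos: "x \<noteq> 0 \<Longrightarrow> 0 < node_sq p (exp x) (level_re x)"
  using level_re_less(3)[of x] by (intro node_sq_pos) (simp add: exp_double)

text \<open>The factor \<open>exp (2 * x) - 2 * level_re x + 1\<close> is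
  \<open>\<bar>u - 1\<bar>\<^sup>2\<close> and the denominator is
  \<open>\<bar>1 - p (u - 1)\<bar>\<^sup>2\<close>. Only \<open>l'\<close> carries a sign, that of
  \<open>x\<close>, so the gain grows in both directions away from the critical point.\<close>

lemma DERIV_level_gain:
  assumes x: "x \<noteq> 0"
  defines "l' \<equiv> (cosh x * sinh x - x) / (sinh x)\<^sup>2"
  shows "(level_gain p has_real_derivative
     (tw p)\<^sup>2 * l' * (exp (2 * x) - 2 * level_re x + 1) / node_sq p (exp x) (level_re x)) (at x)"
proof -
  define k where "k = level_re x"
  define E where "E = exp (2 * x)"
  define Q where "Q = node_sq p (exp x) k"
  have Q: "0 < Q" unfolding Q_def k_def by (rule level_node_sq_pos[OF x])
  have Qe: "Q = (1 + p)\<^sup>2 + p\<^sup>2 * E - 2 * tw p * k" unfolding Q_def node_sq_def E_def by (simp add: exp_double)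
  have dl: "(level_lam has_real_derivative l') (at x)" unfolding l'_def by (rule DERIV_level_lam[OF x])
  have dk: "(level_re has_real_derivative 1 + l') (at x)"
    unfolding level_re_def[abs_def] by (auto intro!: derivative_eq_intros dl)
  \<comment> \<open>Differentiates the equation of the curve; this relation is what removes the
    terms of first order in \<open>T\<close> at the end of the proof.\<close>
  have ode: "(1 + l') * (E - 1) = 2 * (E - k)"
  proof -
    have "((\<lambda>x. level_re x * (exp (2 * x) - 1)) has_real_derivative (1 + l') * (E - 1) + k * (2 * E)) (at x)"
      unfolding E_def k_def by (auto intro!: derivative_eq_intros dk)
    moreover have "((\<lambda>x. level_re x * (exp (2 * x) - 1)) has_real_derivative 2 * E + 2 * x * (2 * E)) (at x)"
    proof (rule has_field_derivative_transform_within_open[where S = "- {0}" and f = "\<lambda>x. 2 * x * exp (2 * x)"])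
      show "((\<lambda>x. 2 * x * exp (2 * x)) has_real_derivative 2 * E + 2 * x * (2 * E)) (at x)"
        unfolding E_def by (auto intro!: derivative_eq_intros)
    qed (use x level_re_eq(1) in auto)
    ultimately have "(1 + l') * (E - 1) + k * (2 * E) = 2 * E + 2 * x * (2 * E)" by (rule DERIV_unique)
    moreover have "k * (E - 1) = 2 * x * E" using level_re_eq(1)[OF x] unfolding E_def k_def .
    ultimately show ?thesis by algebra
  qed
  have dQ: "((\<lambda>x. node_sq p (exp x) (level_re x)) has_real_derivative 2 * (p\<^sup>2 * E - tw p * (1 + l'))) (at x)"
  proof -
    have "((\<lambda>x. node_sq p (exp x) (level_re x)) has_real_derivative p\<^sup>2 * (2 * exp x * exp x) - 2 * tw p * (1 + l')) (at x)"
      unfolding node_sq_def by (auto intro!: derivative_eq_intros dk)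
    moreover have "E = exp x * exp x" unfolding E_def by (simp add: exp_double power2_eq_square)
    then have v: "p\<^sup>2 * (2 * exp x * exp x) - 2 * tw p * (1 + l') = 2 * (p\<^sup>2 * E - tw p * (1 + l'))"
      by (simp add: algebra_simps)
    ultimately show ?thesis by (simp only: v)
  qed
  have "(level_gain p has_real_derivative (2 * (p\<^sup>2 * E - tw p * (1 + l')) / Q) / 2 + p + tw p * l') (at x)"
  proof -
    have "((\<lambda>x. ln (node_sq p (exp x) (level_re x))) has_real_derivative 2 * (p\<^sup>2 * E - tw p * (1 + l')) / Q) (at x)"
      using DERIV_chain2[where f = ln, OF DERIV_ln_divide[OF Q[unfolded Q_def k_def]] dQ] unfolding Q_def k_def by simp
    then have "((\<lambda>x. ln (node_sq p (exp x) (level_re x)) / 2 + p * x + tw p * level_lam x) has_real_derivative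
        2 * (p\<^sup>2 * E - tw p * (1 + l')) / Q / 2 + p * 1 + tw p * l') (at x)"
      by (intro DERIV_add DERIV_cdivide DERIV_cmult DERIV_ident dl)
    then show ?thesis unfolding level_gain_def[abs_def] by simp
  qed
  also have "(2 * (p\<^sup>2 * E - tw p * (1 + l')) / Q) / 2 + p + tw p * l'
     = ((p\<^sup>2 * E - tw p * (1 + l')) + (p + tw p * l') * Q) / Q" using Q by (simp add: field_simps)
  also have "(p\<^sup>2 * E - tw p * (1 + l')) + (p + tw p * l') * Q = (tw p)\<^sup>2 * l' * (E - 2 * k + 1)"
    using ode unfolding Qe by algebra
  finally show ?thesis unfolding Q_def E_def k_def .
qed

lemma level_gain_tendsto_0:
  assumes "s = 1 \<or> s = -1" shows "((\<lambda>y. level_gain p (s * y)) \<longlongrightarrow> 0) (at_right 0)"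
proof -
  have lam: "((\<lambda>y::real. y * cosh y / sinh y - 1) \<longlongrightarrow> 0) (at_right 0)"
    by real_asymp
  then have lam': "((\<lambda>y. level_lam (s * y)) \<longlongrightarrow> 0) (at_right 0)"
    using assms level_lam_minus unfolding level_lam_def by auto
  have "((\<lambda>y::real. s * y) \<longlongrightarrow> s * 0) (at_right 0)" by (intro tendsto_intros)
  then have s0: "((\<lambda>y::real. s * y) \<longlongrightarrow> 0) (at_right 0)" by simp
  have "((\<lambda>y. ln (node_sq p (exp (s * y)) (1 + s * y + level_lam (s * y))) / 2 + p * (s * y) + tw p * level_lam (s * y))
     \<longlongrightarrow> ln (node_sq p (exp 0) (1 + 0 + 0)) / 2 + p * 0 + tw p * 0) (at_right 0)"
    unfolding node_sq_def by (intro tendsto_intros s0 lam') (simp_all add: power2_eq_square algebra_simps)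
  moreover have "node_sq p (exp 0) (1 + 0 + 0) = 1" unfolding node_sq_def by (simp add: power2_eq_square algebra_simps)
  ultimately show ?thesis unfolding level_gain_def level_re_def by simp
qed

text \<open>The gain starts at 0 and is nondecreasing in \<open>\<bar>x\<bar>\<close>, and on
  \<open>[x1 / 2, x1]\<close> its slope is at least a constant times \<open>T\<^sup>2\<close>.
  Compactness handles \<open>x\<close>; uniformity in \<open>p\<close> comes from \<open>\<bar>1 - p
  (u - 1)\<bar>\<^sup>2 \<le> 2 + 2 B\<^sup>2 \<bar>u - 1\<bar>\<^sup>2\<close>. The sign
  \<open>s\<close> treats both halves of the curve at once.\<close>

lemma level_gain_lower_bound:
  assumes "0 < x1" "0 \<le> B"
  obtains c where "0 < c" "\<And>p x. \<lbrakk>\<bar>p\<bar> \<le> B; x1 \<le> \<bar>x\<bar>\<rbrakk> \<Longrightarrow> c * (tw p)\<^sup>2 \<le> level_gain p x"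
proof -
  define l' where "l' y = (cosh y * sinh y - y) / (sinh y)\<^sup>2" for y :: real
  \<comment> \<open>This is \<open>\<bar>u - 1\<bar>\<^sup>2\<close> at the point of the curve with
    parameter \<open>s * y\<close>.\<close>
  define W where "W s y = exp (2 * (s * y)) - 2 * level_re (s * y) + 1" for s y :: real
  have l'odd: "s * l' (s * y) = l' y" if "s = 1 \<or> s = -1" for s y
    using that unfolding l'_def by (auto simp: field_simps minus_divide_left)
  have Wpos: "0 < W s y" if "s = 1 \<or> s = -1" "0 < y" for s y
  proof -
    have "s * y \<noteq> 0" using that by auto
    from level_node_sq_pos[OF this, of 1] level_node_sq_pos[OF this, of "-1"] level_re_less[OF this]
    have "level_re (s * y) < exp (s * y)" by blast
    moreover have "exp (2 * (s * y)) - 2 * exp (s * y) + 1 = (exp (s * y) - 1)\<^sup>2"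
      unfolding exp_double by (simp add: power2_eq_square algebra_simps)
    ultimately show ?thesis unfolding W_def by (smt (verit) zero_le_power2)
  qed
  have Qle: "node_sq p (exp (s * y)) (level_re (s * y)) \<le> 2 + 2 * B\<^sup>2 * W s y" if "\<bar>p\<bar> \<le> B" "s = 1 \<or> s = -1" "0 < y" for p s y
  proof -
    have "node_sq p (exp (s * y)) (level_re (s * y)) = 1 - 2 * (p * (level_re (s * y) - 1)) + p\<^sup>2 * W s y"
      unfolding node_sq_def W_def exp_double by (simp add: power2_eq_square algebra_simps)
    also have "\<dots> \<le> 2 + (p * (level_re (s * y) - 1))\<^sup>2 + p\<^sup>2 * W s y"
      using zero_le_power2[of "1 + p * (level_re (s * y) - 1)"] by (simp add: power2_eq_square algebra_simps)
    also have "(p * (level_re (s * y) - 1))\<^sup>2 \<le> p\<^sup>2 * W s y"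
    proof -
      have "(level_re (s * y))\<^sup>2 < exp (2 * (s * y))" using that by (intro level_re_less) auto
      then have "(level_re (s * y) - 1)\<^sup>2 \<le> W s y" unfolding W_def by (simp add: power2_eq_square algebra_simps)
      then show ?thesis by (simp add: power_mult_distrib mult_left_mono)
    qed
    finally have "node_sq p (exp (s * y)) (level_re (s * y)) \<le> 2 + 2 * (p\<^sup>2 * W s y)" by (simp only: mult_2 add.assoc[symmetric])
    moreover have "p\<^sup>2 * W s y \<le> B\<^sup>2 * W s y" using that assms Wpos[OF that(2,3)]
      by (intro mult_right_mono) (auto simp: power2_le_iff_abs_le)
    ultimately show ?thesis by simp
  qed
  have der: "((\<lambda>y. level_gain p (s * y)) has_real_derivative (tw p)\<^sup>2 * (l' y * W s y / node_sq p (exp (s * y)) (level_re (s * y)))) (at y)"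
    if "s = 1 \<or> s = -1" "0 < y" for p s y
  proof -
    have nz: "s * y \<noteq> 0" using that by auto
    have "((\<lambda>y. s * y) has_real_derivative s) (at y)" by (auto intro!: derivative_eq_intros)
    from DERIV_chain2[OF DERIV_level_gain[OF nz, of p, folded l'_def] this]
    have "((\<lambda>y. level_gain p (s * y)) has_real_derivative (tw p)\<^sup>2 * ((s * l' (s * y)) * W s y / node_sq p (exp (s * y)) (level_re (s * y)))) (at y)"
      unfolding W_def by (simp add: mult_ac)
    then show ?thesis unfolding l'odd[OF that(1)] .
  qed
  have l'pos: "0 < l' y" if "0 < y" for y unfolding l'_def by (rule level_lam_deriv_pos[OF that])
  have mono: "level_gain p (s * y1) \<le> level_gain p (s * y2)" if "s = 1 \<or> s = -1" "0 < y1" "y1 \<le> y2" for p s y1 y2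
  proof (rule DERIV_nonneg_imp_nondecreasing[OF that(3), where f = "\<lambda>y. level_gain p (s * y)"])
    fix y assume "y1 \<le> y" then have y: "0 < y" using that by linarith
    have "s * y \<noteq> 0" using y that(1) by auto
    then have "0 \<le> (tw p)\<^sup>2 * (l' y * W s y / node_sq p (exp (s * y)) (level_re (s * y)))"
      using l'pos[OF y] Wpos[OF that(1) y] level_node_sq_pos[of "s * y" p] by auto
    then show "\<exists>D. ((\<lambda>y. level_gain p (s * y)) has_real_derivative D) (at y) \<and> 0 \<le> D"
      using der[OF that(1) y] by blast
  qed
  have nonneg: "0 \<le> level_gain p (s * y)" if "s = 1 \<or> s = -1" "0 < y" for p s y
  proof (rule tendsto_upperbound[OF level_gain_tendsto_0[OF that(1)]])
    show "\<forall>\<^sub>F z in at_right 0. level_gain p (s * z) \<le> level_gain p (s * y)"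
      unfolding eventually_at_right_field using mono[OF that(1)] that(2) by (intro exI[of _ y]) auto
  qed auto
  have "\<exists>m>0. \<forall>y\<in>{x1/2..x1}. m \<le> l' y * W s y / (2 + 2 * B\<^sup>2 * W s y)" if s: "s = 1 \<or> s = -1" for s
  proof -
    have pos: "y > 0" if "y \<in> {x1/2..x1}" for y using that assms by auto
    have nz: "\<forall>y\<in>{x1/2..x1}. sinh (s * y) \<noteq> 0"
    proof
      fix y assume "y \<in> {x1/2..x1}"
      then have "s * y \<noteq> 0" using pos[of y] s by auto
      then show "sinh (s * y) \<noteq> 0" by (simp only: sinh_real_zero_iff not_False_eq_True)
    qed
    have "continuous_on {x1/2..x1} (\<lambda>y. level_re (s * y))"
      unfolding level_re_def level_lam_def by (intro continuous_intros nz)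
    then have cW: "continuous_on {x1/2..x1} (W s)" unfolding W_def[abs_def] by (intro continuous_intros)
    have den: "2 + 2 * B\<^sup>2 * W s y > 0" if "y > 0" for y
      using Wpos[OF s that] by (smt (verit) mult_nonneg_nonneg zero_le_power2)
    have cl: "continuous_on {x1/2..x1} l'" unfolding l'_def[abs_def] using pos by (intro continuous_intros) fastforce+
    have ne: "{x1/2..x1} \<noteq> {}" using assms by simp
    have cont: "continuous_on {x1/2..x1} (\<lambda>y. l' y * W s y / (2 + 2 * B\<^sup>2 * W s y))"
      using den pos by (intro continuous_intros cW cl) (metis less_irrefl)
    from continuous_attains_inf[OF compact_Icc ne cont]
    obtain y0 where y0: "y0 \<in> {x1/2..x1}" "\<forall>y\<in>{x1/2..x1}. l' y0 * W s y0 / (2 + 2 * B\<^sup>2 * W s y0) \<le> l' y * W s y / (2 + 2 * B\<^sup>2 * W s y)"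
      by blast
    have "0 < l' y0 * W s y0 / (2 + 2 * B\<^sup>2 * W s y0)"
      using l'pos Wpos[OF s] den pos[OF y0(1)] by auto
    then show ?thesis using y0(2) by blast
  qed
  then have "\<forall>s. \<exists>m. s = 1 \<or> s = -1 \<longrightarrow> 0 < m \<and> (\<forall>y\<in>{x1/2..x1}. m \<le> l' y * W s y / (2 + 2 * B\<^sup>2 * W s y))" by blast
  from choice[OF this] obtain m where m0: "\<forall>s. s = 1 \<or> s = -1 \<longrightarrow> 0 < m s \<and> (\<forall>y\<in>{x1/2..x1}. m s \<le> l' y * W s y / (2 + 2 * B\<^sup>2 * W s y))" ..
  have m: "0 < m s" "\<And>y. y\<in>{x1/2..x1} \<Longrightarrow> m s \<le> l' y * W s y / (2 + 2 * B\<^sup>2 * W s y)" if "s = 1 \<or> s = -1" for s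
    using m0 that by blast+
  define c where "c = min (m 1) (m (-1)) * (x1 / 2)"
  have c: "0 < c" unfolding c_def using m(1)[of 1] m(1)[of "-1"] assms by simp
  have main: "c * (tw p)\<^sup>2 \<le> level_gain p (s * x)" if p: "\<bar>p\<bar> \<le> B" and s: "s = 1 \<or> s = -1" and x: "x1 \<le> x" for p s x
  proof -
    define M where "M = min (m 1) (m (-1)) * (tw p)\<^sup>2"
    have "(\<lambda>y. level_gain p (s * y) - M * y) (x1/2) \<le> (\<lambda>y. level_gain p (s * y) - M * y) x1"
    proof (rule DERIV_nonneg_imp_nondecreasing[where f = "\<lambda>y. level_gain p (s * y) - M * y"])
      fix y assume y: "x1/2 \<le> y" "y \<le> x1"
      then have y0: "0 < y" using assms by linarith
      have sy: "s * y \<noteq> 0" using y0 s by auto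
      have q: "0 < node_sq p (exp (s * y)) (level_re (s * y))" by (rule level_node_sq_pos[OF sy])
      have "min (m 1) (m (-1)) \<le> m s" using s by auto
      also have "m s \<le> l' y * W s y / (2 + 2 * B\<^sup>2 * W s y)" using m(2)[OF s] y by auto
      also have "\<dots> \<le> l' y * W s y / node_sq p (exp (s * y)) (level_re (s * y))"
        using Qle[OF p s y0] q l'pos[OF y0] Wpos[OF s y0] by (intro divide_left_mono mult_pos_pos) auto
      finally have X: "min (m 1) (m (-1)) \<le> l' y * W s y / node_sq p (exp (s * y)) (level_re (s * y))" .
      have "M \<le> (tw p)\<^sup>2 * (l' y * W s y / node_sq p (exp (s * y)) (level_re (s * y)))"
        unfolding M_def mult.commute[of "(tw p)\<^sup>2"] by (rule mult_right_mono[OF X]) simp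
      moreover have "((\<lambda>y. level_gain p (s * y) - M * y) has_real_derivative
           (tw p)\<^sup>2 * (l' y * W s y / node_sq p (exp (s * y)) (level_re (s * y))) - M * 1) (at y)"
        by (intro DERIV_diff der[OF s y0] DERIV_cmult DERIV_ident)
      ultimately show "\<exists>D. ((\<lambda>y. level_gain p (s * y) - M * y) has_real_derivative D) (at y) \<and> 0 \<le> D"
        by (intro exI conjI) (assumption, simp)
    qed (use assms in auto)
    then have "M * (x1 / 2) \<le> level_gain p (s * x1)" using nonneg[OF s, of "x1/2" p] assms by simp
    also have "\<dots> \<le> level_gain p (s * x)" using mono[OF s _ x] assms by auto
    finally show ?thesis unfolding M_def c_def by (simp add: mult_ac)
  qed
  show ?thesis
  proof (rule that[OF c])
    fix p x assume "\<bar>p\<bar> \<le> B" "x1 \<le> \<bar>x\<bar>"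
    then show "c * (tw p)\<^sup>2 \<le> level_gain p x"
      using main[of p 1 x] main[of p "-1" "-x"] by (cases "x \<ge> 0") auto
  qed
qed

lemma node_sq_norm: "(norm (1 - of_real p * (u - 1)))\<^sup>2 = node_sq p (norm u) (Re u)"
  unfolding norm_node_factor node_sq_def ..

lemma node_prod_far_bound:
  assumes u: "norm u = exp x"
    and b: "\<And>i. i \<in> I \<Longrightarrow> 0 < node_sq (P i) (exp x) (Re u)"
      "\<And>i. i \<in> I \<Longrightarrow> - (ln (node_sq (P i) (exp x) (Re u)) / 2) \<le> P i * x + l * tw (P i) - c * (tw (P i))\<^sup>2 + \<eta> * \<bar>tw (P i)\<bar>"
    and "finite I"
  shows "norm (node_prod A I P u) \<le> exp ((of_int A + (\<Sum>i\<in>I. P i)) * x + l * (\<Sum>i\<in>I. tw (P i))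
     - c * (\<Sum>i\<in>I. (tw (P i))\<^sup>2) + \<eta> * (\<Sum>i\<in>I. \<bar>tw (P i)\<bar>))"
proof -
  have fac: "norm (1 / (1 - of_real (P i) * (u - 1))) \<le> exp (P i * x + l * tw (P i) - c * (tw (P i))\<^sup>2 + \<eta> * \<bar>tw (P i)\<bar>)"
    if i: "i \<in> I" for i
  proof -
    let ?n = "norm (1 - of_real (P i) * (u - 1))"
    have sq: "?n\<^sup>2 = node_sq (P i) (exp x) (Re u)" using node_sq_norm[of "P i" u] u by simp
    then have n: "?n \<noteq> 0" using b(1)[OF i] by auto
    then have "0 < ?n" by auto
    then have "exp (- ln ?n) = 1 / ?n" by (simp add: exp_minus inverse_eq_divide)
    moreover have "ln (?n\<^sup>2) = 2 * ln ?n" using \<open>0 < ?n\<close> by (simp add: ln_realpow)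
    then have "- ln ?n = - (ln (node_sq (P i) (exp x) (Re u)) / 2)" unfolding sq by simp
    ultimately have "1 / ?n \<le> exp (P i * x + l * tw (P i) - c * (tw (P i))\<^sup>2 + \<eta> * \<bar>tw (P i)\<bar>)"
      using b(2)[OF i] by (metis exp_le_cancel_iff)
    then show ?thesis by (simp add: norm_divide)
  qed
  have "norm (node_prod A I P u) = exp (of_int A * x) * (\<Prod>i\<in>I. norm (1 / (1 - of_real (P i) * (u - 1))))"
    unfolding node_prod_def norm_mult norm_power_int u prod_norm[symmetric] by (simp add: exp_power_int)
  also have "\<dots> \<le> exp (of_int A * x) * (\<Prod>i\<in>I. exp (P i * x + l * tw (P i) - c * (tw (P i))\<^sup>2 + \<eta> * \<bar>tw (P i)\<bar>))"
    using fac by (intro mult_left_mono prod_mono) auto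
  also have "\<dots> = exp (of_int A * x + (\<Sum>i\<in>I. P i * x + l * tw (P i) - c * (tw (P i))\<^sup>2 + \<eta> * \<bar>tw (P i)\<bar>))"
    using \<open>finite I\<close> by (simp add: exp_add exp_sum)
  also have "of_int A * x + (\<Sum>i\<in>I. P i * x + l * tw (P i) - c * (tw (P i))\<^sup>2 + \<eta> * \<bar>tw (P i)\<bar>)
     = (of_int A + (\<Sum>i\<in>I. P i)) * x + l * (\<Sum>i\<in>I. tw (P i))
     - c * (\<Sum>i\<in>I. (tw (P i))\<^sup>2) + \<eta> * (\<Sum>i\<in>I. \<bar>tw (P i)\<bar>)"
    by (simp only: sum.distrib sum_subtractf sum_distrib_left[symmetric] sum_distrib_right[symmetric]) (simp add: algebra_simps)
  finally show ?thesis .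
qed

lemma node_sq_ge: "\<bar>C\<bar> \<le> r \<Longrightarrow> (\<bar>p\<bar> * r - \<bar>1 + p\<bar>)\<^sup>2 \<le> node_sq p r C"
proof -
  assume C: "\<bar>C\<bar> \<le> r"
  have "tw p * C \<le> \<bar>tw p\<bar> * \<bar>C\<bar>" by (metis abs_ge_self abs_mult)
  also have "\<dots> \<le> \<bar>tw p\<bar> * r" using C by (intro mult_left_mono) auto
  finally have "2 * (tw p * C) \<le> 2 * (\<bar>p\<bar> * \<bar>1 + p\<bar> * r)" unfolding abs_mult by simp
  then show ?thesis unfolding node_sq_def by (simp add: power2_eq_square algebra_simps flip: abs_mult)
qed

text \<open>On the closing arcs \<open>norm u = exp (\<plusminus>R)\<close> a factor either shrinks when \<open>u\<close> leaves the level
  curve, or changes by an amount that is exponentially small in \<open>R\<close>.\<close>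

lemma arc_node_bound:
  assumes gain: "c * (tw p)\<^sup>2 \<le> level_gain p x" and x0: "x \<noteq> 0" and C: "\<bar>C\<bar> \<le> exp x"
    and q: "0 < node_sq p (exp x) C" and \<mu>: "0 < \<mu>" and p: "\<bar>p\<bar> \<le> B"
    and alt: "tw p * (C - level_re x) \<le> 0 \<or> x = R \<and> \<mu> \<le> \<bar>p\<bar> \<and> 2 * (1 + B) / \<mu> \<le> exp R
        \<or> x = - R \<and> \<mu> \<le> \<bar>1 + p\<bar> \<and> 2 * B / \<mu> \<le> exp R"
  shows "- (ln (node_sq p (exp x) C) / 2) \<le> p * x + level_lam x * tw p - c * (tw p)\<^sup>2 + 8 * exp (- R) / \<mu>\<^sup>2 * \<bar>tw p\<bar>"
proof -
  let ?QL = "node_sq p (exp x) (level_re x)" let ?Q = "node_sq p (exp x) C"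
  have q0: "0 < ?QL" by (rule level_node_sq_pos[OF x0])
  have diff: "?QL - ?Q = 2 * (tw p * (C - level_re x))" unfolding node_sq_def by (simp add: algebra_simps)
  \<comment> \<open>The point of the arc is compared with the curve point of the same modulus. By
    \<open>ln y \<le> y - 1\<close> only the difference of the squared moduli matters, and this is
    linear in the real part of \<open>u\<close>.\<close>
  have "ln ?QL - ln ?Q \<le> 16 * exp (- R) / \<mu>\<^sup>2 * \<bar>tw p\<bar>"
  proof -
    have k: "\<bar>C - level_re x\<bar> \<le> 2 * exp x" using C level_re_less[OF x0] by linarith
    have "ln ?QL - ln ?Q \<le> ?QL / ?Q - 1" using ln_le_minus_one[of "?QL / ?Q"] q q0 by (simp add: ln_div)
    also have "\<dots> = 2 * (tw p * (C - level_re x)) / ?Q" unfolding diff[symmetric] using q by (simp add: field_simps)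
    finally have 1: "ln ?QL - ln ?Q \<le> 2 * (tw p * (C - level_re x)) / ?Q" .
    have "tw p * (C - level_re x) \<le> \<bar>tw p\<bar> * \<bar>C - level_re x\<bar>" by (metis abs_ge_self abs_mult)
    also have "\<dots> \<le> \<bar>tw p\<bar> * (2 * exp x)" using k by (intro mult_left_mono) auto
    finally have "2 * (tw p * (C - level_re x)) \<le> 4 * \<bar>tw p\<bar> * exp x" by linarith
    then have 2: "2 * (tw p * (C - level_re x)) / ?Q \<le> 4 * \<bar>tw p\<bar> * exp x / ?Q" using q by (intro divide_right_mono) auto
    have B: "0 \<le> B" using p by linarith
    from alt show ?thesis
    proof (elim disjE conjE)
      assume "tw p * (C - level_re x) \<le> 0"
      then have "2 * (tw p * (C - level_re x)) / ?Q \<le> 0" using q by (intro divide_nonpos_pos) auto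
      moreover have "0 \<le> 16 * exp (- R) / \<mu>\<^sup>2 * \<bar>tw p\<bar>" by simp
      ultimately show ?thesis using 1 by linarith
    next
      \<comment> \<open>The bound on \<open>\<bar>p\<bar>\<close> keeps the pole
        \<open>1 + 1 / p\<close> within a fixed distance, so that far out the factor has modulus at
        least \<open>\<mu> * exp R / 2\<close>.\<close>
      assume x: "x = R" and m: "\<mu> \<le> \<bar>p\<bar>" and R: "2 * (1 + B) / \<mu> \<le> exp R"
      have "1 + B \<le> \<mu> * exp R / 2" using R \<mu> by (simp add: field_simps)
      moreover have "\<mu> * exp R \<le> \<bar>p\<bar> * exp R" using m by (intro mult_right_mono) auto
      ultimately have "\<mu> * exp R / 2 \<le> \<bar>p\<bar> * exp R - \<bar>1 + p\<bar>" using p by linarith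
      then have "(\<mu> * exp R / 2)\<^sup>2 \<le> (\<bar>p\<bar> * exp R - \<bar>1 + p\<bar>)\<^sup>2" using \<mu> by (intro power_mono) auto
      then have Qb: "(\<mu> * exp R / 2)\<^sup>2 \<le> ?Q" using node_sq_ge[OF C, of p] x by simp
      then have "4 * \<bar>tw p\<bar> * exp x / ?Q \<le> 4 * \<bar>tw p\<bar> * exp x / (\<mu> * exp R / 2)\<^sup>2"
        using \<mu> q by (intro divide_left_mono mult_pos_pos) auto
      also have "\<dots> = 16 * exp (- R) / \<mu>\<^sup>2 * \<bar>tw p\<bar>"
        unfolding x using \<mu> by (simp add: exp_minus field_simps power2_eq_square)
      finally show ?thesis using 1 2 by linarith
    next
      \<comment> \<open>The bound on \<open>\<bar>1 + p\<bar>\<close> keeps the pole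
        \<open>(1 + p) / p\<close> away from 0, so that near 0 the factor has modulus at least
        \<open>\<mu> / 2\<close>.\<close>
      assume x: "x = - R" and m: "\<mu> \<le> \<bar>1 + p\<bar>" and R: "2 * B / \<mu> \<le> exp R"
      have "\<bar>p\<bar> * exp (- R) \<le> B * exp (- R)" using p by (intro mult_right_mono) auto
      also have "\<dots> \<le> \<mu> / 2" using R \<mu> by (simp add: exp_minus field_simps)
      finally have "\<mu> / 2 \<le> \<bar>1 + p\<bar> - \<bar>p\<bar> * exp (- R)" using m by linarith
      then have "(\<mu> / 2)\<^sup>2 \<le> (\<bar>1 + p\<bar> - \<bar>p\<bar> * exp (- R))\<^sup>2" using \<mu> by (intro power_mono) auto
      also have "\<dots> = (\<bar>p\<bar> * exp (- R) - \<bar>1 + p\<bar>)\<^sup>2" by (rule power2_commute)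
      finally have Qb: "(\<mu> / 2)\<^sup>2 \<le> ?Q" using node_sq_ge[OF C, of p] x by simp
      then have "4 * \<bar>tw p\<bar> * exp x / ?Q \<le> 4 * \<bar>tw p\<bar> * exp x / (\<mu> / 2)\<^sup>2"
        using \<mu> q by (intro divide_left_mono mult_pos_pos) auto
      also have "\<dots> = 16 * exp (- R) / \<mu>\<^sup>2 * \<bar>tw p\<bar>"
        unfolding x using \<mu> by (simp add: field_simps power2_eq_square)
      finally show ?thesis using 1 2 by linarith
    qed
  qed
  moreover have "16 * exp (- R) / \<mu>\<^sup>2 * \<bar>tw p\<bar> = 2 * (8 * exp (- R) / \<mu>\<^sup>2 * \<bar>tw p\<bar>)" by simp
  moreover have "level_lam x * tw p = tw p * level_lam x" by simp
  ultimately show ?thesis using gain unfolding level_gain_def by linarith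
qed

text \<open>In this sector \<open>Re (d ^ 4)\<close> is negative; it contains the directions of the hyperbola (near
  45 degrees) and of the level curve (30 degrees at its start).\<close>

lemma sector_power4:
  assumes d: "\<bar>Re d\<bar> = X" "X / 2 \<le> \<bar>Im d\<bar>" "\<bar>Im d\<bar> \<le> X"
  shows "Re (d ^ 4) \<le> - (norm d ^ 4 / 16)"
proof -
  define a where "a = (Re d)\<^sup>2"
  define b where "b = (Im d)\<^sup>2"
  have X: "0 \<le> X" using d by linarith
  have a: "a = X\<^sup>2" unfolding a_def using d by (metis power2_abs)
  have b: "a / 4 \<le> b" "b \<le> a"
  proof -
    have "(X / 2)\<^sup>2 \<le> \<bar>Im d\<bar>\<^sup>2" using d X by (intro power_mono) auto
    then show "a / 4 \<le> b" unfolding a b_def by (simp add: power2_eq_square)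
    have "\<bar>Im d\<bar>\<^sup>2 \<le> X\<^sup>2" using d by (intro power_mono) auto
    then show "b \<le> a" unfolding a b_def by simp
  qed
  have "Re (d ^ 4) = a\<^sup>2 - 6 * a * b + b\<^sup>2" unfolding a_def b_def
    by (simp add: power4_eq_xxxx power2_eq_square algebra_simps)
  moreover have "norm d ^ 4 = (a + b)\<^sup>2"
  proof -
    have "norm d ^ 4 = ((norm d)\<^sup>2)\<^sup>2" by simp
    then show ?thesis unfolding cmod_power2 a_def b_def .
  qed
  \<comment> \<open>A quadratic form on the cone \<open>a / 4 \<le> b \<le> a\<close>. Two products
    that are nonnegative there give constraints which are linear in \<open>a\<^sup>2\<close>,
    \<open>a b\<close> and \<open>b\<^sup>2\<close>, and these suffice.\<close>
  moreover have "a\<^sup>2 - 6 * a * b + b\<^sup>2 \<le> - ((a + b)\<^sup>2 / 16)"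
  proof -
    have "0 \<le> (b - a / 4) * (a - b)" using b by simp
    also have "\<dots> = 5/4 * (a * b) - 1/4 * (a * a) - b * b" by (simp add: field_simps)
    finally have f1: "b * b \<le> 5/4 * (a * b) - 1/4 * (a * a)" by linarith
    have "0 \<le> a * (b - a / 4)" using b a by simp
    also have "\<dots> = a * b - 1/4 * (a * a)" by (simp add: field_simps)
    finally have f2: "1/4 * (a * a) \<le> a * b" by linarith
    have e: "a\<^sup>2 - 6 * a * b + b\<^sup>2 = a * a - 6 * (a * b) + b * b" "(a + b)\<^sup>2 = a * a + 2 * (a * b) + b * b"
      by (simp_all add: power2_eq_square algebra_simps)
    have lin: "x - 6 * y + z \<le> - ((x + 2 * y + z) / 16)" if "z \<le> 5/4 * y - 1/4 * x" "1/4 * x \<le> y" "0 \<le> x" for x y z :: real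
    proof -
      have "4 * z \<le> 5 * y - x" "x \<le> 4 * y" using that by (simp_all add: field_simps)
      then have "16 * x - 96 * y + 16 * z \<le> - (x + 2 * y + z)" using that(3) by linarith
      then show ?thesis by (simp add: field_simps)
    qed
    show ?thesis unfolding e by (rule lin[OF f1 f2]) simp
  qed
  ultimately show ?thesis by simp
qed

lemma one_minus_cos_le: "1 - cos \<theta> \<le> \<theta>\<^sup>2 / 2" for \<theta> :: real
proof -
  have "1 - cos \<theta> = 2 * (sin (\<theta> / 2))\<^sup>2" using cos_double_sin[of "\<theta> / 2"] by simp
  moreover have "(sin (\<theta> / 2))\<^sup>2 \<le> (\<theta> / 2)\<^sup>2" using abs_sin_x_le_abs_x[of "\<theta> / 2"] by (simp only: abs_le_square_iff)
  ultimately show ?thesis by (simp add: power2_eq_square)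
qed

text \<open>The crude bound \<open>sin x \<ge> x / 4\<close> on \<open>[0, pi / 2]\<close>, used at
  half the angle, gives \<open>2 (\<theta> / 8)\<^sup>2\<close>.\<close>

lemma one_minus_cos_ge:
  assumes "\<bar>\<theta>\<bar> \<le> pi" shows "\<theta>\<^sup>2 / 32 \<le> 1 - cos \<theta>"
proof -
  have half: "x / 2 \<le> sin x" if "0 \<le> x" "x \<le> 1" for x :: real
  proof -
    have "(\<lambda>x. sin x - x / 2) 0 \<le> (\<lambda>x. sin x - x / 2) x"
    proof (rule DERIV_nonneg_imp_nondecreasing[OF that(1)])
      fix y :: real assume y: "0 \<le> y" "y \<le> x"
      have "y\<^sup>2 \<le> 1\<^sup>2" using y that by (intro power_mono) auto
      then have "1/2 \<le> cos y" using one_minus_cos_le[of y] by simp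
      then show "\<exists>D. ((\<lambda>x. sin x - x / 2) has_real_derivative D) (at y) \<and> 0 \<le> D"
        by (intro exI[of _ "cos y - 1/2"]) (auto intro!: derivative_eq_intros)
    qed
    then show ?thesis by simp
  qed
  have q: "x / 4 \<le> sin x" if "0 \<le> x" "x \<le> pi / 2" for x :: real
  proof (cases "x \<le> 1")
    case True then show ?thesis using half[OF that(1) True] that by linarith
  next
    case False
    then have "sin 1 \<le> sin x" using that by (intro sin_monotone_2pi_le) (auto simp: pi_ge_zero intro: order_trans[of _ 0])
    then show ?thesis using half[of 1] that pi_less_4 by simp
  qed
  have "\<bar>\<theta>\<bar> / 8 \<le> sin (\<bar>\<theta>\<bar> / 2)" using q[of "\<bar>\<theta>\<bar> / 2"] assms by simp
  then have "(\<bar>\<theta>\<bar> / 8)\<^sup>2 \<le> (sin (\<bar>\<theta>\<bar> / 2))\<^sup>2" by (intro power_mono) auto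
  moreover have "1 - cos \<theta> = 2 * (sin (\<bar>\<theta>\<bar> / 2))\<^sup>2" using cos_double_sin[of "\<bar>\<theta>\<bar> / 2"] by simp
  ultimately show ?thesis by (simp add: power2_eq_square)
qed

lemma arc_node_sq_pos:
  assumes x0: "x \<noteq> 0" and C: "\<bar>C\<bar> \<le> exp x" and \<mu>: "0 < \<mu>" and p: "\<bar>p\<bar> \<le> B"
    and alt: "tw p * (C - level_re x) \<le> 0 \<or> x = R \<and> \<mu> \<le> \<bar>p\<bar> \<and> 2 * (1 + B) / \<mu> \<le> exp R
        \<or> x = - R \<and> \<mu> \<le> \<bar>1 + p\<bar> \<and> 2 * B / \<mu> \<le> exp R"
  shows "0 < node_sq p (exp x) C"
  using alt
proof (elim disjE conjE)
  assume "tw p * (C - level_re x) \<le> 0"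
  moreover have "node_sq p (exp x) C = node_sq p (exp x) (level_re x) - 2 * (tw p * (C - level_re x))"
    unfolding node_sq_def by (simp add: algebra_simps)
  ultimately show ?thesis using level_node_sq_pos[OF x0, of p] by linarith
next
  assume x: "x = R" and m: "\<mu> \<le> \<bar>p\<bar>" and R: "2 * (1 + B) / \<mu> \<le> exp R"
  have "1 + B \<le> \<mu> * exp R / 2" using R \<mu> by (simp add: field_simps)
  moreover have "\<mu> * exp R \<le> \<bar>p\<bar> * exp R" using m by (intro mult_right_mono) auto
  moreover have "0 < \<mu> * exp R" using \<mu> by simp
  ultimately have "0 < \<bar>p\<bar> * exp R - \<bar>1 + p\<bar>" using p by linarith
  then have "0 < (\<bar>p\<bar> * exp R - \<bar>1 + p\<bar>)\<^sup>2" by simp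
  then show ?thesis using node_sq_ge[OF C, of p] unfolding x by linarith
next
  assume x: "x = - R" and m: "\<mu> \<le> \<bar>1 + p\<bar>" and R: "2 * B / \<mu> \<le> exp R"
  have "\<bar>p\<bar> * exp (- R) \<le> B * exp (- R)" using p by (intro mult_right_mono) auto
  also have "\<dots> \<le> \<mu> / 2" using R \<mu> by (simp add: exp_minus field_simps)
  finally have "\<bar>p\<bar> * exp (- R) - \<bar>1 + p\<bar> < 0" using m \<mu> by linarith
  then have "0 < (\<bar>p\<bar> * exp (- R) - \<bar>1 + p\<bar>)\<^sup>2" by simp
  then show ?thesis using node_sq_ge[OF C, of p] unfolding x by linarith
qed

section \<open>Node arrays at a quartic critical point\<close>

text \<open>Arrays of nodes whose power sums have the sizes that a quartic critical point at \<open>u = 1\<close> forces;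
  \<open>\<epsilon>\<close> is the scale of the critical window and \<open>\<tau>\<close> the sign of the critical point.\<close>

locale node_array =
  fixes I :: "nat \<Rightarrow> 'i set" and P :: "nat \<Rightarrow> 'i \<Rightarrow> real" and \<epsilon> :: "nat \<Rightarrow> real" and B D \<mu> \<tau> :: real
  assumes fin: "\<And>N. finite (I N)" and B0: "0 < B" and Pb: "\<And>N i. i \<in> I N \<Longrightarrow> \<bar>P N i\<bar> \<le> B"
    and \<epsilon>: "filterlim \<epsilon> (at_right 0) sequentially"
    and S2: "(\<lambda>N. \<epsilon> N * (\<Sum>i\<in>I N. tw (P N i))) \<longlonglongrightarrow> 0"
    and S3: "(\<lambda>N. \<epsilon> N * (\<Sum>i\<in>I N. P N i * tw (P N i))) \<longlonglongrightarrow> 0"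
    and S4: "(\<lambda>N. \<epsilon> N ^ 4 * (\<Sum>i\<in>I N. (tw (P N i))\<^sup>2)) \<longlonglongrightarrow> 1"
    and D0: "0 < D" and card: "\<forall>\<^sub>F N in sequentially. \<epsilon> N ^ 4 * real (card (I N)) \<le> D"
    and \<mu>: "0 < \<mu>" and \<tau>: "\<tau> = 1 \<or> \<tau> = -1"
    and sides: "\<And>N i. i \<in> I N \<Longrightarrow> 0 \<le> \<tau> * tw (P N i) \<and> \<mu> \<le> \<bar>1 + P N i\<bar> \<or> \<tau> * tw (P N i) \<le> 0 \<and> \<mu> \<le> \<bar>P N i\<bar>"
begin

abbreviation H :: "(nat \<Rightarrow> int) \<Rightarrow> nat \<Rightarrow> complex \<Rightarrow> complex" where
  "H A N \<equiv> node_prod (A N) (I N) (P N)"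

text \<open>\<open>A N\<close> plus the sum of the nodes is the logarithmic derivative of
  \<open>H A N\<close> at \<open>u = 1\<close>. It has size \<open>1 / \<epsilon>\<close> in the
  critical window and becomes the linear term of the Pearcey exponent.\<close>

definition drift :: "(nat \<Rightarrow> int) \<Rightarrow> real \<Rightarrow> bool" where
  "drift A \<xi> \<longleftrightarrow> (\<lambda>N. \<epsilon> N * (of_int (A N) + (\<Sum>i\<in>I N. P N i))) \<longlonglongrightarrow> - \<xi>"

lemma \<epsilon>_pos: "\<forall>\<^sub>F N in sequentially. 0 < \<epsilon> N"
  using \<epsilon> unfolding filterlim_at_right_to_0 filterlim_at by (simp add: eventually_conj_iff)

lemma \<epsilon>_lim: "\<epsilon> \<longlonglongrightarrow> 0"
  using \<epsilon> unfolding filterlim_at by auto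

lemma \<epsilon>_less: "0 < e \<Longrightarrow> \<forall>\<^sub>F N in sequentially. \<epsilon> N < e"
  using order_tendstoD(2)[OF \<epsilon>_lim] .

text \<open>The limits of the locale in the form of bounds at a fixed \<open>N\<close>, with
  constants that do not depend on \<open>N\<close>. The scaled fourth order sum, whose limit is 1,
  is kept between 1/2 and 2.\<close>

definition good :: "(nat \<Rightarrow> int) \<Rightarrow> real \<Rightarrow> nat \<Rightarrow> bool" where
  "good A M N \<longleftrightarrow> 0 < \<epsilon> N \<and>
     \<epsilon> N * (\<bar>of_int (A N) + (\<Sum>i\<in>I N. P N i)\<bar> + \<bar>\<Sum>i\<in>I N. tw (P N i)\<bar> + \<bar>\<Sum>i\<in>I N. P N i * tw (P N i)\<bar>) \<le> M \<and>
     1/2 \<le> \<epsilon> N ^ 4 * (\<Sum>i\<in>I N. (tw (P N i))\<^sup>2) \<and> \<epsilon> N ^ 4 * (\<Sum>i\<in>I N. (tw (P N i))\<^sup>2) \<le> 2 \<and>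
     \<epsilon> N ^ 4 * (\<Sum>i\<in>I N. \<bar>tw (P N i)\<bar>) \<le> B * (1 + B) * D"

lemma eventually_good:
  assumes "drift A \<xi>" obtains M where "0 < M" "\<forall>\<^sub>F N in sequentially. good A M N"
proof -
  have "(\<lambda>N. \<bar>\<epsilon> N * (of_int (A N) + (\<Sum>i\<in>I N. P N i))\<bar> + \<bar>\<epsilon> N * (\<Sum>i\<in>I N. tw (P N i))\<bar> + \<bar>\<epsilon> N * (\<Sum>i\<in>I N. P N i * tw (P N i))\<bar>)
     \<longlonglongrightarrow> \<bar>- \<xi>\<bar> + \<bar>0\<bar> + \<bar>0\<bar>"
    using assms unfolding drift_def by (intro tendsto_intros S2 S3)
  then have 1: "\<forall>\<^sub>F N in sequentially. \<bar>\<epsilon> N * (of_int (A N) + (\<Sum>i\<in>I N. P N i))\<bar> + \<bar>\<epsilon> N * (\<Sum>i\<in>I N. tw (P N i))\<bar> + \<bar>\<epsilon> N * (\<Sum>i\<in>I N. P N i * tw (P N i))\<bar> < \<bar>\<xi>\<bar> + 1"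
    by (rule order_tendstoD) simp
  have 2: "\<forall>\<^sub>F N in sequentially. 1/2 < \<epsilon> N ^ 4 * (\<Sum>i\<in>I N. (tw (P N i))\<^sup>2)"
    by (rule order_tendstoD(1)[OF S4]) simp
  have 3: "\<forall>\<^sub>F N in sequentially. \<epsilon> N ^ 4 * (\<Sum>i\<in>I N. (tw (P N i))\<^sup>2) < 2"
    by (rule order_tendstoD(2)[OF S4]) simp
  have "\<forall>\<^sub>F N in sequentially. good A (\<bar>\<xi>\<bar> + 1) N"
    using \<epsilon>_pos 1 2 3 card
  proof eventually_elim
    case (elim N)
    have "(\<Sum>i\<in>I N. \<bar>tw (P N i)\<bar>) \<le> (\<Sum>i\<in>I N. B * (1 + B))"
      using abs_tw_le Pb by (intro sum_mono) blast
    then have "\<epsilon> N ^ 4 * (\<Sum>i\<in>I N. \<bar>tw (P N i)\<bar>) \<le> \<epsilon> N ^ 4 * (real (card (I N)) * (B * (1 + B)))"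
      by (intro mult_left_mono) auto
    also have "\<dots> = B * (1 + B) * (\<epsilon> N ^ 4 * real (card (I N)))" by simp
    also have "\<dots> \<le> B * (1 + B) * D" using elim B0 by (intro mult_left_mono) auto
    finally have 4: "\<epsilon> N ^ 4 * (\<Sum>i\<in>I N. \<bar>tw (P N i)\<bar>) \<le> B * (1 + B) * D" .
    have e: "\<bar>\<epsilon> N * x\<bar> = \<epsilon> N * \<bar>x\<bar>" for x using elim(1) by (simp add: abs_mult)
    have "\<epsilon> N * (\<bar>of_int (A N) + (\<Sum>i\<in>I N. P N i)\<bar> + \<bar>\<Sum>i\<in>I N. tw (P N i)\<bar> + \<bar>\<Sum>i\<in>I N. P N i * tw (P N i)\<bar>) \<le> \<bar>\<xi>\<bar> + 1"
      using elim(2)[unfolded e] unfolding distrib_left[of "\<epsilon> N"] by (rule less_imp_le)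
    then show ?case unfolding good_def using elim(1,3,4) 4 by (intro conjI) (assumption | rule less_imp_le)+
  qed
  then show ?thesis by (intro that[of "\<bar>\<xi>\<bar> + 1"]) auto
qed

text \<open>With \<open>d = \<epsilon> \<omega>\<close> the functions multiplying the sums of
  \<open>T\<close> and \<open>p T\<close> are at most of size \<open>\<epsilon>\<close>, while these
  sums are \<open>o(1 / \<epsilon>)\<close>. Only the drift and the quartic term survive.\<close>

lemma H_tendsto:
  assumes dr: "drift A \<xi>" and \<omega>: "\<omega> \<longlonglongrightarrow> w"
  shows "(\<lambda>N. H A N (1 + of_real (\<epsilon> N) * \<omega> N)) \<longlonglongrightarrow> exp (w ^ 4 / 4 - of_real \<xi> * w)"
proof -
  define d where "d N = of_real (\<epsilon> N) * \<omega> N" for N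
  define s where "s N = Ln (1 + d N)" for N
  define T1 T2 T3 T4 where "T1 N = of_int (A N) + (\<Sum>i\<in>I N. P N i)" and "T2 N = (\<Sum>i\<in>I N. tw (P N i))"
    and "T3 N = (\<Sum>i\<in>I N. P N i * tw (P N i))" and "T4 N = (\<Sum>i\<in>I N. (tw (P N i))\<^sup>2)" for N
  have l1: "(\<lambda>N. \<epsilon> N * T1 N) \<longlonglongrightarrow> - \<xi>" using dr unfolding drift_def T1_def .
  have l2: "(\<lambda>N. \<epsilon> N * T2 N) \<longlonglongrightarrow> 0" using S2 unfolding T2_def .
  have l3: "(\<lambda>N. \<epsilon> N * T3 N) \<longlonglongrightarrow> 0" using S3 unfolding T3_def .
  have l4: "(\<lambda>N. \<epsilon> N ^ 4 * T4 N) \<longlonglongrightarrow> 1" using S4 unfolding T4_def .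
  have "d \<longlonglongrightarrow> of_real 0 * w" unfolding d_def[abs_def] by (intro tendsto_intros \<epsilon>_lim \<omega>)
  then have d0: "d \<longlonglongrightarrow> 0" by simp
  then have "(\<lambda>N. norm (d N)) \<longlonglongrightarrow> 0" by (rule tendsto_norm_zero)
  then have dsm: "\<forall>\<^sub>F N in sequentially. norm (d N) < 1 / (2 * (1 + B))" by (rule order_tendstoD) (use B0 in auto)
  have Ln': "((\<lambda>z. (Ln (1 + z) - z) / z) \<longlongrightarrow> 0) (at 0)"
  proof -
    have "((\<lambda>z. Ln (1 + z)) has_field_derivative 1) (at 0)"
      by (auto intro!: derivative_eq_intros)
    then have "((\<lambda>z. Ln (1 + z) / z) \<longlongrightarrow> 1) (at (0::complex))"
      unfolding has_field_derivative_iff by simp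
    then have "((\<lambda>z. Ln (1 + z) / z - 1) \<longlongrightarrow> 1 - 1) (at (0::complex))" by (intro tendsto_intros)
    then have "((\<lambda>z. Ln (1 + z) / z - 1) \<longlongrightarrow> 0) (at (0::complex))" by simp
    then show ?thesis
      by (rule Lim_transform_eventually) (auto simp: eventually_at_filter diff_divide_distrib)
  qed
  \<comment> \<open>The value 0 at the origin is the continuous extension, so indices with
    \<open>d N = 0\<close> need no separate treatment.\<close>
  define q where "q z = (if z = 0 then 0 else (Ln (1 + z) - z) / z)" for z :: complex
  have "isCont q 0" unfolding isCont_def q_def
    using Ln' by (simp) (rule Lim_transform_eventually, assumption, auto simp: eventually_at_filter)
  then have ql: "(\<lambda>N. q (d N)) \<longlonglongrightarrow> 0" using isCont_tendsto_compose[OF _ d0] by (force simp: q_def)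
  have sd: "s N = d N * (1 + q (d N))" for N unfolding s_def q_def by (simp add: field_simps)
  have lim1: "(\<lambda>N. of_real (T1 N) * s N) \<longlonglongrightarrow> of_real (- \<xi>) * (w * (1 + 0))"
  proof -
    have "(\<lambda>N. of_real (\<epsilon> N * T1 N) * (\<omega> N * (1 + q (d N)))) \<longlonglongrightarrow> of_real (- \<xi>) * (w * (1 + 0))"
      by (intro tendsto_intros l1 \<omega> ql)
    then show ?thesis unfolding sd d_def by (simp add: mult_ac)
  qed
  have lim2: "(\<lambda>N. of_real (T2 N) * (d N - s N)) \<longlonglongrightarrow> of_real 0 * (w * - 0)"
  proof -
    have "(\<lambda>N. of_real (\<epsilon> N * T2 N) * (\<omega> N * - q (d N))) \<longlonglongrightarrow> of_real 0 * (w * - 0)"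
      by (intro tendsto_intros l2 \<omega> ql)
    moreover have "of_real (T2 N) * (d N - s N) = of_real (\<epsilon> N * T2 N) * (\<omega> N * - q (d N))" for N
      unfolding sd by (simp add: d_def algebra_simps)
    ultimately show ?thesis by simp
  qed
  have lim3: "(\<lambda>N. of_real (T3 N) * ((1 + d N) - 1 / (1 + d N) - 2 * s N)) \<longlonglongrightarrow> of_real 0 * (w * ((2 + 0) / (1 + 0) - 2 * (1 + 0)))"
  proof -
    have "(\<lambda>N. of_real (\<epsilon> N * T3 N) * (\<omega> N * ((2 + d N) / (1 + d N) - 2 * (1 + q (d N))))) \<longlonglongrightarrow> of_real 0 * (w * ((2 + 0) / (1 + 0) - 2 * (1 + 0)))"
      by (intro tendsto_intros l3 \<omega> ql d0) auto
    then show ?thesis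
    proof (rule Lim_transform_eventually)
      show "\<forall>\<^sub>F N in sequentially. of_real (\<epsilon> N * T3 N) * (\<omega> N * ((2 + d N) / (1 + d N) - 2 * (1 + q (d N))))
          = of_real (T3 N) * ((1 + d N) - 1 / (1 + d N) - 2 * s N)"
        using dsm
      proof eventually_elim
        case (elim N)
        have "1 / (2 * (1 + B)) \<le> 1" using B0 by simp
        then have "1 + d N \<noteq> 0" using elim one_plus_nonpos_Reals[of "d N"] by (metis less_le_trans nonpos_Reals_zero_I)
        then have e: "(1 + d N) - 1 / (1 + d N) = d N * ((2 + d N) / (1 + d N))" by (simp add: field_simps)
        show ?case unfolding e sd by (simp add: d_def algebra_simps)
      qed
    qed
  qed
  have lim4: "(\<lambda>N. of_real (T4 N) * d N ^ 4 / 4) \<longlonglongrightarrow> of_real 1 * w ^ 4 / 4"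
  proof -
    have "(\<lambda>N. of_real (\<epsilon> N ^ 4 * T4 N) * \<omega> N ^ 4 / 4) \<longlonglongrightarrow> of_real 1 * w ^ 4 / 4"
      by (intro tendsto_intros l4 \<omega>) auto
    then show ?thesis unfolding d_def by (simp add: power_mult_distrib mult_ac)
  qed
  \<comment> \<open>Selects the error term of the local expansion for each \<open>N\<close>. The
    default 0 concerns only indices at which no such expansion exists, hence finitely many, since
    \<open>d\<close> tends to 0.\<close>
  define E where "E N = (if \<exists>e. H A N (1 + d N) = exp (of_real (T1 N) * s N + of_real (T2 N) * (d N - s N)
     + of_real (T3 N) * ((1 + d N) - 1 / (1 + d N) - 2 * s N) + of_real (T4 N) * d N ^ 4 / 4 + e) \<and>
       norm e \<le> 24 * (1 + B) * T4 N * norm (d N) ^ 5 then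
     (SOME e. H A N (1 + d N) = exp (of_real (T1 N) * s N + of_real (T2 N) * (d N - s N)
     + of_real (T3 N) * ((1 + d N) - 1 / (1 + d N) - 2 * s N) + of_real (T4 N) * d N ^ 4 / 4 + e) \<and>
       norm e \<le> 24 * (1 + B) * T4 N * norm (d N) ^ 5) else 0)" for N
  have Ep: "\<forall>\<^sub>F N in sequentially. H A N (1 + d N) = exp (of_real (T1 N) * s N + of_real (T2 N) * (d N - s N)
     + of_real (T3 N) * ((1 + d N) - 1 / (1 + d N) - 2 * s N) + of_real (T4 N) * d N ^ 4 / 4 + E N) \<and>
       norm (E N) \<le> 24 * (1 + B) * T4 N * norm (d N) ^ 5"
    using dsm
  proof eventually_elim
    case (elim N)
    have le: "norm (d N) * (1 + B) \<le> 1 / 2" using elim B0 by (simp add: field_simps)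
    have "\<exists>e. H A N (1 + d N) = exp (of_real (T1 N) * s N + of_real (T2 N) * (d N - s N)
     + of_real (T3 N) * ((1 + d N) - 1 / (1 + d N) - 2 * s N) + of_real (T4 N) * d N ^ 4 / 4 + e) \<and>
       norm e \<le> 24 * (1 + B) * T4 N * norm (d N) ^ 5" (is "\<exists>e. ?Q e")
    proof (rule node_prod_local[where I = "I N" and P = "P N" and A = "A N" and B = B and d = "d N", OF fin _ less_imp_le[OF B0] le])
      fix e
      assume "H A N (1 + d N) = exp (of_real (of_int (A N) + (\<Sum>i\<in>I N. P N i)) * Ln (1 + d N)
         + of_real (\<Sum>i\<in>I N. tw (P N i)) * (d N - Ln (1 + d N))
         + of_real (\<Sum>i\<in>I N. P N i * tw (P N i)) * ((1 + d N) - 1 / (1 + d N) - 2 * Ln (1 + d N))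
         + of_real (\<Sum>i\<in>I N. (tw (P N i))\<^sup>2) * d N ^ 4 / 4 + e)"
        "norm e \<le> 24 * (1 + B) * (\<Sum>i\<in>I N. (tw (P N i))\<^sup>2) * norm (d N) ^ 5"
      then show ?thesis unfolding s_def T1_def T2_def T3_def T4_def by (intro exI[of _ e] conjI)
    qed (rule Pb)
    from someI_ex[OF this] this show ?case unfolding E_def by simp
  qed
  have Elim: "E \<longlonglongrightarrow> 0"
  proof (rule Lim_null_comparison)
    show "\<forall>\<^sub>F N in sequentially. norm (E N) \<le> 24 * (1 + B) * (\<epsilon> N ^ 4 * T4 N) * norm (\<omega> N) ^ 4 * norm (d N)"
      using Ep \<epsilon>_pos
    proof eventually_elim
      case (elim N)
      then have "norm (E N) \<le> 24 * (1 + B) * T4 N * norm (d N) ^ 4 * norm (d N)" by (simp add: eval_nat_numeral mult_ac)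
      also have "norm (d N) ^ 4 = \<epsilon> N ^ 4 * norm (\<omega> N) ^ 4" unfolding d_def using elim by (simp add: norm_mult power_mult_distrib)
      finally show ?case by (simp add: mult_ac)
    qed
    have "(\<lambda>N. 24 * (1 + B) * (\<epsilon> N ^ 4 * T4 N) * norm (\<omega> N) ^ 4 * norm (d N)) \<longlonglongrightarrow> 24 * (1 + B) * 1 * norm w ^ 4 * norm (0::complex)"
      by (intro tendsto_intros l4 \<omega> d0)
    then show "(\<lambda>N. 24 * (1 + B) * (\<epsilon> N ^ 4 * T4 N) * norm (\<omega> N) ^ 4 * norm (d N)) \<longlonglongrightarrow> 0" by simp
  qed
  have "(\<lambda>N. exp (of_real (T1 N) * s N + of_real (T2 N) * (d N - s N)
     + of_real (T3 N) * ((1 + d N) - 1 / (1 + d N) - 2 * s N) + of_real (T4 N) * d N ^ 4 / 4 + E N))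
    \<longlonglongrightarrow> exp (of_real (- \<xi>) * (w * (1 + 0)) + of_real 0 * (w * - 0) + of_real 0 * (w * ((2 + 0) / (1 + 0) - 2 * (1 + 0))) + of_real 1 * w ^ 4 / 4 + 0)"
    by (intro tendsto_intros lim1 lim2 lim3 lim4 Elim)
  then have "(\<lambda>N. exp (of_real (T1 N) * s N + of_real (T2 N) * (d N - s N)
     + of_real (T3 N) * ((1 + d N) - 1 / (1 + d N) - 2 * s N) + of_real (T4 N) * d N ^ 4 / 4 + E N))
    \<longlonglongrightarrow> exp (w ^ 4 / 4 - of_real \<xi> * w)" by (simp add: algebra_simps)
  then show ?thesis unfolding d_def[symmetric]
    by (rule Lim_transform_eventually) (use Ep in \<open>auto elim: eventually_mono\<close>)
qed

text \<open>With \<open>m = 1 - cos (\<epsilon> v)\<close>, the bound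
  \<open>m \<le> \<epsilon> \<bar>v\<bar>\<close> absorbs the sum of \<open>T\<close>, which is at
  most \<open>M / \<epsilon>\<close>, and \<open>m \<ge> (\<epsilon> v)\<^sup>2 / 32\<close> makes
  the quadratic gain quartic in \<open>v\<close>. The constant 2048 is twice the square of
  32.\<close>

lemma circle_bound:
  assumes g: "good A M N" and v: "\<bar>\<epsilon> N * v\<bar> \<le> pi"
  shows "norm (1 / H A N (cis (\<epsilon> N * v))) \<le> exp (M * \<bar>v\<bar> - v ^ 4 / (2048 * (1 + 4 * (B * (1 + B)))))"
proof -
  define m where "m = 1 - cos (\<epsilon> N * v)"
  define Z where "Z = 1 + 4 * (B * (1 + B))"
  have \<epsilon>0: "0 < \<epsilon> N" using g unfolding good_def by auto
  have "0 \<le> B * (1 + B)" using B0 by simp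
  then have Z: "0 < Z" unfolding Z_def by linarith
  have m0: "0 \<le> m" unfolding m_def by simp
  have "m \<le> \<bar>\<epsilon> N * v\<bar>"
  proof (cases "\<bar>\<epsilon> N * v\<bar> \<le> 2")
    case True
    have "m \<le> (\<epsilon> N * v)\<^sup>2 / 2" unfolding m_def by (rule one_minus_cos_le)
    also have "(\<epsilon> N * v)\<^sup>2 = \<bar>\<epsilon> N * v\<bar> * \<bar>\<epsilon> N * v\<bar>" by (simp add: power2_eq_square)
    also have "\<dots> \<le> \<bar>\<epsilon> N * v\<bar> * 2" using True by (intro mult_left_mono) auto
    finally show ?thesis by simp
  next
    case False
    have "m \<le> 2" unfolding m_def using cos_ge_minus_one[of "\<epsilon> N * v"] by linarith
    then show ?thesis using False by linarith
  qed
  then have m1: "m \<le> \<epsilon> N * \<bar>v\<bar>" using \<epsilon>0 by (simp add: abs_mult)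
  have "(\<epsilon> N * v)\<^sup>2 / 32 \<le> m" unfolding m_def by (rule one_minus_cos_ge[OF v])
  then have "((\<epsilon> N * v)\<^sup>2 / 32)\<^sup>2 \<le> m\<^sup>2" by (intro power_mono) auto
  then have m2: "\<epsilon> N ^ 4 * v ^ 4 / 1024 \<le> m\<^sup>2" by (simp add: power_divide power_mult_distrib)
  have "m * (\<Sum>i\<in>I N. tw (P N i)) \<le> m * \<bar>\<Sum>i\<in>I N. tw (P N i)\<bar>" using m0 by (intro mult_left_mono) auto
  also have "\<dots> \<le> \<epsilon> N * \<bar>v\<bar> * \<bar>\<Sum>i\<in>I N. tw (P N i)\<bar>" using m1 by (intro mult_right_mono) auto
  also have "\<dots> = \<bar>v\<bar> * (\<epsilon> N * \<bar>\<Sum>i\<in>I N. tw (P N i)\<bar>)" by simp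
  also have "\<dots> \<le> \<bar>v\<bar> * M"
  proof (rule mult_left_mono)
    have "\<epsilon> N * \<bar>\<Sum>i\<in>I N. tw (P N i)\<bar> \<le> \<epsilon> N * (\<bar>of_int (A N) + (\<Sum>i\<in>I N. P N i)\<bar> + \<bar>\<Sum>i\<in>I N. tw (P N i)\<bar> + \<bar>\<Sum>i\<in>I N. P N i * tw (P N i)\<bar>)"
      using \<epsilon>0 by (intro mult_left_mono) auto
    then show "\<epsilon> N * \<bar>\<Sum>i\<in>I N. tw (P N i)\<bar> \<le> M" using g unfolding good_def by linarith
  qed simp
  finally have a1: "m * (\<Sum>i\<in>I N. tw (P N i)) \<le> M * \<bar>v\<bar>" by (simp add: mult.commute)
  have "v ^ 4 / (2048 * Z) = (1/2) * (v ^ 4 / 1024 / Z)" by simp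
  also have "\<dots> \<le> (\<epsilon> N ^ 4 * (\<Sum>i\<in>I N. (tw (P N i))\<^sup>2)) * (v ^ 4 / 1024 / Z)"
    using g Z unfolding good_def by (intro mult_right_mono) auto
  also have "\<dots> = (\<epsilon> N ^ 4 * v ^ 4 / 1024) / Z * (\<Sum>i\<in>I N. (tw (P N i))\<^sup>2)" by (simp add: mult_ac)
  also have "\<dots> \<le> m\<^sup>2 / Z * (\<Sum>i\<in>I N. (tw (P N i))\<^sup>2)"
    using m2 Z by (intro mult_right_mono divide_right_mono sum_nonneg) auto
  finally have a2: "v ^ 4 / (2048 * Z) \<le> m\<^sup>2 / Z * (\<Sum>i\<in>I N. (tw (P N i))\<^sup>2)" .
  have "norm (1 / H A N (cis (\<epsilon> N * v))) \<le> exp (m * (\<Sum>i\<in>I N. tw (P N i)) - m\<^sup>2 / Z * (\<Sum>i\<in>I N. (tw (P N i))\<^sup>2))"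
    using node_prod_circle_bound[of "I N" "P N" B "cis (\<epsilon> N * v)" "A N"] Pb B0 unfolding m_def Z_def by simp
  also have "\<dots> \<le> exp (M * \<bar>v\<bar> - v ^ 4 / (2048 * Z))" using a1 a2 by simp
  finally show ?thesis unfolding Z_def .
qed

lemma local_bound:
  assumes g: "good A M N" and d: "norm d * (1 + B) < 1 / 2"
  shows "norm (H A N (1 + d)) \<le> exp (9 * M * (norm d / \<epsilon> N)
     + (\<epsilon> N ^ 4 * (\<Sum>i\<in>I N. (tw (P N i))\<^sup>2)) * ((Re (d ^ 4) / 4 + 24 * (1 + B) * norm d ^ 5) / \<epsilon> N ^ 4))"
proof -
  have \<epsilon>0: "0 < \<epsilon> N" using g unfolding good_def by auto
  let ?S = "\<bar>of_int (A N) + (\<Sum>i\<in>I N. P N i)\<bar> + \<bar>\<Sum>i\<in>I N. tw (P N i)\<bar> + \<bar>\<Sum>i\<in>I N. P N i * tw (P N i)\<bar>"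
  have "norm (H A N (1 + d)) \<le> exp (9 * ?S * norm d
     + (\<Sum>i\<in>I N. (tw (P N i))\<^sup>2) * (Re (d ^ 4) / 4 + 24 * (1 + B) * norm d ^ 5))"
    using Pb B0 by (intro node_prod_local_bound fin d) auto
  also have "9 * ?S * norm d = 9 * (\<epsilon> N * ?S) * (norm d / \<epsilon> N)" using \<epsilon>0 by simp
  also have "exp (9 * (\<epsilon> N * ?S) * (norm d / \<epsilon> N) + (\<Sum>i\<in>I N. (tw (P N i))\<^sup>2) * (Re (d ^ 4) / 4 + 24 * (1 + B) * norm d ^ 5))
    \<le> exp (9 * M * (norm d / \<epsilon> N) + (\<Sum>i\<in>I N. (tw (P N i))\<^sup>2) * (Re (d ^ 4) / 4 + 24 * (1 + B) * norm d ^ 5))"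
    using g \<epsilon>0 unfolding good_def exp_le_cancel_iff by (intro add_right_mono mult_right_mono mult_left_mono) auto
  also have "(\<Sum>i\<in>I N. (tw (P N i))\<^sup>2) * (Re (d ^ 4) / 4 + 24 * (1 + B) * norm d ^ 5)
    = (\<epsilon> N ^ 4 * (\<Sum>i\<in>I N. (tw (P N i))\<^sup>2)) * ((Re (d ^ 4) / 4 + 24 * (1 + B) * norm d ^ 5) / \<epsilon> N ^ 4)"
    using \<epsilon>0 by simp
  finally show ?thesis .
qed

text \<open>On the hyperbola the real part of the fourth power is
  \<open>1 - 4 v\<^sup>2 (1 + v\<^sup>2)\<close>. The radius \<open>1 / (768 (1 + B))\<close> makes
  the fifth order error at most \<open>\<bar>d\<bar>\<^sup>4 / 16\<close>, which the quartic term
  absorbs.\<close>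

lemma hyperbola_bound:
  assumes g: "good A M N" and e: "e = 1 \<or> e = -1" and v: "\<epsilon> N * sqrt (1 + v\<^sup>2) \<le> 1 / (768 * (1 + B))"
  shows "norm (H A N (1 + of_real (e * \<epsilon> N) * pearcey_zeta v)) \<le> exp (9 * M * (1 + 2 * \<bar>v\<bar>) + 5/8 - 3/8 * v ^ 4)"
proof -
  define d where "d = of_real (e * \<epsilon> N) * pearcey_zeta v"
  define Sg where "Sg = \<epsilon> N ^ 4 * (\<Sum>i\<in>I N. (tw (P N i))\<^sup>2)"
  have \<epsilon>0: "0 < \<epsilon> N" and Sg: "1/2 \<le> Sg" "Sg \<le> 2" using g unfolding good_def Sg_def by auto
  have sq: "(sqrt (1 + v\<^sup>2))\<^sup>2 = 1 + v\<^sup>2" by (simp add: add_nonneg_nonneg)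
  have nz: "(norm (pearcey_zeta v))\<^sup>2 = 1 + 2 * v\<^sup>2" unfolding cmod_power2 pearcey_zeta_def using sq by simp
  have nd: "norm d = \<epsilon> N * norm (pearcey_zeta v)" unfolding d_def using e \<epsilon>0 by (auto simp: norm_mult)
  have "norm (pearcey_zeta v) \<le> 2 * sqrt (1 + v\<^sup>2)"
    by (rule power2_le_imp_le) (simp_all add: nz power_mult_distrib sq)
  then have "norm d \<le> 2 * (\<epsilon> N * sqrt (1 + v\<^sup>2))" unfolding nd using \<epsilon>0 by simp
  also have "\<dots> \<le> 2 * (1 / (768 * (1 + B)))" using v by simp
  finally have nd': "norm d * (1 + B) \<le> 1 / 384" using B0 by (simp add: field_simps)
  have "v\<^sup>2 = \<bar>v\<bar> * \<bar>v\<bar>" by (simp add: power2_eq_square)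
  then have "(norm (pearcey_zeta v))\<^sup>2 \<le> (1 + 2 * \<bar>v\<bar>)\<^sup>2"
    unfolding nz power2_eq_square[of "1 + 2 * \<bar>v\<bar>"] by (simp add: algebra_simps del: abs_mult_self_eq)
  then have n1: "norm d / \<epsilon> N \<le> 1 + 2 * \<bar>v\<bar>" unfolding nd using \<epsilon>0 by (simp add: power2_le_iff_abs_le)
  have z2: "(pearcey_zeta v)\<^sup>2 = Complex 1 (2 * v * sqrt (1 + v\<^sup>2))"
    unfolding pearcey_zeta_def power2_eq_square using sq by (simp add: complex_eq_iff power2_eq_square)
  have "pearcey_zeta v ^ 4 = ((pearcey_zeta v)\<^sup>2)\<^sup>2" by simp
  then have "Re (pearcey_zeta v ^ 4) = 1 - (2 * v * sqrt (1 + v\<^sup>2))\<^sup>2" unfolding z2 by (simp add: power2_eq_square)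
  then have z4: "Re (pearcey_zeta v ^ 4) = 1 - 4 * v\<^sup>2 * (1 + v\<^sup>2)" by (simp add: power_mult_distrib sq)
  have "d ^ 4 = of_real (\<epsilon> N ^ 4) * pearcey_zeta v ^ 4" unfolding d_def using e by (auto simp: power_mult_distrib)
  then have rd: "Re (d ^ 4) = \<epsilon> N ^ 4 * (1 - 4 * v\<^sup>2 * (1 + v\<^sup>2))" by (simp only: times_complex.sel Re_complex_of_real Im_complex_of_real z4)
  have nz4: "norm d ^ 4 = \<epsilon> N ^ 4 * (1 + 2 * v\<^sup>2)\<^sup>2"
  proof -
    have "norm (pearcey_zeta v) ^ 4 = ((norm (pearcey_zeta v))\<^sup>2)\<^sup>2" by simp
    then show ?thesis unfolding nd power_mult_distrib nz by simp
  qed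
  have "24 * (1 + B) * norm d ^ 5 = 24 * (norm d * (1 + B)) * norm d ^ 4" by (simp add: eval_nat_numeral)
  also have "\<dots> \<le> 24 * (1 / 384) * norm d ^ 4" using nd' by (intro mult_right_mono mult_left_mono) auto
  finally have "(Re (d ^ 4) / 4 + 24 * (1 + B) * norm d ^ 5) / \<epsilon> N ^ 4
      \<le> (\<epsilon> N ^ 4 * (1 - 4 * v\<^sup>2 * (1 + v\<^sup>2)) / 4 + (1 / 16) * (\<epsilon> N ^ 4 * (1 + 2 * v\<^sup>2)\<^sup>2)) / \<epsilon> N ^ 4"
    unfolding rd nz4 using \<epsilon>0 by (intro divide_right_mono add_left_mono) auto
  also have "\<dots> = (1 - 4 * v\<^sup>2 * (1 + v\<^sup>2)) / 4 + (1 / 16) * (1 + 2 * v\<^sup>2)\<^sup>2"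
    using \<epsilon>0 by (simp add: add_divide_distrib)
  also have "\<dots> = 5/16 - 3/4 * v\<^sup>2 - 3/4 * v ^ 4" by (simp add: power2_eq_square power4_eq_xxxx field_simps)
  also have "\<dots> \<le> 5/16 - 3/4 * v ^ 4" by simp
  finally have k: "(Re (d ^ 4) / 4 + 24 * (1 + B) * norm d ^ 5) / \<epsilon> N ^ 4 \<le> 5/16 - 3/4 * v ^ 4" .
  have "Sg * ((Re (d ^ 4) / 4 + 24 * (1 + B) * norm d ^ 5) / \<epsilon> N ^ 4) \<le> Sg * (5/16 - 3/4 * v ^ 4)"
    using k Sg by (intro mult_left_mono) auto
  also have "\<dots> = Sg * (5/16) - Sg * (3/4 * v ^ 4)" by (simp add: right_diff_distrib)
  also have "\<dots> \<le> 2 * (5/16) - (1/2) * (3/4 * v ^ 4)" using Sg by (intro diff_mono mult_right_mono) auto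
  finally have 2: "Sg * ((Re (d ^ 4) / 4 + 24 * (1 + B) * norm d ^ 5) / \<epsilon> N ^ 4) \<le> 5/8 - 3/8 * v ^ 4" by simp
  have M: "0 \<le> M" using g unfolding good_def by (meson abs_ge_zero add_nonneg_nonneg less_imp_le mult_nonneg_nonneg order_trans)
  have "9 * M * (norm d / \<epsilon> N) \<le> 9 * M * (1 + 2 * \<bar>v\<bar>)" using n1 M by (intro mult_left_mono) auto
  moreover have "norm (H A N (1 + d)) \<le> exp (9 * M * (norm d / \<epsilon> N) + Sg * ((Re (d ^ 4) / 4 + 24 * (1 + B) * norm d ^ 5) / \<epsilon> N ^ 4))"
    unfolding Sg_def using nd' by (intro local_bound[OF g]) linarith
  ultimately show ?thesis unfolding d_def[symmetric] using 2 by (smt (verit) exp_le_cancel_iff)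
qed

lemma good_nonneg: "good A M N \<Longrightarrow> 0 \<le> M"
  unfolding good_def by (meson abs_ge_zero add_nonneg_nonneg less_imp_le mult_nonneg_nonneg order_trans)

text \<open>Within this radius the fifth order error is at most
  \<open>\<bar>d\<bar>\<^sup>4 / 128\<close>, half of the gain
  \<open>\<bar>d\<bar>\<^sup>4 / 64\<close> that the sector provides. The fourth order sum, at least
  \<open>1 / (2 \<epsilon>\<^sup>4)\<close>, halves the rest and leaves 256.\<close>

lemma sector_bound:
  assumes g: "good A M N" and d: "\<bar>Re d\<bar> = X" "X / 2 \<le> \<bar>Im d\<bar>" "\<bar>Im d\<bar> \<le> X"
    and \<rho>: "0 \<le> \<rho>" "\<rho> \<le> norm d" "norm d \<le> 1 / (3072 * (1 + B))"
  shows "norm (H A N (1 + d)) \<le> exp (9 * M / \<epsilon> N - \<rho> ^ 4 / 256 / \<epsilon> N ^ 4)"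
proof -
  define Sg where "Sg = \<epsilon> N ^ 4 * (\<Sum>i\<in>I N. (tw (P N i))\<^sup>2)"
  have \<epsilon>0: "0 < \<epsilon> N" and Sg: "1/2 \<le> Sg" using g unfolding good_def Sg_def by auto
  have M: "0 \<le> M" by (rule good_nonneg[OF g])
  have nd: "norm d * (1 + B) \<le> 1 / 3072" using \<rho>(3) B0 by (simp add: field_simps)
  have "norm d * 1 \<le> norm d * (1 + B)" using B0 by (intro mult_left_mono) auto
  then have n1: "norm d \<le> 1" using nd by linarith
  have "24 * (1 + B) * norm d ^ 5 = 24 * (norm d * (1 + B)) * norm d ^ 4" by (simp add: eval_nat_numeral)
  also have "\<dots> \<le> 24 * (1 / 3072) * norm d ^ 4" using nd by (intro mult_right_mono mult_left_mono) auto
  finally have "Re (d ^ 4) / 4 + 24 * (1 + B) * norm d ^ 5 \<le> - (norm d ^ 4) / 128"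
    using sector_power4[OF d] by simp
  also have "\<dots> \<le> - (\<rho> ^ 4) / 128" using \<rho> by (simp add: power_mono)
  finally have "(Re (d ^ 4) / 4 + 24 * (1 + B) * norm d ^ 5) / \<epsilon> N ^ 4 \<le> (- (\<rho> ^ 4) / 128) / \<epsilon> N ^ 4"
    by (rule divide_right_mono) simp
  also have "\<dots> = - (\<rho> ^ 4 / 128 / \<epsilon> N ^ 4)" by simp
  finally have "(Re (d ^ 4) / 4 + 24 * (1 + B) * norm d ^ 5) / \<epsilon> N ^ 4 \<le> - (\<rho> ^ 4 / 128 / \<epsilon> N ^ 4)" .
  then have "Sg * ((Re (d ^ 4) / 4 + 24 * (1 + B) * norm d ^ 5) / \<epsilon> N ^ 4) \<le> Sg * - (\<rho> ^ 4 / 128 / \<epsilon> N ^ 4)"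
    using Sg by (intro mult_left_mono) auto
  also have "\<dots> \<le> (1/2) * - (\<rho> ^ 4 / 128 / \<epsilon> N ^ 4)"
    using Sg \<epsilon>0 by (intro mult_right_mono_neg) auto
  finally have 2: "Sg * ((Re (d ^ 4) / 4 + 24 * (1 + B) * norm d ^ 5) / \<epsilon> N ^ 4) \<le> - (\<rho> ^ 4 / 256 / \<epsilon> N ^ 4)" by simp
  have "9 * M * (norm d / \<epsilon> N) \<le> 9 * M * (1 / \<epsilon> N)" using n1 M \<epsilon>0 by (intro mult_left_mono divide_right_mono) auto
  moreover have "norm (H A N (1 + d)) \<le> exp (9 * M * (norm d / \<epsilon> N) + Sg * ((Re (d ^ 4) / 4 + 24 * (1 + B) * norm d ^ 5) / \<epsilon> N ^ 4))"
    unfolding Sg_def using nd by (intro local_bound[OF g]) linarith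
  moreover have "9 * M * (1 / \<epsilon> N) = 9 * M / \<epsilon> N" by simp
  ultimately show ?thesis using 2 by (smt (verit) exp_le_cancel_iff)
qed

text \<open>The fourth order sum provides a gain of \<open>c / 2\<close>, of which the deviation
  from the curve loses at most \<open>c / 4\<close> by the choice of \<open>R\<close>. The first two
  sums cost \<open>O(1 / \<epsilon>)\<close> against a gain of order
  \<open>1 / \<epsilon>\<^sup>4\<close>.\<close>

lemma far_bound:
  assumes g: "good A M N" and x: "x \<noteq> 0" "\<bar>x\<bar> \<le> R" and u: "norm u = exp x"
    and c: "0 < c" "\<And>p. \<bar>p\<bar> \<le> B \<Longrightarrow> c * (tw p)\<^sup>2 \<le> level_gain p x"
    and alt: "\<And>i. i \<in> I N \<Longrightarrow> tw (P N i) * (Re u - level_re x) \<le> 0 \<or> x = R \<and> \<mu> \<le> \<bar>P N i\<bar> \<and> 2 * (1 + B) / \<mu> \<le> exp R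
        \<or> x = - R \<and> \<mu> \<le> \<bar>1 + P N i\<bar> \<and> 2 * B / \<mu> \<le> exp R"
    and R: "8 * exp (- R) / \<mu>\<^sup>2 * (B * (1 + B) * D) \<le> c / 4"
  shows "norm (H A N u) \<le> exp (M * (2 * R + exp R + 1) / \<epsilon> N - c / 4 / \<epsilon> N ^ 4)"
    and "\<And>i. i \<in> I N \<Longrightarrow> 1 - of_real (P N i) * (u - 1) \<noteq> 0"
proof -
  define \<eta> where "\<eta> = 8 * exp (- R) / \<mu>\<^sup>2"
  define Sg where "Sg = \<epsilon> N ^ 4 * (\<Sum>i\<in>I N. (tw (P N i))\<^sup>2)"
  define Sa where "Sa = \<epsilon> N ^ 4 * (\<Sum>i\<in>I N. \<bar>tw (P N i)\<bar>)"
  define T1 where "T1 = of_int (A N) + (\<Sum>i\<in>I N. P N i)"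
  define T2 where "T2 = (\<Sum>i\<in>I N. tw (P N i))"
  have \<epsilon>0: "0 < \<epsilon> N" and Sg: "1/2 \<le> Sg" and Sa: "Sa \<le> B * (1 + B) * D"
    and T: "\<epsilon> N * (\<bar>T1\<bar> + \<bar>T2\<bar> + \<bar>\<Sum>i\<in>I N. P N i * tw (P N i)\<bar>) \<le> M"
    using g unfolding good_def Sg_def Sa_def T1_def T2_def by auto
  have M: "0 \<le> M" by (rule good_nonneg[OF g])
  have R0: "0 \<le> R" using x by linarith
  have C: "\<bar>Re u\<bar> \<le> exp x" using abs_Re_le_cmod[of u] u by simp
  have q: "0 < node_sq (P N i) (exp x) (Re u)" if i: "i \<in> I N" for i
    using arc_node_sq_pos[OF x(1) C \<mu> Pb[OF i] alt[OF i]] .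
  show "1 - of_real (P N i) * (u - 1) \<noteq> 0" if i: "i \<in> I N" for i
    using q[OF i] node_sq_norm[of "P N i" u] u by auto
  have "norm (H A N u) \<le> exp (T1 * x + level_lam x * T2 - c * (\<Sum>i\<in>I N. (tw (P N i))\<^sup>2) + \<eta> * (\<Sum>i\<in>I N. \<bar>tw (P N i)\<bar>))"
    unfolding T1_def T2_def
  proof (rule node_prod_far_bound[OF u q _ fin])
    fix i assume i: "i \<in> I N"
    show "- (ln (node_sq (P N i) (exp x) (Re u)) / 2) \<le> P N i * x + level_lam x * tw (P N i) - c * (tw (P N i))\<^sup>2 + \<eta> * \<bar>tw (P N i)\<bar>"
      unfolding \<eta>_def by (rule arc_node_bound[OF c(2)[OF Pb[OF i]] x(1) C q[OF i] \<mu> Pb[OF i] alt[OF i]])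
  qed
  also have "\<dots> \<le> exp (M * (2 * R + exp R + 1) / \<epsilon> N - c / 4 / \<epsilon> N ^ 4)"
  proof -
    have a: "\<bar>T1\<bar> \<le> M / \<epsilon> N" "\<bar>T2\<bar> \<le> M / \<epsilon> N"
    proof -
      have "\<epsilon> N * \<bar>T1\<bar> \<le> \<epsilon> N * (\<bar>T1\<bar> + \<bar>T2\<bar> + \<bar>\<Sum>i\<in>I N. P N i * tw (P N i)\<bar>)"
           "\<epsilon> N * \<bar>T2\<bar> \<le> \<epsilon> N * (\<bar>T1\<bar> + \<bar>T2\<bar> + \<bar>\<Sum>i\<in>I N. P N i * tw (P N i)\<bar>)"
        using \<epsilon>0 by (auto intro!: mult_left_mono)
      then have "\<epsilon> N * \<bar>T1\<bar> \<le> M" "\<epsilon> N * \<bar>T2\<bar> \<le> M" using T by linarith+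
      then show "\<bar>T1\<bar> \<le> M / \<epsilon> N" "\<bar>T2\<bar> \<le> M / \<epsilon> N" using \<epsilon>0 by (simp_all add: field_simps)
    qed
    have lam: "\<bar>level_lam x\<bar> \<le> R + exp R + 1"
    proof -
      have "exp x \<le> exp R" using x by simp
      then show ?thesis using level_re_less(1,2)[OF x(1)] x(2) exp_gt_zero[of R] unfolding level_re_def by linarith
    qed
    have "T1 * x \<le> \<bar>T1\<bar> * \<bar>x\<bar>" by (metis abs_ge_self abs_mult)
    also have "\<dots> \<le> M / \<epsilon> N * R" using a x R0 by (intro mult_mono) auto
    finally have 1: "T1 * x \<le> M / \<epsilon> N * R" .
    have "level_lam x * T2 \<le> \<bar>level_lam x\<bar> * \<bar>T2\<bar>" by (metis abs_ge_self abs_mult)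
    also have "\<dots> \<le> (R + exp R + 1) * (M / \<epsilon> N)" using a lam R0 by (intro mult_mono) auto
    finally have 2: "level_lam x * T2 \<le> (R + exp R + 1) * (M / \<epsilon> N)" .
    have "\<eta> * Sa \<le> \<eta> * (B * (1 + B) * D)" using Sa by (intro mult_left_mono) (auto simp: \<eta>_def)
    also have "\<dots> \<le> c / 4" using R unfolding \<eta>_def .
    finally have "\<eta> * Sa \<le> c / 4" .
    moreover have "c * (1/2) \<le> c * Sg" using Sg c by (intro mult_left_mono) auto
    ultimately have "- (c * Sg) + \<eta> * Sa \<le> - c / 4" by linarith
    then have "(- (c * Sg) + \<eta> * Sa) / \<epsilon> N ^ 4 \<le> (- c / 4) / \<epsilon> N ^ 4" using \<epsilon>0 by (intro divide_right_mono) auto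
    moreover have "(- (c * Sg) + \<eta> * Sa) / \<epsilon> N ^ 4 = - (c * (\<Sum>i\<in>I N. (tw (P N i))\<^sup>2)) + \<eta> * (\<Sum>i\<in>I N. \<bar>tw (P N i)\<bar>)"
    proof -
      have "Sg / \<epsilon> N ^ 4 = (\<Sum>i\<in>I N. (tw (P N i))\<^sup>2)" "Sa / \<epsilon> N ^ 4 = (\<Sum>i\<in>I N. \<bar>tw (P N i)\<bar>)"
        unfolding Sg_def Sa_def using \<epsilon>0 by simp_all
      then show ?thesis by (simp add: diff_divide_distrib flip: times_divide_eq_right)
    qed
    moreover have "M / \<epsilon> N * R + (R + exp R + 1) * (M / \<epsilon> N) = M * (2 * R + exp R + 1) / \<epsilon> N"
      by (simp add: add_divide_distrib algebra_simps)
    moreover have "(- c / 4) / \<epsilon> N ^ 4 = - (c / 4 / \<epsilon> N ^ 4)" by simp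
    ultimately have "T1 * x + level_lam x * T2 - c * (\<Sum>i\<in>I N. (tw (P N i))\<^sup>2) + \<eta> * (\<Sum>i\<in>I N. \<bar>tw (P N i)\<bar>)
       \<le> M * (2 * R + exp R + 1) / \<epsilon> N - c / 4 / \<epsilon> N ^ 4" using 1 2 by linarith
    then show ?thesis by simp
  qed
  finally show "norm (H A N u) \<le> exp (M * (2 * R + exp R + 1) / \<epsilon> N - c / 4 / \<epsilon> N ^ 4)" .
qed

end

section \<open>Integrable majorants and integrals over the real line\<close>

lemma integrable_exp_minus_abs: "integrable lborel (\<lambda>x::real. exp (- \<bar>x\<bar>))"
proof -
  let ?h = "\<lambda>x::real. exp (- x) * indicator {0..} x"
  have nn: "(\<integral>\<^sup>+x. ennreal (exp (- x)) * indicator {0..} x \<partial>lborel) = 0 - (- exp (- (0::real)))"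
  proof (rule nn_integral_FTC_atLeast)
    show "((\<lambda>x::real. - exp (- x)) \<longlongrightarrow> 0) at_top" by real_asymp
  qed (auto intro!: derivative_eq_intros)
  have 1: "integrable lborel ?h"
  proof (rule integrableI_nonneg)
    have "(\<integral>\<^sup>+x. ennreal (?h x) \<partial>lborel) = (\<integral>\<^sup>+x. ennreal (exp (- x)) * indicator {0..} x \<partial>lborel)"
      by (intro nn_integral_cong) (auto simp: indicator_def)
    then show "(\<integral>\<^sup>+x. ennreal (?h x) \<partial>lborel) < \<infinity>" unfolding nn by simp
  qed auto
  have 2: "integrable lborel (\<lambda>x. ?h (0 + (-1) * x))"
    by (subst lborel_integrable_real_affine_iff) (use 1 in auto)
  have "integrable lborel (\<lambda>x. ?h x + ?h (0 + (-1) * x))" using 1 2 by (rule Bochner_Integration.integrable_add)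
  then show ?thesis
    by (rule Bochner_Integration.integrable_bound) (auto simp: indicator_def)
qed

lemma integrable_exp_quartic:
  assumes "0 < c" shows "integrable lborel (\<lambda>v::real. exp (K + L * \<bar>v\<bar> - c * v ^ 4))"
proof -
  \<comment> \<open>Beyond \<open>G\<close> the quartic dominates
    \<open>(\<bar>L\<bar> + 1) * \<bar>v\<bar>\<close>; up to \<open>G\<close> that quantity is
    bounded. Either way the exponent is at most a constant minus
    \<open>\<bar>v\<bar>\<close>.\<close>
  define G where "G = max 1 ((\<bar>L\<bar> + 1) / c)"
  have G: "1 \<le> G" "\<bar>L\<bar> + 1 \<le> c * G" unfolding G_def using assms by (auto simp: max_def field_simps)
  have b: "K + L * \<bar>v\<bar> - c * v ^ 4 \<le> (\<bar>K\<bar> + (\<bar>L\<bar> + 1) * G) - \<bar>v\<bar>" for v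
  proof (cases "\<bar>v\<bar> \<le> G")
    case True
    have "L * \<bar>v\<bar> \<le> \<bar>L\<bar> * \<bar>v\<bar>" by (intro mult_right_mono) auto
    moreover have "(\<bar>L\<bar> + 1) * \<bar>v\<bar> \<le> (\<bar>L\<bar> + 1) * G" using True by (intro mult_left_mono) auto
    moreover have "0 \<le> c * v ^ 4" using assms by simp
    ultimately show ?thesis using abs_ge_self[of K] by (simp only: distrib_right mult_1_left)
  next
    case False
    then have v: "G \<le> \<bar>v\<bar>" "1 \<le> \<bar>v\<bar>" using G by auto
    have "c * G * \<bar>v\<bar> \<le> c * \<bar>v\<bar> * \<bar>v\<bar>" using v assms by (intro mult_right_mono mult_left_mono) auto
    also have "\<dots> \<le> c * \<bar>v\<bar> * \<bar>v\<bar> ^ 3" using v assms self_le_power[of "\<bar>v\<bar>" 3] by (intro mult_left_mono) auto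
    also have "\<dots> = c * v ^ 4" by (simp add: eval_nat_numeral flip: abs_mult)
    finally have 1: "c * G * \<bar>v\<bar> \<le> c * v ^ 4" .
    have "(\<bar>L\<bar> + 1) * \<bar>v\<bar> \<le> c * G * \<bar>v\<bar>" using G by (intro mult_right_mono) auto
    moreover have "L * \<bar>v\<bar> \<le> \<bar>L\<bar> * \<bar>v\<bar>" by (intro mult_right_mono) auto
    moreover have "0 \<le> (\<bar>L\<bar> + 1) * G" using G by simp
    ultimately show ?thesis using 1 abs_ge_self[of K] by (simp only: distrib_right mult_1_left)
  qed
  have "integrable lborel (\<lambda>v::real. exp (\<bar>K\<bar> + (\<bar>L\<bar> + 1) * G) * exp (- \<bar>v\<bar>))"
    by (intro integrable_mult_right integrable_exp_minus_abs)
  then show ?thesis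
  proof (rule Bochner_Integration.integrable_bound)
    show "AE v in lborel. norm (exp (K + L * \<bar>v\<bar> - c * v ^ 4)) \<le> norm (exp (\<bar>K\<bar> + (\<bar>L\<bar> + 1) * G) * exp (- \<bar>v\<bar>))"
      using b by (auto simp flip: exp_add)
  qed auto
qed

text \<open>Valid also where a factor vanishes, since both sides are then 0. So \<open>1 / H\<close>
  is continuous off 0, even if a pole of \<open>H\<close> lies on the unit circle, as can happen at
  -1.\<close>

lemma inverse_node_prod: "1 / node_prod A I P w = w powi (- A) * (\<Prod>i\<in>I. 1 - of_real (P i) * (w - 1))"
proof -
  have "(\<Prod>i\<in>I. 1 / (1 - of_real (P i) * (w - 1))) = 1 / (\<Prod>i\<in>I. 1 - of_real (P i) * (w - 1))"
    by (simp add: prod_dividef)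
  then show ?thesis unfolding node_prod_def by (simp add: power_int_minus divide_inverse)
qed

lemma inverse_node_prod_continuous: "continuous_on (- {0}) (\<lambda>w. 1 / node_prod A I P w)"
  unfolding inverse_node_prod by (intro continuous_intros) auto

lemma integral_Icc_eq_LINT:
  fixes h :: "real \<Rightarrow> complex"
  assumes "continuous_on {a..b} h"
  shows "integral {a..b} h = (LINT t|lborel. indicator {a..b} t *\<^sub>R h t)"
    and "(\<lambda>t. indicator {a..b} t *\<^sub>R h t) \<in> borel_measurable borel"
proof -
  have "set_integrable lborel {a..b} h" using assms by (rule borel_integrable_atLeastAtMost')
  from set_borel_integral_eq_integral(2)[OF this]
  show "integral {a..b} h = (LINT t|lborel. indicator {a..b} t *\<^sub>R h t)" unfolding set_lebesgue_integral_def by simp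
  show "(\<lambda>t. indicator {a..b} t *\<^sub>R h t) \<in> borel_measurable borel"
    using assms by (intro borel_measurable_continuous_on_indicator) auto
qed

text \<open>The real part is \<open>1 \<plusminus> q\<close> with \<open>q \<ge> \<epsilon>\<close>,
  which settles the outer branch. On the inner branch the imaginary part is at most \<open>q\<close>
  in modulus, and \<open>(1 - q)\<^sup>2 + q\<^sup>2 \<le> (1 - q / 2)\<^sup>2\<close> for
  \<open>q \<le> 1/2\<close>.\<close>

lemma hyperbola_off_circle:
  assumes e: "e = 1 \<or> e = -1" and \<epsilon>: "0 < \<epsilon>" "\<epsilon> * sqrt (1 + v\<^sup>2) \<le> 1/2"
  shows "\<epsilon> / 2 \<le> \<bar>norm (1 + of_real (e * \<epsilon>) * pearcey_zeta v) - 1\<bar>"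
    and "1/2 \<le> norm (1 + of_real (e * \<epsilon>) * pearcey_zeta v)"
    and "e = 1 \<Longrightarrow> 1 < norm (1 + of_real (e * \<epsilon>) * pearcey_zeta v)"
    and "e = -1 \<Longrightarrow> norm (1 + of_real (e * \<epsilon>) * pearcey_zeta v) < 1"
proof -
  define q where "q = \<epsilon> * sqrt (1 + v\<^sup>2)"
  define u where "u = 1 + of_real (e * \<epsilon>) * pearcey_zeta v"
  have "1 \<le> sqrt (1 + v\<^sup>2)" by simp
  then have q: "\<epsilon> \<le> q" "q \<le> 1/2" using \<epsilon> unfolding q_def by (simp_all add: mult_le_cancel_left1)
  have re: "Re u = 1 + e * q" unfolding u_def q_def pearcey_zeta_def by simp
  have "e = 1 \<Longrightarrow> 1 + \<epsilon> \<le> norm u" using re complex_Re_le_cmod[of u] q by simp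
  moreover have "e = -1 \<Longrightarrow> norm u \<le> 1 - q / 2"
  proof (rule power2_le_imp_le)
    assume e: "e = -1"
    have "(norm u)\<^sup>2 = (1 - q)\<^sup>2 + (\<epsilon> * v)\<^sup>2" unfolding cmod_power2 re unfolding u_def pearcey_zeta_def using e by simp
    also have "(\<epsilon> * v)\<^sup>2 \<le> q\<^sup>2" unfolding q_def power_mult_distrib by (simp add: mult_left_mono add_nonneg_nonneg)
    also have "(1 - q)\<^sup>2 + q\<^sup>2 \<le> (1 - q / 2)\<^sup>2"
    proof -
      have "q * q \<le> 1/2 * q" using q \<epsilon>(1) by (intro mult_right_mono) auto
      moreover have "0 \<le> q * q" by simp
      moreover have "(1 - q)\<^sup>2 = 1 - 2 * q + q * q" "q\<^sup>2 = q * q" "(1 - q / 2)\<^sup>2 = 1 - q + (q * q) / 4"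
        by (simp_all add: power2_eq_square algebra_simps)
      ultimately show ?thesis by linarith
    qed
    finally show "(norm u)\<^sup>2 \<le> (1 - q / 2)\<^sup>2" by simp
    show "0 \<le> 1 - q / 2" using q by simp
  qed
  moreover have "1/2 \<le> norm u" using re e complex_Re_le_cmod[of u] q \<epsilon>(1) by auto
  ultimately show "\<epsilon> / 2 \<le> \<bar>norm u - 1\<bar>" "1/2 \<le> norm u" "e = 1 \<Longrightarrow> 1 < norm u" "e = -1 \<Longrightarrow> norm u < 1"
    using e q \<epsilon>(1) by auto
qed

lemma lint_dominated_convergence_eventually:
  fixes s :: "nat \<Rightarrow> real \<Rightarrow> complex"
  assumes "integrable lborel w"
    and "\<forall>\<^sub>F N in sequentially. s N \<in> borel_measurable lborel \<and> (\<forall>t. norm (s N t) \<le> w t)"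
    and lim: "\<And>t. (\<lambda>N. s N t) \<longlonglongrightarrow> f t"
  shows "(\<lambda>N. LINT t|lborel. s N t) \<longlonglongrightarrow> (LINT t|lborel. f t)"
proof -
  obtain N0 where N0: "\<And>N. N0 \<le> N \<Longrightarrow> s N \<in> borel_measurable lborel \<and> (\<forall>t. norm (s N t) \<le> w t)"
    using assms(2) unfolding eventually_sequentially by blast
  have lim': "(\<lambda>N. s (N + N0) t) \<longlonglongrightarrow> f t" for t using lim by (rule LIMSEQ_ignore_initial_segment)
  have m: "(\<lambda>t. s (N + N0) t) \<in> borel_measurable lborel" for N using N0[of "N + N0"] by simp
  have "(\<lambda>N. LINT t|lborel. s (N + N0) t) \<longlonglongrightarrow> (LINT t|lborel. f t)"
  proof (rule integral_dominated_convergence[OF _ m assms(1)])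
    show "f \<in> borel_measurable lborel" by (rule borel_measurable_LIMSEQ_metric[OF m lim'])
  qed (use lim' N0 in auto)
  then show ?thesis by (rule LIMSEQ_offset)
qed

section \<open>The inner integral over the unit circle\<close>

context node_array begin

definition inner :: "(nat \<Rightarrow> int) \<Rightarrow> nat \<Rightarrow> complex \<Rightarrow> complex" where
  "inner A' N u = contour_integral unit_circle (\<lambda>w. 1 / H A' N w / (u - w))"

text \<open>The substitution \<open>t = \<epsilon> v\<close> blows up the critical window. The
  circle becomes the indicator of a growing interval inside an integral over the whole line, ready
  for dominated convergence.\<close>

lemma inner_eq_LINT:
  assumes "0 < \<epsilon> N" "norm u \<noteq> 1"
  shows "inner A' N u = (LINT v|lborel. indicator {-pi..pi} (\<epsilon> N * v) *\<^sub>R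
       (of_real (\<epsilon> N) * (1 / H A' N (cis (\<epsilon> N * v)) / (u - cis (\<epsilon> N * v)) * \<i> * cis (\<epsilon> N * v))))"
    and "(\<lambda>v. indicator {-pi..pi} (\<epsilon> N * v) *\<^sub>R
       (of_real (\<epsilon> N) * (1 / H A' N (cis (\<epsilon> N * v)) / (u - cis (\<epsilon> N * v)) * \<i> * cis (\<epsilon> N * v)))) \<in> borel_measurable borel"
proof -
  define h where "h t = 1 / H A' N (cis t) / (u - cis t) * \<i> * cis t" for t
  define k where "k t = 1 / H A' N (cis t)" for t
  have "continuous_on {-pi..pi} k" unfolding k_def
    by (rule continuous_on_compose2[OF inverse_node_prod_continuous, of _ cis]) (auto intro!: continuous_intros)
  moreover have "u - cis t \<noteq> 0" for t using assms(2) norm_cis[of t] by auto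
  ultimately have c: "continuous_on {-pi..pi} h" unfolding h_def k_def[symmetric] by (intro continuous_intros) auto
  have "inner A' N u = integral {-pi..pi} h"
    unfolding inner_def h_def by (subst contour_integral_part_circlepath_eq) auto
  also have "\<dots> = (LINT t|lborel. indicator {-pi..pi} t *\<^sub>R h t)" by (rule integral_Icc_eq_LINT[OF c])
  also have "\<dots> = \<bar>\<epsilon> N\<bar> *\<^sub>R (LINT v|lborel. indicator {-pi..pi} (0 + \<epsilon> N * v) *\<^sub>R h (0 + \<epsilon> N * v))"
    using assms by (intro lborel_integral_real_affine) auto
  also have "\<dots> = (LINT v|lborel. indicator {-pi..pi} (\<epsilon> N * v) *\<^sub>R (of_real (\<epsilon> N) * h (\<epsilon> N * v)))"
    using assms by (simp add: scaleR_conv_of_real mult_ac flip: integral_mult_right_zero)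
  finally show "inner A' N u = (LINT v|lborel. indicator {-pi..pi} (\<epsilon> N * v) *\<^sub>R
       (of_real (\<epsilon> N) * (1 / H A' N (cis (\<epsilon> N * v)) / (u - cis (\<epsilon> N * v)) * \<i> * cis (\<epsilon> N * v))))" unfolding h_def .
  have "(\<lambda>v. indicator {-pi..pi} (\<epsilon> N * v) *\<^sub>R h (\<epsilon> N * v)) \<in> borel_measurable borel"
    using integral_Icc_eq_LINT(2)[OF c] by (rule measurable_compose_rev) measurable
  then have "(\<lambda>v. of_real (\<epsilon> N) * (indicator {-pi..pi} (\<epsilon> N * v) *\<^sub>R h (\<epsilon> N * v))) \<in> borel_measurable borel" by measurable
  then show "(\<lambda>v. indicator {-pi..pi} (\<epsilon> N * v) *\<^sub>R
       (of_real (\<epsilon> N) * (1 / H A' N (cis (\<epsilon> N * v)) / (u - cis (\<epsilon> N * v)) * \<i> * cis (\<epsilon> N * v)))) \<in> borel_measurable borel"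
    unfolding h_def by (simp add: scaleR_conv_of_real mult_ac)
qed

text \<open>The right side of \<open>circle_bound\<close>; the summand 0 only matches the shape of
  \<open>integrable_exp_quartic\<close>.\<close>

definition circle_weight :: "real \<Rightarrow> real \<Rightarrow> real" where
  "circle_weight M v = exp (0 + M * \<bar>v\<bar> - 1 / (2048 * (1 + 4 * (B * (1 + B)))) * v ^ 4)"

lemma circle_weight_integrable: "integrable lborel (circle_weight M)"
proof -
  have "0 \<le> B * (1 + B)" using B0 by simp
  then show ?thesis unfolding circle_weight_def[abs_def] by (intro integrable_exp_quartic) auto
qed

lemma inner_integrand_bound:
  assumes g: "good A' M N" and r: "0 < r" "r \<le> \<bar>norm u - 1\<bar>"
  shows "norm (indicator {-pi..pi} (\<epsilon> N * v) *\<^sub>R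
       (of_real (\<epsilon> N) * (1 / H A' N (cis (\<epsilon> N * v)) / (u - cis (\<epsilon> N * v)) * \<i> * cis (\<epsilon> N * v)))) \<le> \<epsilon> N / r * circle_weight M v"
proof (cases "\<epsilon> N * v \<in> {-pi..pi}")
  case True
  have \<epsilon>0: "0 < \<epsilon> N" using g unfolding good_def by auto
  have "r \<le> norm (u - cis (\<epsilon> N * v))" using r norm_triangle_ineq3[of u "cis (\<epsilon> N * v)"] by simp
  then have "norm (1 / H A' N (cis (\<epsilon> N * v))) / norm (u - cis (\<epsilon> N * v)) \<le> circle_weight M v / r"
    using circle_bound[OF g, of v] True r unfolding circle_weight_def by (intro frac_le) auto
  then have "\<epsilon> N * (norm (1 / H A' N (cis (\<epsilon> N * v))) / norm (u - cis (\<epsilon> N * v))) \<le> \<epsilon> N * (circle_weight M v / r)"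
    using \<epsilon>0 by (intro mult_left_mono) auto
  then show ?thesis using True \<epsilon>0 by (simp add: norm_mult norm_divide)
next
  case False
  have "0 < \<epsilon> N" using g unfolding good_def by auto
  then show ?thesis using False r unfolding circle_weight_def by simp
qed

text \<open>The distance from the circle decides the size: at distance
  \<open>\<epsilon> / 2\<close>, which is all that the hyperbola guarantees, the bound is of order
  1, and at a fixed distance it is of order \<open>\<epsilon>\<close>.\<close>

lemma inner_bound:
  assumes g: "good A' M N" and r: "0 < r" "r \<le> \<bar>norm u - 1\<bar>"
  shows "norm (inner A' N u) \<le> \<epsilon> N / r * (LINT v|lborel. circle_weight M v)"
proof -
  have \<epsilon>0: "0 < \<epsilon> N" using g unfolding good_def by auto
  have "norm u \<noteq> 1" using r by auto
  have "norm (inner A' N u) \<le> (LINT v|lborel. norm (indicator {-pi..pi} (\<epsilon> N * v) *\<^sub>R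
       (of_real (\<epsilon> N) * (1 / H A' N (cis (\<epsilon> N * v)) / (u - cis (\<epsilon> N * v)) * \<i> * cis (\<epsilon> N * v)))))"
    unfolding inner_eq_LINT(1)[of N u A', OF \<epsilon>0 \<open>norm u \<noteq> 1\<close>] by (rule Bochner_Integration.integral_norm_bound)
  also have "\<dots> \<le> (LINT v|lborel. \<epsilon> N / r * circle_weight M v)"
  proof (rule integral_mono_AE')
    show "integrable lborel (\<lambda>v. \<epsilon> N / r * circle_weight M v)" by (intro integrable_mult_right circle_weight_integrable)
    show "AE v in lborel. norm (indicator {-pi..pi} (\<epsilon> N * v) *\<^sub>R
       (of_real (\<epsilon> N) * (1 / H A' N (cis (\<epsilon> N * v)) / (u - cis (\<epsilon> N * v)) * \<i> * cis (\<epsilon> N * v)))) \<le> \<epsilon> N / r * circle_weight M v"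
      using inner_integrand_bound[OF g r] by (intro AE_I2)
    show "AE v in lborel. 0 \<le> \<epsilon> N / r * circle_weight M v"
      using \<epsilon>0 r unfolding circle_weight_def by (intro AE_I2) simp
  qed
  also have "\<dots> = \<epsilon> N / r * (LINT v|lborel. circle_weight M v)" by simp
  finally show ?thesis .
qed

lemma cis_scaled_lim: "(\<lambda>N. (cis (\<epsilon> N * v) - 1) / of_real (\<epsilon> N)) \<longlonglongrightarrow> \<i> * of_real v"
proof -
  have "((\<lambda>t. exp (\<i> * of_real v * t)) has_field_derivative \<i> * of_real v) (at 0)"
    by (auto intro!: derivative_eq_intros)
  then have "((\<lambda>t. (exp (\<i> * of_real v * t) - 1) / t) \<longlongrightarrow> \<i> * of_real v) (at 0)"
    unfolding has_field_derivative_iff by simp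
  moreover have "filterlim (\<lambda>N. complex_of_real (\<epsilon> N)) (at 0) sequentially"
    unfolding filterlim_at using \<epsilon>_lim \<epsilon>_pos by (auto intro!: tendsto_eq_intros elim: eventually_mono)
  ultimately have "(\<lambda>N. (exp (\<i> * of_real v * of_real (\<epsilon> N)) - 1) / of_real (\<epsilon> N)) \<longlonglongrightarrow> \<i> * of_real v"
    by (rule filterlim_compose)
  then show ?thesis by (simp add: cis_conv_exp mult_ac)
qed

lemma inner_tendsto:
  assumes dr: "drift A' \<eta>" and e: "e = 1 \<or> e = -1"
  shows "(\<lambda>N. inner A' N (1 + of_real (e * \<epsilon> N) * pearcey_zeta v)) \<longlonglongrightarrow>
     (LINT t|lborel. 1 / exp ((\<i> * of_real t) ^ 4 / 4 - (\<i> * of_real t) * of_real \<eta>)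
         * (1 / (of_real e * pearcey_zeta v - \<i> * of_real t)) * \<i>)"
    (is "_ \<longlonglongrightarrow> (LINT t|lborel. ?f t)")
proof -
  obtain M where M: "\<forall>\<^sub>F N in sequentially. good A' M N" using eventually_good[OF dr] by metis
  define u where "u N = 1 + of_real (e * \<epsilon> N) * pearcey_zeta v" for N
  define s where "s N t = indicator {-pi..pi} (\<epsilon> N * t) *\<^sub>R
       (of_real (\<epsilon> N) * (1 / H A' N (cis (\<epsilon> N * t)) / (u N - cis (\<epsilon> N * t)) * \<i> * cis (\<epsilon> N * t)))" for N t
  have sq: "0 < sqrt (1 + v\<^sup>2)" by (simp add: add_pos_nonneg)
  have "\<forall>\<^sub>F N in sequentially. \<epsilon> N < 1 / (2 * sqrt (1 + v\<^sup>2))" using sq by (intro \<epsilon>_less) simp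
  with M have ev: "\<forall>\<^sub>F N in sequentially. good A' M N \<and> \<epsilon> N / 2 \<le> \<bar>norm (u N) - 1\<bar>"
  proof eventually_elim
    case (elim N)
    then have "0 < \<epsilon> N" unfolding good_def by auto
    moreover have "\<epsilon> N * sqrt (1 + v\<^sup>2) \<le> 1/2" using elim sq by (simp add: field_simps)
    ultimately show ?case using elim hyperbola_off_circle(1)[OF e] unfolding u_def by auto
  qed
  have "(\<lambda>N. LINT t|lborel. s N t) \<longlonglongrightarrow> (LINT t|lborel. ?f t)"
  proof (rule lint_dominated_convergence_eventually)
    show "integrable lborel (\<lambda>t. 2 * circle_weight M t)" by (intro integrable_mult_right circle_weight_integrable)
    show "\<forall>\<^sub>F N in sequentially. s N \<in> borel_measurable lborel \<and> (\<forall>t. norm (s N t) \<le> 2 * circle_weight M t)"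
      using ev
    proof eventually_elim
      case (elim N)
      then have \<epsilon>0: "0 < \<epsilon> N" unfolding good_def by auto
      then have "norm (u N) \<noteq> 1" using elim by auto
      then have "s N \<in> borel_measurable borel" unfolding s_def[abs_def] by (rule inner_eq_LINT(2)[of N "u N" A', OF \<epsilon>0])
      moreover have "norm (s N t) \<le> 2 * circle_weight M t" for t
        using inner_integrand_bound[of A' M N "\<epsilon> N / 2" "u N" t] elim \<epsilon>0 unfolding s_def by simp
      ultimately show ?case by simp
    qed
    fix t
    \<comment> \<open>Writes the point of the circle as \<open>1 + \<epsilon> \<omega>\<close>, the
      form that \<open>H_tendsto\<close> expects. The factor \<open>\<epsilon>\<close> of the
      substitution cancels against the one in the difference of \<open>u\<close> and that
      point.\<close>
    define \<omega> where "\<omega> N = (cis (\<epsilon> N * t) - 1) / of_real (\<epsilon> N)" for N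
    have \<omega>: "\<omega> \<longlonglongrightarrow> \<i> * of_real t" unfolding \<omega>_def[abs_def] by (rule cis_scaled_lim)
    have nz: "of_real e * pearcey_zeta v - \<i> * of_real t \<noteq> 0"
      using e sq by (auto simp: complex_eq_iff pearcey_zeta_def)
    have "(\<lambda>N. 1 / H A' N (1 + of_real (\<epsilon> N) * \<omega> N) * (1 / (of_real e * pearcey_zeta v - \<omega> N)) * \<i> * (1 + of_real (\<epsilon> N) * \<omega> N))
      \<longlonglongrightarrow> 1 / exp ((\<i> * of_real t) ^ 4 / 4 - of_real \<eta> * (\<i> * of_real t)) * (1 / (of_real e * pearcey_zeta v - \<i> * of_real t)) * \<i> * (1 + of_real 0 * (\<i> * of_real t))"
      by (intro tendsto_intros H_tendsto[OF dr] \<omega> nz \<epsilon>_lim) auto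
    then have "(\<lambda>N. 1 / H A' N (1 + of_real (\<epsilon> N) * \<omega> N) * (1 / (of_real e * pearcey_zeta v - \<omega> N)) * \<i> * (1 + of_real (\<epsilon> N) * \<omega> N)) \<longlonglongrightarrow> ?f t"
      by (simp add: mult.commute)
    then show "(\<lambda>N. s N t) \<longlonglongrightarrow> ?f t"
    proof (rule Lim_transform_eventually)
      have "(\<lambda>N. \<epsilon> N * t) \<longlonglongrightarrow> 0 * t" by (intro tendsto_intros \<epsilon>_lim)
      then have "(\<lambda>N. \<bar>\<epsilon> N * t\<bar>) \<longlonglongrightarrow> 0" using tendsto_rabs_zero by fastforce
      then have "\<forall>\<^sub>F N in sequentially. \<bar>\<epsilon> N * t\<bar> < pi" by (rule order_tendstoD) simp
      then show "\<forall>\<^sub>F N in sequentially. 1 / H A' N (1 + of_real (\<epsilon> N) * \<omega> N) * (1 / (of_real e * pearcey_zeta v - \<omega> N)) * \<i> * (1 + of_real (\<epsilon> N) * \<omega> N) = s N t"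
        using \<epsilon>_pos
      proof eventually_elim
        case (elim N)
        then have "\<epsilon> N * t \<in> {-pi..pi}" by auto
        moreover have c: "1 + of_real (\<epsilon> N) * \<omega> N = cis (\<epsilon> N * t)" unfolding \<omega>_def using elim by simp
        moreover have "u N - cis (\<epsilon> N * t) = of_real (\<epsilon> N) * (of_real e * pearcey_zeta v - \<omega> N)"
          unfolding c[symmetric] u_def by (simp add: algebra_simps)
        ultimately show ?case unfolding s_def using elim(2) by (simp add: mult_ac)
      qed
    qed
  qed
  then show ?thesis
  proof (rule Lim_transform_eventually)
    show "\<forall>\<^sub>F N in sequentially. (LINT t|lborel. s N t) = inner A' N (1 + of_real (e * \<epsilon> N) * pearcey_zeta v)"
      using ev
    proof eventually_elim
      case (elim N)
      then have \<epsilon>0: "0 < \<epsilon> N" unfolding good_def by auto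
      then have "norm (u N) \<noteq> 1" using elim by auto
      then show ?case unfolding s_def u_def using inner_eq_LINT(1)[OF \<epsilon>0] by simp
    qed
  qed
qed

end

section \<open>The contribution of the Pearcey hyperbola\<close>

definition zeta_deriv :: "real \<Rightarrow> complex" where
  "zeta_deriv v = Complex (v / sqrt (1 + v\<^sup>2)) 1"

lemma has_vector_derivative_Complex:
  assumes "(f has_real_derivative f') (at v within S)" "(g has_real_derivative g') (at v within S)"
  shows "((\<lambda>v. Complex (f v) (g v)) has_vector_derivative Complex f' g') (at v within S)"
  unfolding Complex_eq using assms[THEN has_vector_derivative_of_real]
  by (intro has_vector_derivative_add has_vector_derivative_mult_right)

lemma pearcey_zeta_derivative: "(pearcey_zeta has_vector_derivative zeta_deriv v) (at v within S)"
proof -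
  have p: "0 < 1 + v\<^sup>2" by (simp add: add_pos_nonneg)
  have "((\<lambda>v. sqrt (1 + v\<^sup>2)) has_real_derivative v / sqrt (1 + v\<^sup>2)) (at v within S)"
    using p by (auto intro!: derivative_eq_intros simp: field_simps)
  then show ?thesis unfolding pearcey_zeta_def[abs_def] zeta_deriv_def
    by (rule has_vector_derivative_Complex) (rule DERIV_ident)
qed

lemma zeta_deriv_continuous: "continuous_on S zeta_deriv"
proof -
  have "1 + v\<^sup>2 \<noteq> 0" for v :: real by (metis add_pos_nonneg less_irrefl zero_le_power2 zero_less_one)
  then show ?thesis unfolding zeta_deriv_def by (intro continuous_intros) auto
qed

lemma norm_zeta_deriv: "norm (zeta_deriv v) \<le> 2"
proof -
  have "0 < sqrt (1 + v\<^sup>2)" by (simp add: add_pos_nonneg)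
  moreover have "\<bar>v\<bar> \<le> sqrt (1 + v\<^sup>2)" by (rule real_le_rsqrt) simp
  ultimately have "\<bar>v / sqrt (1 + v\<^sup>2)\<bar> \<le> 1" by (simp only: abs_divide abs_of_pos pos_divide_le_eq mult_1)
  then show ?thesis unfolding zeta_deriv_def using cmod_le[of "Complex (v / sqrt (1 + v\<^sup>2)) 1"] by simp
qed

context node_array begin

text \<open>The rescaled \<open>z\<close>-integrand; the constant between \<open>K\<close> and
  \<open>H\<close> cancels because \<open>K\<close> occurs once inverted. Of
  \<open>z powi (- a - 1)\<close> the part with exponent \<open>- a\<close> is absorbed by
  \<open>H\<close>, and \<open>1 / u\<close> is the rest.\<close>

definition F :: "(nat \<Rightarrow> int) \<Rightarrow> (nat \<Rightarrow> int) \<Rightarrow> nat \<Rightarrow> complex \<Rightarrow> complex" where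
  "F A A' N u = H A N u / u * inner A' N u"

definition regular :: "nat \<Rightarrow> complex set" where
  "regular N = {u. u \<noteq> 0 \<and> norm u \<noteq> 1 \<and> (\<forall>i\<in>I N. 1 - of_real (P N i) * (u - 1) \<noteq> 0)}"

lemma open_regular: "open (regular N)"
proof -
  have "regular N = - {0} \<inter> - sphere 0 1 \<inter> (\<Inter>i\<in>I N. - {u. 1 - of_real (P N i) * (u - 1) = 0})"
    unfolding regular_def by auto
  moreover have "closed {u. 1 - complex_of_real (P N i) * (u - 1) = 0}" for i
    by (intro closed_Collect_eq continuous_intros)
  ultimately show ?thesis using fin[of N]
    by (metis (no_types, lifting) closed_sphere open_Compl open_INT open_Int open_delete open_UNIV closed_singleton)
qed

lemma F_holomorphic: "F A A' N holomorphic_on regular N"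
proof -
  have "continuous_on (path_image unit_circle) (\<lambda>w. 1 / H A' N w)"
    using path_image_unit_circle by (intro continuous_on_subset[OF inverse_node_prod_continuous]) auto
  then have "inner A' N holomorphic_on - path_image unit_circle"
    unfolding inner_def[abs_def] by (rule cauchy_transform_holomorphic)
  then have "inner A' N holomorphic_on regular N"
    by (rule holomorphic_on_subset) (use path_image_unit_circle in \<open>auto simp: regular_def\<close>)
  moreover have "H A N holomorphic_on regular N"
    unfolding node_prod_def[abs_def] by (intro holomorphic_intros) (auto simp: regular_def)
  ultimately show ?thesis unfolding F_def[abs_def] by (intro holomorphic_intros) (auto simp: regular_def)
qed

text \<open>The pole of a node \<open>p\<close> is at distance
  \<open>1 / \<bar>p\<bar> \<ge> 1 / B\<close> from 1.\<close>

lemma regular_small: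
  assumes "norm d * (1 + B) < 1" "norm (1 + d) \<noteq> 1" shows "1 + d \<in> regular N"
proof -
  have "norm d * 1 \<le> norm d * (1 + B)" using B0 by (intro mult_left_mono) auto
  then have d: "norm d < 1" using assms by linarith
  have "1 + d \<noteq> 0" using d one_plus_nonpos_Reals[of d] by auto
  moreover have "1 - of_real (P N i) * d \<noteq> 0" if "i \<in> I N" for i
  proof
    assume "1 - of_real (P N i) * d = 0"
    then have "norm (of_real (P N i) * d) = 1" by (metis eq_iff_diff_eq_0 norm_one)
    moreover have "norm (of_real (P N i) * d) \<le> norm d * (1 + B)"
      using Pb[OF that] by (simp add: norm_mult mult.commute[of "\<bar>P N i\<bar>"] mult_left_mono)
    ultimately show False using assms by linarith
  qed
  ultimately show ?thesis using assms(2) unfolding regular_def by auto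
qed

lemma regular_nonreal: "Im u \<noteq> 0 \<Longrightarrow> norm u \<noteq> 1 \<Longrightarrow> u \<in> regular N"
proof -
  assume u: "Im u \<noteq> 0" "norm u \<noteq> 1"
  have "1 - of_real p * (u - 1) \<noteq> 0" for p
    using u(1) by (cases "p = 0") (auto simp: complex_eq_iff)
  then show ?thesis using u unfolding regular_def by auto
qed

text \<open>Half the radius of \<open>sector_bound\<close>: the hyperbola is followed up to
  imaginary part \<open>\<delta>\<close>, and its end is then at distance at most
  \<open>2 * \<delta>\<close> from 1.\<close>

definition \<delta> :: real where "\<delta> = 1 / (6144 * (1 + B))"

lemma \<delta>_pos: "0 < \<delta>" "\<delta> \<le> 1 / 6144"
  unfolding \<delta>_def using B0 by (auto simp: divide_simps)

lemma hyperbola_range: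
  assumes "0 < \<epsilon> N" "\<epsilon> N \<le> \<delta>" "\<bar>v\<bar> \<le> \<delta> / \<epsilon> N"
  shows "\<epsilon> N * sqrt (1 + v\<^sup>2) \<le> 1 / (768 * (1 + B))" "\<epsilon> N * sqrt (1 + v\<^sup>2) \<le> 1 / 2"
    "norm (pearcey_zeta v) * \<epsilon> N \<le> 4 * \<delta>"
proof -
  have "\<epsilon> N * \<bar>v\<bar> \<le> \<delta>" using assms by (simp add: field_simps)
  then have "(\<epsilon> N * \<bar>v\<bar>)\<^sup>2 \<le> \<delta>\<^sup>2" "\<epsilon> N ^ 2 \<le> \<delta>\<^sup>2" using assms by (auto intro!: power_mono)
  then have "\<epsilon> N ^ 2 * v\<^sup>2 \<le> \<delta>\<^sup>2" "\<epsilon> N ^ 2 \<le> \<delta>\<^sup>2" by (simp_all add: power_mult_distrib)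
  moreover have "(\<epsilon> N * sqrt (1 + v\<^sup>2))\<^sup>2 = \<epsilon> N ^ 2 + \<epsilon> N ^ 2 * v\<^sup>2"
    by (simp add: power_mult_distrib add_nonneg_nonneg distrib_left)
  moreover have "(2 * \<delta>)\<^sup>2 = 4 * \<delta>\<^sup>2" "0 \<le> \<delta>\<^sup>2" by (simp_all add: power_mult_distrib)
  ultimately have "(\<epsilon> N * sqrt (1 + v\<^sup>2))\<^sup>2 \<le> (2 * \<delta>)\<^sup>2" by linarith
  then have 1: "\<epsilon> N * sqrt (1 + v\<^sup>2) \<le> 2 * \<delta>" by (rule power2_le_imp_le) (use \<delta>_pos in simp)
  have "\<delta> = inverse (1 + B) / 6144" "1 / (768 * (1 + B)) = inverse (1 + B) / 768" "0 < inverse (1 + B)"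
  proof -
    have y: "1 / (6144 * y) = inverse y / 6144" "1 / (768 * y) = inverse y / 768" for y :: real
      by (simp_all add: inverse_eq_divide)
    show "\<delta> = inverse (1 + B) / 6144" unfolding \<delta>_def by (rule y)
    show "1 / (768 * (1 + B)) = inverse (1 + B) / 768" by (rule y)
    show "0 < inverse (1 + B)" using B0 by simp
  qed
  then show "\<epsilon> N * sqrt (1 + v\<^sup>2) \<le> 1 / (768 * (1 + B))" "\<epsilon> N * sqrt (1 + v\<^sup>2) \<le> 1 / 2"
    using 1 \<delta>_pos by linarith+
  have sq: "(sqrt (1 + v\<^sup>2))\<^sup>2 = 1 + v\<^sup>2" by (simp add: add_nonneg_nonneg)
  have "(norm (pearcey_zeta v))\<^sup>2 \<le> (2 * sqrt (1 + v\<^sup>2))\<^sup>2"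
    unfolding cmod_power2 pearcey_zeta_def complex.sel power_mult_distrib sq by simp
  then have "norm (pearcey_zeta v) \<le> 2 * sqrt (1 + v\<^sup>2)" by (rule power2_le_imp_le) simp
  then have "norm (pearcey_zeta v) * \<epsilon> N \<le> 2 * sqrt (1 + v\<^sup>2) * \<epsilon> N" using assms by (intro mult_right_mono) auto
  also have "\<dots> = 2 * (\<epsilon> N * sqrt (1 + v\<^sup>2))" by simp
  finally show "norm (pearcey_zeta v) * \<epsilon> N \<le> 4 * \<delta>" using 1 by linarith
qed

lemma hyperbola_regular:
  assumes e: "e = 1 \<or> e = -1" and "0 < \<epsilon> N" "\<epsilon> N \<le> \<delta>" "\<bar>v\<bar> \<le> \<delta> / \<epsilon> N"
  shows "1 + of_real (e * \<epsilon> N) * pearcey_zeta v \<in> regular N"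
proof (rule regular_small)
  have "norm (of_real (e * \<epsilon> N) * pearcey_zeta v) = norm (pearcey_zeta v) * \<epsilon> N"
    using e assms(2) by (auto simp: norm_mult)
  also have "\<dots> \<le> 4 * \<delta>" by (rule hyperbola_range(3)[OF assms(2-4)])
  also have "\<dots> < 1 / (1 + B)" unfolding \<delta>_def using B0 by (simp add: field_simps)
  finally show "norm (of_real (e * \<epsilon> N) * pearcey_zeta v) * (1 + B) < 1" using B0 by (simp add: field_simps)
  show "norm (1 + of_real (e * \<epsilon> N) * pearcey_zeta v) \<noteq> 1"
    using hyperbola_off_circle(1)[OF e assms(2) hyperbola_range(2)[OF assms(2-4)]] assms(2) by auto
qed

definition main_part :: "(nat \<Rightarrow> int) \<Rightarrow> (nat \<Rightarrow> int) \<Rightarrow> real \<Rightarrow> nat \<Rightarrow> complex" where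
  "main_part A A' e N = integral {- (\<delta> / \<epsilon> N)..\<delta> / \<epsilon> N}
     (\<lambda>v. F A A' N (1 + of_real (e * \<epsilon> N) * pearcey_zeta v) * (of_real (e * \<epsilon> N) * zeta_deriv v))"

lemma main_continuous:
  assumes e: "e = 1 \<or> e = -1" and "0 < \<epsilon> N" "\<epsilon> N \<le> \<delta>"
  shows "continuous_on {- (\<delta> / \<epsilon> N)..\<delta> / \<epsilon> N}
     (\<lambda>v. F A A' N (1 + of_real (e * \<epsilon> N) * pearcey_zeta v) * (of_real (e * \<epsilon> N) * zeta_deriv v))"
proof -
  have z: "continuous_on S pearcey_zeta" for S
    unfolding continuous_on_eq_continuous_within by (intro ballI has_vector_derivative_continuous[OF pearcey_zeta_derivative])
  have "continuous_on {- (\<delta> / \<epsilon> N)..\<delta> / \<epsilon> N} (\<lambda>v. F A A' N (1 + of_real (e * \<epsilon> N) * pearcey_zeta v))"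
  proof (rule continuous_on_compose2[OF holomorphic_on_imp_continuous_on[OF F_holomorphic]])
    show "(\<lambda>v. 1 + of_real (e * \<epsilon> N) * pearcey_zeta v) ` {- (\<delta> / \<epsilon> N)..\<delta> / \<epsilon> N} \<subseteq> regular N"
      using hyperbola_regular[OF assms] by (auto simp: abs_le_iff)
  qed (intro continuous_intros z)
  then show ?thesis by (intro continuous_intros zeta_deriv_continuous)
qed

text \<open>The inner integral is treated as a single factor: \<open>inner_bound\<close> dominates
  it uniformly on the hyperbola and \<open>inner_tendsto\<close> gives its pointwise limit. So no
  convergence theorem for double integrals is involved.\<close>

lemma main_part_tendsto:
  assumes dr: "drift A \<xi>" and dr': "drift A' \<eta>" and e: "e = 1 \<or> e = -1"
  shows "(\<lambda>N. main_part A A' e N / of_real (\<epsilon> N)) \<longlonglongrightarrow>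
     (LINT v|lborel. LINT t|lborel. pearcey_integrand \<xi> \<eta> (of_real e * pearcey_zeta v) (\<i> * of_real t)
        * (of_real e * vector_derivative pearcey_zeta (at v)) * \<i>)"
proof -
  obtain M where M: "0 < M" "\<forall>\<^sub>F N in sequentially. good A M N" using eventually_good[OF dr] by metis
  obtain M' where M': "0 < M'" "\<forall>\<^sub>F N in sequentially. good A' M' N" using eventually_good[OF dr'] by metis
  define W where "W = (LINT v|lborel. circle_weight M' v)"
  have W0: "0 \<le> W" unfolding W_def by (intro Bochner_Integration.integral_nonneg) (simp add: circle_weight_def)
  define s where "s N v = indicator {- (\<delta> / \<epsilon> N)..\<delta> / \<epsilon> N} v *\<^sub>R
     (F A A' N (1 + of_real (e * \<epsilon> N) * pearcey_zeta v) * (of_real e * zeta_deriv v))" for N v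
  define J where "J v = (LINT t|lborel. 1 / exp ((\<i> * of_real t) ^ 4 / 4 - (\<i> * of_real t) * of_real \<eta>)
         * (1 / (of_real e * pearcey_zeta v - \<i> * of_real t)) * \<i>)" for v
  \<comment> \<open>The 8 collects a factor 2 from \<open>1 / \<bar>u\<bar>\<close>, a factor 2 from
    the inner bound at distance \<open>\<epsilon> / 2\<close>, and a factor 2 from the derivative of
    the hyperbola.\<close>
  define w where "w v = 8 * W * exp ((9 * M + 5/8) + 18 * M * \<bar>v\<bar> - 3/8 * v ^ 4)" for v :: real
  have ev: "\<forall>\<^sub>F N in sequentially. good A M N \<and> good A' M' N \<and> 0 < \<epsilon> N \<and> \<epsilon> N \<le> \<delta>"
    using M(2) M'(2) \<epsilon>_pos \<epsilon>_less[OF \<delta>_pos(1)] by eventually_elim auto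
  have "(\<lambda>N. LINT v|lborel. s N v) \<longlonglongrightarrow> (LINT v|lborel. exp ((of_real e * pearcey_zeta v) ^ 4 / 4 - of_real \<xi> * (of_real e * pearcey_zeta v)) / (1 + of_real 0 * (of_real e * pearcey_zeta v)) * J v * (of_real e * zeta_deriv v))"
  proof (rule lint_dominated_convergence_eventually)
    show "integrable lborel w" unfolding w_def[abs_def] by (intro integrable_mult_right integrable_exp_quartic) auto
    show "\<forall>\<^sub>F N in sequentially. s N \<in> borel_measurable lborel \<and> (\<forall>v. norm (s N v) \<le> w v)"
      using ev
    proof eventually_elim
      case (elim N)
      then have g: "good A M N" "good A' M' N" and \<epsilon>0: "0 < \<epsilon> N" "\<epsilon> N \<le> \<delta>" by auto
      have "(\<lambda>v. inverse (of_real (\<epsilon> N)) * (indicator {- (\<delta> / \<epsilon> N)..\<delta> / \<epsilon> N} v *\<^sub>R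
         (F A A' N (1 + of_real (e * \<epsilon> N) * pearcey_zeta v) * (of_real (e * \<epsilon> N) * zeta_deriv v)))) \<in> borel_measurable borel"
        by (intro borel_measurable_times borel_measurable_const integral_Icc_eq_LINT(2)[OF main_continuous[OF e \<epsilon>0]])
      also have "(\<lambda>v. inverse (of_real (\<epsilon> N)) * (indicator {- (\<delta> / \<epsilon> N)..\<delta> / \<epsilon> N} v *\<^sub>R
         (F A A' N (1 + of_real (e * \<epsilon> N) * pearcey_zeta v) * (of_real (e * \<epsilon> N) * zeta_deriv v)))) = s N"
        unfolding s_def using \<epsilon>0 by (intro ext) (simp add: scaleR_conv_of_real field_simps)
      finally have "s N \<in> borel_measurable lborel" by simp
      moreover have "norm (s N v) \<le> w v" for v
      proof (cases "\<bar>v\<bar> \<le> \<delta> / \<epsilon> N")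
        case True
        let ?u = "1 + of_real (e * \<epsilon> N) * pearcey_zeta v"
        note r = hyperbola_range[OF \<epsilon>0 True]
        have hb: "norm (H A N ?u) \<le> exp (9 * M * (1 + 2 * \<bar>v\<bar>) + 5/8 - 3/8 * v ^ 4)"
          by (rule hyperbola_bound[OF g(1) e r(1)])
        have "norm (inner A' N ?u) \<le> \<epsilon> N / (\<epsilon> N / 2) * W" unfolding W_def
          using \<epsilon>0 by (intro inner_bound[OF g(2)] hyperbola_off_circle(1)[OF e \<epsilon>0(1) r(2)]) auto
        then have ib: "norm (inner A' N ?u) \<le> 2 * W" using \<epsilon>0 by simp
        have "1/2 \<le> norm ?u" by (rule hyperbola_off_circle(2)[OF e \<epsilon>0(1) r(2)])
        then have "norm (H A N ?u) / norm ?u \<le> exp (9 * M * (1 + 2 * \<bar>v\<bar>) + 5/8 - 3/8 * v ^ 4) / (1/2)"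
          using hb by (intro frac_le) auto
        then have "norm (H A N ?u) / norm ?u * norm (inner A' N ?u) * norm (of_real e * zeta_deriv v)
           \<le> exp (9 * M * (1 + 2 * \<bar>v\<bar>) + 5/8 - 3/8 * v ^ 4) / (1/2) * (2 * W) * 2"
          using ib norm_zeta_deriv[of v] e W0 by (intro mult_mono) (auto simp: norm_mult)
        then have "norm (s N v) \<le> exp (9 * M * (1 + 2 * \<bar>v\<bar>) + 5/8 - 3/8 * v ^ 4) / (1/2) * (2 * W) * 2"
          unfolding s_def F_def using True by (auto simp: norm_mult norm_divide indicator_def abs_le_iff)
        also have "\<dots> = w v" unfolding w_def by (simp add: algebra_simps)
        finally show ?thesis .
      next
        case False
        then have "v \<notin> {- (\<delta> / \<epsilon> N)..\<delta> / \<epsilon> N}" by auto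
        then show ?thesis unfolding s_def w_def using W0 by simp
      qed
      ultimately show ?case by simp
    qed
    fix v
    have "(\<lambda>N. H A N (1 + of_real (\<epsilon> N) * (of_real e * pearcey_zeta v)) / (1 + of_real (\<epsilon> N) * (of_real e * pearcey_zeta v))
        * inner A' N (1 + of_real (e * \<epsilon> N) * pearcey_zeta v) * (of_real e * zeta_deriv v))
      \<longlonglongrightarrow> exp ((of_real e * pearcey_zeta v) ^ 4 / 4 - of_real \<xi> * (of_real e * pearcey_zeta v)) / (1 + of_real 0 * (of_real e * pearcey_zeta v)) * J v * (of_real e * zeta_deriv v)"
      unfolding J_def by (intro tendsto_intros H_tendsto[OF dr] inner_tendsto[OF dr' e] \<epsilon>_lim) auto
    then show "(\<lambda>N. s N v) \<longlonglongrightarrow> exp ((of_real e * pearcey_zeta v) ^ 4 / 4 - of_real \<xi> * (of_real e * pearcey_zeta v)) / (1 + of_real 0 * (of_real e * pearcey_zeta v)) * J v * (of_real e * zeta_deriv v)"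
    proof (rule Lim_transform_eventually)
      have "\<forall>\<^sub>F N in sequentially. \<epsilon> N < \<delta> / (\<bar>v\<bar> + 1)" using \<delta>_pos by (intro \<epsilon>_less) (simp add: add_nonneg_pos)
      then show "\<forall>\<^sub>F N in sequentially. H A N (1 + of_real (\<epsilon> N) * (of_real e * pearcey_zeta v)) / (1 + of_real (\<epsilon> N) * (of_real e * pearcey_zeta v))
        * inner A' N (1 + of_real (e * \<epsilon> N) * pearcey_zeta v) * (of_real e * zeta_deriv v) = s N v"
        using \<epsilon>_pos
      proof eventually_elim
        case (elim N)
        have "\<epsilon> N * (\<bar>v\<bar> + 1) < \<delta>" using elim(1) by (simp add: field_simps)
        then have "\<bar>v\<bar> \<le> \<delta> / \<epsilon> N" using elim(2) by (simp add: field_simps)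
        then have "v \<in> {- (\<delta> / \<epsilon> N)..\<delta> / \<epsilon> N}" by auto
        moreover have eq: "1 + of_real (\<epsilon> N) * (of_real e * pearcey_zeta v) = 1 + of_real (e * \<epsilon> N) * pearcey_zeta v" by simp
        ultimately show ?case unfolding s_def F_def eq by simp
      qed
    qed
  qed
  also have "(LINT v|lborel. exp ((of_real e * pearcey_zeta v) ^ 4 / 4 - of_real \<xi> * (of_real e * pearcey_zeta v)) / (1 + of_real 0 * (of_real e * pearcey_zeta v)) * J v * (of_real e * zeta_deriv v))
    = (LINT v|lborel. LINT t|lborel. pearcey_integrand \<xi> \<eta> (of_real e * pearcey_zeta v) (\<i> * of_real t)
        * (of_real e * vector_derivative pearcey_zeta (at v)) * \<i>)"
  proof (rule Bochner_Integration.integral_cong[OF refl])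
    fix v
    have vd: "vector_derivative pearcey_zeta (at v) = zeta_deriv v"
      using pearcey_zeta_derivative by (rule vector_derivative_at)
    define C where "C = exp ((of_real e * pearcey_zeta v) ^ 4 / 4 - of_real \<xi> * (of_real e * pearcey_zeta v)) * (of_real e * zeta_deriv v)"
    have "(LINT t|lborel. pearcey_integrand \<xi> \<eta> (of_real e * pearcey_zeta v) (\<i> * of_real t)
        * (of_real e * vector_derivative pearcey_zeta (at v)) * \<i>) = (LINT t|lborel. C * (1 / exp ((\<i> * of_real t) ^ 4 / 4 - (\<i> * of_real t) * of_real \<eta>)
         * (1 / (of_real e * pearcey_zeta v - \<i> * of_real t)) * \<i>))"
      unfolding vd pearcey_integrand_def C_def by (simp add: mult_ac)
    also have "\<dots> = C * J v" unfolding J_def by (rule integral_mult_right_zero)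
    finally have eq: "(LINT t|lborel. pearcey_integrand \<xi> \<eta> (of_real e * pearcey_zeta v) (\<i> * of_real t)
        * (of_real e * vector_derivative pearcey_zeta (at v)) * \<i>) = C * J v" .
    show "exp ((of_real e * pearcey_zeta v) ^ 4 / 4 - of_real \<xi> * (of_real e * pearcey_zeta v)) / (1 + of_real 0 * (of_real e * pearcey_zeta v)) * J v * (of_real e * zeta_deriv v)
      = (LINT t|lborel. pearcey_integrand \<xi> \<eta> (of_real e * pearcey_zeta v) (\<i> * of_real t)
        * (of_real e * vector_derivative pearcey_zeta (at v)) * \<i>)" unfolding eq C_def by simp
  qed
  finally have lim: "(\<lambda>N. LINT v|lborel. s N v) \<longlonglongrightarrow> (LINT v|lborel. LINT t|lborel. pearcey_integrand \<xi> \<eta> (of_real e * pearcey_zeta v) (\<i> * of_real t)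
        * (of_real e * vector_derivative pearcey_zeta (at v)) * \<i>)" .
  show ?thesis
  proof (rule Lim_transform_eventually[OF lim])
    show "\<forall>\<^sub>F N in sequentially. (LINT v|lborel. s N v) = main_part A A' e N / of_real (\<epsilon> N)"
      using ev
    proof eventually_elim
      case (elim N)
      then have \<epsilon>0: "0 < \<epsilon> N" "\<epsilon> N \<le> \<delta>" by auto
      have "main_part A A' e N = (LINT v|lborel. of_real (\<epsilon> N) * s N v)"
        unfolding main_part_def integral_Icc_eq_LINT(1)[OF main_continuous[OF e \<epsilon>0]] s_def
        by (intro Bochner_Integration.integral_cong) (simp_all add: scaleR_conv_of_real mult_ac)
      then show ?case using \<epsilon>0 by simp
    qed
  qed
qed

end

section \<open>The descent contours\<close>

text \<open>The integral over \<open>p\<close> followed by its reversed mirror image, kept as a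
  difference so that it is additive over pieces of \<open>p\<close>, whose mirrored pairs need not
  form loops.\<close>

definition sym_int :: "(real \<Rightarrow> complex) \<Rightarrow> (complex \<Rightarrow> complex) \<Rightarrow> complex" where
  "sym_int p f = contour_integral p f - contour_integral (cnj \<circ> p) f"

text \<open>A length bound encoded by its effect on integrals, so that derivatives of the paths do
  not reappear in later estimates.\<close>

definition path_bound :: "(real \<Rightarrow> complex) \<Rightarrow> real \<Rightarrow> bool" where
  "path_bound p L \<longleftrightarrow> (\<forall>f K. f contour_integrable_on p \<longrightarrow> 0 \<le> K \<longrightarrow> (\<forall>z\<in>path_image p. norm (f z) \<le> K)
      \<longrightarrow> norm (contour_integral p f) \<le> L * K)"

lemma path_boundI:
  assumes "\<And>t. t \<in> {0..1} \<Longrightarrow> norm (vector_derivative p (at t)) \<le> L" shows "path_bound p L"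
  unfolding path_bound_def
proof (intro allI impI)
  fix f K assume f: "f contour_integrable_on p" and K: "0 \<le> K" "\<forall>z\<in>path_image p. norm (f z) \<le> K"
  have "norm (integral {0..1} (\<lambda>t. f (p t) * vector_derivative p (at t))) \<le> integral {0..1} (\<lambda>t::real. K * L)"
  proof (rule Henstock_Kurzweil_Integration.integral_norm_bound_integral)
    show "(\<lambda>t. f (p t) * vector_derivative p (at t)) integrable_on {0..1}"
      using f unfolding contour_integrable_on .
    fix t :: real assume t: "t \<in> {0..1}"
    then have "norm (f (p t)) \<le> K" using K unfolding path_image_def by auto
    then show "norm (f (p t) * vector_derivative p (at t)) \<le> K * L"
      unfolding norm_mult using assms[OF t] K by (intro mult_mono) auto
  qed auto
  then show "norm (contour_integral p f) \<le> L * K"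
    unfolding contour_integral_integral by (simp add: mult.commute)
qed

text \<open>Reflection reduces the mirror image to \<open>p\<close> itself: its integral is the
  conjugate of the integral of \<open>cnj \<circ> f \<circ> cnj\<close> over
  \<open>p\<close>.\<close>

lemma sym_int_bound:
  assumes p: "path_bound p L" "valid_path p" and f: "f contour_integrable_on p" "f contour_integrable_on (cnj \<circ> p)"
    and K: "0 \<le> K" "\<And>z. z \<in> path_image p \<Longrightarrow> norm (f z) \<le> K \<and> norm (f (cnj z)) \<le> K"
  shows "norm (sym_int p f) \<le> 2 * L * K"
proof -
  have 1: "norm (contour_integral p f) \<le> L * K" using p f K unfolding path_bound_def by blast
  have "(cnj \<circ> f \<circ> cnj) contour_integrable_on p" using f(2) contour_integrable_on_compose_cnj_iff[OF p(2)] by simp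
  then have "norm (contour_integral p (cnj \<circ> f \<circ> cnj)) \<le> L * K"
    using p K unfolding path_bound_def by simp
  then have 2: "norm (contour_integral (cnj \<circ> p) f) \<le> L * K" unfolding contour_integral_cnj[OF p(2)] by simp
  show ?thesis unfolding sym_int_def using norm_triangle_ineq4[of "contour_integral p f" "contour_integral (cnj \<circ> p) f"] 1 2 by linarith
qed

lemma path_bound_linepath: "path_bound (linepath a b) (norm (b - a))"
  by (rule path_boundI) (simp add: vector_derivative_linepath_at)

lemma path_bound_part_circlepath: "path_bound (part_circlepath z r s t) (\<bar>r\<bar> * \<bar>t - s\<bar>)"
  by (rule path_boundI) (simp add: vector_derivative_part_circlepath norm_mult flip: of_real_diff)

lemma cnj_join: "cnj \<circ> (p +++ q) = (cnj \<circ> p) +++ (cnj \<circ> q)"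
  by (auto simp: joinpaths_def)

lemma sym_int_join:
  assumes "valid_path p" "valid_path q" "pathfinish p = pathstart q"
    and "f contour_integrable_on p" "f contour_integrable_on (cnj \<circ> p)"
    and "f contour_integrable_on q" "f contour_integrable_on (cnj \<circ> q)"
  shows "sym_int (p +++ q) f = sym_int p f + sym_int q f"
  unfolding sym_int_def cnj_join using assms valid_path_cnj[of p] valid_path_cnj[of q]
  by (simp add: contour_integral_join)

definition level_path :: "real \<Rightarrow> real \<Rightarrow> real \<Rightarrow> real \<Rightarrow> complex" where
  "level_path e x1 R t = level_curve (e * (x1 + (R - x1) * t))"

text \<open>Runs from the end of the level curve to the real axis, towards smaller real parts
  exactly if \<open>\<tau> * e = 1\<close>. This direction makes the change of the real part
  favourable to the nodes with \<open>\<tau> T \<ge> 0\<close> on the outer arc and to those with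
  \<open>\<tau> T \<le> 0\<close> on the inner one, and it decides which poles the loop
  encloses.\<close>

definition arc_path :: "real \<Rightarrow> real \<Rightarrow> real \<Rightarrow> real \<Rightarrow> complex" where
  "arc_path e R \<tau> = part_circlepath 0 (exp (e * R)) (arccos (level_re (e * R) / exp (e * R))) (if \<tau> * e = 1 then pi else 0)"

text \<open>The argument \<open>e * V * t\<close> makes either branch start on the real axis and
  rise into the upper half-plane.\<close>

definition hyp_path :: "real \<Rightarrow> real \<Rightarrow> real \<Rightarrow> real \<Rightarrow> complex" where
  "hyp_path e \<epsilon> V t = 1 + of_real (e * \<epsilon>) * pearcey_zeta (e * V * t)"

text \<open>Away from \<open>x = 0\<close> the radicand of the imaginary part is positive, so the
  curve is smooth there; both halves of the path stay away from this point because they start at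
  \<open>\<bar>x\<bar> = x1\<close>.\<close>

lemma level_path_valid:
  assumes e: "e = 1 \<or> e = -1" and x: "0 < x1" "x1 \<le> R"
  shows "valid_path (level_path e x1 R)" "\<exists>L. path_bound (level_path e x1 R) L"
    "pathstart (level_path e x1 R) = level_curve (e * x1)" "pathfinish (level_path e x1 R) = level_curve (e * R)"
    "\<And>z. z \<in> path_image (level_path e x1 R) \<Longrightarrow> \<exists>y. z = level_curve (e * y) \<and> x1 \<le> y \<and> y \<le> R"
proof -
  define l' where "l' x = (cosh x * sinh x - x) / (sinh x)\<^sup>2" for x :: real
  define D where "D x = Complex (1 + l' x) ((exp (2 * x) - level_re x * (1 + l' x)) / sqrt (exp (2 * x) - (level_re x)\<^sup>2))" for x
  have der: "(level_curve has_vector_derivative D x) (at x)" if "x \<noteq> 0" for x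
  proof -
    have dk: "(level_re has_real_derivative 1 + l' x) (at x)"
      unfolding level_re_def[abs_def] l'_def by (auto intro!: derivative_eq_intros DERIV_level_lam that)
    have pos: "0 < exp (2 * x) - (level_re x)\<^sup>2" using level_re_less(3)[OF that] by simp
    have "((\<lambda>x. exp (2 * x) - (level_re x)\<^sup>2) has_real_derivative 2 * (exp (2 * x) - level_re x * (1 + l' x))) (at x)"
      by (auto intro!: derivative_eq_intros dk simp: algebra_simps)
    note d = DERIV_chain2[OF DERIV_real_sqrt[OF pos] this]
    have half: "inverse s / 2 * (2 * a) = a / s" for s a :: real by (simp add: inverse_eq_divide)
    from d
    have "((\<lambda>x. sqrt (exp (2 * x) - (level_re x)\<^sup>2)) has_real_derivative (exp (2 * x) - level_re x * (1 + l' x)) / sqrt (exp (2 * x) - (level_re x)\<^sup>2)) (at x)"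
      by (simp only: half)
    then show ?thesis unfolding level_curve_def[abs_def] D_def using dk by (intro has_vector_derivative_Complex)
  qed
  have contD: "continuous_on (- {0}) D"
  proof -
    have cl: "continuous_on (- {0}) l'" unfolding l'_def[abs_def] by (intro continuous_intros) auto
    have ck: "continuous_on (- {0}) level_re" unfolding level_re_def level_lam_def by (intro continuous_intros) auto
    have "sqrt (exp (2 * x) - (level_re x)\<^sup>2) \<noteq> 0" if "x \<noteq> 0" for x using level_re_less(3)[OF that] by simp
    then show ?thesis unfolding D_def[abs_def] by (intro continuous_intros cl ck) auto
  qed
  have nz: "e * (x1 + (R - x1) * t) \<noteq> 0" if "t \<in> {0..1}" for t
    using e x that by (auto simp: add_nonneg_eq_0_iff add_pos_nonneg)
  have derp: "(level_path e x1 R has_vector_derivative (e * (R - x1)) *\<^sub>R D (e * (x1 + (R - x1) * t))) (at t)" if "t \<in> {0..1}" for t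
  proof -
    have "((\<lambda>t. e * (x1 + (R - x1) * t)) has_vector_derivative e * (R - x1)) (at t)"
      unfolding has_real_derivative_iff_has_vector_derivative[symmetric] by (auto intro!: derivative_eq_intros)
    from vector_diff_chain_at[OF this der[OF nz[OF that]]]
    show ?thesis unfolding level_path_def[abs_def] by (simp add: o_def)
  qed
  have cont: "continuous_on {0..1} (\<lambda>t. (e * (R - x1)) *\<^sub>R D (e * (x1 + (R - x1) * t)))"
    using nz by (intro continuous_intros continuous_on_compose2[OF contD]) auto
  have "level_path e x1 R C1_differentiable_on {0..1}"
    unfolding C1_differentiable_on_def using derp cont
    by (intro exI[of _ "\<lambda>t. (e * (R - x1)) *\<^sub>R D (e * (x1 + (R - x1) * t))"] conjI ballI)
  then show "valid_path (level_path e x1 R)" unfolding valid_path_def by (rule C1_differentiable_imp_piecewise)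
  obtain L where Lb: "\<And>t. t \<in> {0..1} \<Longrightarrow> norm ((e * (R - x1)) *\<^sub>R D (e * (x1 + (R - x1) * t))) \<le> L"
  proof -
    have "bounded ((\<lambda>t. (e * (R - x1)) *\<^sub>R D (e * (x1 + (R - x1) * t))) ` {0..1})"
      using cont compact_Icc by (intro compact_imp_bounded compact_continuous_image)
    then show ?thesis using that unfolding bounded_iff by blast
  qed
  have "path_bound (level_path e x1 R) L"
  proof (rule path_boundI)
    fix t :: real assume t: "t \<in> {0..1}"
    show "norm (vector_derivative (level_path e x1 R) (at t)) \<le> L"
      unfolding vector_derivative_at[OF derp[OF t]] by (rule Lb[OF t])
  qed
  then show "\<exists>L. path_bound (level_path e x1 R) L" ..
  show "pathstart (level_path e x1 R) = level_curve (e * x1)" "pathfinish (level_path e x1 R) = level_curve (e * R)"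
    unfolding pathstart_def pathfinish_def level_path_def by simp_all
  show "\<exists>y. z = level_curve (e * y) \<and> x1 \<le> y \<and> y \<le> R" if zp: "z \<in> path_image (level_path e x1 R)" for z
  proof -
    obtain t where t: "0 \<le> t" "t \<le> 1" "z = level_curve (e * (x1 + (R - x1) * t))"
      using zp unfolding path_image_def level_path_def by auto
    have "(R - x1) * t \<le> (R - x1) * 1" using x t by (intro mult_left_mono) auto
    then show ?thesis using t x by (intro exI[of _ "x1 + (R - x1) * t"]) auto
  qed
qed

lemma arc_path_props:
  assumes e: "e = 1 \<or> e = -1" and \<tau>: "\<tau> = 1 \<or> \<tau> = -1" and R: "0 < R"
  shows "pathstart (arc_path e R \<tau>) = level_curve (e * R)" "pathfinish (arc_path e R \<tau>) = of_real (- \<tau> * e * exp (e * R))"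
    "\<And>z. z \<in> path_image (arc_path e R \<tau>) \<Longrightarrow> 0 \<le> Im z \<and> norm z = exp (e * R) \<and> \<tau> * e * (Re z - level_re (e * R)) \<le> 0"
proof -
  have nz: "e * R \<noteq> 0" using e R by auto
  define c where "c = level_re (e * R) / exp (e * R)"
  have c: "0 < c" "c < 1" unfolding c_def using level_re_less[OF nz] by auto
  define \<theta> where "\<theta> = arccos c"
  have \<theta>: "cos \<theta> = c" "0 \<le> \<theta>" "\<theta> \<le> pi" unfolding \<theta>_def using c by (auto simp: arccos_lbound arccos_ubound)
  have ek: "exp (e * R) * c = level_re (e * R)" unfolding c_def by simp
  have "sin \<theta> = sqrt (1 - c\<^sup>2)" unfolding \<theta>_def using c by (intro sin_arccos) auto
  then have "exp (e * R) * sin \<theta> = sqrt ((exp (e * R))\<^sup>2 * (1 - c\<^sup>2))" by (simp add: real_sqrt_mult)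
  also have "(exp (e * R))\<^sup>2 * (1 - c\<^sup>2) = exp (2 * (e * R)) - (level_re (e * R))\<^sup>2"
    unfolding ek[symmetric] exp_double by (simp add: power_mult_distrib right_diff_distrib)
  finally have es: "exp (e * R) * sin \<theta> = sqrt (exp (2 * (e * R)) - (level_re (e * R))\<^sup>2)" .
  have arc: "arc_path e R \<tau> = part_circlepath 0 (exp (e * R)) \<theta> (if \<tau> * e = 1 then pi else 0)"
    unfolding arc_path_def \<theta>_def c_def ..
  show "pathstart (arc_path e R \<tau>) = level_curve (e * R)"
    unfolding arc level_curve_def using ek es \<theta>(1) by (simp add: cis_conv_exp[symmetric] complex_eq_iff)
  show "pathfinish (arc_path e R \<tau>) = of_real (- \<tau> * e * exp (e * R))"
    unfolding arc using e \<tau> by (auto simp: exp_pi_i')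
  fix z assume "z \<in> path_image (arc_path e R \<tau>)"
  then obtain y where y: "y \<in> closed_segment \<theta> (if \<tau> * e = 1 then pi else 0)" "z = exp (e * R) * cis y"
    unfolding arc path_image_part_circlepath' by auto
  have y': "0 \<le> y" "y \<le> pi" using y(1) \<theta> by (auto simp: closed_segment_eq_real_ivl split: if_splits)
  have "0 \<le> Im z" unfolding y(2) using sin_ge_zero[OF y'] by simp
  moreover have "norm z = exp (e * R)" unfolding y(2) by (simp add: norm_mult)
  moreover have "\<tau> * e * (Re z - level_re (e * R)) \<le> 0"
  proof -
    have re: "Re z - level_re (e * R) = exp (e * R) * (cos y - cos \<theta>)" unfolding y(2) \<theta>(1) using ek by (simp add: right_diff_distrib)
    show ?thesis
    proof (cases "\<tau> * e = 1")
      case True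
      then have "cos y \<le> cos \<theta>" using y(1) y' \<theta> by (intro cos_monotone_0_pi_le) (auto simp: closed_segment_eq_real_ivl)
      then show ?thesis unfolding re True by (simp add: mult_nonneg_nonpos)
    next
      case False
      then have m: "\<tau> * e = -1" using e \<tau> by auto
      have "cos \<theta> \<le> cos y" using y(1) y' \<theta> False by (intro cos_monotone_0_pi_le) (auto simp: closed_segment_eq_real_ivl split: if_splits)
      then show ?thesis unfolding re m by simp
    qed
  qed
  ultimately show "0 \<le> Im z \<and> norm z = exp (e * R) \<and> \<tau> * e * (Re z - level_re (e * R)) \<le> 0" by blast
qed

lemma hyp_path_props:
  assumes e: "e = 1 \<or> e = -1" and V: "0 \<le> V"
  shows "valid_path (hyp_path e \<epsilon> V)" "pathstart (hyp_path e \<epsilon> V) = of_real (1 + e * \<epsilon>)"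
    "pathfinish (hyp_path e \<epsilon> V) = 1 + Complex (e * \<epsilon> * sqrt (1 + V\<^sup>2)) (\<epsilon> * V)"
    "\<And>z. z \<in> path_image (hyp_path e \<epsilon> V) \<Longrightarrow> \<exists>v. z = 1 + of_real (e * \<epsilon>) * pearcey_zeta (e * v) \<and> 0 \<le> v \<and> v \<le> V"
    "\<And>t. (hyp_path e \<epsilon> V has_vector_derivative of_real (e * \<epsilon>) * ((e * V) *\<^sub>R zeta_deriv (e * V * t))) (at t)"
proof -
  show der: "(hyp_path e \<epsilon> V has_vector_derivative of_real (e * \<epsilon>) * ((e * V) *\<^sub>R zeta_deriv (e * V * t))) (at t)" for t
  proof -
    have "((\<lambda>t. e * V * t) has_vector_derivative e * V) (at t)"
      unfolding has_real_derivative_iff_has_vector_derivative[symmetric] by (auto intro!: derivative_eq_intros)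
    from vector_diff_chain_at[OF this pearcey_zeta_derivative]
    have "((\<lambda>t. pearcey_zeta (e * V * t)) has_vector_derivative (e * V) *\<^sub>R zeta_deriv (e * V * t)) (at t)" by (simp add: o_def)
    then have "((\<lambda>t. 1 + of_real (e * \<epsilon>) * pearcey_zeta (e * V * t)) has_vector_derivative 0 + of_real (e * \<epsilon>) * ((e * V) *\<^sub>R zeta_deriv (e * V * t))) (at t)"
      by (intro has_vector_derivative_add has_vector_derivative_const has_vector_derivative_mult_right)
    then show ?thesis unfolding hyp_path_def[abs_def] by simp
  qed
  have "continuous_on {0..1} (\<lambda>t. of_real (e * \<epsilon>) * ((e * V) *\<^sub>R zeta_deriv (e * V * t)))"
    by (intro continuous_intros continuous_on_compose2[OF zeta_deriv_continuous[of UNIV]]) auto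
  then have "hyp_path e \<epsilon> V C1_differentiable_on {0..1}"
    unfolding C1_differentiable_on_def using der
    by (intro exI[of _ "\<lambda>t. of_real (e * \<epsilon>) * ((e * V) *\<^sub>R zeta_deriv (e * V * t))"] conjI ballI)
  then show "valid_path (hyp_path e \<epsilon> V)" unfolding valid_path_def by (rule C1_differentiable_imp_piecewise)
  show "pathstart (hyp_path e \<epsilon> V) = of_real (1 + e * \<epsilon>)"
    "pathfinish (hyp_path e \<epsilon> V) = 1 + Complex (e * \<epsilon> * sqrt (1 + V\<^sup>2)) (\<epsilon> * V)"
    unfolding pathstart_def pathfinish_def hyp_path_def pearcey_zeta_def using e by (auto simp: complex_eq_iff)
  show "\<exists>v. z = 1 + of_real (e * \<epsilon>) * pearcey_zeta (e * v) \<and> 0 \<le> v \<and> v \<le> V" if z: "z \<in> path_image (hyp_path e \<epsilon> V)" for z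
  proof -
    obtain t where "0 \<le> t" "t \<le> 1" "z = 1 + of_real (e * \<epsilon>) * pearcey_zeta (e * V * t)"
      using z unfolding path_image_def hyp_path_def by auto
    then show ?thesis using V by (intro exI[of _ "V * t"]) (auto simp: mult_ac mult_left_le)
  qed
qed

text \<open>Half a branch and its mirror image assemble to the whole branch, traversed upwards. The
  parametrization of the left branch by the negative of \<open>pearcey_zeta\<close> runs downwards,
  hence the factor \<open>e\<close>.\<close>

lemma hyp_path_sym_int:
  assumes e: "e = 1 \<or> e = -1" and V: "0 < V"
    and c: "continuous_on {-V..V} (\<lambda>v. f (1 + of_real (e * \<epsilon>) * pearcey_zeta v) * (of_real (e * \<epsilon>) * zeta_deriv v))"
  shows "of_real e * sym_int (hyp_path e \<epsilon> V) f
     = integral {-V..V} (\<lambda>v. f (1 + of_real (e * \<epsilon>) * pearcey_zeta v) * (of_real (e * \<epsilon>) * zeta_deriv v))"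
proof -
  define k where "k v = f (1 + of_real (e * \<epsilon>) * pearcey_zeta v) * (of_real (e * \<epsilon>) * zeta_deriv v)" for v
  have ck: "continuous_on {-V..V} k" using c unfolding k_def .
  have sub: "integral {0..1} (\<lambda>t. V *\<^sub>R k (V * t)) = integral {0..V} k"
  proof -
    have "((\<lambda>t. V *\<^sub>R k (V * t)) has_integral (integral {V * 0..V * 1} k)) {0..1}"
    proof (rule has_integral_substitution[where c = 0 and d = V])
      show "continuous_on {0..V} k" using ck V by (auto elim: continuous_on_subset)
      show "((*) V has_real_derivative V) (at x within {0..1})" for x by (auto intro!: derivative_eq_intros)
    qed (use V in \<open>auto simp: mult_left_le\<close>)
    from integral_unique[OF this] show ?thesis by (simp only: mult_zero_right mult_1_right)
  qed
  have sub': "integral {0..1} (\<lambda>t. V *\<^sub>R k (- (V * t))) = integral {-V..0} k"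
  proof -
    have "((\<lambda>t. V *\<^sub>R k (- (V * t))) has_integral (integral {V * 0..V * 1} (\<lambda>v. k (- v)))) {0..1}"
    proof (rule has_integral_substitution[where c = 0 and d = V])
      show "continuous_on {0..V} (\<lambda>v. k (- v))"
        by (rule continuous_on_compose2[OF ck]) (auto intro!: continuous_intros)
      show "((*) V has_real_derivative V) (at x within {0..1})" for x by (auto intro!: derivative_eq_intros)
    qed (use V in \<open>auto simp: mult_left_le\<close>)
    from integral_unique[OF this] have "integral {0..1} (\<lambda>t. V *\<^sub>R k (- (V * t))) = integral {0..V} (\<lambda>v. k (- v))"
      by (simp only: mult_zero_right mult_1_right)
    also have "\<dots> = integral {-V..0} k" using Henstock_Kurzweil_Integration.integral_reflect_real[of 0 "-V" k] by simp
    finally show ?thesis .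
  qed
  have "integral {-V..0} k + integral {0..V} k = integral {-V..V} k"
    using V ck by (intro Henstock_Kurzweil_Integration.integral_combine integrable_continuous_interval) auto
  moreover have "contour_integral (hyp_path e \<epsilon> V) f = of_real e * integral {0..1} (\<lambda>t. V *\<^sub>R k (e * (V * t)))"
  proof -
    have "contour_integral (hyp_path e \<epsilon> V) f = integral {0..1} (\<lambda>t. of_real e * (V *\<^sub>R k (e * (V * t))))"
      unfolding contour_integral_integral
    proof (rule Henstock_Kurzweil_Integration.integral_cong)
      fix t :: real
      show "f (hyp_path e \<epsilon> V t) * vector_derivative (hyp_path e \<epsilon> V) (at t) = of_real e * (V *\<^sub>R k (e * (V * t)))"
        unfolding vector_derivative_at[OF hyp_path_props(5)[OF e less_imp_le[OF V]]] unfolding k_def hyp_path_def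
        by (simp add: scaleR_conv_of_real mult_ac)
    qed
    then show ?thesis by simp
  qed
  moreover have "contour_integral (cnj \<circ> hyp_path e \<epsilon> V) f = - (of_real e * integral {0..1} (\<lambda>t. V *\<^sub>R k (- (e * (V * t)))))"
  proof -
    have cz: "cnj (pearcey_zeta v) = pearcey_zeta (- v)" "cnj (zeta_deriv v) = - zeta_deriv (- v)" for v
      unfolding pearcey_zeta_def zeta_deriv_def by (simp_all add: complex_eq_iff)
    have vd: "vector_derivative (cnj \<circ> hyp_path e \<epsilon> V) (at t) = cnj (of_real (e * \<epsilon>) * ((e * V) *\<^sub>R zeta_deriv (e * V * t)))" for t
      unfolding o_def by (intro vector_derivative_at has_vector_derivative_cnj hyp_path_props(5)[OF e less_imp_le[OF V]])
    have "contour_integral (cnj \<circ> hyp_path e \<epsilon> V) f = integral {0..1} (\<lambda>t. - of_real e * (V *\<^sub>R k (- (e * (V * t)))))"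
      unfolding contour_integral_integral
    proof (rule Henstock_Kurzweil_Integration.integral_cong)
      fix t :: real
      show "f ((cnj \<circ> hyp_path e \<epsilon> V) t) * vector_derivative (cnj \<circ> hyp_path e \<epsilon> V) (at t) = - of_real e * (V *\<^sub>R k (- (e * (V * t))))"
        unfolding vd unfolding k_def hyp_path_def
        by (simp add: scaleR_conv_of_real mult_ac cz)
    qed
    then show ?thesis by simp
  qed
  ultimately show ?thesis unfolding sym_int_def k_def[symmetric] using e sub sub'
    by (auto simp: algebra_simps)
qed

text \<open>As \<open>x\<close> tends to 0, the squared ratio of imaginary to real displacement
  tends to 1/3. This lies strictly between 1/4 and 1, the bounds that define the sector.\<close>

lemma level_start:
  assumes "0 < \<delta>"
  obtains x1 where "0 < x1" "\<And>e. e = 1 \<or> e = -1 \<Longrightarrow> 0 < e * (level_re (e * x1) - 1) \<and>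
     e * (level_re (e * x1) - 1) / 2 \<le> Im (level_curve (e * x1)) \<and> Im (level_curve (e * x1)) \<le> e * (level_re (e * x1) - 1)
     \<and> norm (level_curve (e * x1) - 1) \<le> \<delta>"
proof -
  have ev: "\<forall>\<^sub>F x in at_right 0. 0 < e * (level_re (e * x) - 1) \<and>
     e * (level_re (e * x) - 1) / 2 \<le> Im (level_curve (e * x)) \<and> Im (level_curve (e * x)) \<le> e * (level_re (e * x) - 1)
     \<and> norm (level_curve (e * x) - 1) \<le> \<delta>" if e: "e = 1 \<or> e = -1" for e
  proof -
    have lim: "((\<lambda>x::real. (exp (2 * x) - (x + x * cosh x / sinh x)\<^sup>2) / (x + x * cosh x / sinh x - 1)\<^sup>2) \<longlongrightarrow> 1/3) (at_right 0)"
      "((\<lambda>x::real. (exp (- 2 * x) - (x * cosh x / sinh x - x)\<^sup>2) / (x * cosh x / sinh x - x - 1)\<^sup>2) \<longlongrightarrow> 1/3) (at_right 0)"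
      "((\<lambda>x::real. (x + x * cosh x / sinh x - 1) / x) \<longlongrightarrow> 1) (at_right 0)"
      "((\<lambda>x::real. (1 - (x * cosh x / sinh x - x)) / x) \<longlongrightarrow> 1) (at_right 0)"
      "((\<lambda>x::real. x + x * cosh x / sinh x - 1) \<longlongrightarrow> 0) (at_right 0)"
      "((\<lambda>x::real. 1 - (x * cosh x / sinh x - x)) \<longlongrightarrow> 0) (at_right 0)"
      by real_asymp+
    define X where "X x = e * (level_re (e * x) - 1)" for x
    have l1: "((\<lambda>x. (exp (2 * (e * x)) - (level_re (e * x))\<^sup>2) / (X x)\<^sup>2) \<longlongrightarrow> 1/3) (at_right 0)"
      using e lim(1,2) unfolding X_def level_re_def level_lam_def by (auto simp: power2_commute algebra_simps)
    have l2: "((\<lambda>x. X x / x) \<longlongrightarrow> 1) (at_right 0)"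
      using e lim(3,4) unfolding X_def level_re_def level_lam_def by (auto simp: algebra_simps)
    have l3: "(X \<longlongrightarrow> 0) (at_right 0)"
      using e lim(5,6) unfolding X_def[abs_def] level_re_def level_lam_def by (auto simp: algebra_simps)
    have "\<forall>\<^sub>F x in at_right 0. 0 < x \<and> 0 < X x / x \<and> 1/4 < (exp (2 * (e * x)) - (level_re (e * x))\<^sup>2) / (X x)\<^sup>2
       \<and> (exp (2 * (e * x)) - (level_re (e * x))\<^sup>2) / (X x)\<^sup>2 < 1 \<and> X x < \<delta> / 2"
      using order_tendstoD(1)[OF l1, of "1/4"] order_tendstoD(2)[OF l1, of 1] order_tendstoD(1)[OF l2, of 0]
        order_tendstoD(2)[OF l3, of "\<delta> / 2"] assms eventually_at_right_less[of "0::real"]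
      by (simp add: eventually_conj_iff)
    then show ?thesis
    proof eventually_elim
      case (elim x)
      then have X: "0 < X x" by (auto simp: zero_less_divide_iff)
      have nz: "e * x \<noteq> 0" using e elim by auto
      define Y where "Y = Im (level_curve (e * x))"
      have Y: "0 < Y" "Y\<^sup>2 = exp (2 * (e * x)) - (level_re (e * x))\<^sup>2"
        unfolding Y_def using level_curve_props(2)[OF nz] level_re_less(3)[OF nz] by (simp_all add: level_curve_def)
      have "1/4 * (X x)\<^sup>2 < Y\<^sup>2" "Y\<^sup>2 < 1 * (X x)\<^sup>2" using elim X unfolding Y(2) by (simp_all add: field_simps)
      then have "(X x / 2)\<^sup>2 \<le> Y\<^sup>2" "Y\<^sup>2 \<le> (X x)\<^sup>2" by (simp_all add: power_divide)
      then have xy: "X x / 2 \<le> Y" "Y \<le> X x" using X Y(1) by (simp_all add: power2_le_iff_abs_le abs_le_square_iff[symmetric])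
      have "norm (level_curve (e * x) - 1) \<le> \<bar>Re (level_curve (e * x) - 1)\<bar> + \<bar>Im (level_curve (e * x) - 1)\<bar>" by (rule cmod_le)
      also have "Re (level_curve (e * x) - 1) = e * X x" unfolding X_def using level_curve_props(1)[OF nz] e by auto
      also have "\<bar>e * X x\<bar> + \<bar>Im (level_curve (e * x) - 1)\<bar> \<le> \<delta>" using e X xy Y(1) elim by (auto simp: Y_def[symmetric])
      finally have "norm (level_curve (e * x) - 1) \<le> \<delta>" .
      then show ?case using X xy unfolding X_def Y_def by blast
    qed
  qed
  define Q where "Q e x \<longleftrightarrow> 0 < e * (level_re (e * x) - 1) \<and>
     e * (level_re (e * x) - 1) / 2 \<le> Im (level_curve (e * x)) \<and> Im (level_curve (e * x)) \<le> e * (level_re (e * x) - 1)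
     \<and> norm (level_curve (e * x) - 1) \<le> \<delta>" for e x
  have "\<forall>\<^sub>F x in at_right (0::real). 0 < x" by (rule eventually_at_right_less)
  moreover have "\<forall>\<^sub>F x in at_right 0. Q 1 x" unfolding Q_def by (rule ev) simp
  moreover have "\<forall>\<^sub>F x in at_right 0. Q (-1) x" unfolding Q_def by (rule ev) simp
  ultimately have "\<forall>\<^sub>F x in at_right 0. 0 < x \<and> Q 1 x \<and> Q (-1) x" by (intro eventually_conj)
  then obtain x where x: "0 < x \<and> Q 1 x \<and> Q (-1) x"
    using eventually_happens'[OF trivial_limit_at_right_real] by blast
  show ?thesis
  proof (rule that)
    show "0 < x" using x by blast
    fix e :: real assume "e = 1 \<or> e = -1"
    then have "Q e x" using x by blast
    then show "0 < e * (level_re (e * x) - 1) \<and>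
     e * (level_re (e * x) - 1) / 2 \<le> Im (level_curve (e * x)) \<and> Im (level_curve (e * x)) \<le> e * (level_re (e * x) - 1)
     \<and> norm (level_curve (e * x) - 1) \<le> \<delta>" unfolding Q_def .
  qed
qed

text \<open>Adds the contour parameters that are the same for all \<open>N\<close>: the level curve
  is followed for \<open>\<bar>x\<bar>\<close> from \<open>x1\<close> to \<open>R\<close>,
  \<open>c\<close> is its gain, \<open>start\<close> places its first point in the sector, and the
  last two conditions make the closing arcs harmless.\<close>

locale contour_setup = node_array I P \<epsilon> B D \<mu> \<tau>
  for I :: "nat \<Rightarrow> 'i set" and P :: "nat \<Rightarrow> 'i \<Rightarrow> real" and \<epsilon> :: "nat \<Rightarrow> real" and B D \<mu> \<tau> :: real +
  fixes x1 R c :: real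
  assumes x1: "0 < x1" and xR: "x1 \<le> R" and c0: "0 < c"
    and start: "\<And>e. e = 1 \<or> e = -1 \<Longrightarrow> 0 < e * (level_re (e * x1) - 1) \<and>
     e * (level_re (e * x1) - 1) / 2 \<le> Im (level_curve (e * x1)) \<and> Im (level_curve (e * x1)) \<le> e * (level_re (e * x1) - 1)
     \<and> norm (level_curve (e * x1) - 1) \<le> 2 * \<delta>"
    and gain: "\<And>p x. \<lbrakk>\<bar>p\<bar> \<le> B; x1 \<le> \<bar>x\<bar>\<rbrakk> \<Longrightarrow> c * (tw p)\<^sup>2 \<le> level_gain p x"
    and R1: "2 * (1 + B) / \<mu> \<le> exp R" and R2: "8 * exp (- R) / \<mu>\<^sup>2 * (B * (1 + B) * D) \<le> c / 4"
begin

definition seg :: "real \<Rightarrow> nat \<Rightarrow> real \<Rightarrow> complex" where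
  "seg e N = linepath (pathfinish (hyp_path e (\<epsilon> N) (\<delta> / \<epsilon> N))) (level_curve (e * x1))"

definition upper :: "real \<Rightarrow> nat \<Rightarrow> real \<Rightarrow> complex" where
  "upper e N = hyp_path e (\<epsilon> N) (\<delta> / \<epsilon> N) +++ (seg e N +++ (level_path e x1 R +++ arc_path e R \<tau>))"

text \<open>A lower bound for the horizontal distance from 1 along both joining segments, read off
  at their endpoints.\<close>

definition \<rho> :: real where
  "\<rho> = min \<delta> (min (level_re x1 - 1) (1 - level_re (- x1)))"

lemma \<rho>_pos: "0 < \<rho>"
  unfolding \<rho>_def using \<delta>_pos start[of 1] start[of "-1"] by simp

lemma R0: "0 < R" using x1 xR by linarith

lemma two_delta: "2 * \<delta> = 1 / (3072 * (1 + B))"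
proof -
  have "2 * (1 / (6144 * y)) = 1 / (3072 * y)" for y :: real by simp
  then show ?thesis unfolding \<delta>_def .
qed

text \<open>The sector is a convex cone with vertex 1, so the endpoints decide. The end of the
  hyperbola has imaginary part \<open>\<delta>\<close> and a horizontal displacement between
  \<open>\<delta>\<close> and \<open>2 * \<delta>\<close>; the start of the level curve is covered
  by \<open>start\<close>.\<close>

lemma seg_sector:
  assumes e: "e = 1 \<or> e = -1" and \<epsilon>0: "0 < \<epsilon> N" "\<epsilon> N \<le> \<delta>" and z: "z \<in> path_image (seg e N)"
  obtains X where "e * Re (z - 1) = X" "\<rho> \<le> X" "X / 2 \<le> Im z" "Im z \<le> X" "norm (z - 1) \<le> 2 * \<delta>"
proof -
  define V where "V = \<delta> / \<epsilon> N"
  define h where "h = \<epsilon> N * sqrt (1 + V\<^sup>2)"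
  define d1 where "d1 = Complex (e * h) \<delta>"
  define d2 where "d2 = level_curve (e * x1) - 1"
  have V0: "0 \<le> V" unfolding V_def using \<epsilon>0 \<delta>_pos by simp
  have eV: "\<epsilon> N * V = \<delta>" unfolding V_def using \<epsilon>0 by simp
  have h2: "h\<^sup>2 = \<epsilon> N ^ 2 + \<delta>\<^sup>2"
    unfolding h_def eV[symmetric] by (simp add: power_mult_distrib add_nonneg_nonneg distrib_left)
  have h0: "0 \<le> h" unfolding h_def using \<epsilon>0 by simp
  have e2: "\<epsilon> N ^ 2 \<le> \<delta>\<^sup>2" using \<epsilon>0 by (intro power_mono) auto
  have h1: "\<delta> \<le> h" by (rule power2_le_imp_le) (use h2 h0 in auto)
  have d4: "(2 * \<delta>)\<^sup>2 = 4 * \<delta>\<^sup>2" "0 \<le> \<delta>\<^sup>2" by (simp_all add: power_mult_distrib)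
  then have "h\<^sup>2 \<le> (2 * \<delta>)\<^sup>2" unfolding h2 using e2 by linarith
  then have h3: "h \<le> 2 * \<delta>" by (rule power2_le_imp_le) (use \<delta>_pos in simp)
  have nd1: "norm d1 \<le> 2 * \<delta>"
  proof (rule power2_le_imp_le)
    have "(norm d1)\<^sup>2 = h\<^sup>2 + \<delta>\<^sup>2" unfolding d1_def cmod_power2 using e by auto
    then show "(norm d1)\<^sup>2 \<le> (2 * \<delta>)\<^sup>2" unfolding h2 using e2 d4 by linarith
  qed (use \<delta>_pos in simp)
  have pf: "pathfinish (hyp_path e (\<epsilon> N) V) = 1 + d1"
    unfolding hyp_path_props(3)[OF e V0] d1_def h_def eV by (simp add: mult.assoc)
  obtain t where t: "0 \<le> t" "t \<le> 1" "z = linepath (1 + d1) (1 + d2) t"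
    using z unfolding seg_def V_def[symmetric] pf d2_def path_image_def by auto
  have zd: "z - 1 = of_real (1 - t) * d1 + of_real t * d2"
    unfolding t(3) linepath_def by (simp add: scaleR_conv_of_real algebra_simps)
  define X2 where "X2 = e * (level_re (e * x1) - 1)"
  have nz: "e * x1 \<noteq> 0" using e x1 by auto
  have s2: "0 < X2" "X2 / 2 \<le> Im d2" "Im d2 \<le> X2" "norm d2 \<le> 2 * \<delta>" "e * Re d2 = X2"
    unfolding X2_def d2_def using start[OF e] level_curve_props(1)[OF nz] by auto
  have \<rho>2: "\<rho> \<le> X2" unfolding \<rho>_def X2_def using e by auto
  define X where "X = (1 - t) * h + t * X2"
  have ee: "e * e = 1" using e by auto
  have 1: "e * Re (z - 1) = X"
  proof -
    have "e * Re (z - 1) = (1 - t) * ((e * e) * h) + t * (e * Re d2)" unfolding zd d1_def by (simp add: algebra_simps)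
    then show ?thesis unfolding X_def s2(5) ee by simp
  qed
  have im: "Im z = (1 - t) * \<delta> + t * Im d2"
  proof -
    have "Im z = Im (z - 1)" by simp
    also have "\<dots> = (1 - t) * \<delta> + t * Im d2" unfolding zd d1_def by simp
    finally show ?thesis .
  qed
  have t1: "0 \<le> 1 - t" using t by simp
  have "\<rho> = (1 - t) * \<rho> + t * \<rho>" by (simp add: algebra_simps)
  also have "\<dots> \<le> X" unfolding X_def using t t1 \<rho>2 h1 by (intro add_mono mult_left_mono) (auto simp: \<rho>_def)
  finally have 2: "\<rho> \<le> X" .
  have "X / 2 = (1 - t) * (h / 2) + t * (X2 / 2)" unfolding X_def by (simp add: add_divide_distrib)
  also have "\<dots> \<le> Im z" unfolding im using t t1 s2 h3 by (intro add_mono mult_left_mono) auto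
  finally have 3: "X / 2 \<le> Im z" .
  have 4: "Im z \<le> X" unfolding im X_def using t t1 s2 h1 by (intro add_mono mult_left_mono) auto
  have "norm (z - 1) \<le> norm (of_real (1 - t) * d1) + norm (of_real t * d2)" unfolding zd by (rule norm_triangle_ineq)
  also have "\<dots> = (1 - t) * norm d1 + t * norm d2" using t t1 by (simp only: norm_mult norm_of_real abs_of_nonneg)
  also have "\<dots> \<le> (1 - t) * (2 * \<delta>) + t * (2 * \<delta>)" using t t1 nd1 s2 by (intro add_mono mult_left_mono) auto
  also have "\<dots> = 2 * \<delta>" by (simp add: algebra_simps)
  finally have 5: "norm (z - 1) \<le> 2 * \<delta>" .
  show ?thesis by (rule that[OF 1 2 3 4 5])
qed

lemma sector_off_circle:
  assumes e: "e = 1 \<or> e = -1" and X: "e * Re (z - 1) = X" "\<rho> \<le> X" "\<bar>Im z\<bar> \<le> X" "norm (z - 1) \<le> 2 * \<delta>"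
  shows "\<rho> / 2 \<le> \<bar>norm z - 1\<bar>" "1/2 \<le> norm z" "e = 1 \<Longrightarrow> 1 < norm z" "e = -1 \<Longrightarrow> norm z < 1"
proof -
  have X0: "0 < X" using X \<rho>_pos by linarith
  have "X \<le> \<bar>Re (z - 1)\<bar>" using X(1) e by auto
  also have "\<dots> \<le> norm (z - 1)" by (rule abs_Re_le_cmod)
  finally have X2: "X \<le> 1/2" using X(4) \<delta>_pos by linarith
  have re: "Re z = 1 + e * X" using X(1) e by auto
  have a: "1 + X \<le> norm z" if "e = 1" using re complex_Re_le_cmod[of z] that by simp
  have b: "norm z \<le> 1 - X / 2" if "e = -1"
  proof (rule power2_le_imp_le)
    have "\<bar>Im z\<bar>\<^sup>2 \<le> X\<^sup>2" using X(3) by (intro power_mono) auto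
    then have "(norm z)\<^sup>2 \<le> (1 - X)\<^sup>2 + X\<^sup>2" unfolding cmod_power2 re using that by simp
    also have "\<dots> \<le> (1 - X / 2)\<^sup>2"
    proof -
      have "X * X \<le> 1/2 * X" using X2 X0 by (intro mult_right_mono) auto
      moreover have "0 \<le> X * X" by simp
      moreover have "(1 - X)\<^sup>2 = 1 - 2 * X + X * X" "X\<^sup>2 = X * X" "(1 - X / 2)\<^sup>2 = 1 - X + (X * X) / 4"
        by (simp_all add: power2_eq_square algebra_simps)
      ultimately show ?thesis by linarith
    qed
    finally show "(norm z)\<^sup>2 \<le> (1 - X / 2)\<^sup>2" .
  qed (use X2 in simp)
  show "\<rho> / 2 \<le> \<bar>norm z - 1\<bar>" using e a b X(2) \<rho>_pos by (elim disjE) force+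
  show "1/2 \<le> norm z" using re complex_Re_le_cmod[of z] e X2 X0 by auto
  show "e = 1 \<Longrightarrow> 1 < norm z" using a X0 by linarith
  show "e = -1 \<Longrightarrow> norm z < 1" using b X0 by linarith
qed

text \<open>The points of the level path and of the closing arc, described by modulus and real part
  alone; the predicate is thereby invariant under conjugation.\<close>

definition far :: "real \<Rightarrow> complex \<Rightarrow> bool" where
  "far e z \<longleftrightarrow> (\<exists>y. norm z = exp (e * y) \<and> x1 \<le> y \<and> y \<le> R \<and>
     (Re z = level_re (e * y) \<or> y = R \<and> \<tau> * e * (Re z - level_re (e * R)) \<le> 0))"

lemma far_cnj: "far e (cnj z) \<longleftrightarrow> far e z"
  unfolding far_def by simp

lemma far_estimates:
  assumes e: "e = 1 \<or> e = -1" and z: "far e z" and g: "good A M N"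
  shows "norm (H A N z) \<le> exp (M * (2 * R + exp R + 1) / \<epsilon> N - c / 4 / \<epsilon> N ^ 4)" "z \<in> regular N"
    "1 - exp (- x1) \<le> \<bar>norm z - 1\<bar>" "exp (- R) \<le> norm z" "e = 1 \<Longrightarrow> 1 < norm z" "e = -1 \<Longrightarrow> norm z < 1"
proof -
  obtain y where y: "norm z = exp (e * y)" "x1 \<le> y" "y \<le> R"
     "Re z = level_re (e * y) \<or> y = R \<and> \<tau> * e * (Re z - level_re (e * R)) \<le> 0"
    using z unfolding far_def by blast
  have nz: "e * y \<noteq> 0" and ab: "\<bar>e * y\<bar> \<le> R" "x1 \<le> \<bar>e * y\<bar>" using e y x1 by auto
  have R1': "2 * B / \<mu> \<le> exp R"
  proof -
    have "2 * B / \<mu> \<le> 2 * (1 + B) / \<mu>" using \<mu> by (intro divide_right_mono) auto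
    then show ?thesis using R1 by linarith
  qed
  \<comment> \<open>On each arc one kind of node profits from the displacement. For the other kind
    \<open>sides\<close> supplies just the bound that is wanted there: on
    \<open>\<bar>p\<bar>\<close> for the outer arc, on \<open>\<bar>1 + p\<bar>\<close> for the
    inner one.\<close>
  have alt: "tw (P N i) * (Re z - level_re (e * y)) \<le> 0 \<or> e * y = R \<and> \<mu> \<le> \<bar>P N i\<bar> \<and> 2 * (1 + B) / \<mu> \<le> exp R
        \<or> e * y = - R \<and> \<mu> \<le> \<bar>1 + P N i\<bar> \<and> 2 * B / \<mu> \<le> exp R" if i: "i \<in> I N" for i
  proof (cases "Re z = level_re (e * y)")
    case False
    then have yR: "y = R" and le: "\<tau> * e * (Re z - level_re (e * R)) \<le> 0" using y(4) by auto
    have tt: "\<tau> * \<tau> = 1" using \<tau> by auto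
    have "tw (P N i) * (Re z - level_re (e * y)) = (\<tau> * \<tau>) * (tw (P N i) * (Re z - level_re (e * y)))" unfolding tt by simp
    also have "\<dots> = (\<tau> * tw (P N i)) * (\<tau> * (Re z - level_re (e * y)))" by (simp only: mult_ac)
    finally have eq: "tw (P N i) * (Re z - level_re (e * y)) = (\<tau> * tw (P N i)) * (\<tau> * (Re z - level_re (e * y)))" .
    from e show ?thesis
    proof
      assume e: "e = 1"
      from sides[OF i] show ?thesis
      proof (elim disjE conjE)
        assume "0 \<le> \<tau> * tw (P N i)"
        then have "(\<tau> * tw (P N i)) * (\<tau> * (Re z - level_re (e * y))) \<le> 0"
          by (rule mult_nonneg_nonpos) (use le in \<open>simp add: e yR\<close>)
        then show ?thesis unfolding eq by blast
      next
        assume "\<mu> \<le> \<bar>P N i\<bar>" then show ?thesis using R1 unfolding e yR by simp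
      qed
    next
      assume e: "e = -1"
      from sides[OF i] show ?thesis
      proof (elim disjE conjE)
        assume "\<mu> \<le> \<bar>1 + P N i\<bar>" then show ?thesis using R1' unfolding e yR by simp
      next
        assume "\<tau> * tw (P N i) \<le> 0"
        then have "(\<tau> * tw (P N i)) * (\<tau> * (Re z - level_re (e * y))) \<le> 0"
          by (rule mult_nonpos_nonneg) (use le in \<open>simp add: e yR\<close>)
        then show ?thesis unfolding eq by blast
      qed
    qed
  qed simp
  note fb = far_bound[OF g nz ab(1) y(1) c0 gain[OF _ ab(2)] alt R2]
  show "norm (H A N z) \<le> exp (M * (2 * R + exp R + 1) / \<epsilon> N - c / 4 / \<epsilon> N ^ 4)" by (rule fb(1))
  have "norm z \<noteq> 1" using y(1) nz by simp
  moreover have "z \<noteq> 0" using y(1) by auto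
  ultimately show "z \<in> regular N" unfolding regular_def using fb(2) by auto
  have "exp (- x1) * exp x1 = 1" by (simp flip: exp_add)
  have ex: "1 - exp (- x1) \<le> exp x1 - 1"
  proof -
    have "1 + x1 \<le> exp x1" by (rule exp_ge_add_one_self)
    moreover have "1 + - x1 \<le> exp (- x1)" by (rule exp_ge_add_one_self)
    ultimately show ?thesis by linarith
  qed
  show "1 - exp (- x1) \<le> \<bar>norm z - 1\<bar>"
  proof (cases "e = 1")
    case True
    have "exp x1 \<le> norm z" unfolding y(1) True using y by simp
    then show ?thesis using ex by linarith
  next
    case False
    then have "norm z \<le> exp (- x1)" unfolding y(1) using e y by simp
    then show ?thesis by linarith
  qed
  show "exp (- R) \<le> norm z" unfolding y(1) using ab by simp
  show "e = 1 \<Longrightarrow> 1 < norm z" "e = -1 \<Longrightarrow> norm z < 1" unfolding y(1) using y x1 by auto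
qed

lemma level_far: "e = 1 \<or> e = -1 \<Longrightarrow> z \<in> path_image (level_path e x1 R) \<Longrightarrow> far e z \<and> 0 \<le> Im z"
proof -
  assume e: "e = 1 \<or> e = -1" and z: "z \<in> path_image (level_path e x1 R)"
  obtain y where y: "z = level_curve (e * y)" "x1 \<le> y" "y \<le> R" using level_path_valid(5)[OF e x1 xR z] by blast
  have nz: "e * y \<noteq> 0" using e y x1 by auto
  show ?thesis unfolding far_def y(1) using level_curve_props[OF nz] y by (auto intro!: exI[of _ y])
qed

lemma arc_far: "e = 1 \<or> e = -1 \<Longrightarrow> z \<in> path_image (arc_path e R \<tau>) \<Longrightarrow> far e z \<and> 0 \<le> Im z"
  unfolding far_def using arc_path_props(3)[OF _ \<tau> R0, of e z] xR by (auto intro!: exI[of _ R])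

lemma seg_regular:
  assumes "e = 1 \<or> e = -1" "0 < \<epsilon> N" "\<epsilon> N \<le> \<delta>" "z \<in> path_image (seg e N)"
  shows "z \<in> regular N" "cnj z \<in> regular N" "0 \<le> Im z" "e = 1 \<Longrightarrow> 1 < norm z" "e = -1 \<Longrightarrow> norm z < 1"
proof -
  obtain X where X: "e * Re (z - 1) = X" "\<rho> \<le> X" "X / 2 \<le> Im z" "Im z \<le> X" "norm (z - 1) \<le> 2 * \<delta>"
    using seg_sector[OF assms] by metis
  have im: "0 < Im z" using X \<rho>_pos by linarith
  then have "\<bar>Im z\<bar> \<le> X" using X by simp
  note o = sector_off_circle[OF assms(1) X(1,2) this X(5)]
  have "norm z \<noteq> 1" using o(1) \<rho>_pos by auto
  then show "z \<in> regular N" "cnj z \<in> regular N" using im by (auto intro!: regular_nonreal)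
  show "0 \<le> Im z" "e = 1 \<Longrightarrow> 1 < norm z" "e = -1 \<Longrightarrow> norm z < 1" using im o by auto
qed

lemma hyp_regular:
  assumes "e = 1 \<or> e = -1" "0 < \<epsilon> N" "\<epsilon> N \<le> \<delta>" "z \<in> path_image (hyp_path e (\<epsilon> N) (\<delta> / \<epsilon> N))"
  shows "z \<in> regular N" "cnj z \<in> regular N" "0 \<le> Im z" "e = 1 \<Longrightarrow> 1 < norm z" "e = -1 \<Longrightarrow> norm z < 1"
proof -
  have V: "0 \<le> \<delta> / \<epsilon> N" using assms \<delta>_pos by simp
  obtain v where v: "z = 1 + of_real (e * \<epsilon> N) * pearcey_zeta (e * v)" "0 \<le> v" "v \<le> \<delta> / \<epsilon> N"
    using hyp_path_props(4)[OF assms(1) V assms(4)] by blast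
  have ab: "\<bar>e * v\<bar> \<le> \<delta> / \<epsilon> N" "\<bar>- (e * v)\<bar> \<le> \<delta> / \<epsilon> N" using assms(1) v by auto
  show "z \<in> regular N" unfolding v(1) by (rule hyperbola_regular[OF assms(1-3) ab(1)])
  have "cnj z = 1 + of_real (e * \<epsilon> N) * pearcey_zeta (- (e * v))"
    unfolding v(1) pearcey_zeta_def by (simp add: complex_eq_iff)
  then show "cnj z \<in> regular N" using hyperbola_regular[OF assms(1-3) ab(2)] by simp
  show "0 \<le> Im z" unfolding v(1) pearcey_zeta_def using assms v by auto
  show "e = 1 \<Longrightarrow> 1 < norm z" "e = -1 \<Longrightarrow> norm z < 1"
    unfolding v(1) using hyperbola_off_circle(3,4)[OF assms(1,2) hyperbola_range(2)[OF assms(2,3) ab(1)]] by auto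
qed

lemma joins:
  assumes e: "e = 1 \<or> e = -1" and "0 < \<epsilon> N"
  shows "valid_path (hyp_path e (\<epsilon> N) (\<delta> / \<epsilon> N))" "valid_path (seg e N)" "valid_path (level_path e x1 R)" "valid_path (arc_path e R \<tau>)"
    "pathfinish (hyp_path e (\<epsilon> N) (\<delta> / \<epsilon> N)) = pathstart (seg e N)"
    "pathfinish (seg e N) = pathstart (level_path e x1 R)" "pathfinish (level_path e x1 R) = pathstart (arc_path e R \<tau>)"
proof -
  have V: "0 \<le> \<delta> / \<epsilon> N" using assms \<delta>_pos by simp
  show "valid_path (hyp_path e (\<epsilon> N) (\<delta> / \<epsilon> N))" by (rule hyp_path_props(1)[OF e V])
  show "valid_path (seg e N)" "pathfinish (hyp_path e (\<epsilon> N) (\<delta> / \<epsilon> N)) = pathstart (seg e N)" unfolding seg_def by simp_all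
  show "valid_path (level_path e x1 R)" by (rule level_path_valid(1)[OF e x1 xR])
  show "valid_path (arc_path e R \<tau>)" unfolding arc_path_def by simp
  show "pathfinish (seg e N) = pathstart (level_path e x1 R)" unfolding seg_def level_path_valid(3)[OF e x1 xR] by simp
  show "pathfinish (level_path e x1 R) = pathstart (arc_path e R \<tau>)"
    unfolding level_path_valid(4)[OF e x1 xR] arc_path_props(1)[OF e \<tau> R0] ..
qed

lemma upper_image:
  assumes "e = 1 \<or> e = -1" "0 < \<epsilon> N"
  shows "path_image (upper e N) = path_image (hyp_path e (\<epsilon> N) (\<delta> / \<epsilon> N)) \<union> path_image (seg e N)
     \<union> path_image (level_path e x1 R) \<union> path_image (arc_path e R \<tau>)"
  unfolding upper_def using joins[OF assms] by (simp add: path_image_join pathfinish_join pathstart_join Un_assoc)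

lemma upper_props:
  assumes e: "e = 1 \<or> e = -1" and \<epsilon>0: "0 < \<epsilon> N" "\<epsilon> N \<le> \<delta>" and g: "good A M N"
  shows "valid_path (upper e N)" "pathstart (upper e N) = of_real (1 + e * \<epsilon> N)"
    "pathfinish (upper e N) = of_real (- \<tau> * e * exp (e * R))"
    "\<And>z. z \<in> path_image (upper e N) \<Longrightarrow> 0 \<le> Im z \<and> z \<in> regular N \<and> cnj z \<in> regular N \<and> (e = 1 \<longrightarrow> 1 < norm z) \<and> (e = -1 \<longrightarrow> norm z < 1)"
proof -
  note j = joins[OF e \<epsilon>0(1)]
  have V: "0 \<le> \<delta> / \<epsilon> N" using \<epsilon>0 \<delta>_pos by simp
  show "valid_path (upper e N)" unfolding upper_def using j by (intro valid_path_join) (simp_all add: pathstart_join)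
  show "pathstart (upper e N) = of_real (1 + e * \<epsilon> N)" unfolding upper_def using hyp_path_props(2)[OF e V] by (simp add: pathstart_join)
  show "pathfinish (upper e N) = of_real (- \<tau> * e * exp (e * R))" unfolding upper_def
    using arc_path_props(2)[OF e \<tau> R0] by (simp add: pathfinish_join)
  fix z assume "z \<in> path_image (upper e N)"
  then consider "z \<in> path_image (hyp_path e (\<epsilon> N) (\<delta> / \<epsilon> N))" | "z \<in> path_image (seg e N)" | "far e z \<and> 0 \<le> Im z"
    unfolding upper_image[OF e \<epsilon>0(1)] using level_far[OF e] arc_far[OF e] by blast
  then show "0 \<le> Im z \<and> z \<in> regular N \<and> cnj z \<in> regular N \<and> (e = 1 \<longrightarrow> 1 < norm z) \<and> (e = -1 \<longrightarrow> norm z < 1)"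
  proof cases
    case 1 then show ?thesis using hyp_regular[OF e \<epsilon>0] by blast
  next
    case 2 then show ?thesis using seg_regular[OF e \<epsilon>0] by blast
  next
    case 3
    then have "far e (cnj z)" by (simp add: far_cnj)
    with 3 show ?thesis using far_estimates[OF e _ g] by blast
  qed
qed

end

lemma path_bound_mono: "path_bound p L \<Longrightarrow> L \<le> L' \<Longrightarrow> path_bound p L'"
  unfolding path_bound_def by (meson mult_right_mono order_trans)

text \<open>The common shape of the error terms: a cost of order \<open>1 / \<epsilon>\<close>
  against a gain of order \<open>1 / \<epsilon>\<^sup>4\<close>, divided by the normalization
  \<open>\<epsilon>\<close>.\<close>

lemma exp_quartic_decay:
  assumes "0 < (c::real)"
  shows "((\<lambda>x. exp (K / x - c / x ^ 4) / x) \<longlongrightarrow> 0) (at_right 0)"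
  using assms by real_asymp

section \<open>Negligible pieces of the contours and the limit over both loops\<close>

context contour_setup begin

lemma F_contour_integrable:
  assumes "valid_path p" "path_image p \<subseteq> regular N" shows "F A A' N contour_integrable_on p"
  using F_holomorphic open_regular assms by (rule contour_integrable_holomorphic_simple)

lemma sym_int_F_bound:
  assumes p: "valid_path p" "path_bound p L"
    and z: "\<And>z. z \<in> path_image p \<Longrightarrow> z \<in> regular N \<and> cnj z \<in> regular N \<and> norm (F A A' N z) \<le> K \<and> norm (F A A' N (cnj z)) \<le> K"
    and K: "0 \<le> K"
  shows "norm (sym_int p (F A A' N)) \<le> 2 * L * K"
proof (rule sym_int_bound[OF p(2,1)])
  show "F A A' N contour_integrable_on p" using z by (intro F_contour_integrable p) auto
  show "F A A' N contour_integrable_on (cnj \<circ> p)"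
    using z p valid_path_cnj[of p] by (intro F_contour_integrable) (auto simp: path_image_def)
qed (use z K in auto)

lemma F_bound:
  assumes g': "good A' M' N" and H: "norm (H A N z) \<le> h" and m: "0 < m" "m \<le> norm z"
    and r: "0 < r" "r \<le> \<bar>norm z - 1\<bar>" and \<epsilon>1: "\<epsilon> N \<le> 1"
  shows "norm (F A A' N z) \<le> h * ((LINT v|lborel. circle_weight M' v) / (m * r))"
proof -
  define W where "W = (LINT v|lborel. circle_weight M' v)"
  have W0: "0 \<le> W" unfolding W_def by (intro Bochner_Integration.integral_nonneg) (simp add: circle_weight_def)
  have h0: "0 \<le> h" using H norm_ge_zero order_trans by blast
  have "norm (inner A' N z) \<le> \<epsilon> N / r * W" unfolding W_def by (rule inner_bound[OF g' r])
  also have "\<dots> \<le> 1 / r * W" using \<epsilon>1 r W0 by (intro mult_right_mono divide_right_mono) auto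
  finally have "norm (inner A' N z) \<le> W / r" by simp
  moreover have "norm (H A N z) / norm z \<le> h / m" using H m h0 by (intro frac_le) auto
  ultimately have "norm (H A N z) / norm z * norm (inner A' N z) \<le> h / m * (W / r)"
    using h0 m by (intro mult_mono) auto
  then show ?thesis unfolding F_def W_def[symmetric] by (simp add: norm_mult norm_divide)
qed

lemma seg_negligible:
  assumes dr: "drift A \<xi>" "drift A' \<eta>" and e: "e = 1 \<or> e = -1"
  shows "(\<lambda>N. sym_int (seg e N) (F A A' N) / of_real (\<epsilon> N)) \<longlonglongrightarrow> 0"
proof -
  obtain M where M: "0 < M" "\<forall>\<^sub>F N in sequentially. good A M N" using eventually_good[OF dr(1)] by metis
  obtain M' where M': "0 < M'" "\<forall>\<^sub>F N in sequentially. good A' M' N" using eventually_good[OF dr(2)] by metis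
  define W where "W = (LINT v|lborel. circle_weight M' v)"
  have W0: "0 \<le> W" unfolding W_def by (intro Bochner_Integration.integral_nonneg) (simp add: circle_weight_def)
  define G where "G x = exp (9 * M / x - (\<rho> ^ 4 / 256) / x ^ 4)" for x
  have "((\<lambda>x. G x / x) \<longlongrightarrow> 0) (at_right 0)" unfolding G_def using \<rho>_pos by (intro exp_quartic_decay) simp
  from filterlim_compose[OF this \<epsilon>] have "(\<lambda>N. G (\<epsilon> N) / \<epsilon> N) \<longlonglongrightarrow> 0" .
  then have lim: "(\<lambda>N. 2 * 1 * (W / (1/2 * (\<rho> / 2))) * (G (\<epsilon> N) / \<epsilon> N)) \<longlonglongrightarrow> 0" by (rule tendsto_mult_right_zero)
  have "\<forall>\<^sub>F N in sequentially. norm (sym_int (seg e N) (F A A' N) / of_real (\<epsilon> N)) \<le> 2 * 1 * (W / (1/2 * (\<rho> / 2))) * (G (\<epsilon> N) / \<epsilon> N)"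
    using M(2) M'(2) \<epsilon>_pos \<epsilon>_less[OF \<delta>_pos(1)]
  proof eventually_elim
    case (elim N)
    then have \<epsilon>0: "0 < \<epsilon> N" "\<epsilon> N \<le> \<delta>" and g: "good A M N" and g': "good A' M' N" by auto
    have \<epsilon>1: "\<epsilon> N \<le> 1" using \<epsilon>0 \<delta>_pos by linarith
    have "norm (sym_int (seg e N) (F A A' N)) \<le> 2 * 1 * (G (\<epsilon> N) * (W / (1/2 * (\<rho> / 2))))"
    proof (rule sym_int_F_bound)
      show "valid_path (seg e N)" using joins[OF e \<epsilon>0(1)] by simp
      show "path_bound (seg e N) 1"
      proof -
        have "norm (pathstart (seg e N) - 1) \<le> 2 * \<delta>" "norm (pathfinish (seg e N) - 1) \<le> 2 * \<delta>"
          using seg_sector[OF e \<epsilon>0 pathstart_in_path_image] seg_sector[OF e \<epsilon>0 pathfinish_in_path_image] by metis+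
        moreover have "norm (pathfinish (seg e N) - pathstart (seg e N)) \<le> norm (pathfinish (seg e N) - 1) + norm (pathstart (seg e N) - 1)"
          using norm_triangle_ineq4[of "pathfinish (seg e N) - 1" "pathstart (seg e N) - 1"] by simp
        ultimately have "norm (pathfinish (seg e N) - pathstart (seg e N)) \<le> 1" using \<delta>_pos by linarith
        then show ?thesis unfolding seg_def by (intro path_bound_mono[OF path_bound_linepath]) simp
      qed
      show "0 \<le> G (\<epsilon> N) * (W / (1/2 * (\<rho> / 2)))" unfolding G_def using W0 \<rho>_pos by simp
      fix z assume z: "z \<in> path_image (seg e N)"
      obtain X where X: "e * Re (z - 1) = X" "\<rho> \<le> X" "X / 2 \<le> Im z" "Im z \<le> X" "norm (z - 1) \<le> 2 * \<delta>"
        using seg_sector[OF e \<epsilon>0 z] by metis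
      \<comment> \<open>One estimate serves \<open>z\<close> and its conjugate, because only the
        real part and the size of the imaginary part enter.\<close>
      have b: "norm (F A A' N w) \<le> G (\<epsilon> N) * (W / (1/2 * (\<rho> / 2)))" if w: "Re w = Re z" "\<bar>Im w\<bar> = Im z" for w
      proof -
        have nw: "norm (w - 1) = norm (z - 1)"
        proof -
          have "(norm (w - 1))\<^sup>2 = (norm (z - 1))\<^sup>2" unfolding cmod_power2 using w by (metis minus_complex.sel diff_zero one_complex.sel(2) power2_abs)
          then show ?thesis by (simp add: power2_eq_iff_nonneg)
        qed
        have Xw: "e * Re (w - 1) = X" "\<bar>Im w\<bar> \<le> X" "norm (w - 1) \<le> 2 * \<delta>" using X w nw by auto
        note o = sector_off_circle[OF e Xw(1) X(2) Xw(2,3)]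
        have "norm (H A N (1 + (w - 1))) \<le> exp (9 * M / \<epsilon> N - \<rho> ^ 4 / 256 / \<epsilon> N ^ 4)"
        proof (rule sector_bound[OF g])
          have X0: "0 < X" using X \<rho>_pos by linarith
          show aX: "\<bar>Re (w - 1)\<bar> = X" using Xw(1) e X0 by auto
          show "X / 2 \<le> \<bar>Im (w - 1)\<bar>" "\<bar>Im (w - 1)\<bar> \<le> X" using X w by auto
          show "0 \<le> \<rho>" using \<rho>_pos by simp
          show "\<rho> \<le> norm (w - 1)" using X(2) aX abs_Re_le_cmod[of "w - 1"] by linarith
          show "norm (w - 1) \<le> 1 / (3072 * (1 + B))" using Xw(3) unfolding two_delta .
        qed
        then have "norm (H A N w) \<le> G (\<epsilon> N)" unfolding G_def by simp
        then show ?thesis unfolding W_def using o(1,2) \<rho>_pos by (intro F_bound[OF g']) (auto intro: \<epsilon>1)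
      qed
      have "0 < Im z" using X \<rho>_pos by linarith
      then show "z \<in> regular N \<and> cnj z \<in> regular N \<and> norm (F A A' N z) \<le> G (\<epsilon> N) * (W / (1/2 * (\<rho> / 2)))
         \<and> norm (F A A' N (cnj z)) \<le> G (\<epsilon> N) * (W / (1/2 * (\<rho> / 2)))"
        using seg_regular[OF e \<epsilon>0 z] b[of z] b[of "cnj z"] by simp
    qed
    then have "norm (sym_int (seg e N) (F A A' N)) / \<epsilon> N \<le> 2 * 1 * (G (\<epsilon> N) * (W / (1/2 * (\<rho> / 2)))) / \<epsilon> N"
      using \<epsilon>0 by (intro divide_right_mono) auto
    then show ?case using \<epsilon>0 by (simp add: norm_divide mult_ac)
  qed
  then show ?thesis using lim by (rule Lim_null_comparison)
qed

lemma far_negligible: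
  assumes dr: "drift A \<xi>" "drift A' \<eta>" and e: "e = 1 \<or> e = -1"
    and p: "valid_path p" "path_bound p L" "\<And>z. z \<in> path_image p \<Longrightarrow> far e z"
  shows "(\<lambda>N. sym_int p (F A A' N) / of_real (\<epsilon> N)) \<longlonglongrightarrow> 0"
proof -
  obtain M where M: "0 < M" "\<forall>\<^sub>F N in sequentially. good A M N" using eventually_good[OF dr(1)] by metis
  obtain M' where M': "0 < M'" "\<forall>\<^sub>F N in sequentially. good A' M' N" using eventually_good[OF dr(2)] by metis
  define W where "W = (LINT v|lborel. circle_weight M' v)"
  have W0: "0 \<le> W" unfolding W_def by (intro Bochner_Integration.integral_nonneg) (simp add: circle_weight_def)
  define q where "q = W / (exp (- R) * (1 - exp (- x1)))"
  have r0: "0 < 1 - exp (- x1)" using x1 by simp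
  have q0: "0 \<le> q" unfolding q_def using W0 r0 by simp
  define G where "G x = exp (M * (2 * R + exp R + 1) / x - (c / 4) / x ^ 4)" for x
  have "((\<lambda>x. G x / x) \<longlongrightarrow> 0) (at_right 0)" unfolding G_def using c0 by (intro exp_quartic_decay) simp
  from filterlim_compose[OF this \<epsilon>] have "(\<lambda>N. G (\<epsilon> N) / \<epsilon> N) \<longlonglongrightarrow> 0" .
  then have lim: "(\<lambda>N. 2 * L * q * (G (\<epsilon> N) / \<epsilon> N)) \<longlonglongrightarrow> 0" by (rule tendsto_mult_right_zero)
  have "\<forall>\<^sub>F N in sequentially. norm (sym_int p (F A A' N) / of_real (\<epsilon> N)) \<le> 2 * L * q * (G (\<epsilon> N) / \<epsilon> N)"
    using M(2) M'(2) \<epsilon>_pos \<epsilon>_less[OF \<delta>_pos(1)]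
  proof eventually_elim
    case (elim N)
    then have \<epsilon>0: "0 < \<epsilon> N" "\<epsilon> N \<le> \<delta>" and g: "good A M N" and g': "good A' M' N" by auto
    have \<epsilon>1: "\<epsilon> N \<le> 1" using \<epsilon>0 \<delta>_pos by linarith
    have b: "w \<in> regular N \<and> norm (F A A' N w) \<le> G (\<epsilon> N) * q" if w: "far e w" for w
    proof -
      note fe = far_estimates[OF e w g]
      have "norm (H A N w) \<le> G (\<epsilon> N)" unfolding G_def by (rule fe(1))
      then show ?thesis unfolding q_def W_def using r0 by (intro conjI fe(2) F_bound[OF g']) (auto intro: \<epsilon>1 fe)
    qed
    have "norm (sym_int p (F A A' N)) \<le> 2 * L * (G (\<epsilon> N) * q)"
      using p b far_cnj[of e] q0 by (intro sym_int_F_bound p) (auto simp: G_def)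
    then have "norm (sym_int p (F A A' N)) / \<epsilon> N \<le> 2 * L * (G (\<epsilon> N) * q) / \<epsilon> N"
      using \<epsilon>0 by (intro divide_right_mono) auto
    then show ?case using \<epsilon>0 by (simp add: norm_divide mult_ac)
  qed
  then show ?thesis using lim by (rule Lim_null_comparison)
qed

lemma upper_sym_int:
  assumes e: "e = 1 \<or> e = -1" and \<epsilon>0: "0 < \<epsilon> N" "\<epsilon> N \<le> \<delta>" and g: "good A M N"
  shows "of_real e * sym_int (upper e N) (F A A' N) = main_part A A' e N
     + of_real e * (sym_int (seg e N) (F A A' N) + (sym_int (level_path e x1 R) (F A A' N) + sym_int (arc_path e R \<tau>) (F A A' N)))"
proof -
  note j = joins[OF e \<epsilon>0(1)]
  have img: "F A A' N contour_integrable_on p \<and> F A A' N contour_integrable_on (cnj \<circ> p)"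
    if "valid_path p" "path_image p \<subseteq> path_image (upper e N)" for p
  proof
    have r: "z \<in> regular N \<and> cnj z \<in> regular N" if "z \<in> path_image p" for z
      using upper_props(4)[OF e \<epsilon>0 g] that \<open>path_image p \<subseteq> path_image (upper e N)\<close> by blast
    then show "F A A' N contour_integrable_on p" using that by (intro F_contour_integrable) auto
    show "F A A' N contour_integrable_on (cnj \<circ> p)"
      using r that valid_path_cnj[of p] by (intro F_contour_integrable) (auto simp: path_image_def)
  qed
  define q where "q = level_path e x1 R +++ arc_path e R \<tau>"
  define q2 where "q2 = seg e N +++ q"
  have vq: "valid_path q" "pathstart q = pathstart (level_path e x1 R)" unfolding q_def using j by (auto intro: valid_path_join simp: pathstart_join)
  have vq2: "valid_path q2" "pathstart q2 = pathstart (seg e N)" unfolding q2_def using j vq by (auto intro: valid_path_join simp: pathstart_join)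
  have iq: "path_image q = path_image (level_path e x1 R) \<union> path_image (arc_path e R \<tau>)"
    unfolding q_def using j by (simp add: path_image_join)
  have iq2: "path_image q2 = path_image (seg e N) \<union> path_image q"
    unfolding q2_def using j vq by (simp add: path_image_join)
  note ui = upper_image[OF e \<epsilon>0(1)]
  have sub: "path_image (hyp_path e (\<epsilon> N) (\<delta> / \<epsilon> N)) \<subseteq> path_image (upper e N)" "path_image (seg e N) \<subseteq> path_image (upper e N)"
    "path_image (level_path e x1 R) \<subseteq> path_image (upper e N)" "path_image (arc_path e R \<tau>) \<subseteq> path_image (upper e N)"
    "path_image q \<subseteq> path_image (upper e N)" "path_image q2 \<subseteq> path_image (upper e N)"
    unfolding iq2 iq ui by auto
  have "sym_int q (F A A' N) = sym_int (level_path e x1 R) (F A A' N) + sym_int (arc_path e R \<tau>) (F A A' N)"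
    unfolding q_def using img[OF j(3) sub(3)] img[OF j(4) sub(4)] by (intro sym_int_join j) auto
  moreover have "sym_int q2 (F A A' N) = sym_int (seg e N) (F A A' N) + sym_int q (F A A' N)"
    unfolding q2_def using img[OF j(2) sub(2)] img[OF vq(1) sub(5)] j(6) vq by (intro sym_int_join j vq) auto
  moreover have "sym_int (upper e N) (F A A' N) = sym_int (hyp_path e (\<epsilon> N) (\<delta> / \<epsilon> N)) (F A A' N) + sym_int q2 (F A A' N)"
    unfolding upper_def q_def[symmetric] q2_def[symmetric]
    using img[OF j(1) sub(1)] img[OF vq2(1) sub(6)] j(5) vq2 by (intro sym_int_join j vq2) auto
  moreover have "of_real e * sym_int (hyp_path e (\<epsilon> N) (\<delta> / \<epsilon> N)) (F A A' N) = main_part A A' e N"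
    unfolding main_part_def using \<epsilon>0 \<delta>_pos by (intro hyp_path_sym_int e main_continuous) auto
  ultimately show ?thesis by (simp add: distrib_left)
qed

theorem core_tendsto:
  assumes dr: "drift A \<xi>" "drift A' \<eta>"
  shows "(\<lambda>N. 1 / (2 * of_real pi * \<i>)\<^sup>2 * (sym_int (upper 1 N) (F A A' N) - sym_int (upper (-1) N) (F A A' N)) / of_real (\<epsilon> N))
     \<longlonglongrightarrow> pearcey_kernel \<xi> \<eta>"
proof -
  obtain M where M: "0 < M" "\<forall>\<^sub>F N in sequentially. good A M N" using eventually_good[OF dr(1)] by metis
  define J where "J e = (LINT v|lborel. LINT t|lborel. pearcey_integrand \<xi> \<eta> (of_real e * pearcey_zeta v) (\<i> * of_real t)
        * (of_real e * vector_derivative pearcey_zeta (at v)) * \<i>)" for e :: real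
  have each: "(\<lambda>N. of_real e * sym_int (upper e N) (F A A' N) / of_real (\<epsilon> N)) \<longlonglongrightarrow> J e" if e: "e = 1 \<or> e = -1" for e
  proof -
    obtain L where L: "path_bound (level_path e x1 R) L" using level_path_valid(2)[OF e x1 xR] by blast
    have La: "path_bound (arc_path e R \<tau>) (\<bar>exp (e * R)\<bar> * \<bar>(if \<tau> * e = 1 then pi else 0) - arccos (level_re (e * R) / exp (e * R))\<bar>)"
      unfolding arc_path_def by (rule path_bound_part_circlepath)
    have va: "valid_path (arc_path e R \<tau>)" unfolding arc_path_def by simp
    have l1: "(\<lambda>N. sym_int (level_path e x1 R) (F A A' N) / of_real (\<epsilon> N)) \<longlonglongrightarrow> 0"
      by (rule far_negligible[OF dr e level_path_valid(1)[OF e x1 xR] L]) (use level_far[OF e] in blast)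
    have l2: "(\<lambda>N. sym_int (arc_path e R \<tau>) (F A A' N) / of_real (\<epsilon> N)) \<longlonglongrightarrow> 0"
      by (rule far_negligible[OF dr e va La]) (use arc_far[OF e] in blast)
    have "(\<lambda>N. main_part A A' e N / of_real (\<epsilon> N) + of_real e * (sym_int (seg e N) (F A A' N) / of_real (\<epsilon> N)
        + (sym_int (level_path e x1 R) (F A A' N) / of_real (\<epsilon> N) + sym_int (arc_path e R \<tau>) (F A A' N) / of_real (\<epsilon> N))))
       \<longlonglongrightarrow> J e + of_real e * (0 + (0 + 0))"
      unfolding J_def by (intro tendsto_add tendsto_mult tendsto_const main_part_tendsto dr e seg_negligible[OF dr e] l1 l2)
    then have "(\<lambda>N. main_part A A' e N / of_real (\<epsilon> N) + of_real e * (sym_int (seg e N) (F A A' N) / of_real (\<epsilon> N)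
        + (sym_int (level_path e x1 R) (F A A' N) / of_real (\<epsilon> N) + sym_int (arc_path e R \<tau>) (F A A' N) / of_real (\<epsilon> N))))
       \<longlonglongrightarrow> J e" by simp
    then show ?thesis
    proof (rule Lim_transform_eventually)
      show "\<forall>\<^sub>F N in sequentially. main_part A A' e N / of_real (\<epsilon> N) + of_real e * (sym_int (seg e N) (F A A' N) / of_real (\<epsilon> N)
        + (sym_int (level_path e x1 R) (F A A' N) / of_real (\<epsilon> N) + sym_int (arc_path e R \<tau>) (F A A' N) / of_real (\<epsilon> N)))
        = of_real e * sym_int (upper e N) (F A A' N) / of_real (\<epsilon> N)"
        using M(2) \<epsilon>_pos \<epsilon>_less[OF \<delta>_pos(1)]
      proof eventually_elim
        case (elim N)
        have "of_real e * sym_int (upper e N) (F A A' N) = main_part A A' e N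
          + of_real e * (sym_int (seg e N) (F A A' N) + (sym_int (level_path e x1 R) (F A A' N) + sym_int (arc_path e R \<tau>) (F A A' N)))"
          using elim by (intro upper_sym_int[OF e]) auto
        then show ?case by (simp only: add_divide_distrib[symmetric] times_divide_eq_right)
      qed
    qed
  qed
  have "(\<lambda>N. 1 / (2 * of_real pi * \<i>)\<^sup>2 * (of_real 1 * sym_int (upper 1 N) (F A A' N) / of_real (\<epsilon> N) + of_real (-1) * sym_int (upper (-1) N) (F A A' N) / of_real (\<epsilon> N)))
     \<longlonglongrightarrow> 1 / (2 * of_real pi * \<i>)\<^sup>2 * (J 1 + J (-1))"
    by (intro tendsto_mult tendsto_add tendsto_const each) auto
  moreover have "1 / (2 * of_real pi * \<i>)\<^sup>2 * (J 1 + J (-1)) = pearcey_kernel \<xi> \<eta>"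
    unfolding pearcey_kernel_def J_def by simp
  moreover have "1 / (2 * of_real pi * \<i>)\<^sup>2 * (of_real 1 * sym_int (upper 1 N) (F A A' N) / of_real (\<epsilon> N) + of_real (-1) * sym_int (upper (-1) N) (F A A' N) / of_real (\<epsilon> N))
     = 1 / (2 * of_real pi * \<i>)\<^sup>2 * (sym_int (upper 1 N) (F A A' N) - sym_int (upper (-1) N) (F A A' N)) / of_real (\<epsilon> N)" for N
  proof -
    have "q * (of_real 1 * v / e + of_real (-1) * w / e) = q * (v - w) / e" for q v w e :: complex
      by (simp add: diff_divide_distrib right_diff_distrib)
    then show ?thesis .
  qed
  ultimately show ?thesis by simp
qed

end

section \<open>Reduction of the correlation kernel to the nodes\<close>

text \<open>Changing the sign of both integration variables exchanges the two branches. This serves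
  negative critical points, where \<open>\<sigma>\<close> is negative and the rescaled positions
  change sign.\<close>

lemma pearcey_kernel_uminus: "pearcey_kernel (- \<xi>) (- \<eta>) = pearcey_kernel \<xi> \<eta>"
proof -
  define J where "J \<xi> \<eta> \<epsilon> = (LINT u|lborel. LINT v|lborel.
        pearcey_integrand \<xi> \<eta> (\<epsilon> * pearcey_zeta u) (\<i> * of_real v)
        * (\<epsilon> * vector_derivative pearcey_zeta (at u)) * \<i>)" for \<xi> \<eta> :: real and \<epsilon> :: complex
  have J: "J (- \<xi>) (- \<eta>) (- \<epsilon>) = J \<xi> \<eta> \<epsilon>" for \<epsilon>
  proof -
    have int: "pearcey_integrand (- \<xi>) (- \<eta>) (- z) (- w) = - pearcey_integrand \<xi> \<eta> z w" for z w
    proof -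
      have "1 / (- z - - w) = - (1 / (z - w))" by (metis minus_diff_commute minus_diff_minus divide_minus_right)
      then show ?thesis unfolding pearcey_integrand_def by simp
    qed
    have "(LINT v|lborel. pearcey_integrand (- \<xi>) (- \<eta>) (- \<epsilon> * pearcey_zeta u) (\<i> * of_real v)
        * (- \<epsilon> * vector_derivative pearcey_zeta (at u)) * \<i>)
      = (LINT v|lborel. pearcey_integrand \<xi> \<eta> (\<epsilon> * pearcey_zeta u) (\<i> * of_real v)
        * (\<epsilon> * vector_derivative pearcey_zeta (at u)) * \<i>)" for u
      by (subst lborel_integral_real_affine[where c = "-1" and t = 0])
        (use int[of "\<epsilon> * pearcey_zeta u" "\<i> * of_real v" for v] in simp_all)
    then show ?thesis unfolding J_def by simp
  qed
  have pk: "pearcey_kernel \<xi> \<eta> = 1 / (2 * of_real pi * \<i>)\<^sup>2 * (\<Sum>\<epsilon>\<in>{1, - 1}. J \<xi> \<eta> \<epsilon>)" for \<xi> \<eta>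
    unfolding pearcey_kernel_def J_def ..
  show ?thesis unfolding pk using J[of 1] J[of "-1"] by simp
qed

text \<open>Each factor \<open>1 / (1 + Y / u) = u / (u + Y)\<close> releases one power of
  \<open>u\<close>, which explains the exponent \<open>k - a\<close>. Normalizing all factors to 1
  at \<open>u = 1\<close> produces the nodes.\<close>

lemma K_fun_node_prod:
  assumes X: "\<And>i. i \<in> {1..n} \<Longrightarrow> X i \<noteq> 1" and Y: "\<And>j. j \<in> {1..k} \<Longrightarrow> Y j \<noteq> -1" and u: "u \<noteq> 0"
  shows "K_fun X n Y k u * u powi (- a)
    = K_fun X n Y k 1 * node_prod (int k - a) ({1..n} <+> {1..k}) (case_sum (\<lambda>i. X i / (1 - X i)) (\<lambda>j. - 1 / (1 + Y j))) u"
proof -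
  have x: "1 / (1 - of_real (X i) * u) = 1 / (1 - of_real (X i)) * (1 / (1 - of_real (X i / (1 - X i)) * (u - 1)))"
    if "i \<in> {1..n}" for i
  proof -
    have n: "1 - complex_of_real (X i) \<noteq> 0" using X[OF that] by (metis of_real_1 of_real_eq_iff right_minus_eq)
    have "1 - of_real (X i / (1 - X i)) * (u - 1) = (1 - of_real (X i) * u) / (1 - of_real (X i))"
      using n by (simp add: field_simps)
    then show ?thesis using n by simp
  qed
  have y: "1 / (1 + of_real (Y j) / u) = 1 / (1 + of_real (Y j)) * (u * (1 / (1 - of_real (- 1 / (1 + Y j)) * (u - 1))))"
    if "j \<in> {1..k}" for j
  proof -
    have n: "1 + complex_of_real (Y j) \<noteq> 0" using Y[OF that] by (metis of_real_1 of_real_add of_real_eq_0_iff add_eq_0_iff)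
    have "1 - of_real (- 1 / (1 + Y j)) * (u - 1) = (u + of_real (Y j)) / (1 + of_real (Y j))"
      using n by (simp add: field_simps)
    moreover have "1 + of_real (Y j) / u = (u + of_real (Y j)) / u" using u by (simp add: field_simps)
    ultimately show ?thesis using n by simp
  qed
  have "u powi (int k - a) = u ^ k * u powi (- a)" using u by (simp add: power_int_diff power_int_minus field_simps)
  moreover have "(\<Prod>i=1..n. 1 / (1 - of_real (X i) * u))
    = (\<Prod>i=1..n. 1 / (1 - of_real (X i)) * (1 / (1 - of_real (X i / (1 - X i)) * (u - 1))))"
    by (rule prod.cong[OF refl x])
  moreover have "(\<Prod>j=1..k. 1 / (1 + of_real (Y j) / u))
    = (\<Prod>j=1..k. 1 / (1 + of_real (Y j)) * (u * (1 / (1 - of_real (- 1 / (1 + Y j)) * (u - 1)))))"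
    by (rule prod.cong[OF refl y])
  ultimately show ?thesis
    unfolding K_fun_def node_prod_def
    by (simp add: prod.Plus prod.distrib prod_dividef)
qed

text \<open>Unconditional, because functions without an integral get the value 0 on both sides.
  Iterated integrals can thus be rescaled without any integrability proof.\<close>

lemma contour_integral_cmult: "contour_integral g (\<lambda>u. c * f u) = c * contour_integral g f"
  unfolding contour_integral_integral by (simp add: mult.assoc)

lemma contour_integral_scale:
  assumes "valid_path \<gamma>" and z: "z \<noteq> 0"
  shows "valid_path (\<lambda>t. \<gamma> t / z)" "contour_integral \<gamma> f = z * contour_integral (\<lambda>t. \<gamma> t / z) (\<lambda>u. f (z * u))"
proof -
  have an: "(\<lambda>w. w / z) analytic_on UNIV" by (intro analytic_intros) (use z in auto)
  have v: "valid_path ((\<lambda>w. w / z) \<circ> \<gamma>)"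
    by (rule valid_path_compose_holomorphic[where S = UNIV]) (use assms in \<open>auto intro!: holomorphic_intros\<close>)
  then show "valid_path (\<lambda>t. \<gamma> t / z)" by (simp add: comp_def)
  have "contour_integral ((\<lambda>w. w / z) \<circ> \<gamma>) (\<lambda>u. f (z * u)) = contour_integral \<gamma> (\<lambda>w. deriv (\<lambda>w. w / z) w * f (z * (w / z)))"
    by (rule contour_integral_comp_analyticW[OF an assms(1)]) auto
  also have "\<dots> = contour_integral \<gamma> (\<lambda>w. (1 / z) * f w)"
  proof -
    have "deriv (\<lambda>w. w / z) w = 1 / z" for w
      by (rule DERIV_imp_deriv) (use z in \<open>auto intro!: derivative_eq_intros\<close>)
    then show ?thesis using z by simp
  qed
  also have "\<dots> = 1 / z * contour_integral \<gamma> f" by (rule contour_integral_cmult)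
  finally show "contour_integral \<gamma> f = z * contour_integral (\<lambda>t. \<gamma> t / z) (\<lambda>u. f (z * u))"
    using z by (simp add: comp_def)
qed

text \<open>Complex scaling preserves winding numbers, in particular division by a negative critical
  point, which reverses the real line.\<close>

lemma winding_number_scale:
  assumes "valid_path \<gamma>" and z: "z \<noteq> 0" and p: "z * p \<notin> path_image \<gamma>"
  shows "p \<notin> path_image (\<lambda>t. \<gamma> t / z)" "winding_number (\<lambda>t. \<gamma> t / z) p = winding_number \<gamma> (z * p)"
proof -
  show n: "p \<notin> path_image (\<lambda>t. \<gamma> t / z)" using p z unfolding path_image_def by auto
  have "contour_integral \<gamma> (\<lambda>w. 1 / (w - z * p)) = z * contour_integral (\<lambda>t. \<gamma> t / z) (\<lambda>u. 1 / (z * u - z * p))"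
    by (rule contour_integral_scale[OF assms(1,2)])
  also have "(\<lambda>u. 1 / (z * u - z * p)) = (\<lambda>u. 1 / z * (1 / (u - p)))"
    by (simp add: fun_eq_iff flip: right_diff_distrib)
  also have "z * contour_integral (\<lambda>t. \<gamma> t / z) (\<lambda>u. 1 / z * (1 / (u - p))) = contour_integral (\<lambda>t. \<gamma> t / z) (\<lambda>u. 1 / (u - p))"
    unfolding contour_integral_cmult using z by simp
  finally show "winding_number (\<lambda>t. \<gamma> t / z) p = winding_number \<gamma> (z * p)"
    using winding_number_valid_path[OF contour_integral_scale(1)[OF assms(1,2)] n] winding_number_valid_path[OF assms(1) p] by simp
qed

lemma K_fun_scale:
  "z0 \<noteq> 0 \<Longrightarrow> K_fun x n y k (of_real z0 * u) = K_fun (\<lambda>i. x i * z0) n (\<lambda>j. y j / z0) k u"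
  unfolding K_fun_def by (simp add: mult.assoc)

text \<open>The integrand is homogeneous of degree \<open>b - a - 2\<close> and the two
  differentials add 2, so the power of the critical point in the theorem is exactly the scaling
  factor.\<close>

lemma corr_kernel_scale:
  fixes z0 :: real
  assumes v: "valid_path \<gamma>" "valid_path \<delta>" and z0: "z0 \<noteq> 0"
  shows "of_real z0 powi (a - b) * corr_kernel \<gamma> \<delta> x n y k a b
    = corr_kernel (\<lambda>t. \<gamma> t / of_real z0) (\<lambda>t. \<delta> t / of_real z0) (\<lambda>i. x i * z0) n (\<lambda>j. y j / z0) k a b"
proof -
  define z where "z = complex_of_real z0"
  have z: "z \<noteq> 0" unfolding z_def using z0 by simp
  define G where "G u w = K_fun x n y k u / K_fun x n y k w * (u powi (- a - 1) * w powi b) / (u - w)" for u w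
  define G' where "G' u w = K_fun (\<lambda>i. x i * z0) n (\<lambda>j. y j / z0) k u / K_fun (\<lambda>i. x i * z0) n (\<lambda>j. y j / z0) k w * (u powi (- a - 1) * w powi b) / (u - w)" for u w
  have G: "G (z * u) (z * w) = z powi (b - a - 2) * G' u w" for u w
  proof -
    have "(z * u) powi (- a - 1) * (z * w) powi b / (z * u - z * w) = z powi (b - a - 2) * (u powi (- a - 1) * w powi b / (u - w))"
    proof -
      have "z powi (b - a - 2) = z powi (- a - 1) * z powi b / z"
        using z by (simp add: power_int_diff power_int_minus power_int_add field_simps power2_eq_square)
      moreover have "z * u - z * w = z * (u - w)" by (simp add: right_diff_distrib)
      moreover have "p * q * (r * s) / (z * d) = p * r / z * (q * s / d)" for p q r s d by simp
      ultimately show ?thesis by (simp only: power_int_mult_distrib)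
    qed
    moreover have "r * m / d = c * (r * m' / d')" if "m / d = c * (m' / d')" for r m d m' d' c :: complex
      using that by (metis times_divide_eq_right mult.left_commute)
    ultimately show ?thesis unfolding G_def G'_def z_def K_fun_scale[OF z0] by blast
  qed
  have "contour_integral \<gamma> (\<lambda>u. contour_integral \<delta> (G u))
    = z * contour_integral (\<lambda>t. \<gamma> t / z) (\<lambda>u. z * contour_integral (\<lambda>t. \<delta> t / z) (\<lambda>w. G (z * u) (z * w)))"
    by (subst contour_integral_scale(2)[OF v(1) z], subst contour_integral_scale(2)[OF v(2) z]) rule
  also have "\<dots> = z powi (b - a) * contour_integral (\<lambda>t. \<gamma> t / z) (\<lambda>u. contour_integral (\<lambda>t. \<delta> t / z) (G' u))"
  proof -
    have "z * (z * z powi (b - a - 2)) = z powi (b - a)" using z by (simp add: power_int_diff power2_eq_square)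
    then have "z * (z * (z powi (b - a - 2) * h)) = z powi (b - a) * h" for h by (simp only: mult.assoc[symmetric])
    moreover have "z * contour_integral (\<lambda>t. \<gamma> t / z) (\<lambda>u. z * contour_integral (\<lambda>t. \<delta> t / z) (\<lambda>w. G (z * u) (z * w)))
      = z * (z * (z powi (b - a - 2) * contour_integral (\<lambda>t. \<gamma> t / z) (\<lambda>u. contour_integral (\<lambda>t. \<delta> t / z) (G' u))))"
      unfolding G contour_integral_cmult ..
    ultimately show ?thesis by (rule trans[rotated])
  qed
  finally have "z powi (a - b) * contour_integral \<gamma> (\<lambda>u. contour_integral \<delta> (G u))
    = contour_integral (\<lambda>t. \<gamma> t / z) (\<lambda>u. contour_integral (\<lambda>t. \<delta> t / z) (G' u))"
    using z by (simp add: power_int_diff)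
  then show ?thesis unfolding corr_kernel_def G_def G'_def z_def[symmetric] by simp
qed

lemma kernel_contours_scale:
  assumes kc: "kernel_contours x n y k \<gamma> \<delta>" and z0: "z0 \<noteq> 0"
  shows "kernel_contours (\<lambda>i. x i * z0) n (\<lambda>j. y j / z0) k (\<lambda>t. \<gamma> t / of_real z0) (\<lambda>t. \<delta> t / of_real z0)"
proof -
  define z where "z = complex_of_real z0"
  have z: "z \<noteq> 0" unfolding z_def using z0 by simp
  note K = kc[unfolded kernel_contours_def]
  have v: "valid_path \<gamma>" "valid_path \<delta>" using K by blast+
  have pim: "path_image (\<lambda>t. g t / z) = (\<lambda>w. w / z) ` path_image g" for g unfolding path_image_def by auto
  have y: "z * - of_real (y j / z0) = - of_real (y j)" for j unfolding z_def using z0 by simp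
  have x: "z * of_real (1 / (x i * z0)) = of_real (1 / x i)" for i unfolding z_def using z0 by simp
  have "- of_real (y j / z0) \<notin> path_image (\<lambda>t. \<gamma> t / z) \<and> winding_number (\<lambda>t. \<gamma> t / z) (- of_real (y j / z0)) = 1"
    if "j \<in> {1..k}" for j
    using winding_number_scale[OF v(1) z, of "- of_real (y j / z0)"] K that unfolding y by simp
  moreover have "of_real (1 / (x i * z0)) \<notin> path_image (\<lambda>t. \<gamma> t / z) \<and> winding_number (\<lambda>t. \<gamma> t / z) (of_real (1 / (x i * z0))) = 0"
    if "i \<in> {1..n}" for i
    using winding_number_scale[OF v(1) z, of "of_real (1 / (x i * z0))"] K that unfolding x by simp
  moreover have "0 \<notin> path_image (\<lambda>t. \<gamma> t / z) \<and> winding_number (\<lambda>t. \<gamma> t / z) 0 = 1"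
    "0 \<notin> path_image (\<lambda>t. \<delta> t / z) \<and> winding_number (\<lambda>t. \<delta> t / z) 0 = 1"
    using winding_number_scale[OF v(1) z, of 0] winding_number_scale[OF v(2) z, of 0] K by simp_all
  moreover have "\<forall>u\<in>path_image (\<lambda>t. \<gamma> t / z). \<forall>w\<in>path_image (\<lambda>t. \<delta> t / z). norm w < norm u"
    unfolding pim using K z by (auto simp: norm_divide divide_strict_right_mono)
  ultimately show ?thesis
    unfolding kernel_contours_def z_def[symmetric]
    using contour_integral_scale(1)[OF v(1) z] contour_integral_scale(1)[OF v(2) z] K
    by (simp add: pathfinish_def pathstart_def)
qed

text \<open>The poles are real and not regular, so the winding formula for mirror symmetric loops
  applies to each of them.\<close>

lemma (in contour_setup) symmetric_loop:
  assumes e: "e = 1 \<or> e = -1" and \<epsilon>0: "0 < \<epsilon> N" "\<epsilon> N \<le> \<delta>" and g: "good A M N"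
  defines "l \<equiv> upper e N +++ reversepath (cnj \<circ> upper e N)"
  shows "valid_path l" "pathfinish l = pathstart l" "path_image l \<subseteq> regular N"
    "\<And>z. z \<in> path_image l \<Longrightarrow> if e = 1 then 1 < norm z else norm z < 1"
    "\<And>p. of_real p \<notin> regular N \<Longrightarrow> winding_number l (of_real p)
       = (if p < 1 + e * \<epsilon> N then 1 else 0) - (if p < - \<tau> * e * exp (e * R) then 1 else 0)"
    "contour_integral l (F A A' N) = sym_int (upper e N) (F A A' N)"
proof -
  note u = upper_props[OF e \<epsilon>0 g]
  have vc: "valid_path (cnj \<circ> upper e N)" using u(1) valid_path_cnj by blast
  have pf: "pathfinish (upper e N) = pathfinish (cnj \<circ> upper e N)" "pathstart (upper e N) = pathstart (cnj \<circ> upper e N)"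
    using u(2,3) by (simp_all add: pathfinish_def pathstart_def)
  have ic: "path_image (cnj \<circ> upper e N) = cnj ` path_image (upper e N)" by (simp add: path_image_def image_comp)
  have im: "path_image l = path_image (upper e N) \<union> cnj ` path_image (upper e N)"
    unfolding l_def using pf by (simp add: path_image_join ic)
  show "valid_path l" unfolding l_def using u(1) vc pf by (intro valid_path_join) auto
  show "pathfinish l = pathstart l" unfolding l_def using pf by simp
  show "path_image l \<subseteq> regular N" unfolding im using u(4) by auto
  show "if e = 1 then 1 < norm z else norm z < 1" if "z \<in> path_image l" for z
    using that u(4) e unfolding im by (auto split: if_splits)
  show "winding_number l (of_real p) = (if p < 1 + e * \<epsilon> N then 1 else 0) - (if p < - \<tau> * e * exp (e * R) then 1 else 0)"
    if "of_real p \<notin> regular N" for p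
    unfolding l_def by (rule symmetric_loop_winding[OF u(1) _ u(2,3)]) (use u(4) that in auto)
  have "F A A' N contour_integrable_on upper e N" "F A A' N contour_integrable_on (cnj \<circ> upper e N)"
    using u(1,4) vc ic by (auto intro!: F_contour_integrable)
  then show "contour_integral l (F A A' N) = sym_int (upper e N) (F A A' N)"
    unfolding l_def sym_int_def by (rule symmetric_loop_integral[OF u(1,3)])
qed

theorem corr_kernel_tendsto_pearcey:
  fixes n k :: "nat \<Rightarrow> nat" and a b :: "nat \<Rightarrow> int" and X Y :: "nat \<Rightarrow> nat \<Rightarrow> real"
  defines "I \<equiv> \<lambda>N. {1..n N} <+> {1..k N}"
    and "P \<equiv> \<lambda>N. case_sum (\<lambda>i. X N i / (1 - X N i)) (\<lambda>j. - 1 / (1 + Y N j))"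
  assumes na: "node_array I P \<epsilon> B D \<mu> \<tau>"
    and X: "\<And>N i. i \<in> {1..n N} \<Longrightarrow> X N i \<noteq> 1 \<and> 0 < \<tau> * X N i \<and> \<bar>X N i\<bar> \<le> M"
    and Y: "\<And>N j. j \<in> {1..k N} \<Longrightarrow> Y N j \<noteq> -1 \<and> 0 \<le> \<tau> * Y N j \<and> \<bar>Y N j\<bar> \<le> M"
    and drift: "node_array.drift I P \<epsilon> (\<lambda>N. int (k N) - a N) \<xi>" "node_array.drift I P \<epsilon> (\<lambda>N. int (k N) - b N) \<eta>"
    and ab: "\<tau> = -1 \<Longrightarrow> \<forall>\<^sub>F N in sequentially. a N \<noteq> b N"
    and kc: "\<And>N. kernel_contours (X N) (n N) (Y N) (k N) (\<gamma> N) (\<gamma>' N)"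
  shows "(\<lambda>N. of_real (\<tau> / \<epsilon> N) * corr_kernel (\<gamma> N) (\<gamma>' N) (X N) (n N) (Y N) (k N) (a N) (b N)) \<longlonglongrightarrow> pearcey_kernel \<xi> \<eta>"
proof -
  interpret node_array I P \<epsilon> B D \<mu> \<tau> by (rule na)
  obtain x1 where x1: "0 < x1" and start: "\<And>e. e = 1 \<or> e = -1 \<Longrightarrow> 0 < e * (level_re (e * x1) - 1) \<and>
     e * (level_re (e * x1) - 1) / 2 \<le> Im (level_curve (e * x1)) \<and> Im (level_curve (e * x1)) \<le> e * (level_re (e * x1) - 1)
     \<and> norm (level_curve (e * x1) - 1) \<le> 2 * \<delta>"
  proof -
    have "0 < 2 * \<delta>" using \<delta>_pos(1) by simp
    then show thesis using that by (rule level_start)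
  qed
  obtain c where c: "0 < c" and gain: "\<And>p x. \<lbrakk>\<bar>p\<bar> \<le> B; x1 \<le> \<bar>x\<bar>\<rbrakk> \<Longrightarrow> c * (tw p)\<^sup>2 \<le> level_gain p x"
    by (rule level_gain_lower_bound[OF x1 less_imp_le[OF B0]]) (rule that)
  define Q where "Q = 8 / \<mu>\<^sup>2 * (B * (1 + B) * D)"
  \<comment> \<open>Besides the two conditions of \<open>contour_setup\<close>, \<open>exp R\<close>
    has to exceed \<open>M\<close>: then the closing points at \<open>exp R\<close> or
    \<open>exp (- R)\<close> in modulus lie beyond all \<open>- Y\<close> and below all
    \<open>1 / X\<close>.\<close>
  define q where "q = \<bar>2 * (1 + B) / \<mu>\<bar> + \<bar>M\<bar> + \<bar>4 * Q / c\<bar> + 1"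
  define R where "R = max x1 (ln q)"
  have "exp (ln q) \<le> exp R" unfolding R_def by simp
  moreover have "0 < q" unfolding q_def by linarith
  ultimately have "q \<le> exp R" by simp
  then have R: "x1 \<le> R" "2 * (1 + B) / \<mu> \<le> exp R" "M < exp R" "4 * Q / c \<le> exp R"
    unfolding q_def R_def by linarith+
  have "8 * exp (- R) / \<mu>\<^sup>2 * (B * (1 + B) * D) = Q / exp R" unfolding Q_def by (simp add: exp_minus field_simps)
  also have "\<dots> \<le> c / 4" using R(4) c by (simp add: field_simps)
  finally have R2: "8 * exp (- R) / \<mu>\<^sup>2 * (B * (1 + B) * D) \<le> c / 4" .
  interpret contour_setup I P \<epsilon> B D \<mu> \<tau> x1 R c
    by unfold_locales (fact x1 R(1) c start gain R(2) R2)+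
  define A where "A N = int (k N) - a N" for N
  define A' where "A' N = int (k N) - b N" for N
  define V where "V N = sym_int (upper 1 N) (F A A' N) - sym_int (upper (-1) N) (F A A' N)" for N
  have dr: "drift A \<xi>" "drift A' \<eta>" unfolding A_def A'_def by (rule drift)+
  obtain M' where M': "\<forall>\<^sub>F N in sequentially. good A M' N" using eventually_good[OF dr(1)] by metis
  have ev: "\<forall>\<^sub>F N in sequentially. \<tau> = -1 \<longrightarrow> a N \<noteq> b N" using ab by (cases "\<tau> = -1") auto
  have main: "corr_kernel (\<gamma> N) (\<gamma>' N) (X N) (n N) (Y N) (k N) (a N) (b N) = of_real \<tau> * (1 / (2 * of_real pi * \<i>)\<^sup>2 * V N)"
    if \<epsilon>0: "0 < \<epsilon> N" and \<epsilon>1: "\<epsilon> N < \<delta>" and g: "good A M' N" and nab: "\<tau> = -1 \<longrightarrow> a N \<noteq> b N" for N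
  proof -
    note loop = symmetric_loop[OF _ \<epsilon>0 less_imp_le[OF \<epsilon>1] g]
    define l where "l e = upper e N +++ reversepath (cnj \<circ> upper e N)" for e
    let ?S = "kernel_poles (X N) (n N) (Y N) (k N)"
    \<comment> \<open>Poles are at distance at least \<open>1 / B\<close> from 1, so none lies
      between \<open>1 - \<epsilon>\<close> and \<open>1 + \<epsilon>\<close>, where the two loops
      cross the real axis.\<close>
    have Bd: "\<delta> < 1 / B" unfolding \<delta>_def using B0 by (simp add: field_simps)
    have PX: "\<bar>p - 1\<bar> > \<epsilon> N \<and> complex_of_real p \<notin> regular N" if p: "P N i * (p - 1) = 1" and i: "i \<in> I N" for p i
    proof
      have "1 = \<bar>P N i\<bar> * \<bar>p - 1\<bar>" using p by (metis abs_mult abs_one)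
      also have "\<dots> \<le> B * \<bar>p - 1\<bar>" using Pb[OF i] by (intro mult_right_mono) auto
      finally have "1 / B \<le> \<bar>p - 1\<bar>" using B0 by (simp add: field_simps)
      then show "\<bar>p - 1\<bar> > \<epsilon> N" using \<epsilon>1 Bd by linarith
      have "1 - complex_of_real (P N i) * (of_real p - 1) = of_real (1 - P N i * (p - 1))" by simp
      also have "\<dots> = 0" using p by simp
      finally show "complex_of_real p \<notin> regular N" unfolding regular_def using i by blast
    qed
    have pole: "p = 0 \<or> p \<in> (\<lambda>i. 1 / X N i) ` {1..n N} \<or> p \<in> (\<lambda>j. - Y N j) ` {1..k N}" if "p \<in> ?S" for p
      using that unfolding kernel_poles_def by auto
    have poleX: "\<bar>1 / X N i - 1\<bar> > \<epsilon> N \<and> complex_of_real (1 / X N i) \<notin> regular N" if i: "i \<in> {1..n N}" for i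
    proof (rule PX)
      have "X N i \<noteq> 0" "1 - X N i \<noteq> 0" using X[OF i] by auto
      then show "P N (Inl i) * (1 / X N i - 1) = 1" unfolding P_def by (simp add: field_simps)
      show "Inl i \<in> I N" unfolding I_def using i by auto
    qed
    have poleY: "\<bar>- Y N j - 1\<bar> > \<epsilon> N \<and> complex_of_real (- Y N j) \<notin> regular N" if j: "j \<in> {1..k N}" for j
    proof (rule PX)
      have "1 + Y N j \<noteq> 0" using Y[OF j] by auto
      then show "P N (Inr j) * (- Y N j - 1) = 1" unfolding P_def by (simp add: field_simps)
      show "Inr j \<in> I N" unfolding I_def using j by auto
    qed
    have reg: "complex_of_real p \<notin> regular N" if "p \<in> ?S" for p
      using pole[OF that]
    proof (elim disjE imageE)
      assume "p = 0" then show ?thesis unfolding regular_def by simp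
    next
      fix i assume "p = 1 / X N i" "i \<in> {1..n N}" then show ?thesis using poleX by blast
    next
      fix j assume "p = - Y N j" "j \<in> {1..k N}" then show ?thesis using poleY by blast
    qed
    have \<epsilon>h: "\<epsilon> N < 1" using \<epsilon>1 \<delta>_pos(2) by linarith
    have eR: "exp (- R) < 1" using R0 by simp
    \<comment> \<open>For \<open>\<tau> = 1\<close> the outer loop winds once about the reals
      between \<open>- exp R\<close> and \<open>1 + \<epsilon>\<close>, the inner one about those
      between \<open>exp (- R)\<close> and \<open>1 - \<epsilon>\<close>; the difference keeps 0 and
      the poles \<open>- Y\<close> and drops all \<open>1 / X\<close>. For
      \<open>\<tau> = -1\<close> the outer loop winds -1 times about the reals between
      \<open>1 + \<epsilon>\<close> and \<open>exp R\<close>, and the inner one once about those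
      between \<open>- exp (- R)\<close> and \<open>1 - \<epsilon>\<close>.\<close>
    have wn: "winding_number (\<gamma> N) (of_real p) = of_real \<tau> * winding_number (l 1) (of_real p) + of_real (- \<tau>) * winding_number (l (-1)) (of_real p)"
      if p: "p \<in> ?S" for p
    proof -
      define v where "v e = (if p < 1 + e * \<epsilon> N then 1 else 0) - (if p < - \<tau> * e * exp (e * R) then 1 else 0 :: real)" for e
      have w: "winding_number (l e) (of_real p) = of_real (v e)" if "e = 1 \<or> e = -1" for e
        unfolding l_def loop(5)[OF that reg[OF p]] v_def by simp
      define E where "E s = exp (s * R)" for s :: real
      have E: "exp R = E 1" "exp (- R) = E (-1)" "0 < E 1" "0 < E (-1)" unfolding E_def by simp_all
      have v': "v 1 = (if p < 1 + \<epsilon> N then 1 else 0) - (if p < - \<tau> * E 1 then 1 else 0)"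
        "v (-1) = (if p < 1 - \<epsilon> N then 1 else 0) - (if p < \<tau> * E (-1) then 1 else 0)"
        unfolding v_def E_def by simp_all
      note kc' = kc[of N, unfolded kernel_contours_def]
      have "winding_number (\<gamma> N) (of_real p) = of_real (\<tau> * v 1 - \<tau> * v (-1))"
        using pole[OF p]
      proof (elim disjE imageE)
        assume p0: "p = 0"
        have "\<tau> * v 1 - \<tau> * v (-1) = 1" unfolding v' p0 using \<tau> \<epsilon>h \<epsilon>0 E(3,4) by auto
        then show ?thesis using kc' p0 by simp
      next
        fix i assume i: "p = 1 / X N i" "i \<in> {1..n N}"
        have xi: "0 < \<tau> * X N i" "\<bar>X N i\<bar> < exp R" using X[OF i(2)] R(3) by auto
        then have "exp (- R) < \<tau> * p" unfolding i using \<tau> by (auto simp: exp_minus field_simps)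
        moreover have "\<epsilon> N < \<bar>p - 1\<bar>" using poleX[OF i(2)] unfolding i by blast
        ultimately have "\<tau> * v 1 - \<tau> * v (-1) = 0" unfolding v' using \<tau> \<epsilon>0 \<epsilon>h E(3,4) unfolding E(1,2) by auto
        moreover have "winding_number (\<gamma> N) (of_real p) = 0" using kc' i by blast
        ultimately show ?thesis by simp
      next
        fix j assume j: "p = - Y N j" "j \<in> {1..k N}"
        have yj: "\<tau> * p \<le> 0" "\<bar>p\<bar> < exp R" using Y[OF j(2)] R(3) unfolding j by auto
        moreover have "\<epsilon> N < \<bar>p - 1\<bar>" using poleY[OF j(2)] unfolding j by blast
        ultimately have "\<tau> * v 1 - \<tau> * v (-1) = 1" unfolding v' using \<tau> \<epsilon>0 \<epsilon>h E(3,4) unfolding E(1,2) by auto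
        moreover have "winding_number (\<gamma> N) (of_real p) = 1" using kc' j by simp
        ultimately show ?thesis by simp
      qed
      then show ?thesis using w[of 1] w[of "-1"] by simp
    qed
    have X1: "X N i \<noteq> 1" if "i \<in> {1..n N}" for i using X[OF that] by blast
    have Y1: "Y N j \<noteq> -1" if "j \<in> {1..k N}" for j using Y[OF that] by blast
    \<comment> \<open>The constant \<open>K1\<close> enters through the value of \<open>K\<close> at
      \<open>z\<close> and inversely through the one at \<open>w\<close>, and cancels.\<close>
    have KF: "K_fun (X N) (n N) (Y N) (k N) z * z powi (- a N - 1) * contour_integral unit_circle (\<lambda>w. w powi b N / K_fun (X N) (n N) (Y N) (k N) w / (z - w))
       = F A A' N z" if z: "z \<noteq> 0" for z
    proof -
      define K1 where "K1 = K_fun (X N) (n N) (Y N) (k N) 1"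
      have "(1 :: complex) \<notin> of_real ` kernel_poles (X N) (n N) (Y N) (k N)"
      proof
        assume "(1 :: complex) \<in> of_real ` kernel_poles (X N) (n N) (Y N) (k N)"
        then have "1 \<in> kernel_poles (X N) (n N) (Y N) (k N)" by (metis image_iff of_real_1 of_real_eq_iff)
        from pole[OF this] show False using poleX poleY \<epsilon>0 by fastforce
      qed
      then have K10: "K1 \<noteq> 0" unfolding K1_def by (rule K_fun_nonzero(1))
      have HK: "K_fun (X N) (n N) (Y N) (k N) u * u powi (- d) = K1 * node_prod (int (k N) - d) (I N) (P N) u" if "u \<noteq> 0" for u d
        unfolding K1_def I_def P_def by (rule K_fun_node_prod[OF X1 Y1 that])
      have c: "contour_integral unit_circle (\<lambda>w. w powi b N / K_fun (X N) (n N) (Y N) (k N) w / (z - w))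
        = contour_integral unit_circle (\<lambda>w. 1 / K1 * (1 / H A' N w / (z - w)))"
      proof (rule contour_integral_eq)
        fix w assume "w \<in> path_image unit_circle"
        then have "w \<noteq> 0" using path_image_unit_circle by auto
        then have "w powi b N / K_fun (X N) (n N) (Y N) (k N) w = 1 / (K_fun (X N) (n N) (Y N) (k N) w * w powi (- b N))"
          by (simp add: power_int_minus field_simps)
        then show "w powi b N / K_fun (X N) (n N) (Y N) (k N) w / (z - w) = 1 / K1 * (1 / H A' N w / (z - w))"
          unfolding HK[OF \<open>w \<noteq> 0\<close>] A'_def by simp
      qed
      have "K_fun (X N) (n N) (Y N) (k N) z * z powi (- a N - 1) = K1 * H A N z / z"
        using HK[OF z, of "a N"] z unfolding A_def by (simp add: power_int_diff)
      then show ?thesis unfolding c contour_integral_cmult F_def inner_def using K10 by simp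
    qed
    have lp: "valid_path (l e)" "pathfinish (l e) = pathstart (l e)" "path_image (l e) \<inter> of_real ` ?S = {}"
      "\<And>z. z \<in> path_image (l e) \<Longrightarrow> if e = 1 then 1 < norm z else norm z < 1"
      "contour_integral (l e) (F A A' N) = sym_int (upper e N) (F A A' N)"
      "contour_integral (l e) (\<lambda>z. K_fun (X N) (n N) (Y N) (k N) z * z powi (- a N - 1)
        * contour_integral unit_circle (\<lambda>w. w powi b N / K_fun (X N) (n N) (Y N) (k N) w / (z - w)))
       = contour_integral (l e) (F A A' N)" if e: "e = 1 \<or> e = -1" for e
    proof -
      note L = loop[OF e, folded l_def]
      show "valid_path (l e)" "pathfinish (l e) = pathstart (l e)" by (fact L(1) L(2))+
      show "path_image (l e) \<inter> of_real ` ?S = {}" using L(3) reg by blast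
      show "if e = 1 then 1 < norm z else norm z < 1" if "z \<in> path_image (l e)" for z by (rule L(4)[OF that])
      show "contour_integral (l e) (F A A' N) = sym_int (upper e N) (F A A' N)" by (fact L(6))
      show "contour_integral (l e) (\<lambda>z. K_fun (X N) (n N) (Y N) (k N) z * z powi (- a N - 1)
        * contour_integral unit_circle (\<lambda>w. w powi b N / K_fun (X N) (n N) (Y N) (k N) w / (z - w)))
       = contour_integral (l e) (F A A' N)"
      proof (rule contour_integral_eq)
        fix z assume "z \<in> path_image (l e)"
        then have "z \<noteq> 0" using L(3) unfolding regular_def by blast
        then show "K_fun (X N) (n N) (Y N) (k N) z * z powi (- a N - 1)
          * contour_integral unit_circle (\<lambda>w. w powi b N / K_fun (X N) (n N) (Y N) (k N) w / (z - w)) = F A A' N z"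
          by (rule KF)
      qed
    qed
    have pm: "(1 :: real) = 1 \<or> (1 :: real) = -1" "(-1 :: real) = 1 \<or> (-1 :: real) = -1" by simp_all
    have "corr_kernel (\<gamma> N) (\<gamma>' N) (X N) (n N) (Y N) (k N) (a N) (b N) = 1 / (2 * of_real pi * \<i>)\<^sup>2 *
      (of_real \<tau> * contour_integral (l 1) (F A A' N) + of_real (- \<tau>) * contour_integral (l (-1)) (F A A' N))"
      unfolding lp(6)[OF pm(1), symmetric] lp(6)[OF pm(2), symmetric]
    proof (rule corr_kernel_two_loops[OF kc lp(1-3)[OF pm(1)] _ lp(1-3)[OF pm(2)]])
      show "1 < norm z" if "z \<in> path_image (l 1)" for z using lp(4)[OF pm(1) that] by simp
      show "norm z < 1" if "z \<in> path_image (l (-1))" for z using lp(4)[OF pm(2) that] by simp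
      show "winding_number (\<gamma> N) (of_real p) = of_real \<tau> * winding_number (l 1) (of_real p) + of_real (- \<tau>) * winding_number (l (-1)) (of_real p)"
        if "p \<in> ?S" for p by (rule wn[OF that])
      assume "a N = b N"
      then have "\<tau> = 1" using nab \<tau> by blast
      then show "winding_number (l (-1)) 0 = 0"
        using loop(5)[OF pm(2), of 0, folded l_def] reg[of 0] \<epsilon>h unfolding kernel_poles_def by simp
    qed
    then show ?thesis unfolding V_def lp(5)[OF pm(1)] lp(5)[OF pm(2)] by (simp add: algebra_simps)
  qed
  have "(\<lambda>N. 1 / (2 * of_real pi * \<i>)\<^sup>2 * V N / of_real (\<epsilon> N)) \<longlonglongrightarrow> pearcey_kernel \<xi> \<eta>"
    unfolding V_def by (rule core_tendsto[OF dr])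
  then show ?thesis
  proof (rule Lim_transform_eventually)
    show "\<forall>\<^sub>F N in sequentially. 1 / (2 * of_real pi * \<i>)\<^sup>2 * V N / of_real (\<epsilon> N)
      = of_real (\<tau> / \<epsilon> N) * corr_kernel (\<gamma> N) (\<gamma>' N) (X N) (n N) (Y N) (k N) (a N) (b N)"
      using M' ev \<epsilon>_pos \<epsilon>_less[OF \<delta>_pos(1)]
    proof eventually_elim
      case (elim N)
      have "of_real \<tau> * of_real \<tau> = (1 :: complex)" using \<tau> by auto
      then have "h / e = of_real \<tau> / e * (of_real \<tau> * h)" for h e :: complex
        by (metis times_divide_eq_left mult.assoc mult.commute mult_1_left)
      then show ?case unfolding main[OF elim(3,4,1,2)] of_real_divide .
    qed
  qed
qed

section \<open>Moments of the nodes at the critical point\<close>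

text \<open>Multiplication by a power of \<open>z\<close> turns derivatives of the action into
  moments of the nodes. The leftover term is the moment of a mass \<open>t - c\<close> at
  \<open>p = -1\<close>, where \<open>T = 0\<close>; this is why it cancels from every combination
  of moments that is divisible by \<open>T\<close>.\<close>

lemma action_D_moment:
  assumes z: "z \<noteq> 0"
  shows "z ^ Suc r * action_D f g c t (Suc r) z = fact r * (integral {0..1} (\<lambda>s. (f s * z / (1 - f s * z)) ^ Suc r)
     + c * integral {0..1} (\<lambda>s. (- 1 / (1 + g s / z)) ^ Suc r) + (-1) ^ Suc r * (t - c))"
proof -
  have "z ^ Suc r * integral {0..1} (\<lambda>s. (f s / (1 - f s * z)) ^ Suc r)
    = integral {0..1} (\<lambda>s. (f s * z / (1 - f s * z)) ^ Suc r)"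
    unfolding integral_mult_right[symmetric] power_mult_distrib[symmetric]
    by (rule arg_cong[where f = "integral {0..1}"]) (simp add: fun_eq_iff mult.commute)
  moreover have "(-1) ^ Suc r * (z ^ Suc r * integral {0..1} (\<lambda>s. (1 / (z + g s)) ^ Suc r))
    = integral {0..1} (\<lambda>s. (- 1 / (1 + g s / z)) ^ Suc r)"
    unfolding integral_mult_right[symmetric] power_mult_distrib[symmetric]
  proof (rule arg_cong[where f = "integral {0..1}"], rule ext)
    fix s
    have "1 + g s / z = (z + g s) / z" using z by (simp add: field_simps)
    then have "-1 * (z * (1 / (z + g s))) = - 1 / (1 + g s / z)" by simp
    then show "(-1 * (z * (1 / (z + g s)))) ^ Suc r = (- 1 / (1 + g s / z)) ^ Suc r" by (simp only:)
  qed
  moreover have "z ^ Suc r * (1 / z) ^ Suc r = 1" using z by (simp add: power_mult_distrib[symmetric] del: power_Suc)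
  moreover have "z ^ Suc r * action_D f g c t (Suc r) z = fact r * (z ^ Suc r * integral {0..1} (\<lambda>s. (f s / (1 - f s * z)) ^ Suc r)
     + c * ((-1) ^ Suc r * (z ^ Suc r * integral {0..1} (\<lambda>s. (1 / (z + g s)) ^ Suc r))) + (-1) ^ Suc r * ((t - c) * (z ^ Suc r * (1 / z) ^ Suc r)))"
    unfolding action_D_def by (simp add: algebra_simps del: power_Suc)
  ultimately show ?thesis by (simp only: mult_1_right)
qed

text \<open>The Riemann sum errors are bounded, and hypothesis \<open>d\<close> controls the
  deviation of \<open>k\<close> from \<open>c n\<close>. The precision is the one at which the drift
  has to be known.\<close>

lemma power_sum_asymptotics:
  fixes n k :: "nat \<Rightarrow> nat"
  assumes p: "pw_lip p" and q: "pw_lip q" and n: "filterlim n at_top sequentially" and k: "filterlim k at_top sequentially"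
    and d: "(\<lambda>N. (real (k N) - c * real (n N)) / real (n N) powr (1 / 4)) \<longlonglongrightarrow> 0"
  shows "(\<lambda>N. ((\<Sum>i=1..n N. p (real i / real (n N))) + (\<Sum>j=1..k N. q (real j / real (k N)))
     - real (n N) * (integral {0..1} p + c * integral {0..1} q)) / real (n N) powr (1 / 4)) \<longlonglongrightarrow> 0"
proof -
  obtain C1 where C1: "\<And>n. n > 0 \<Longrightarrow> \<bar>(\<Sum>i=1..n. p (real i / real n)) - real n * integral {0..1} p\<bar> \<le> C1"
    using pw_lip_riemann_sum[OF p] by blast
  obtain C2 where C2: "\<And>n. n > 0 \<Longrightarrow> \<bar>(\<Sum>i=1..n. q (real i / real n)) - real n * integral {0..1} q\<bar> \<le> C2"
    using pw_lip_riemann_sum[OF q] by blast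
  define E where "E N = (\<Sum>i=1..n N. p (real i / real (n N))) - real (n N) * integral {0..1} p
     + ((\<Sum>j=1..k N. q (real j / real (k N))) - real (k N) * integral {0..1} q)" for N
  have n': "filterlim (\<lambda>N. real (n N)) at_top sequentially" by (rule filterlim_compose[OF filterlim_real_sequentially n])
  have "((\<lambda>x::real. (C1 + C2) / x powr (1 / 4)) \<longlongrightarrow> 0) at_top" by real_asymp
  then have "(\<lambda>N. (C1 + C2) / real (n N) powr (1 / 4)) \<longlonglongrightarrow> 0" using n' by (rule filterlim_compose)
  moreover have "\<forall>\<^sub>F N in sequentially. norm (E N / real (n N) powr (1 / 4)) \<le> (C1 + C2) / real (n N) powr (1 / 4)"
    using eventually_compose_filterlim[OF eventually_gt_at_top n, of 0] eventually_compose_filterlim[OF eventually_gt_at_top k, of 0]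
  proof eventually_elim
    case (elim N)
    have "\<bar>E N\<bar> \<le> C1 + C2" using C1[OF elim(1)] C2[OF elim(2)] unfolding E_def by linarith
    then show ?case by (simp add: divide_right_mono)
  qed
  ultimately have "(\<lambda>N. E N / real (n N) powr (1 / 4)) \<longlonglongrightarrow> 0" by (rule Lim_null_comparison[rotated])
  then have "(\<lambda>N. E N / real (n N) powr (1 / 4) + integral {0..1} q * ((real (k N) - c * real (n N)) / real (n N) powr (1 / 4))) \<longlonglongrightarrow> 0 + integral {0..1} q * 0"
    by (intro tendsto_intros d)
  moreover have "E N / y + integral {0..1} q * ((real (k N) - c * real (n N)) / y) = ((\<Sum>i=1..n N. p (real i / real (n N))) + (\<Sum>j=1..k N. q (real j / real (k N)))
     - real (n N) * (integral {0..1} p + c * integral {0..1} q)) / y" for N y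
    unfolding E_def times_divide_eq_right add_divide_distrib[symmetric] by (rule arg_cong[where f = "\<lambda>x. x / y"]) (simp add: algebra_simps)
  ultimately show ?thesis by simp
qed

theorem theorem1p6:
  fixes f g :: "real \<Rightarrow> real"
    and c t_minus t_d t_plus z_c \<xi> \<eta> :: real
    and n k :: "nat \<Rightarrow> nat"
    and a b :: "nat \<Rightarrow> int"
    and \<gamma> \<delta> :: "nat \<Rightarrow> real \<Rightarrow> complex"
  defines "\<sigma> \<equiv> pearcey_sigma f g c t_d z_c"
  assumes "piecewise_C1 f" and "piecewise_C1 g"
    and "\<forall>s\<in>{0..1}. f s > 0" and "\<forall>s\<in>{0..1}. g s \<ge> 0"
    and "filterlim n at_top sequentially" and "filterlim k at_top sequentially"
    and "(\<lambda>N. real (k N) / real (n N)) \<longlonglongrightarrow> c"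
    and "(\<lambda>N. (real (k N) - c * real (n N)) / real (n N) powr (1 / 4)) \<longlonglongrightarrow> 0"
    and "support_interval f g c t_minus t_d" and "support_interval f g c t_d t_plus"
    and "real_double_critical f g c z_c t_d"
    and "action_deriv 3 f g c z_c t_d = 0" and "action_deriv 4 f g c z_c t_d \<noteq> 0"
    and "(\<lambda>N. (site (a N) - t_d * real (n N)) / real (n N) powr (1 / 4)) \<longlonglongrightarrow> \<xi> / \<sigma>"
    and "(\<lambda>N. (site (b N) - t_d * real (n N)) / real (n N) powr (1 / 4)) \<longlonglongrightarrow> \<eta> / \<sigma>"
    and "z_c < 0 \<Longrightarrow> \<forall>\<^sub>F N in sequentially. a N \<noteq> b N"
    and "\<And>N. kernel_contours (\<lambda>i. f (real i / real (n N))) (n N)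
                             (\<lambda>j. g (real j / real (k N))) (k N) (\<gamma> N) (\<delta> N)"
  shows "(\<lambda>N. of_real (real (n N) powr (1 / 4) / \<sigma>) * of_real z_c powi (a N - b N)
            * corr_kernel (\<gamma> N) (\<delta> N) (\<lambda>i. f (real i / real (n N))) (n N)
                (\<lambda>j. g (real j / real (k N))) (k N) (a N) (b N))
         \<longlonglongrightarrow> pearcey_kernel \<xi> \<eta>"
proof -
  note n = assms(6) and k = assms(7) and kn = assms(8) and kd = assms(9) and kc = assms(18)
  have f0: "\<And>s. s \<in> {0..1} \<Longrightarrow> f s > 0" and g0: "\<And>s. s \<in> {0..1} \<Longrightarrow> g s \<ge> 0" using assms(4,5) by blast+
  have f: "pw_lip f" and g: "pw_lip g" using assms(2,3) by (auto intro: piecewise_C1_imp_pw_lip)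
  have dom: "z_c \<in> action_domain f g" and cr: "action_deriv 1 f g c z_c t_d = 0" "action_deriv 2 f g c z_c t_d = 0"
    using assms(12) unfolding real_double_critical_def by auto
  have z: "z_c \<noteq> 0" using dom unfolding action_domain_def by auto
  define \<tau> where "\<tau> = sgn z_c"
  have \<tau>: "\<tau> = 1 \<or> \<tau> = -1" unfolding \<tau>_def using z by (auto simp: sgn_if)
  have \<tau>z: "\<tau> * z_c = \<bar>z_c\<bar>" unfolding \<tau>_def by (simp add: abs_sgn mult.commute)
  obtain e where e: "e > 0" "\<And>s. s \<in> {0..1} \<Longrightarrow> e \<le> \<bar>1 - f s * z_c\<bar>" "\<And>s. s \<in> {0..1} \<Longrightarrow> e \<le> \<bar>z_c + g s\<bar>"
    by (rule action_domain_bound[OF dom f0]) (assumption, rule that)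
  define X where "X s = f s * z_c" for s
  define Y where "Y s = g s / z_c" for s
  have lip: "pw_lip X" "pw_lip Y" unfolding X_def[abs_def] Y_def[abs_def] divide_inverse by (intro pw_lip_intros f g)+
  obtain M1 where M1: "M1 > 0" "\<And>s. s \<in> {0..1} \<Longrightarrow> \<bar>X s\<bar> \<le> M1" by (rule pw_lip_bounded[OF lip(1)]) (rule that)
  obtain M2 where M2: "M2 > 0" "\<And>s. s \<in> {0..1} \<Longrightarrow> \<bar>Y s\<bar> \<le> M2" by (rule pw_lip_bounded[OF lip(2)]) (rule that)
  define M where "M = max M1 M2"
  have M: "M > 0" "\<And>s. s \<in> {0..1} \<Longrightarrow> \<bar>X s\<bar> \<le> M \<and> \<bar>Y s\<bar> \<le> M" unfolding M_def using M1 M2 by fastforce+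
  define e' where "e' = min e (e / \<bar>z_c\<bar>)"
  have e'0: "e' > 0" unfolding e'_def using e z by simp
  have e': "e' \<le> \<bar>1 - X s\<bar>" "e' \<le> \<bar>1 + Y s\<bar>" if s: "s \<in> {0..1}" for s
  proof -
    show "e' \<le> \<bar>1 - X s\<bar>" unfolding e'_def X_def using e(2)[OF s] by simp
    have "1 + Y s = (z_c + g s) / z_c" unfolding Y_def using z by (simp add: field_simps)
    then have "\<bar>1 + Y s\<bar> = \<bar>z_c + g s\<bar> / \<bar>z_c\<bar>" by simp
    then have "e / \<bar>z_c\<bar> \<le> \<bar>1 + Y s\<bar>" using e(3)[OF s] by (simp add: divide_right_mono)
    then show "e' \<le> \<bar>1 + Y s\<bar>" unfolding e'_def by simp
  qed
  define p where "p s = X s / (1 - X s)" for s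
  define q where "q s = - 1 / (1 + Y s)" for s
  have pq: "pw_lip p" "pw_lip q" unfolding p_def[abs_def] q_def[abs_def]
    by (rule pw_lip_divide[OF _ _ e'0]; intro pw_lip_intros lip e'; assumption)+
  define m where "m r = integral {0..1} (\<lambda>s. p s ^ r) + c * integral {0..1} (\<lambda>s. q s ^ r)" for r
  have mom: "z_c ^ Suc r * action_deriv (Suc r) f g c z_c t_d = fact r * (m (Suc r) + (-1) ^ Suc r * (t_d - c))" for r
  proof -
    have "action_deriv (Suc r) f g c z_c t_d = action_D f g c t_d (Suc r) z_c" by (rule action_deriv_eq[OF f0 f g dom])
    then have "z_c ^ Suc r * action_deriv (Suc r) f g c z_c t_d = z_c ^ Suc r * action_D f g c t_d (Suc r) z_c" by (simp only:)
    also have "\<dots> = fact r * (m (Suc r) + (-1) ^ Suc r * (t_d - c))"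
      unfolding action_D_moment[OF z] m_def p_def q_def X_def Y_def ..
    finally show ?thesis .
  qed
  define A4 where "A4 = action_deriv 4 f g c z_c t_d"
  define \<kappa> where "\<kappa> = z_c ^ 4 * A4 / 6"
  have m1: "m 1 = t_d - c" using mom[of 0] cr(1) by simp
  have m2: "m 2 = - (t_d - c)" using mom[of 1] cr(2) by (simp add: numeral_2_eq_2)
  have m3: "m 3 = t_d - c" using mom[of 2] assms(13) by (simp add: eval_nat_numeral)
  have m4: "m 4 = \<kappa> - (t_d - c)" using mom[of 3] unfolding \<kappa>_def A4_def by (simp add: eval_nat_numeral field_simps)
  \<comment> \<open>The moments of \<open>T\<close>, \<open>p T\<close> and
    \<open>T\<^sup>2\<close>, written out with \<open>T = p + p\<^sup>2\<close>.\<close>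
  have mT: "m 1 + m 2 = 0" "m 2 + m 3 = 0" "m 2 + 2 * m 3 + m 4 = \<kappa>" using m1 m2 m3 m4 by simp_all
  have c0: "0 \<le> c" by (rule tendsto_lowerbound[OF kn]) (auto intro!: always_eventually)
  have int: "(\<lambda>s. p s ^ r) integrable_on {0..1}" "(\<lambda>s. q s ^ r) integrable_on {0..1}" for r
    by (intro pw_lip_integrable pw_lip_power pq)+
  \<comment> \<open>As the moment of \<open>T\<^sup>2\<close>, \<open>\<kappa>\<close> is an
    integral of squares and cannot be negative; the nonzero fourth derivative is therefore positive,
    and the root in \<open>\<sigma>\<close> is a genuine one.\<close>
  have \<kappa>0: "\<kappa> > 0"
  proof -
    have I: "integral {0..1} (\<lambda>s. (tw (h s))\<^sup>2) = integral {0..1} (\<lambda>s. h s ^ 2) + 2 * integral {0..1} (\<lambda>s. h s ^ 3) + integral {0..1} (\<lambda>s. h s ^ 4)"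
      if h: "\<And>r. (\<lambda>s. h s ^ r) integrable_on {0..1}" for h :: "real \<Rightarrow> real"
    proof -
      have "((\<lambda>s. h s ^ 2 + 2 * h s ^ 3 + h s ^ 4) has_integral
          integral {0..1} (\<lambda>s. h s ^ 2) + 2 * integral {0..1} (\<lambda>s. h s ^ 3) + integral {0..1} (\<lambda>s. h s ^ 4)) {0..1}"
        by (intro has_integral_add has_integral_mult_right integrable_integral h)
      moreover have "(tw x)\<^sup>2 = x ^ 2 + 2 * x ^ 3 + x ^ 4" for x :: real by (simp add: algebra_simps eval_nat_numeral)
      ultimately show ?thesis by (simp add: integral_unique)
    qed
    have "\<kappa> = integral {0..1} (\<lambda>s. (tw (p s))\<^sup>2) + c * integral {0..1} (\<lambda>s. (tw (q s))\<^sup>2)"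
      unfolding I[OF int(1)] I[OF int(2)] mT(3)[symmetric] m_def by (simp add: algebra_simps)
    moreover have "0 \<le> integral {0..1} (\<lambda>s. (tw (h s))\<^sup>2)" for h :: "real \<Rightarrow> real"
      by (cases "(\<lambda>s. (tw (h s))\<^sup>2) integrable_on {0..1}") (auto intro: Henstock_Kurzweil_Integration.integral_nonneg simp: not_integrable_integral)
    ultimately have "0 \<le> \<kappa>" using c0 by simp
    moreover have "\<kappa> \<noteq> 0" unfolding \<kappa>_def A4_def using assms(14) z by simp
    ultimately show ?thesis by simp
  qed
  have A4: "A4 = 6 * \<kappa> / z_c ^ 4" unfolding \<kappa>_def using z by simp
  then have A40: "A4 > 0" using \<kappa>0 z by (simp add: zero_less_power_eq)
  have \<sigma>: "\<sigma> = (6 / A4) powr (1 / 4) / z_c" unfolding \<sigma>_def pearcey_sigma_def A4_def by simp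
  have s0: "\<sigma> \<noteq> 0" unfolding \<sigma> using z A40 by simp
  have s\<tau>: "\<sigma> = \<tau> * \<bar>\<sigma>\<bar>" unfolding \<sigma> \<tau>_def using z by (simp add: abs_divide sgn_if)
  have s4: "\<bar>\<sigma>\<bar> ^ 4 = 1 / \<kappa>"
  proof -
    have "((6 / A4) powr (1 / 4)) ^ 4 = 6 / A4" using A40 by (simp add: powr_realpow[symmetric] powr_powr)
    then show ?thesis unfolding \<sigma> using A40 z \<kappa>0 by (simp add: power_divide A4)
  qed
  define y where "y N = real (n N) powr (1 / 4)" for N
  \<comment> \<open>The constant \<open>\<sigma>\<close> satisfies
    \<open>\<bar>\<sigma>\<bar>\<^sup>4 = 1 / \<kappa>\<close>. At this scale the sum of
    \<open>T\<^sup>2\<close>, asymptotically \<open>\<kappa> n\<close>, is normalized to 1.\<close>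
  define \<epsilon> where "\<epsilon> N = \<bar>\<sigma>\<bar> / y N" for N
  have npos: "\<forall>\<^sub>F N in sequentially. 0 < n N" by (rule eventually_compose_filterlim[OF eventually_gt_at_top n])
  have \<epsilon>4: "\<epsilon> N ^ 4 * real (n N) = 1 / \<kappa>" if "0 < n N" for N
  proof -
    have "y N ^ 4 = real (n N)" unfolding y_def using that by (simp add: powr_realpow[symmetric] powr_powr)
    then show ?thesis unfolding \<epsilon>_def power_divide s4 using that by simp
  qed
  have n': "filterlim (\<lambda>N. real (n N)) at_top sequentially" by (rule filterlim_compose[OF filterlim_real_sequentially n])
  have \<epsilon>lim: "filterlim \<epsilon> (at_right 0) sequentially"
  proof -
    have "filterlim (\<lambda>x::real. \<bar>\<sigma>\<bar> / x powr (1 / 4)) (at_right 0) at_top" using s0 by real_asymp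
    then show ?thesis unfolding \<epsilon>_def[abs_def] y_def using n' by (rule filterlim_compose)
  qed
  define I where "I N = {1..n N} <+> {1..k N}" for N
  define P where "P N = case_sum (\<lambda>i. p (real i / real (n N))) (\<lambda>j. q (real j / real (k N)))" for N
  define S where "S r N = (\<Sum>i\<in>I N. P N i ^ r)" for r N
  have S: "(\<lambda>N. \<epsilon> N * (S r N - real (n N) * m r)) \<longlonglongrightarrow> 0" for r
  proof -
    have "(\<lambda>N. \<bar>\<sigma>\<bar> * ((S r N - real (n N) * m r) / y N)) \<longlonglongrightarrow> \<bar>\<sigma>\<bar> * 0"
      using tendsto_mult[OF tendsto_const power_sum_asymptotics[OF pw_lip_power[OF pq(1)] pw_lip_power[OF pq(2)] n k kd]]
      unfolding S_def I_def P_def m_def y_def by (simp add: sum.Plus)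
    then show ?thesis unfolding \<epsilon>_def by simp
  qed
  have fin: "finite (I N)" for N unfolding I_def by simp
  have sums: "(\<Sum>i\<in>I N. P N i) = S 1 N" "(\<Sum>i\<in>I N. tw (P N i)) = S 1 N + S 2 N"
    "(\<Sum>i\<in>I N. P N i * tw (P N i)) = S 2 N + S 3 N" "(\<Sum>i\<in>I N. (tw (P N i))\<^sup>2) = S 2 N + 2 * S 3 N + S 4 N" for N
    unfolding S_def by (simp_all add: sum.distrib sum_distrib_left algebra_simps eval_nat_numeral)
  have S2: "(\<lambda>N. \<epsilon> N * (\<Sum>i\<in>I N. tw (P N i))) \<longlonglongrightarrow> 0"
  proof -
    have "(\<lambda>N. \<epsilon> N * (S 1 N - real (n N) * m 1) + \<epsilon> N * (S 2 N - real (n N) * m 2)) \<longlonglongrightarrow> 0 + 0" by (intro tendsto_add S)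
    moreover have "\<epsilon> N * (S 1 N - real (n N) * m 1) + \<epsilon> N * (S 2 N - real (n N) * m 2) = \<epsilon> N * (S 1 N + S 2 N) - \<epsilon> N * real (n N) * (m 1 + m 2)" for N
      by (simp add: algebra_simps)
    ultimately show ?thesis unfolding sums mT by simp
  qed
  have S3: "(\<lambda>N. \<epsilon> N * (\<Sum>i\<in>I N. P N i * tw (P N i))) \<longlonglongrightarrow> 0"
  proof -
    have "(\<lambda>N. \<epsilon> N * (S 2 N - real (n N) * m 2) + \<epsilon> N * (S 3 N - real (n N) * m 3)) \<longlonglongrightarrow> 0 + 0" by (intro tendsto_add S)
    moreover have "\<epsilon> N * (S 2 N - real (n N) * m 2) + \<epsilon> N * (S 3 N - real (n N) * m 3) = \<epsilon> N * (S 2 N + S 3 N) - \<epsilon> N * real (n N) * (m 2 + m 3)" for N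
      by (simp add: algebra_simps)
    ultimately show ?thesis unfolding sums mT by simp
  qed
  have \<epsilon>0: "\<epsilon> \<longlonglongrightarrow> 0" using \<epsilon>lim unfolding filterlim_at by auto
  have S4: "(\<lambda>N. \<epsilon> N ^ 4 * (\<Sum>i\<in>I N. (tw (P N i))\<^sup>2)) \<longlonglongrightarrow> 1"
  proof -
    have "(\<lambda>N. \<epsilon> N ^ 3 * (\<epsilon> N * (S 2 N - real (n N) * m 2) + 2 * (\<epsilon> N * (S 3 N - real (n N) * m 3)) + \<epsilon> N * (S 4 N - real (n N) * m 4)) + 1)
      \<longlonglongrightarrow> 0 ^ 3 * (0 + 2 * 0 + 0) + 1" by (intro tendsto_intros S \<epsilon>0)
    then have "(\<lambda>N. \<epsilon> N ^ 3 * (\<epsilon> N * (S 2 N - real (n N) * m 2) + 2 * (\<epsilon> N * (S 3 N - real (n N) * m 3)) + \<epsilon> N * (S 4 N - real (n N) * m 4)) + 1)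
      \<longlonglongrightarrow> 1" by simp
    then show ?thesis
    proof (rule Lim_transform_eventually)
      show "\<forall>\<^sub>F N in sequentially. \<epsilon> N ^ 3 * (\<epsilon> N * (S 2 N - real (n N) * m 2) + 2 * (\<epsilon> N * (S 3 N - real (n N) * m 3)) + \<epsilon> N * (S 4 N - real (n N) * m 4)) + 1
        = \<epsilon> N ^ 4 * (\<Sum>i\<in>I N. (tw (P N i))\<^sup>2)"
        using npos
      proof eventually_elim
        case (elim N)
        have "\<epsilon> N ^ 4 * real (n N) * (m 2 + 2 * m 3 + m 4) = 1" unfolding \<epsilon>4[OF elim] mT using \<kappa>0 by simp
        moreover have "E ^ 3 * (E * (s2 - r * a) + 2 * (E * (s3 - r * b)) + E * (s4 - r * d)) = E ^ 4 * (s2 + 2 * s3 + s4) - E ^ 4 * r * (a + 2 * b + d)"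
          for E s2 s3 s4 r a b d :: real by (simp add: algebra_simps eval_nat_numeral)
        ultimately show ?case unfolding sums by simp
      qed
    qed
  qed
  \<comment> \<open>Comes from \<open>\<epsilon>\<^sup>4 n = 1 / \<kappa>\<close> and the eventual
    bound \<open>k / n < c + \<kappa>\<close>; the slack \<open>\<kappa>\<close> turns into the
    summand 1.\<close>
  define D where "D = (1 + c) / \<kappa> + 1"
  have D0: "0 < D" unfolding D_def using c0 \<kappa>0 by (intro add_nonneg_pos) auto
  have card: "\<forall>\<^sub>F N in sequentially. \<epsilon> N ^ 4 * real (card (I N)) \<le> D"
  proof -
    have "\<forall>\<^sub>F N in sequentially. real (k N) / real (n N) < c + \<kappa>" using order_tendstoD(2)[OF kn, of "c + \<kappa>"] \<kappa>0 by simp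
    then show ?thesis using npos
    proof eventually_elim
      case (elim N)
      have "real (card (I N)) = real (n N) * (1 + real (k N) / real (n N))"
        unfolding I_def using elim(2) by (simp add: card_Plus field_simps)
      then have "\<epsilon> N ^ 4 * real (card (I N)) = 1 / \<kappa> * (1 + real (k N) / real (n N))"
        using \<epsilon>4[OF elim(2)] by (simp only: mult.assoc[symmetric])
      also have "\<dots> \<le> 1 / \<kappa> * (1 + (c + \<kappa>))" using elim(1) \<kappa>0 by (intro mult_left_mono) auto
      also have "\<dots> = D" unfolding D_def using \<kappa>0 by (simp add: field_simps)
      finally show ?case .
    qed
  qed
  have s01: "real i / real l \<in> {0..1}" if "i \<in> {1..l}" for i l :: nat using that by (simp add: divide_le_eq_1)
  have node: "(\<exists>s\<in>{0..1}. P N i = p s) \<or> (\<exists>s\<in>{0..1}. P N i = q s)" if "i \<in> I N" for N i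
    using that unfolding I_def P_def by (elim PlusE) (use s01 in auto)
  have nz: "1 - X s \<noteq> 0" "1 + Y s \<noteq> 0" if "s \<in> {0..1}" for s using e'[OF that] e'0 by auto
  \<comment> \<open>For these nodes \<open>1 + p = 1 / (1 - X)\<close> and
    \<open>T = X / (1 - X)\<^sup>2\<close>, so \<open>T\<close> has the sign of the critical
    point.\<close>
  have pb: "\<bar>p s\<bar> \<le> M / e'" "1 / (1 + M) \<le> \<bar>1 + p s\<bar>" "0 \<le> \<tau> * tw (p s)" if s: "s \<in> {0..1}" for s
  proof -
    show "\<bar>p s\<bar> \<le> M / e'" unfolding p_def abs_divide using M(2)[OF s] e'(1)[OF s] e'0 M(1) by (intro frac_le) auto
    have p1: "1 + p s = 1 / (1 - X s)" unfolding p_def using nz(1)[OF s] by (simp add: field_simps)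
    have "\<bar>1 - X s\<bar> \<le> 1 + M" using M(2)[OF s] by linarith
    then show "1 / (1 + M) \<le> \<bar>1 + p s\<bar>" unfolding p1 abs_divide using nz(1)[OF s] M(1) by (intro frac_le) auto
    have "\<tau> * tw (p s) = \<tau> * X s / (1 - X s)\<^sup>2" unfolding p1 unfolding p_def by (simp add: power2_eq_square)
    moreover have "0 \<le> \<tau> * X s" unfolding X_def using f0[OF s] \<tau>z by (metis abs_ge_zero less_imp_le mult.left_commute mult_nonneg_nonneg)
    ultimately show "0 \<le> \<tau> * tw (p s)" by simp
  qed
  have \<tau>Y: "0 \<le> \<tau> * Y s" if s: "s \<in> {0..1}" for s
  proof -
    have "\<tau> * Y s = g s / \<bar>z_c\<bar>" unfolding Y_def \<tau>_def by (simp add: sgn_if)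
    then show ?thesis using g0[OF s] by simp
  qed
  \<comment> \<open>For these nodes \<open>T = - Y / (1 + Y)\<^sup>2\<close>, with the opposite
    sign, and it is \<open>p\<close> itself that stays away from 0.\<close>
  have qb: "\<bar>q s\<bar> \<le> 1 / e'" "1 / (1 + M) \<le> \<bar>q s\<bar>" "\<tau> * tw (q s) \<le> 0" if s: "s \<in> {0..1}" for s
  proof -
    show "\<bar>q s\<bar> \<le> 1 / e'" unfolding q_def abs_divide using e'(2)[OF s] e'0 by (intro frac_le) auto
    have "\<bar>1 + Y s\<bar> \<le> 1 + M" using M(2)[OF s] by linarith
    then show "1 / (1 + M) \<le> \<bar>q s\<bar>" unfolding q_def abs_divide using nz(2)[OF s] M(1) by (intro frac_le) auto
    have "1 + q s = Y s / (1 + Y s)" unfolding q_def using nz(2)[OF s] by (simp add: field_simps)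
    then have "\<tau> * tw (q s) = - (\<tau> * Y s / (1 + Y s)\<^sup>2)" by (simp add: q_def power2_eq_square)
    then show "\<tau> * tw (q s) \<le> 0" using \<tau>Y[OF s] by simp
  qed
  define B where "B = M / e' + 1 / e'"
  have B: "0 < M / e'" "0 < 1 / e'" using M(1) e'0 by simp_all
  have na: "node_array I P \<epsilon> B D (1 / (1 + M)) \<tau>"
  proof
    show "0 < B" unfolding B_def using B by linarith
    show "\<bar>P N i\<bar> \<le> B" if "i \<in> I N" for N i
      using node[OF that] pb(1) qb(1) B unfolding B_def by (fastforce intro: add_increasing add_increasing2)
    show "0 \<le> \<tau> * tw (P N i) \<and> 1 / (1 + M) \<le> \<bar>1 + P N i\<bar> \<or> \<tau> * tw (P N i) \<le> 0 \<and> 1 / (1 + M) \<le> \<bar>P N i\<bar>"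
      if "i \<in> I N" for N i
      using node[OF that] pb(2,3) qb(2,3) by metis
    show "0 < 1 / (1 + M)" using M(1) by simp
  qed (fact fin \<epsilon>lim S2 S3 S4 D0 card \<tau>)+
  \<comment> \<open>Since \<open>m 1 = t_d - c\<close>, the drift splits into the Riemann error of
    the first moment, the deviation \<open>k - c n\<close>, and the displacement of the site from
    \<open>t_d n\<close>. The half-integer shift in \<open>site\<close> costs
    \<open>\<epsilon> / 2\<close> and vanishes.\<close>
  have drift: "node_array.drift I P \<epsilon> (\<lambda>N. int (k N) - a N) (\<tau> * \<xi>)"
    if a: "(\<lambda>N. (site (a N) - t_d * real (n N)) / real (n N) powr (1 / 4)) \<longlonglongrightarrow> \<xi> / \<sigma>" for a \<xi>
  proof -
    have "(\<lambda>N. \<epsilon> N * (S 1 N - real (n N) * m 1) + \<bar>\<sigma>\<bar> * ((real (k N) - c * real (n N)) / real (n N) powr (1 / 4))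
      - \<bar>\<sigma>\<bar> * ((site (a N) - t_d * real (n N)) / real (n N) powr (1 / 4)) + \<epsilon> N * (1 / 2))
      \<longlonglongrightarrow> 0 + \<bar>\<sigma>\<bar> * 0 - \<bar>\<sigma>\<bar> * (\<xi> / \<sigma>) + 0 * (1 / 2)" by (intro tendsto_intros S kd a \<epsilon>0)
    moreover have "\<epsilon> N * (S 1 N - real (n N) * m 1) + \<bar>\<sigma>\<bar> * ((real (k N) - c * real (n N)) / real (n N) powr (1 / 4))
      - \<bar>\<sigma>\<bar> * ((site (a N) - t_d * real (n N)) / real (n N) powr (1 / 4)) + \<epsilon> N * (1 / 2)
      = \<epsilon> N * (of_int (int (k N) - a N) + (\<Sum>i\<in>I N. P N i))" for N
    proof -
      have e: "\<bar>\<sigma>\<bar> * (x / real (n N) powr (1 / 4)) = \<epsilon> N * x" for x unfolding \<epsilon>_def y_def by simp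
      show ?thesis unfolding e sums m1 site_def by (simp add: algebra_simps)
    qed
    moreover have "0 + \<bar>\<sigma>\<bar> * 0 - \<bar>\<sigma>\<bar> * (\<xi> / \<sigma>) + 0 * (1 / 2) = - (\<tau> * \<xi>)"
      using s\<tau> s0 \<tau> by auto
    ultimately show ?thesis unfolding node_array.drift_def[OF na] by simp
  qed
  define x where "x N i = f (real i / real (n N)) * z_c" for N i
  define w where "w N j = g (real j / real (k N)) / z_c" for N j
  have P: "P = (\<lambda>N. case_sum (\<lambda>i. x N i / (1 - x N i)) (\<lambda>j. - 1 / (1 + w N j)))"
    unfolding P_def p_def q_def x_def w_def X_def Y_def ..
  have I: "I = (\<lambda>N. {1..n N} <+> {1..k N})" unfolding I_def ..
  have "(\<lambda>N. of_real (\<tau> / \<epsilon> N) * corr_kernel (\<lambda>t. \<gamma> N t / of_real z_c) (\<lambda>t. \<delta> N t / of_real z_c) (x N) (n N) (w N) (k N) (a N) (b N))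
    \<longlonglongrightarrow> pearcey_kernel (\<tau> * \<xi>) (\<tau> * \<eta>)"
  proof (rule corr_kernel_tendsto_pearcey[where M = M])
    show "node_array (\<lambda>N. {1..n N} <+> {1..k N}) (\<lambda>N. case_sum (\<lambda>i. x N i / (1 - x N i)) (\<lambda>j. - 1 / (1 + w N j))) \<epsilon> B D (1 / (1 + M)) \<tau>"
      using na unfolding I P .
    show "x N i \<noteq> 1 \<and> 0 < \<tau> * x N i \<and> \<bar>x N i\<bar> \<le> M" if "i \<in> {1..n N}" for N i
    proof -
      have s: "real i / real (n N) \<in> {0..1}" by (rule s01[OF that])
      have "\<tau> * x N i = f (real i / real (n N)) * \<bar>z_c\<bar>" unfolding x_def \<tau>z[symmetric] by simp
      then have "0 < \<tau> * x N i" using f0[OF s] z by simp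
      moreover have "x N i \<noteq> 1 \<and> \<bar>x N i\<bar> \<le> M" using nz(1)[OF s] M(2)[OF s] unfolding x_def X_def by auto
      ultimately show ?thesis by blast
    qed
    show "w N j \<noteq> -1 \<and> 0 \<le> \<tau> * w N j \<and> \<bar>w N j\<bar> \<le> M" if "j \<in> {1..k N}" for N j
    proof -
      have s: "real j / real (k N) \<in> {0..1}" by (rule s01[OF that])
      show ?thesis using nz(2)[OF s] M(2)[OF s] \<tau>Y[OF s] unfolding w_def Y_def by auto
    qed
    show "node_array.drift (\<lambda>N. {1..n N} <+> {1..k N}) (\<lambda>N. case_sum (\<lambda>i. x N i / (1 - x N i)) (\<lambda>j. - 1 / (1 + w N j))) \<epsilon>
        (\<lambda>N. int (k N) - a N) (\<tau> * \<xi>)"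
      using drift[OF assms(15)] unfolding I P .
    show "node_array.drift (\<lambda>N. {1..n N} <+> {1..k N}) (\<lambda>N. case_sum (\<lambda>i. x N i / (1 - x N i)) (\<lambda>j. - 1 / (1 + w N j))) \<epsilon>
        (\<lambda>N. int (k N) - b N) (\<tau> * \<eta>)"
      using drift[OF assms(16)] unfolding I P .
    show "\<forall>\<^sub>F N in sequentially. a N \<noteq> b N" if "\<tau> = -1"
      by (rule assms(17)) (use that in \<open>simp add: \<tau>_def sgn_if split: if_splits\<close>)
    show "kernel_contours (x N) (n N) (w N) (k N) (\<lambda>t. \<gamma> N t / of_real z_c) (\<lambda>t. \<delta> N t / of_real z_c)" for N
      unfolding x_def w_def by (rule kernel_contours_scale[OF kc z])
  qed
  \<comment> \<open>The sign \<open>\<tau>\<close> and \<open>\<bar>\<sigma>\<bar>\<close> recombine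
    to \<open>\<sigma>\<close>, and undoing the scaling by \<open>z_c\<close> restores the power of
    the critical point.\<close>
  moreover have "of_real (\<tau> / \<epsilon> N) * corr_kernel (\<lambda>t. \<gamma> N t / of_real z_c) (\<lambda>t. \<delta> N t / of_real z_c) (x N) (n N) (w N) (k N) (a N) (b N)
    = of_real (real (n N) powr (1 / 4) / \<sigma>) * of_real z_c powi (a N - b N)
            * corr_kernel (\<gamma> N) (\<delta> N) (\<lambda>i. f (real i / real (n N))) (n N)
                (\<lambda>j. g (real j / real (k N))) (k N) (a N) (b N)" for N
  proof -
    have "\<tau> / \<bar>\<sigma>\<bar> = 1 / \<sigma>" using s\<tau> s0 \<tau> by (auto simp: field_simps)
    then have "\<tau> / \<epsilon> N = real (n N) powr (1 / 4) / \<sigma>" unfolding \<epsilon>_def y_def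
      by (metis divide_divide_eq_right mult.commute mult_1_left times_divide_eq_left)
    moreover have "valid_path (\<gamma> N)" "valid_path (\<delta> N)" using kc[of N] unfolding kernel_contours_def by blast+
    ultimately show ?thesis unfolding x_def w_def by (simp only: corr_kernel_scale[OF _ _ z, symmetric] mult.assoc)
  qed
  moreover have "pearcey_kernel (\<tau> * \<xi>) (\<tau> * \<eta>) = pearcey_kernel \<xi> \<eta>" using \<tau> pearcey_kernel_uminus by auto
  ultimately show ?thesis by simp
qed

end
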